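(* Let $u\in\mathcal L^{1,2,2-}$ be $L^2$-bounded. Let $\sigma\in\mathcal L^{1,2}$ be an $\mathcal F_t$-adapted process which is $L^2$-bounded and left-continuous in the norm of $L^2(\Omega)$. Assume also that $\sigma$ and $D_s\sigma_t$ are bounded. Then $u\sigma\in\mathcal L^{1,2,1-}$, and for all $t\in[0,T]$, $$\int_0^tu_s\sigma_s\,\mathrm d^-W_s=\int_0^tu_s\sigma_s\,\mathrm dW_s+\int_0^t(D^-u)_s\,\sigma_s\,\mathrm ds .$$
   Context: Fix $T>0$. $W=\{W_t\}_{0\le t\le T}$ is a standard Brownian motion on $(\Omega,\mathcal F_T,\{\mathcal F_t\}_{0\le t\le T},\mathbb P)$, where $\{\mathcal F_t\}$ is the $\mathbb P$-augmentation of the filtration generated by $W$. $D$ is the Malliavin derivative, $D^{1,2}(\Omega)$ the usual Malliavin–Sobolev space, and $\delta$ the Skorohod integral (the adjoint of $D:L^2(\Omega)\to L^2(\Omega\times[0,T])$). $\mathcal L^{1,2}:=D^{1,2}(\Omega;L^2([0,T]))\cong L^2([0,T];D^{1,2}(\Omega))$. For $u\in\mathcal L^{1,2}$, $\int_0^tu_s\,\mathrm dW_s:=\delta(u1_{[0,t]})$. A process $u$ is $L^2$-bounded if $\sup_{t\in[0,T]}\mathbb E|u_t|^2<\infty$. For $q\in[1,2]$, a process $u\in\mathcal L^{1,2}$ belongs to $\mathcal L^{1,2,q-}$ if there is a (unique) process $D^-u\in L^q(\Omega\times[0,T])$ with $$\lim_{\varepsilon\to0^+}\int_0^T\sup_{(s-\varepsilon)\vee0\le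 t<s}\mathbb E\big(|D_su_t-(D^-u)_s|^q\big)\,\mathrm ds=0 .$$ Forward integral: for a process $u$, $$\int_0^Tu_t\,\mathrm d^-W_t:=\lim_{\varepsilon\to0^+}\varepsilon^{-1}\int_0^Tu_t\,(W_{(t+\varepsilon)\wedge T}-W_t)\,\mathrm dt$$ if the limit exists in probability. $\int_0^tu_s\,\mathrm d^-W_s$ denotes the forward integral of $u1_{[0,t]}$. *)

theory Defs
  imports "HOL-Probability.Probability"
begin

text \<open>
  Processes are written \<open>u t \<omega>\<close>, and two-parameter derivatives \<open>D\<^sub>s u\<^sub>t (\<omega>)\<close> as \<open>Du s t \<omega>\<close>.
  Since Malliavin derivatives, \<open>D\<^sup>-u\<close> and stochastic integrals are only determined almost
  everywhere, they are given as relations ``is a version of'', in the style of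
  \<^const>\<open>has_bochner_integral\<close>.
\<close>

definition time_measure :: "real \<Rightarrow> real measure" where
  "time_measure T = restrict_space lborel {0..T}"

definition square_integrable :: "'b measure \<Rightarrow> ('b \<Rightarrow> real) \<Rightarrow> bool" where
  "square_integrable N f \<longleftrightarrow> f \<in> borel_measurable N \<and> integrable N (\<lambda>x. (f x)\<^sup>2)"

definition in_Lp :: "real \<Rightarrow> 'b measure \<Rightarrow> ('b \<Rightarrow> real) \<Rightarrow> bool" where
  "in_Lp q N f \<longleftrightarrow> f \<in> borel_measurable N \<and> integrable N (\<lambda>x. \<bar>f x\<bar> powr q)"

definition L2_converges :: "'b measure \<Rightarrow> (nat \<Rightarrow> 'b \<Rightarrow> real) \<Rightarrow> ('b \<Rightarrow> real) \<Rightarrow> bool" where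
  "L2_converges N fs f \<longleftrightarrow> (\<forall>n. square_integrable N (fs n)) \<and> square_integrable N f \<and>
     (\<lambda>n. \<integral>x. (fs n x - f x)\<^sup>2 \<partial>N) \<longlonglongrightarrow> 0"


section \<open>Brownian motion and its augmented filtration\<close>

definition natural_filtration :: "'a measure \<Rightarrow> (real \<Rightarrow> 'a \<Rightarrow> real) \<Rightarrow> real \<Rightarrow> 'a measure" where
  "natural_filtration M W t =
     sigma (space M) (\<Union>s\<in>{0..t}. {W s -` A \<inter> space M |A. A \<in> sets borel})"

definition augmented_filtration ::
    "'a measure \<Rightarrow> real \<Rightarrow> (real \<Rightarrow> 'a \<Rightarrow> real) \<Rightarrow> real \<Rightarrow> 'a measure" where
  "augmented_filtration M T W t =
     sigma (space M) (sets (natural_filtration M W t) \<union>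
       {N. \<exists>B\<in>sets (natural_filtration M W T). emeasure M B = 0 \<and> N \<subseteq> B})"

text \<open>The last clause says that the \<open>\<sigma>\<close>-algebra of the probability space is \<open>\<F>\<^sub>T\<close>.\<close>

definition brownian_motion :: "'a measure \<Rightarrow> real \<Rightarrow> (real \<Rightarrow> 'a \<Rightarrow> real) \<Rightarrow> bool" where
  "brownian_motion M T W \<longleftrightarrow>
     prob_space M \<and>
     (\<forall>t\<in>{0..T}. W t \<in> borel_measurable M) \<and>
     (AE \<omega> in M. W 0 \<omega> = 0) \<and>
     (AE \<omega> in M. continuous_on {0..T} (\<lambda>t. W t \<omega>)) \<and>
     (\<forall>s t. 0 \<le> s \<and> s < t \<and> t \<le> T \<longrightarrow>
        distributed M lborel (\<lambda>\<omega>. W t \<omega> - W s \<omega>) (normal_density 0 (sqrt (t - s))) \<and>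
        prob_space.indep_set M (sets (augmented_filtration M T W s))
          {(\<lambda>\<omega>. W t \<omega> - W s \<omega>) -` A \<inter> space M |A. A \<in> sets borel}) \<and>
     sets M = sets (augmented_filtration M T W T)"


section \<open>Wiener integrals of deterministic functions\<close>

text \<open>A list of triples \<open>(c, a, b)\<close> stands for the step function \<open>\<Sum> c \<cdot> 1\<^bsub>(a, b]\<^esub>\<close>.\<close>

definition step_fun :: "(real \<times> real \<times> real) list \<Rightarrow> real \<Rightarrow> real" where
  "step_fun xs t = (\<Sum>(c, a, b)\<leftarrow>xs. c * indicator {a<..b} t)"

definition step_integral ::
    "(real \<Rightarrow> 'a \<Rightarrow> real) \<Rightarrow> (real \<times> real \<times> real) list \<Rightarrow> 'a \<Rightarrow> real" where
  "step_integral W xs \<omega> = (\<Sum>(c, a, b)\<leftarrow>xs. c * (W b \<omega> - W a \<omega>))"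

text \<open>\<open>X\<close> is a version of \<open>W(h) = \<integral>\<^sub>0\<^sup>T h dW\<close>.\<close>

definition has_wiener_integral ::
    "'a measure \<Rightarrow> real \<Rightarrow> (real \<Rightarrow> 'a \<Rightarrow> real) \<Rightarrow> (real \<Rightarrow> real) \<Rightarrow> ('a \<Rightarrow> real) \<Rightarrow> bool" where
  "has_wiener_integral M T W h X \<longleftrightarrow>
     (\<exists>xs. (\<forall>n. \<forall>(c, a, b)\<in>set (xs n). 0 \<le> a \<and> a \<le> b \<and> b \<le> T) \<and>
        L2_converges (time_measure T) (\<lambda>n. step_fun (xs n)) h \<and>
        L2_converges M (\<lambda>n. step_integral W (xs n)) X)"


section \<open>Malliavin derivative\<close>

definition partial_deriv ::
    "nat \<Rightarrow> ((nat \<Rightarrow> real) \<Rightarrow> real) \<Rightarrow> (nat \<Rightarrow> real) \<Rightarrow> real" where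
  "partial_deriv i f x = deriv (\<lambda>y. f (x(i := y))) (x i)"

text \<open>
  \<open>C\<^sub>b\<^sup>\<infinity>(\<real>\<^sup>n)\<close>, where a function on \<open>\<real>\<^sup>n\<close> is a function of a sequence that depends on the
  coordinates \<open>0, \<dots>, n - 1\<close> only; its continuity for the product topology is then
  continuity on \<open>\<real>\<^sup>n\<close>.
\<close>

definition Cb_infty :: "nat \<Rightarrow> ((nat \<Rightarrow> real) \<Rightarrow> real) set" where
  "Cb_infty n = {f. (\<forall>x y. (\<forall>i<n. x i = y i) \<longrightarrow> f x = f y) \<and>
     (\<forall>\<alpha>. set \<alpha> \<subseteq> {..<n} \<longrightarrow>
        continuous_on UNIV (foldr partial_deriv \<alpha> f) \<and>
        bounded (range (foldr partial_deriv \<alpha> f)) \<and>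
        (\<forall>i<n. \<forall>x. (\<lambda>y. foldr partial_deriv \<alpha> f (x(i := y))) field_differentiable at (x i)))}"

text \<open>
  Smooth functionals \<open>F = f(W(h\<^sub>0), \<dots>, W(h\<^bsub>n-1\<^esub>))\<close> with
  \<open>D\<^sub>sF = \<Sum>\<^sub>i \<partial>\<^sub>if(W(h\<^sub>0), \<dots>, W(h\<^bsub>n-1\<^esub>)) h\<^sub>i(s)\<close>.
\<close>

definition smooth_functional ::
    "'a measure \<Rightarrow> real \<Rightarrow> (real \<Rightarrow> 'a \<Rightarrow> real) \<Rightarrow> ('a \<Rightarrow> real) \<Rightarrow> (real \<Rightarrow> 'a \<Rightarrow> real) \<Rightarrow> bool" where
  "smooth_functional M T W F DF \<longleftrightarrow>
     (\<exists>n f h X. f \<in> Cb_infty n \<and> (\<forall>i<n. has_wiener_integral M T W (h i) (X i)) \<and>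
        (\<forall>\<omega>\<in>space M. F \<omega> = f (\<lambda>i. X i \<omega>)) \<and>
        (\<forall>s\<in>{0..T}. \<forall>\<omega>\<in>space M. DF s \<omega> = (\<Sum>i<n. partial_deriv i f (\<lambda>j. X j \<omega>) * h i s)))"

text \<open>\<open>F \<in> D\<^sup>1\<^sup>,\<^sup>2(\<Omega>)\<close> with derivative \<open>DF\<close>: the closure of the derivative of smooth functionals.\<close>

definition has_malliavin_deriv ::
    "'a measure \<Rightarrow> real \<Rightarrow> (real \<Rightarrow> 'a \<Rightarrow> real) \<Rightarrow> ('a \<Rightarrow> real) \<Rightarrow> (real \<Rightarrow> 'a \<Rightarrow> real) \<Rightarrow> bool" where
  "has_malliavin_deriv M T W F DF \<longleftrightarrow>
     (\<exists>Fs DFs. (\<forall>n. smooth_functional M T W (Fs n) (DFs n)) \<and>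
        L2_converges M Fs F \<and>
        L2_converges (time_measure T \<Otimes>\<^sub>M M) (\<lambda>n (s, \<omega>). DFs n s \<omega>) (\<lambda>(s, \<omega>). DF s \<omega>))"

text \<open>Smooth \<open>L\<^sup>2([0,T])\<close>-valued functionals \<open>\<Sum>\<^sub>j F\<^sub>j h\<^sub>j\<close>.\<close>

definition smooth_process ::
    "'a measure \<Rightarrow> real \<Rightarrow> (real \<Rightarrow> 'a \<Rightarrow> real) \<Rightarrow>
     (real \<Rightarrow> 'a \<Rightarrow> real) \<Rightarrow> (real \<Rightarrow> real \<Rightarrow> 'a \<Rightarrow> real) \<Rightarrow> bool" where
  "smooth_process M T W u Du \<longleftrightarrow>
     (\<exists>(m::nat) F DF h. (\<forall>j<m. smooth_functional M T W (F j) (DF j) \<and>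
                          square_integrable (time_measure T) (h j)) \<and>
        (\<forall>t\<in>{0..T}. \<forall>\<omega>\<in>space M. u t \<omega> = (\<Sum>j<m. F j \<omega> * h j t)) \<and>
        (\<forall>s\<in>{0..T}. \<forall>t\<in>{0..T}. \<forall>\<omega>\<in>space M. Du s t \<omega> = (\<Sum>j<m. DF j s \<omega> * h j t)))"

text \<open>
  \<open>u \<in> D\<^sup>1\<^sup>,\<^sup>2(\<Omega>; L\<^sup>2([0,T]))\<close>, and \<open>Du\<close> is a jointly measurable version of \<open>(s, t, \<omega>) \<mapsto> D\<^sub>s u\<^sub>t(\<omega>)\<close>.
\<close>

definition has_malliavin_deriv_process ::
    "'a measure \<Rightarrow> real \<Rightarrow> (real \<Rightarrow> 'a \<Rightarrow> real) \<Rightarrow>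
     (real \<Rightarrow> 'a \<Rightarrow> real) \<Rightarrow> (real \<Rightarrow> real \<Rightarrow> 'a \<Rightarrow> real) \<Rightarrow> bool" where
  "has_malliavin_deriv_process M T W u Du \<longleftrightarrow>
     (\<exists>us Dus. (\<forall>n. smooth_process M T W (us n) (Dus n)) \<and>
        L2_converges (time_measure T \<Otimes>\<^sub>M M) (\<lambda>n (t, \<omega>). us n t \<omega>) (\<lambda>(t, \<omega>). u t \<omega>) \<and>
        L2_converges (time_measure T \<Otimes>\<^sub>M (time_measure T \<Otimes>\<^sub>M M))
          (\<lambda>n (s, t, \<omega>). Dus n s t \<omega>) (\<lambda>(s, t, \<omega>). Du s t \<omega>))"

text \<open>
  \<open>u \<in> \<L>\<^sup>1\<^sup>,\<^sup>2\<^sup>,\<^sup>q\<^sup>-\<close> with \<open>D\<^sup>-u = v\<close>. The supremum over \<open>t\<close> depends on the version of \<open>D\<^sub>s u\<^sub>t\<close>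
  (a class up to \<open>ds \<otimes> dt \<otimes> d\<P>\<close>-null sets), so the condition is read as holding for some
  version. The supremum is Lebesgue measurable in \<open>s\<close> by measurable projection, although
  possibly not Borel; its nonnegative integral is then the Lebesgue integral.
\<close>

definition has_Dminus ::
    "'a measure \<Rightarrow> real \<Rightarrow> (real \<Rightarrow> 'a \<Rightarrow> real) \<Rightarrow> real \<Rightarrow>
     (real \<Rightarrow> 'a \<Rightarrow> real) \<Rightarrow> (real \<Rightarrow> 'a \<Rightarrow> real) \<Rightarrow> bool" where
  "has_Dminus M T W q u v \<longleftrightarrow>
     in_Lp q (time_measure T \<Otimes>\<^sub>M M) (\<lambda>(s, \<omega>). v s \<omega>) \<and>
     (\<exists>Du. has_malliavin_deriv_process M T W u Du \<and>
        ((\<lambda>\<epsilon>. \<integral>\<^sup>+s. (SUP t\<in>{max (s - \<epsilon>) 0..<s}. \<integral>\<^sup>+\<omega>. ennreal (\<bar>Du s t \<omega> - v s \<omega>\<bar> powr q) \<partial>M)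
               \<partial>time_measure T) \<longlongrightarrow> 0) (at_right 0))"

definition L12_minus ::
    "'a measure \<Rightarrow> real \<Rightarrow> (real \<Rightarrow> 'a \<Rightarrow> real) \<Rightarrow> real \<Rightarrow> (real \<Rightarrow> 'a \<Rightarrow> real) set" where
  "L12_minus M T W q = {u. \<exists>v. has_Dminus M T W q u v}"


section \<open>Skorohod and forward integrals\<close>

text \<open>\<open>u \<in> Dom \<delta>\<close> and \<open>\<delta>(u) = X\<close>, with \<open>\<delta>\<close> the adjoint of \<open>D\<close>.\<close>

definition has_skorohod_integral ::
    "'a measure \<Rightarrow> real \<Rightarrow> (real \<Rightarrow> 'a \<Rightarrow> real) \<Rightarrow> (real \<Rightarrow> 'a \<Rightarrow> real) \<Rightarrow> ('a \<Rightarrow> real) \<Rightarrow> bool" where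
  "has_skorohod_integral M T W u X \<longleftrightarrow>
     square_integrable (time_measure T \<Otimes>\<^sub>M M) (\<lambda>(s, \<omega>). u s \<omega>) \<and> square_integrable M X \<and>
     (\<forall>F DF. has_malliavin_deriv M T W F DF \<longrightarrow>
        (\<integral>\<omega>. F \<omega> * X \<omega> \<partial>M) = (\<integral>(s, \<omega>). DF s \<omega> * u s \<omega> \<partial>(time_measure T \<Otimes>\<^sub>M M)))"

definition forward_approx ::
    "real \<Rightarrow> (real \<Rightarrow> 'a \<Rightarrow> real) \<Rightarrow> (real \<Rightarrow> 'a \<Rightarrow> real) \<Rightarrow> real \<Rightarrow> 'a \<Rightarrow> real" where
  "forward_approx T W u \<epsilon> \<omega> =
     inverse \<epsilon> * (\<integral>t. u t \<omega> * (W (min (t + \<epsilon>) T) \<omega> - W t \<omega>) \<partial>time_measure T)"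

text \<open>
  The integrability and measurability clauses ensure that neither the pathwise integral nor the
  probability takes its default value \<open>0\<close>.
\<close>

definition has_forward_integral ::
    "'a measure \<Rightarrow> real \<Rightarrow> (real \<Rightarrow> 'a \<Rightarrow> real) \<Rightarrow> (real \<Rightarrow> 'a \<Rightarrow> real) \<Rightarrow> ('a \<Rightarrow> real) \<Rightarrow> bool" where
  "has_forward_integral M T W u X \<longleftrightarrow>
     X \<in> borel_measurable M \<and>
     (\<forall>\<epsilon>>0. (AE \<omega> in M. integrable (time_measure T)
                         (\<lambda>t. u t \<omega> * (W (min (t + \<epsilon>) T) \<omega> - W t \<omega>))) \<and>
            forward_approx T W u \<epsilon> \<in> borel_measurable M) \<and>
     (\<forall>\<eta>>0. ((\<lambda>\<epsilon>. measure M {\<omega>\<in>space M. \<bar>forward_approx T W u \<epsilon> \<omega> - X \<omega>\<bar> > \<eta>}) \<longlongrightarrow> 0)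
              (at_right 0))"


section \<open>Regularity of processes\<close>

definition L2_bounded :: "'a measure \<Rightarrow> real \<Rightarrow> (real \<Rightarrow> 'a \<Rightarrow> real) \<Rightarrow> bool" where
  "L2_bounded M T u \<longleftrightarrow> (SUP t\<in>{0..T}. \<integral>\<^sup>+\<omega>. ennreal ((u t \<omega>)\<^sup>2) \<partial>M) < \<infinity>"

definition L2_left_continuous :: "'a measure \<Rightarrow> real \<Rightarrow> (real \<Rightarrow> 'a \<Rightarrow> real) \<Rightarrow> bool" where
  "L2_left_continuous M T u \<longleftrightarrow>
     (\<forall>t\<in>{0<..T}. ((\<lambda>s. \<integral>\<^sup>+\<omega>. ennreal ((u s \<omega> - u t \<omega>)\<^sup>2) \<partial>M) \<longlongrightarrow> 0) (at_left t))"

end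

theory Submission
 imports Defs
begin

text \<open>
The increment \<open>W\<^bsub>t+\<epsilon>\<^esub> - W\<^sub>t\<close> is the Wiener integral of the indicator of \<open>(t, t+\<epsilon>]\<close>. For a smooth
process \<open>v = \<Sum>\<^sub>j F\<^sub>j h\<^sub>j\<close>, the rule \<open>F W(g) = \<delta>(F g) + \<langle>DF, g\<rangle>\<close> therefore gives
\<open>\<epsilon>\<^sup>-\<^sup>1 \<integral> v\<^sub>t (W\<^bsub>t+\<epsilon>\<^esub> - W\<^sub>t) dt = \<delta>(B v) + \<epsilon>\<^sup>-\<^sup>1 \<integral>\<integral> 1\<^bsub>t < s \<le> t+\<epsilon>\<^esub> D\<^sub>s v\<^sub>t ds dt\<close>,
where \<open>B\<close> replaces each \<open>h\<^sub>j(s)\<close> by the mean of \<open>h\<^sub>j\<close> over \<open>[s-\<epsilon>, s)\<close>. These means are contractions of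
\<open>L\<^sup>2\<close> that tend to the identity, and \<open>\<delta>\<close> is bounded for the norm of \<open>\<L>\<^sup>1\<^sup>,\<^sup>2\<close>, hence \<open>\<delta>(B v)\<close> tends to
\<open>\<delta>(v)\<close>. As the bounds are uniform in \<open>\<epsilon>\<close>, this extends to every \<open>v\<close> in \<open>\<L>\<^sup>1\<^sup>,\<^sup>2\<close>
(\<open>forward_minus_trace_converges\<close>). The last term sees \<open>D\<^sub>s v\<^sub>t\<close> only for \<open>t\<close> just before \<open>s\<close>, so that it
converges to the integral of \<open>D\<^sup>-v\<close> in \<open>L\<^sup>1\<close> (\<open>trace_avg_L1_bound\<close>).

It remains to determine \<open>D\<^sup>-(u \<sigma>)\<close>. The product rule is \<open>D\<^sub>s(u\<^sub>t \<sigma>\<^sub>t) = \<sigma>\<^sub>t D\<^sub>s u\<^sub>t + u\<^sub>t D\<^sub>s \<sigma>\<^sub>t\<close>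
(\<open>malliavin_process_mult\<close>), and the last summand vanishes for \<open>t < s\<close> because \<open>\<sigma>\<close> is adapted
(\<open>adapted_derivative_zero\<close>). The distance of \<open>\<sigma>\<^sub>t D\<^sub>s u\<^sub>t\<close> from \<open>\<sigma>\<^sub>s (D\<^sup>-u)\<^sub>s\<close> is controlled by that of
\<open>D\<^sub>s u\<^sub>t\<close> from \<open>(D\<^sup>-u)\<^sub>s\<close>, as \<open>\<sigma>\<close> is bounded, and by that of \<open>\<sigma>\<^sub>t\<close> from \<open>\<sigma>\<^sub>s\<close>, as \<open>\<sigma>\<close> is
left-continuous (\<open>Dminus_mult\<close>).

The underlying calculus is built from Gaussian integration by parts: it yields the duality and the
isometry of \<open>\<delta>\<close> on smooth processes (\<open>elem_skorohod_duality\<close>, \<open>elem_skorohod_sum_bound\<close>). Smooth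
functionals separate the integrable random variables (\<open>orthogonal_to_smooth\<close>), hence Skorohod
integrals are unique.

Sample points are written \<open>w\<close>, and \<open>TM\<close> and \<open>TTM\<close> are the measures \<open>dt \<otimes> d\<P>\<close> and \<open>ds \<otimes> dt \<otimes> d\<P>\<close>.
\<close>

abbreviation "L2 \<equiv> square_integrable"
abbreviation "tm \<equiv> time_measure"
abbreviation "pd \<equiv> partial_deriv"
abbreviation "case_triple f \<equiv> \<lambda>(s, t, w). f s t w"
lemmas lint_cong = Bochner_Integration.integral_cong[OF refl]

section \<open>Square integrable functions\<close>

lemma L2D:
 assumes "L2 N f"
 shows "f \<in> borel_measurable N" "integrable N (%x. (f x)^2)"
 using assms by (auto simp: square_integrable_def)

lemma L2_cong:
 assumes "\<And>x. x \<in> space N \<Longrightarrow> f x = g x"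
 shows "L2 N f = L2 N g"
 unfolding square_integrable_def
 using measurable_cong[of N f g borel] Bochner_Integration.integrable_cong[of N N "%x. (f x)^2" "%x. (g x)^2"] assms
 by auto

lemma L2_bound:
 assumes "L2 N g" "f \<in> borel_measurable N" "\<And>x. x \<in> space N \<Longrightarrow> \<bar>f x\<bar> \<le> C * \<bar>g x\<bar>"
 shows "L2 N f"
 unfolding square_integrable_def
proof
 show "integrable N (%x. (f x)^2)"
 proof (rule Bochner_Integration.integrable_bound[of N "%x. C^2 * (g x)^2"])
  show "integrable N (%x. C^2 * (g x)^2)" using assms(1) by (auto simp: square_integrable_def)
  show "(%x. (f x)^2) \<in> borel_measurable N" using assms(2) by (rule borel_measurable_power)
  have "(f x)^2 \<le> C^2 * (g x)^2" if "x \<in> space N" for x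
   using power_mono[OF assms(3)[OF that], of 2] by (simp add: power_mult_distrib)
  then show "AE x in N. norm ((f x)^2) \<le> norm (C^2 * (g x)^2)" by (intro AE_I2) simp
 qed
qed (fact assms)

lemma integrable_mult_L2:
 assumes "L2 N f" "L2 N g"
 shows "integrable N (%x. f x * g x)"
proof (rule Bochner_Integration.integrable_bound[of N "%x. (f x)^2 + (g x)^2"])
 show "integrable N (%x. (f x)^2 + (g x)^2)" using assms by (auto simp: square_integrable_def)
 show "(%x. f x * g x) \<in> borel_measurable N"
  using assms by (auto simp: square_integrable_def)
 have "\<bar>f x * g x\<bar> \<le> \<bar>(f x)^2 + (g x)^2\<bar>" for x
 proof -
  have "2 * (\<bar>f x\<bar> * \<bar>g x\<bar>) \<le> (f x)^2 + (g x)^2" "0 \<le> \<bar>f x\<bar> * \<bar>g x\<bar>"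
   using sum_squares_bound[of "\<bar>f x\<bar>" "\<bar>g x\<bar>"] by auto
  then have "\<bar>f x\<bar> * \<bar>g x\<bar> \<le> (f x)^2 + (g x)^2" by linarith
  then show ?thesis by (simp add: abs_mult)
 qed
 then show "AE x in N. norm (f x * g x) \<le> norm ((f x)^2 + (g x)^2)" by simp
qed

lemma square_sum_le: "(a + b)^2 \<le> 2 * a^2 + 2 * (b::real)^2"
 using sum_squares_bound[of a b] by (simp add: power2_sum)

lemma L2_add:
 assumes "L2 N f" "L2 N g"
 shows "L2 N (%x. f x + g x)"
 unfolding square_integrable_def
proof
 show "integrable N (%x. (f x + g x)^2)"
  using integrable_mult_L2[OF assms] assms
  by (auto simp: power2_sum square_integrable_def mult.assoc)
qed (use assms in \<open>auto simp: square_integrable_def\<close>)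

lemma L2_cmult:
 assumes "L2 N f"
 shows "L2 N (%x. c * f x)"
 using assms by (auto simp: square_integrable_def power_mult_distrib)

lemma L2_diff:
 assumes "L2 N f" "L2 N g"
 shows "L2 N (%x. f x - g x)"
 using L2_add[OF assms(1) L2_cmult[OF assms(2), of "-1"]] by simp

lemma L2_zero: "L2 N (%x. 0)"
 by (simp add: square_integrable_def)

lemma L2_sum:
 assumes "\<And>i. i \<in> I \<Longrightarrow> L2 N (f i)"
 shows "L2 N (%x. \<Sum>i\<in>I. f i x)"
 using assms
 by (induction I rule: infinite_finite_induct) (auto intro: L2_add L2_zero)

lemma (in finite_measure) L2_of_bounded:
 assumes "f \<in> borel_measurable M" "\<And>x. x \<in> space M \<Longrightarrow> \<bar>f x\<bar> \<le> C"
 shows "L2 M f"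
 by (rule L2_bound[of M "%_. 1" _ C]) (use assms in \<open>auto simp: square_integrable_def\<close>)

lemma (in finite_measure) L2_integrable:
 assumes "L2 M f"
 shows "integrable M f"
 using assms square_integrable_imp_integrable by (auto simp: square_integrable_def)

lemma L2_Cauchy_Schwarz:
 assumes f: "L2 N f" and g: "L2 N g"
 shows "(LINT x|N. f x * g x)^2 \<le> (LINT x|N. (f x)^2) * (LINT x|N. (g x)^2)"
proof -
 define a b c where "a = (LINT x|N. (f x)^2)" and "b = (LINT x|N. f x * g x)" and "c = (LINT x|N. (g x)^2)"
 note [simp] = integrable_mult_L2[OF f g] L2D(2)[OF f] L2D(2)[OF g]
 note [measurable] = L2D(1)[OF f] L2D(1)[OF g]
 have quad: "0 \<le> a - 2 * t * b + t^2 * c" for t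
 proof -
  have "0 \<le> (LINT x|N. (f x - t * g x)^2)" by simp
  also have "\<dots> = (LINT x|N. (f x)^2 - (2 * t) * (f x * g x) + t^2 * (g x)^2)"
   by (intro Bochner_Integration.integral_cong) (auto simp: power2_eq_square algebra_simps)
  also have "\<dots> = a - 2 * t * b + t^2 * c" by (simp add: a_def b_def c_def)
  finally show ?thesis .
 qed
 have "c \<ge> 0" by (simp add: c_def)
 show ?thesis
 proof (cases "c = 0")
  case True
  then have "AE x in N. (g x)^2 = 0"
   unfolding c_def by (subst (asm) integral_nonneg_eq_0_iff_AE) auto
  then have "AE x in N. f x * g x = 0" by eventually_elim simp
  then have "b = 0" unfolding b_def by (subst integral_cong_AE[of _ _ "%_. 0"]) auto
  then show ?thesis using True by (simp add: b_def c_def)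
 next
  case False
  then have "c > 0" using \<open>c \<ge> 0\<close> by simp
  have "0 \<le> a - 2 * (b / c) * b + (b / c)^2 * c" by (rule quad)
  also have "\<dots> = a - b^2 / c" using \<open>c > 0\<close> by (simp add: field_simps power2_eq_square)
  finally have "b^2 \<le> a * c" using \<open>c > 0\<close> by (simp add: field_simps)
  then show ?thesis by (simp add: a_def b_def c_def)
 qed
qed

lemma integral_square_sum_le:
 assumes f: "L2 N f" and g: "L2 N g"
 shows "(LINT x|N. (f x + g x)^2) \<le> 2 * (LINT x|N. (f x)^2) + 2 * (LINT x|N. (g x)^2)"
proof -
 have "(LINT x|N. (f x + g x)^2) \<le> (LINT x|N. 2 * (f x)^2 + 2 * (g x)^2)"
  using L2D(2)[OF f] L2D(2)[OF g]
   L2D(2)[OF L2_add[OF f g]]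
  by (intro integral_mono) (auto simp: square_sum_le)
 also have "\<dots> = 2 * (LINT x|N. (f x)^2) + 2 * (LINT x|N. (g x)^2)"
  using L2D(2)[OF f] L2D(2)[OF g] by simp
 finally show ?thesis .
qed

lemma L2_triangle:
 assumes f: "L2 N f" and g: "L2 N g" and h: "L2 N h"
 shows "(LINT x|N. (f x - h x)^2) \<le> 2 * (LINT x|N. (f x - g x)^2) + 2 * (LINT x|N. (g x - h x)^2)"
 using integral_square_sum_le[OF L2_diff[OF f g] L2_diff[OF g h]] by simp

lemma L2_convergesD:
 assumes "L2_converges N fs f"
 shows "L2 N (fs n)" "L2 N f" "(%n. (LINT x|N. (fs n x - f x)^2)) \<longlonglongrightarrow> 0"
 using assms by (auto simp: L2_converges_def)

lemma L2_converges_const: "L2 N f \<Longrightarrow> L2_converges N (%_. f) f"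
 by (simp add: L2_converges_def)

lemma L2_converges_add:
 assumes f: "L2_converges N fs f" and g: "L2_converges N gs g"
 shows "L2_converges N (%n x. fs n x + gs n x) (%x. f x + g x)"
 unfolding L2_converges_def
proof (intro conjI allI)
 show "(%n. (LINT x|N. (fs n x + gs n x - (f x + g x))^2)) \<longlonglongrightarrow> 0"
 proof (rule tendsto_sandwich[OF _ _ tendsto_const])
  show "\<forall>\<^sub>F n in sequentially. (LINT x|N. (fs n x + gs n x - (f x + g x))^2)
    \<le> 2 * (LINT x|N. (fs n x - f x)^2) + 2 * (LINT x|N. (gs n x - g x)^2)"
  proof (intro always_eventually allI)
   fix n
   show "(LINT x|N. (fs n x + gs n x - (f x + g x))^2)
    \<le> 2 * (LINT x|N. (fs n x - f x)^2) + 2 * (LINT x|N. (gs n x - g x)^2)"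
    using integral_square_sum_le[OF L2_diff[OF L2_convergesD(1)[OF f, of n] L2_convergesD(2)[OF f]] L2_diff[OF L2_convergesD(1)[OF g, of n] L2_convergesD(2)[OF g]]]
    by (simp add: algebra_simps)
  qed
  show "(%n. 2 * (LINT x|N. (fs n x - f x)^2) + 2 * (LINT x|N. (gs n x - g x)^2)) \<longlonglongrightarrow> 0"
   using tendsto_add[OF tendsto_mult_left[OF L2_convergesD(3)[OF f], of 2] tendsto_mult_left[OF L2_convergesD(3)[OF g], of 2]] by simp
 qed simp
qed (use f g in \<open>auto simp: L2_converges_def intro!: L2_add\<close>)

lemma L2_converges_cmult:
 assumes f: "L2_converges N fs f"
 shows "L2_converges N (%n x. c * fs n x) (%x. c * f x)"
proof -
 have *: "(c * fs n x - c * f x)^2 = c^2 * (fs n x - f x)^2" for n x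
  by (simp add: power2_eq_square algebra_simps)
 show ?thesis
  unfolding L2_converges_def *
  using f tendsto_mult_left[OF L2_convergesD(3)[OF f], of "c^2"]
  by (auto simp: L2_converges_def L2_cmult)
qed

lemma L2_converges_sum:
 assumes "\<And>i. i \<in> I \<Longrightarrow> L2_converges N (fs i) (f i)"
 shows "L2_converges N (%n x. \<Sum>i\<in>I. fs i n x) (%x. \<Sum>i\<in>I. f i x)"
 using assms
 by (induction I rule: infinite_finite_induct)
  (auto intro!: L2_converges_add L2_converges_const L2_zero)

lemma tendsto_0_of_square: "(%n. (a n)^2) \<longlonglongrightarrow> 0 \<Longrightarrow> a \<longlonglongrightarrow> (0::real)"
 using tendsto_real_sqrt[of "%n. (a n)^2" 0 sequentially] tendsto_rabs_zero_cancel by fastforce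

lemma L2_converges_inner:
 assumes f: "L2_converges N fs f" and g: "L2_converges N gs g"
 shows "(%n. (LINT x|N. fs n x * gs n x)) \<longlonglongrightarrow> (LINT x|N. f x * g x)"
proof -
 note S = L2_convergesD(1)[OF f] L2_convergesD(2)[OF f] L2_convergesD(1)[OF g] L2_convergesD(2)[OF g]
 have F: "L2 N (%x. fs n x - f x)" and G: "L2 N (%x. gs n x - g x)" for n
  by (rule L2_diff[OF S(1,2)], rule L2_diff[OF S(3,4)])
 have z: "(%n. (LINT x|N. u n x * v n x)) \<longlonglongrightarrow> 0"
  if u: "\<And>n. L2 N (u n)" and v: "\<And>n. L2 N (v n)" and
   lim: "(%n. (LINT x|N. (u n x)^2) * (LINT x|N. (v n x)^2)) \<longlonglongrightarrow> 0" for u v :: "nat \<Rightarrow> _ \<Rightarrow> real"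
  by (rule tendsto_0_of_square, rule tendsto_sandwich[OF _ _ tendsto_const lim])
   (auto intro!: always_eventually L2_Cauchy_Schwarz u v)
 have 1: "(%n. (LINT x|N. (fs n x - f x) * (gs n x - g x))) \<longlonglongrightarrow> 0"
  using tendsto_mult[OF L2_convergesD(3)[OF f] L2_convergesD(3)[OF g]] by (intro z[OF F G]) simp
 have 2: "(%n. (LINT x|N. (fs n x - f x) * g x)) \<longlonglongrightarrow> 0"
  using tendsto_mult_right[OF L2_convergesD(3)[OF f], of "(LINT x|N. (g x)^2)"] by (intro z[OF F S(4)]) simp
 have 3: "(%n. (LINT x|N. f x * (gs n x - g x))) \<longlonglongrightarrow> 0"
  using tendsto_mult_left[OF L2_convergesD(3)[OF g], of "(LINT x|N. (f x)^2)"] by (intro z[OF S(2) G]) simp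
 have "(LINT x|N. fs n x * gs n x) = (LINT x|N. (fs n x - f x) * (gs n x - g x))
   + (LINT x|N. (fs n x - f x) * g x) + (LINT x|N. f x * (gs n x - g x)) + (LINT x|N. f x * g x)" for n
 proof -
  have "(LINT x|N. fs n x * gs n x) = (LINT x|N. (fs n x - f x) * (gs n x - g x)
   + (fs n x - f x) * g x + f x * (gs n x - g x) + f x * g x)"
   by (rule lint_cong) (simp add: algebra_simps)
  then show ?thesis
   using integrable_mult_L2[OF F[of n] G[of n]] integrable_mult_L2[OF F[of n] S(4)]
    integrable_mult_L2[OF S(2) G[of n]] integrable_mult_L2[OF S(2) S(4)] by simp
 qed
 then show ?thesis
  using tendsto_add[OF tendsto_add[OF tendsto_add[OF 1 2] 3] tendsto_const[of "(LINT x|N. f x * g x)"]] by simp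
qed

lemma L2_converges_dominated:
 assumes fs: "\<And>n. fs n \<in> borel_measurable N" and f: "f \<in> borel_measurable N"
  and g: "L2 N g"
  and bd: "\<And>n. AE x in N. \<bar>fs n x\<bar> \<le> g x" and lim: "AE x in N. (%n. fs n x) \<longlonglongrightarrow> f x"
 shows "L2_converges N fs f"
proof -
 note [measurable] = fs f
 have bf: "AE x in N. \<bar>f x\<bar> \<le> g x"
 proof -
  have "AE x in N. \<forall>n. \<bar>fs n x\<bar> \<le> g x" using bd by (simp add: AE_all_countable)
  with lim show ?thesis
  proof eventually_elim
   case (elim x)
   have "(%n. \<bar>fs n x\<bar>) \<longlonglongrightarrow> \<bar>f x\<bar>" using elim(1) by (rule tendsto_rabs)
   then show ?case by (rule LIMSEQ_le_const2) (use elim(2) in auto)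
  qed
 qed
 have sq: "L2 N k" if "k \<in> borel_measurable N" "AE x in N. \<bar>k x\<bar> \<le> g x" for k
  unfolding square_integrable_def
 proof
  show "integrable N (%x. (k x)^2)"
   by (rule Bochner_Integration.integrable_bound[OF L2D(2)[OF g]])
    (use that in \<open>auto elim!: eventually_mono intro!: power_mono abs_leI simp: abs_le_square_iff[symmetric]\<close>)
 qed fact
 have "(%n. (LINT x|N. (fs n x - f x)^2)) \<longlonglongrightarrow> (LINT x|N. 0)"
 proof (rule integral_dominated_convergence[where w = "%x. 4 * (g x)^2"])
  show "integrable N (%x. 4 * (g x)^2)" using L2D(2)[OF g] by simp
  show "AE x in N. (%n. (fs n x - f x)^2) \<longlonglongrightarrow> 0"
   using lim
  proof eventually_elim
   case (elim x)
   show ?case using tendsto_power[OF tendsto_diff[OF elim tendsto_const[of "f x"]], of 2] by simp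
  qed
  show "AE x in N. norm ((fs n x - f x)^2) \<le> 4 * (g x)^2" for n
   using bd[of n] bf
  proof eventually_elim
   case (elim x)
   have "\<bar>fs n x - f x\<bar> \<le> 2 * g x" using elim by linarith
   then have "(fs n x - f x)^2 \<le> (2 * g x)^2" by (metis abs_ge_zero power2_abs power_mono)
   then show ?case by (simp add: power_mult_distrib)
  qed
 qed auto
 then show ?thesis
  unfolding L2_converges_def using sq[OF fs bd] sq[OF f bf] by simp
qed

text \<open>Completeness of \<open>L^2\<close>: a subsequence converges almost everywhere, and Fatou's lemma
 identifies its limit as the limit in \<open>L^2\<close> of the whole sequence.\<close>

lemma (in finite_measure) L2_complete:
 assumes sq: "\<And>n. L2 M (fs n)"
  and cauchy: "\<And>e. e > 0 \<Longrightarrow> \<exists>N. \<forall>i\<ge>N. \<forall>j\<ge>N. (LINT x|M. (fs i x - fs j x)^2) < e"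
 shows "\<exists>f. L2_converges M fs f"
proof -
 have [measurable]: "fs n \<in> borel_measurable M" for n using sq by (auto simp: square_integrable_def)
 obtain r where r: "strict_mono r" "AE x in M. Cauchy (%i. fs (r i) x)"
 proof (rule cauchy_L1_AE_cauchy_subseq)
  show "integrable M (fs n)" for n using sq by (rule L2_integrable)
  fix e :: real assume "e > 0"
  define m where "m = measure M (space M) + 1"
  have m: "m > 0" by (simp add: m_def add_nonneg_pos)
  obtain N where N: "\<And>i j. i \<ge> N \<Longrightarrow> j \<ge> N \<Longrightarrow> (LINT x|M. (fs i x - fs j x)^2) < e^2 / m"
   using cauchy[of "e^2 / m"] \<open>e > 0\<close> m by auto
  show "\<exists>N. \<forall>i\<ge>N. \<forall>j\<ge>N. (LINT x|M. norm (fs i x - fs j x)) < e"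
  proof (intro exI allI impI)
   fix i j assume ij: "i \<ge> N" "j \<ge> N"
   have d: "L2 M (%x. \<bar>fs i x - fs j x\<bar>)"
    using L2_diff[OF sq sq, of i j] by (auto simp: square_integrable_def)
   have "(LINT x|M. \<bar>fs i x - fs j x\<bar> * 1)^2 \<le> (LINT x|M. (\<bar>fs i x - fs j x\<bar>)^2) * (LINT x|M. 1^2)"
    by (rule L2_Cauchy_Schwarz[OF d]) (auto simp: square_integrable_def)
   also have "\<dots> \<le> (LINT x|M. (fs i x - fs j x)^2) * m" by (auto simp: m_def intro!: mult_left_mono)
   also have "\<dots> < e^2" using N[OF ij] m by (simp add: field_simps)
   finally show "(LINT x|M. norm (fs i x - fs j x)) < e"
    using \<open>e > 0\<close> by (simp add: power_less_imp_less_base)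
  qed
 qed auto
 define f where "f x = lim (%i. fs (r i) x)" for x
 have [measurable]: "f \<in> borel_measurable M" unfolding f_def by measurable
 have lim: "AE x in M. (%i. fs (r i) x) \<longlonglongrightarrow> f x"
  using r(2) by eventually_elim (auto simp: f_def convergent_LIMSEQ_iff[symmetric] intro: Cauchy_convergent)
 have key: "(\<integral>\<^sup>+x. ennreal ((fs i x - f x)^2) \<partial>M) \<le> ennreal e"
  if N: "\<And>i j. i \<ge> N \<Longrightarrow> j \<ge> N \<Longrightarrow> (LINT x|M. (fs i x - fs j x)^2) < e" and "i \<ge> N" for N e i
 proof -
  have "(\<integral>\<^sup>+x. ennreal ((fs i x - f x)^2) \<partial>M) = (\<integral>\<^sup>+x. liminf (%k. ennreal ((fs i x - fs (r k) x)^2)) \<partial>M)"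
  proof (rule nn_integral_cong_AE, use lim in eventually_elim)
   case (elim x)
   have "(%k. ennreal ((fs i x - fs (r k) x)^2)) \<longlonglongrightarrow> ennreal ((fs i x - f x)^2)"
    by (intro tendsto_intros elim)
   then show ?case by (metis lim_imp_Liminf sequentially_bot)
  qed
  also have "\<dots> \<le> liminf (%k. \<integral>\<^sup>+x. ennreal ((fs i x - fs (r k) x)^2) \<partial>M)"
   by (rule nn_integral_liminf) auto
  also have "\<dots> \<le> ennreal e"
  proof -
   have "liminf (%k. \<integral>\<^sup>+x. ennreal ((fs i x - fs (r k) x)^2) \<partial>M) \<le> liminf (%k. ennreal e)"
  proof (rule Liminf_mono, rule eventually_sequentiallyI[of N])
   fix k assume "k \<ge> N"
   then have "r k \<ge> N" using seq_suble[OF r(1), of k] by simp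
   have "(\<integral>\<^sup>+x. ennreal ((fs i x - fs (r k) x)^2) \<partial>M) = ennreal (LINT x|M. (fs i x - fs (r k) x)^2)"
    using L2D(2)[OF L2_diff[OF sq sq, of i "r k"]]
    by (intro nn_integral_eq_integral) auto
   also have "\<dots> \<le> ennreal e" using N[OF \<open>i \<ge> N\<close> \<open>r k \<ge> N\<close>] by (intro ennreal_leI) simp
   finally show "(\<integral>\<^sup>+x. ennreal ((fs i x - fs (r k) x)^2) \<partial>M) \<le> ennreal e" .
  qed
  then show ?thesis by (simp add: Liminf_const)
  qed
  finally show ?thesis .
 qed
 have sqd: "L2 M (%x. fs i x - f x) \<and> (LINT x|M. (fs i x - f x)^2) \<le> e"
  if N: "\<And>i j. i \<ge> N \<Longrightarrow> j \<ge> N \<Longrightarrow> (LINT x|M. (fs i x - fs j x)^2) < e" and "i \<ge> N" "e > 0" for N e i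
 proof -
  note K = key[OF N \<open>i \<ge> N\<close>]
  have I: "integrable M (%x. (fs i x - f x)^2)"
   using le_less_trans[OF K] by (intro integrableI_nonneg) auto
  moreover have "ennreal (LINT x|M. (fs i x - f x)^2) \<le> ennreal e"
   using K nn_integral_eq_integral[OF I] by simp
  ultimately show ?thesis using \<open>e > 0\<close> by (auto simp: square_integrable_def)
 qed
 have "L2 M f"
 proof -
  obtain N where "\<And>i j. i \<ge> N \<Longrightarrow> j \<ge> N \<Longrightarrow> (LINT x|M. (fs i x - fs j x)^2) < 1"
   using cauchy[of 1] by auto
  then have "L2 M (%x. fs N x - f x)" using sqd[of N 1 N] by auto
  from L2_diff[OF sq[of N] this] show ?thesis by simp
 qed
 moreover have "(%n. (LINT x|M. (fs n x - f x)^2)) \<longlonglongrightarrow> 0"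
 proof (rule LIMSEQ_I)
  fix e :: real assume "e > 0"
  then obtain N where N: "\<And>i j. i \<ge> N \<Longrightarrow> j \<ge> N \<Longrightarrow> (LINT x|M. (fs i x - fs j x)^2) < e/2"
   using cauchy[of "e/2"] by auto
  have "(LINT x|M. (fs n x - f x)^2) < e" if "n \<ge> N" for n
   using sqd[of N "e/2" n, OF N] that \<open>e > 0\<close> by auto
  then show "\<exists>N. \<forall>n\<ge>N. norm ((LINT x|M. (fs n x - f x)^2) - 0) < e" by auto
 qed
 ultimately show ?thesis using sq unfolding L2_converges_def by blast
qed

text \<open>The sets over which \<open>f\<close> has integral zero form a Dynkin system.\<close>

lemma set_integral_zero_Dynkin:
 fixes f :: "'a \<Rightarrow> real"
 assumes f: "integrable N f" and G: "Int_stable G" "G \<subseteq> sets N"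
  and gen: "\<And>A. A \<in> G \<Longrightarrow> (LINT x:A|N. f x) = 0" and tot: "(LINT x|N. f x) = 0"
  and A: "A \<in> sigma_sets (space N) G"
 shows "(LINT x:A|N. f x) = 0"
proof -
 have si: "set_integrable N B f" if "B \<in> sets N" for B
  using integrable_mult_indicator[OF that f] unfolding set_integrable_def .
 have sub: "sigma_sets (space N) G \<subseteq> sets N" using G(2) by (rule sets.sigma_sets_subset)
 have "G \<subseteq> Pow (space N)" using G(2) sets.sets_into_space by blast
 with G(1) show ?thesis using A
 proof (induction rule: sigma_sets_induct_disjoint)
  case (compl B)
  then have B: "B \<in> sets N" using sub by blast
  have "(LINT x:space N|N. f x) = (LINT x:B|N. f x) + (LINT x:space N - B|N. f x)"
   using set_integral_Un[OF _ si[OF B] si[of "space N - B"]] B sets.sets_into_space[OF B]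
   by (simp add: Un_absorb1)
  moreover have "(LINT x:space N|N. f x) = (LINT x|N. f x)"
   using f by (rule set_integral_space)
  ultimately show ?case using compl tot by simp
 next
  case (union B)
  then have B: "B i \<in> sets N" for i using sub by blast
  have "(LINT x:(\<Union>i. B i)|N. f x) = (\<Sum>i. LINT x:B i|N. f x)"
   by (rule lebesgue_integral_countable_add) (use B union(1) si[of "\<Union>i. B i"] in \<open>auto simp: disjoint_family_on_def\<close>)
  then show ?case using union by simp
 qed (use gen in \<open>auto simp: set_lebesgue_integral_def\<close>)
qed

lemma AE_zero_Dynkin:
 fixes f :: "'a \<Rightarrow> real"
 assumes "finite_measure N" and f: "integrable N f" and G: "Int_stable G" "G \<subseteq> Pow (space N)" "sets N = sigma_sets (space N) G"
  and gen: "\<And>A. A \<in> G \<Longrightarrow> (LINT x:A|N. f x) = 0" and tot: "(LINT x|N. f x) = 0"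
 shows "AE x in N. f x = 0"
proof -
 interpret finite_measure N by fact
 have "G \<subseteq> sets N" using G(2,3) by (auto intro: sigma_sets.Basic)
 then show ?thesis using G(3) by (intro density_zero[OF f] set_integral_zero_Dynkin[OF f G(1) _ gen tot]) auto
qed

lemma AE_zero_rectangles:
 fixes f :: "'a \<times> 'b \<Rightarrow> real"
 assumes N1: "finite_measure N1" and N2: "finite_measure N2" and f: "integrable (N1 \<Otimes>\<^sub>M N2) f"
  and gen: "\<And>A B. A \<in> sets N1 \<Longrightarrow> B \<in> sets N2 \<Longrightarrow> (LINT x:A\<times>B|N1 \<Otimes>\<^sub>M N2. f x) = 0"
 shows "AE x in N1 \<Otimes>\<^sub>M N2. f x = 0"
proof (rule AE_zero_Dynkin[where G = "{A \<times> B | A B. A \<in> sets N1 \<and> B \<in> sets N2}"])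
 interpret N1: finite_measure N1 by fact
 interpret N2: finite_measure N2 by fact
 interpret pair_sigma_finite N1 N2 ..
 show "finite_measure (N1 \<Otimes>\<^sub>M N2)" by (rule finite_measure_pair_measure) fact+
 show "Int_stable {A \<times> B | A B. A \<in> sets N1 \<and> B \<in> sets N2}" by (rule Int_stable_pair_measure_generator)
 show "{A \<times> B | A B. A \<in> sets N1 \<and> B \<in> sets N2} \<subseteq> Pow (space (N1 \<Otimes>\<^sub>M N2))"
  using pair_measure_closed[of N1 N2] by (simp add: space_pair_measure)
 show "sets (N1 \<Otimes>\<^sub>M N2) = sigma_sets (space (N1 \<Otimes>\<^sub>M N2)) {A \<times> B | A B. A \<in> sets N1 \<and> B \<in> sets N2}"
  by (simp add: sets_pair_measure space_pair_measure)
 show "(LINT x|(N1 \<Otimes>\<^sub>M N2). f x) = 0"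
  using gen[of "space N1" "space N2"] set_integral_space[OF f] by (simp add: space_pair_measure)
qed (use f gen in auto)

section \<open>Functions on the time interval\<close>

lemma space_time_measure [simp]: "space (tm T) = {0..T}"
 by (simp add: time_measure_def space_restrict_space)

lemma sets_time_measure [measurable_cong]: "sets (tm T) = sets (restrict_space borel {0..T})"
 unfolding time_measure_def by (intro sets_restrict_space_cong) simp

lemma finite_measure_time_measure: "finite_measure (tm T)"
proof
 have "emeasure (tm T) {0..T} = emeasure lborel ({0..T} \<inter> {0..T})"
  unfolding time_measure_def by (subst emeasure_restrict_space) auto
 then show "emeasure (tm T) (space (tm T)) \<noteq> \<infinity>" by (simp add: emeasure_lborel_Icc_eq)
qed

lemma sigma_finite_time_measure: "sigma_finite_measure (tm T)"
 using finite_measure_time_measure[of T] by (simp add: finite_measure_def)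

lemma measurable_time_measureI: "f \<in> borel_measurable borel \<Longrightarrow> f \<in> borel_measurable (tm T)"
 by (simp add: time_measure_def measurable_restrict_space1)

lemma sets_time_measure_subset: "A \<in> sets borel \<Longrightarrow> A \<subseteq> {0..T} \<Longrightarrow> A \<in> sets (tm T)"
 by (auto simp: sets_time_measure sets_restrict_space)

lemma sets_time_measureD: "A \<in> sets (tm T) \<Longrightarrow> A \<in> sets borel \<and> A \<subseteq> {0..T}"
 by (auto simp: sets_time_measure sets_restrict_space)

lemma emeasure_time_measure:
 "A \<in> sets borel \<Longrightarrow> A \<subseteq> {0..T} \<Longrightarrow> emeasure (tm T) A = emeasure lborel A"
 unfolding time_measure_def by (subst emeasure_restrict_space) auto

lemma integral_time_measure:
 "(LINT t|(tm T). f t) = (LINT t:{0..T}|lborel. f t)" for f :: "real \<Rightarrow> real"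
 unfolding time_measure_def by (subst integral_restrict_space) (auto simp: set_lebesgue_integral_def)

lemma nn_integral_time_measure:
 "(\<integral>\<^sup>+t. f t \<partial>tm T) = (\<integral>\<^sup>+t. f t * indicator {0..T} t \<partial>lborel)"
 unfolding time_measure_def by (subst nn_integral_restrict_space) auto

lemma AE_time_measure_neq: "AE t in tm T. t \<noteq> c"
proof (rule AE_I[where N = "{c} \<inter> {0..T}"])
 have "emeasure (tm T) ({c} \<inter> {0..T}) = emeasure lborel ({c} \<inter> {0..T})"
  by (rule emeasure_time_measure) auto
 also have "\<dots> = 0" by (intro emeasure_lborel_countable countable_Int1) auto
 finally show "emeasure (tm T) ({c} \<inter> {0..T}) = 0" .
qed (auto intro!: sets_time_measure_subset)

lemma step_fun_Nil [simp]: "step_fun [] t = 0" by (simp add: step_fun_def)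

lemma step_fun_append: "step_fun (xs @ ys) t = step_fun xs t + step_fun ys t" by (simp add: step_fun_def)

lemma step_fun_scale: "step_fun (map (%(c, ab). (k * c, ab)) xs) t = k * step_fun xs t"
 by (induction xs) (auto simp: step_fun_def algebra_simps)

lemma step_fun_Cons: "step_fun ((c, a, b) # xs) t = c * indicator {a<..b} t + step_fun xs t"
 by (simp add: step_fun_def)

lemma step_fun_measurable [measurable]: "step_fun xs \<in> borel_measurable borel"
proof (induction xs)
 case Nil then show ?case by (simp add: step_fun_def)
next
 case (Cons x xs)
 obtain c a b where "x = (c, a, b)" by (cases x)
 with Cons show ?case by (subst step_fun_Cons[abs_def, of c a b xs, folded \<open>x = (c, a, b)\<close>]) measurable
qed

definition steps_in :: "real \<Rightarrow> (real \<times> real \<times> real) list \<Rightarrow> bool" where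
 "steps_in T xs \<longleftrightarrow> (\<forall>(c, a, b)\<in>set xs. 0 \<le> a \<and> a \<le> b \<and> b \<le> T)"

lemma step_fun_bound: "\<bar>step_fun xs t\<bar> \<le> (\<Sum>(c, a, b)\<leftarrow>xs. \<bar>c\<bar>)"
proof (induction xs)
 case (Cons x xs)
 obtain c a b where x: "x = (c, a, b)" by (cases x)
 have "\<bar>c * indicator {a<..b} t + step_fun xs t\<bar> \<le> \<bar>c\<bar> + \<bar>step_fun xs t\<bar>"
  by (auto simp: indicator_def abs_triangle_ineq)
 then show ?case using Cons by (simp add: x step_fun_Cons)
qed simp

lemma L2_step_fun: "L2 (tm T) (step_fun xs)"
 using finite_measure_time_measure
 by (rule finite_measure.L2_of_bounded[where C = "\<Sum>(c, a, b)\<leftarrow>xs. \<bar>c\<bar>"])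
  (auto intro: measurable_time_measureI step_fun_bound)

definition step_approx :: "real \<Rightarrow> (real \<Rightarrow> real) \<Rightarrow> bool" where
 "step_approx T h \<longleftrightarrow> L2 (tm T) h \<and>
  (\<forall>e>0. \<exists>xs. steps_in T xs \<and> (LINT t|(tm T). (step_fun xs t - h t)^2) < e)"

lemma step_approx_closed:
 assumes h: "L2 (tm T) h"
  and app: "\<And>e. e > 0 \<Longrightarrow> \<exists>g. step_approx T g \<and> (LINT t|(tm T). (g t - h t)^2) < e"
 shows "step_approx T h"
 unfolding step_approx_def
proof (intro conjI allI impI h)
 fix e :: real assume "e > 0"
 obtain g where g: "step_approx T g" "(LINT t|(tm T). (g t - h t)^2) < e / 4"
  using app[of "e/4"] \<open>e > 0\<close> by auto
 obtain xs where xs: "steps_in T xs" "(LINT t|(tm T). (step_fun xs t - g t)^2) < e / 4"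
  using g(1) \<open>e > 0\<close> unfolding step_approx_def by (metis zero_less_divide_iff zero_less_numeral)
 have "(LINT t|(tm T). (step_fun xs t - h t)^2) < e"
  using L2_triangle[OF L2_step_fun _ h, of g xs] g xs unfolding step_approx_def by linarith
 then show "\<exists>xs. steps_in T xs \<and> (LINT t|(tm T). (step_fun xs t - h t)^2) < e" using xs by auto
qed

lemma step_approx_add:
 assumes f: "step_approx T f" and g: "step_approx T g"
 shows "step_approx T (%t. f t + g t)"
 unfolding step_approx_def
proof (intro conjI allI impI)
 fix e :: real assume "e > 0"
 then have e: "e / 4 > 0" by simp
 obtain xs where xs: "steps_in T xs" "(LINT t|(tm T). (step_fun xs t - f t)^2) < e / 4"
  using f e unfolding step_approx_def by meson
 obtain ys where ys: "steps_in T ys" "(LINT t|(tm T). (step_fun ys t - g t)^2) < e / 4"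
  using g e unfolding step_approx_def by meson
 have "(LINT t|(tm T). (step_fun (xs @ ys) t - (f t + g t))^2)
   = (LINT t|(tm T). ((step_fun xs t - f t) + (step_fun ys t - g t))^2)"
  by (simp add: step_fun_append algebra_simps)
 also have "\<dots> \<le> 2 * (LINT t|(tm T). (step_fun xs t - f t)^2) + 2 * (LINT t|(tm T). (step_fun ys t - g t)^2)"
  using f g by (intro integral_square_sum_le L2_diff L2_step_fun) (auto simp: step_approx_def)
 also have "\<dots> < e" using xs ys by linarith
 finally show "\<exists>xs. steps_in T xs \<and> (LINT t|(tm T). (step_fun xs t - (f t + g t))^2) < e"
  using xs(1) ys(1) by (intro exI[of _ "xs @ ys"]) (auto simp: steps_in_def)
qed (use f g in \<open>auto simp: step_approx_def intro: L2_add\<close>)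

lemma step_approx_cmult:
 assumes f: "step_approx T f"
 shows "step_approx T (%t. k * f t)"
 unfolding step_approx_def
proof (intro conjI allI impI)
 fix e :: real assume "e > 0"
 then have "e / (k^2 + 1) > 0" by (simp add: add_nonneg_pos)
 then obtain xs where xs: "steps_in T xs" "(LINT t|(tm T). (step_fun xs t - f t)^2) < e / (k^2 + 1)"
  using f unfolding step_approx_def by meson
 have "(LINT t|(tm T). (step_fun (map (%(c, ab). (k * c, ab)) xs) t - k * f t)^2)
   = (LINT t|(tm T). k^2 * (step_fun xs t - f t)^2)"
  by (simp add: step_fun_scale power_mult_distrib[symmetric] right_diff_distrib)
 also have "\<dots> = k^2 * (LINT t|(tm T). (step_fun xs t - f t)^2)" by simp
 also have "\<dots> \<le> k^2 * (e / (k^2 + 1))" using xs by (intro mult_left_mono) auto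
 also have "\<dots> < e"
 proof -
  have "k^2 + 1 > 0" by (simp add: add_nonneg_pos)
  then show ?thesis using \<open>e > 0\<close> by (simp add: pos_divide_less_eq algebra_simps)
 qed
 finally show "\<exists>xs. steps_in T xs \<and> (LINT t|(tm T). (step_fun xs t - k * f t)^2) < e"
  using xs(1) by (intro exI[of _ "map (%(c, ab). (k * c, ab)) xs"]) (auto simp: steps_in_def)
qed (use f in \<open>auto simp: step_approx_def intro: L2_cmult\<close>)

lemma step_approx_sum:
 assumes "\<And>i. i \<in> I \<Longrightarrow> step_approx T (f i)"
 shows "step_approx T (%t. \<Sum>i\<in>I. f i t)"
proof -
 have 0: "step_approx T (%t. 0)"
  unfolding step_approx_def by (auto intro!: L2_zero exI[of _ "[]"] simp: steps_in_def)
 show ?thesis using assms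
  by (induction I rule: infinite_finite_induct) (auto intro: step_approx_add 0)
qed

lemma step_approx_cong_AE:
 assumes f: "step_approx T f" and g: "g \<in> borel_measurable (tm T)" and eq: "AE t in tm T. f t = g t"
 shows "step_approx T g"
proof -
 have [measurable]: "f \<in> borel_measurable (tm T)" "g \<in> borel_measurable (tm T)"
   "step_fun xs \<in> borel_measurable (tm T)" for xs
  using f g by (auto simp: step_approx_def square_integrable_def intro: measurable_time_measureI)
 have "(LINT t|(tm T). (step_fun xs t - f t)^2) = (LINT t|(tm T). (step_fun xs t - g t)^2)" for xs
  by (rule integral_cong_AE) (use eq in auto)
 moreover have "integrable (tm T) (%t. (f t)^2) = integrable (tm T) (%t. (g t)^2)"
  by (rule integrable_cong_AE) (use eq in auto)
 ultimately show ?thesis using f g by (auto simp: step_approx_def square_integrable_def)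
qed

lemma step_approx_seq:
 assumes "\<And>n. step_approx T (f n)" and lim: "L2_converges (tm T) f h"
 shows "step_approx T h"
proof (rule step_approx_closed)
 fix e :: real assume "e > 0"
 then have "\<forall>\<^sub>F n in sequentially. (LINT t|(tm T). (f n t - h t)^2) < e"
  using L2_convergesD(3)[OF lim] by (rule order_tendstoD(2)[rotated])
 then show "\<exists>g. step_approx T g \<and> (LINT t|(tm T). (g t - h t)^2) < e"
  using assms(1) eventually_happens'[OF sequentially_bot] by blast
qed (rule L2_convergesD(2)[OF lim])

lemma step_approx_indicator:
 assumes A: "A \<in> sets (tm T)" and T: "0 \<le> T"
 shows "step_approx T (indicator A)"
proof -
 interpret finite_measure "tm T" by (rule finite_measure_time_measure)
 define G where "G = ((\<inter>) {0..T}) ` range (%a. {..a::real})"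
 have gen: "sets (tm T) = sigma_sets {0..T} G"
 proof -
  have b: "sets borel = sigma_sets UNIV (range (%a. {..a::real}))"
   by (subst borel_eq_atMost) (simp add: sets_measure_of)
  have "{0..T} \<in> sets borel" by simp
  then have "(\<inter>) {0..T} ` sigma_sets UNIV (range (%a. {..a::real})) = sigma_sets {0..T} G"
   unfolding G_def by (intro sigma_sets_Int) (auto simp: b)
  then show ?thesis by (simp add: sets_time_measure sets_restrict_space b)
 qed
 have Int: "Int_stable G"
 proof (rule Int_stableI)
  fix a b assume "a \<in> G" "b \<in> G"
  then obtain x y where "a = {0..T} \<inter> {..x}" "b = {0..T} \<inter> {..y}" unfolding G_def by blast
  then have "a \<inter> b = {0..T} \<inter> {..min x y}" by auto
  then show "a \<inter> b \<in> G" unfolding G_def by blast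
 qed
 have meas: "indicator B \<in> borel_measurable (tm T)" if "B \<in> sets (tm T)" for B :: "real set"
  using that by measurable
 have ind: "step_approx T (indicator {a<..b})" if "0 \<le> a" "a \<le> b" "b \<le> T" for a b
  unfolding step_approx_def
 proof (intro conjI allI impI)
  have eq: "indicator {a<..b} = step_fun [(1, a, b)]" by (auto simp: step_fun_def fun_eq_iff)
  show "L2 (tm T) (indicator {a<..b})" unfolding eq by (rule L2_step_fun)
  show "\<exists>xs. steps_in T xs \<and> (LINT t|(tm T). (step_fun xs t - indicator {a<..b} t)^2) < e" if "e > 0" for e
   unfolding eq using \<open>0 \<le> a\<close> \<open>a \<le> b\<close> \<open>b \<le> T\<close> that by (intro exI[of _ "[(1, a, b)]"]) (simp add: steps_in_def)
 qed
 have all: "step_approx T (indicator {0..T})"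
 proof (rule step_approx_cong_AE[OF ind[of 0 T]])
  have "AE t in tm T. t \<in> {0..T}" using AE_space[of "tm T"] by simp
  then show "AE t in tm T. indicator {0<..T} t = (indicator {0..T} t :: real)"
   using AE_time_measure_neq[of 0 T] by eventually_elim (auto simp: indicator_def)
 qed (use T in \<open>auto intro!: measurable_time_measureI\<close>)
 have zero: "step_approx T (indicator {})"
  using step_approx_cmult[OF all, of 0] by (simp add: indicator_def[abs_def])
 have AG: "A \<in> sigma_sets {0..T} G" using A gen by simp
 have GP: "G \<subseteq> Pow {0..T}" by (auto simp: G_def)
 from Int GP AG show ?thesis
 proof (induction rule: sigma_sets_induct_disjoint)
  case (basic B)
  then obtain x where B: "B = {0..T} \<inter> {..x}" unfolding G_def by blast
  show ?case
  proof (cases "x < 0")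
   case True
   then have "B = {}" using B by auto
   then show ?thesis using zero by (simp only:)
  next
   case False
   have "step_approx T (indicator {0<..min x T})" using False T by (intro ind) auto
   then show ?thesis
   proof (rule step_approx_cong_AE)
    show "indicator B \<in> borel_measurable (tm T)" using B by (auto intro!: measurable_time_measureI)
    have "AE t in tm T. t \<in> {0..T}" using AE_space[of "tm T"] by simp
    then show "AE t in tm T. indicator {0<..min x T} t = (indicator B t :: real)"
     using AE_time_measure_neq[of 0 T] by eventually_elim (auto simp: B indicator_def)
   qed
  qed
 next
  case empty
  show ?case by (rule zero)
 next
  case (compl B)
  then have B: "B \<in> sets (tm T)" unfolding gen by blast
  have "step_approx T (%t. indicator {0..T} t + (-1) * indicator B t)"
   using step_approx_add[OF all step_approx_cmult[OF compl(2), of "-1"]] .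
  then show ?case
  proof (rule step_approx_cong_AE)
   show "indicator ({0..T} - B) \<in> borel_measurable (tm T)"
    using sets.compl_sets[OF B] by (intro meas) simp
   show "AE t in tm T. indicator {0..T} t + (- 1) * indicator B t = (indicator ({0..T} - B) t :: real)"
    using sets_time_measureD[OF B] by (intro AE_I2) (auto simp: indicator_def)
  qed
 next
  case (union B)
  then have B: "B i \<in> sets (tm T)" for i unfolding gen by blast
  have p: "step_approx T (%t. \<Sum>i<n. indicator (B i) t)" for n
   by (rule step_approx_sum) (use union in auto)
  have eq: "(\<Sum>i<n. indicator (B i) t :: real) = indicator (\<Union>i<n. B i) t" for n t
   using union(1) by (subst indicator_UN_disjoint) (auto simp: disjoint_family_on_def)
  show ?case
  proof (rule step_approx_seq[OF p])
   show "L2_converges (tm T) (%n t. \<Sum>i<n. indicator (B i) t) (indicator (\<Union>i. B i))"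
    unfolding eq
   proof (rule L2_converges_dominated[where g = "%_. 1"])
    show "L2 (tm T) (%_. 1)" by (simp add: square_integrable_def)
    show "AE x in tm T. (%n. indicator (\<Union>i<n. B i) x :: real) \<longlonglongrightarrow> indicator (\<Union>i. B i) x"
     by (intro AE_I2 LIMSEQ_indicator_UN)
    show "indicator (\<Union>i<n. B i) \<in> borel_measurable (tm T)" for n
     by (rule meas) (use B in auto)
    show "indicator (\<Union>i. B i) \<in> borel_measurable (tm T)"
     by (rule meas) (use B in auto)
   qed (auto simp: indicator_def)
  qed
 qed
qed

text \<open>The functions that step functions approximate form a closed subspace, and it contains all indicators.\<close>

lemma step_fun_dense:
 assumes h: "L2 (tm T) h" and T: "0 \<le> T"
 shows "step_approx T h"
proof -
 have [measurable]: "h \<in> borel_measurable (tm T)" using h by (rule L2D)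
 obtain F where F: "\<And>i. simple_function (tm T) (F i)"
  "\<And>x. x \<in> space (tm T) \<Longrightarrow> (%i. F i x) \<longlonglongrightarrow> h x"
  "\<And>i x. x \<in> space (tm T) \<Longrightarrow> dist (F i x) 0 \<le> 2 * dist (h x) 0"
  using borel_measurable_implies_sequence_metric[OF L2D(1)[OF h], of 0] by metis
 have Fm: "F i \<in> borel_measurable (tm T)" for i by (rule borel_measurable_simple_function[OF F(1)])
 show ?thesis
 proof (rule step_approx_seq)
  show "L2_converges (tm T) F h"
  proof (rule L2_converges_dominated[where g = "%x. 2 * \<bar>h x\<bar>"])
   show "L2 (tm T) (%x. 2 * \<bar>h x\<bar>)"
    using h by (intro L2_cmult) (auto simp: square_integrable_def)
   show "AE x in tm T. \<bar>F n x\<bar> \<le> 2 * \<bar>h x\<bar>" for n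
    using F(3)[of _ n] by (intro AE_I2) (auto simp: dist_real_def)
  qed (use F(2) Fm in auto)
  fix n
  have "step_approx T (%x. \<Sum>y\<in>F n ` space (tm T). y * indicator (F n -` {y} \<inter> space (tm T)) x)"
   by (rule step_approx_sum, rule step_approx_cmult, rule step_approx_indicator[OF simple_functionD(2)[OF F(1)] T])
  then show "step_approx T (F n)"
  proof (rule step_approx_cong_AE[OF _ Fm])
   show "AE x in tm T. (\<Sum>y\<in>F n ` space (tm T). y * indicator (F n -` {y} \<inter> space (tm T)) x) = F n x"
    using simple_function_indicator_representation_banach[OF F(1)[of n]]
    by (intro AE_I2) (simp only: real_scaleR_def mult.commute)
  qed
 qed
qed


section \<open>Backward averages\<close>

text \<open>The mean of \<open>h\<close> over \<open>[s-\<epsilon>, s)\<close>, where \<open>h\<close> is continued by zero to the left of \<open>0\<close>.\<close>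

definition back_avg :: "real \<Rightarrow> real \<Rightarrow> (real \<Rightarrow> real) \<Rightarrow> real \<Rightarrow> real" where
 "back_avg T eps h s = inverse eps * (LINT t|(tm T). indicator {s - eps..<s} t * h t)"

lemma nn_integral_time_measure_interval:
 assumes "A \<in> sets borel" "A \<subseteq> {a..b}" "a \<le> b"
 shows "(\<integral>\<^sup>+t. indicator A t \<partial>tm T) \<le> ennreal (b - a)"
proof -
 have "(\<integral>\<^sup>+t. indicator A t \<partial>tm T) \<le> (\<integral>\<^sup>+t. indicator {a..b} t \<partial>lborel)"
  unfolding nn_integral_time_measure using assms(2) by (intro nn_integral_mono) (auto simp: indicator_def)
 also have "\<dots> = ennreal (b - a)" using assms(3) by simp
 finally show ?thesis .
qed

lemma L2_indicator_mult:
 assumes "L2 (tm T) h" "A \<in> sets borel"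
 shows "L2 (tm T) (%t. indicator A t * h t)"
proof (rule L2_bound[OF assms(1), where C = 1])
 have "indicator A \<in> borel_measurable (tm T)" using assms(2) by (intro measurable_time_measureI) simp
 then show "(%t. indicator A t * h t) \<in> borel_measurable (tm T)"
  using L2D(1)[OF assms(1)] by (rule borel_measurable_times)
qed (auto simp: indicator_def)

lemma L2_indicator: "A \<in> sets borel \<Longrightarrow> L2 (tm T) (indicator A)"
 using finite_measure_time_measure
 by (rule finite_measure.L2_of_bounded[where C = 1])
  (auto intro!: measurable_time_measureI simp: indicator_def)

lemma integral_window_le:
 assumes "A \<in> sets borel" "A \<subseteq> {a..b}" "a \<le> b"
 shows "(LINT t|(tm T). indicator A t) \<le> b - a"
proof -
 have "integrable (tm T) (indicator A :: real \<Rightarrow> real)"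
  using L2_indicator[OF assms(1)]
  by (rule finite_measure.L2_integrable[OF finite_measure_time_measure])
 then have "ennreal (LINT t|(tm T). indicator A t) = (\<integral>\<^sup>+t. ennreal (indicator A t) \<partial>tm T)"
  by (subst nn_integral_eq_integral) auto
 also have "\<dots> \<le> ennreal (b - a)"
  using nn_integral_time_measure_interval[OF assms] by (simp add: ennreal_indicator)
 finally show ?thesis using assms by (simp add: ennreal_le_iff)
qed

lemma measurable_window [measurable]:
 "(%(s, t). indicator {s - eps..<s} t :: real) \<in> borel_measurable (tm T \<Otimes>\<^sub>M tm T)"
proof -
 have [measurable]: "fst \<in> borel_measurable (tm T \<Otimes>\<^sub>M tm T)"
   "snd \<in> borel_measurable (tm T \<Otimes>\<^sub>M tm T)"
  using measurable_compose[OF measurable_fst measurable_time_measureI[OF measurable_ident]]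
   measurable_compose[OF measurable_snd measurable_time_measureI[OF measurable_ident]] by auto
 have "(%p. if fst p - eps \<le> snd p \<and> snd p < fst p then 1 else 0 :: real) \<in> borel_measurable (tm T \<Otimes>\<^sub>M tm T)"
  by measurable
 moreover have "(%p. if fst p - eps \<le> snd p \<and> snd p < fst p then 1 else 0 :: real) = (%(s, t). indicator {s - eps..<s} t)"
  by (auto simp: fun_eq_iff indicator_def)
 ultimately show ?thesis by simp
qed

lemma back_avg_measurable:
 assumes "h \<in> borel_measurable (tm T)"
 shows "back_avg T eps h \<in> borel_measurable (tm T)"
proof -
 interpret sigma_finite_measure "tm T" by (rule sigma_finite_time_measure)
 note [measurable] = assms
 have "(%(s, t). indicator {s - eps..<s} t * h t) \<in> borel_measurable (tm T \<Otimes>\<^sub>M tm T)"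
  using measurable_window[of eps T] by (simp add: split_beta')
 then have "(%s. (LINT t|(tm T). indicator {s - eps..<s} t * h t)) \<in> borel_measurable (tm T)"
  by (rule borel_measurable_lebesgue_integral)
 then show ?thesis unfolding back_avg_def[abs_def] by measurable
qed

text \<open>Cauchy-Schwarz on each window, then Fubini: a given \<open>t\<close> lies in the windows of the points
 \<open>s\<close> of an interval of length \<open>\<epsilon>\<close>.\<close>

lemma back_avg_contraction:
 assumes h: "L2 (tm T) h" and eps: "eps > 0"
 shows "L2 (tm T) (back_avg T eps h)"
  and "(LINT s|(tm T). (back_avg T eps h s)^2) \<le> (LINT t|(tm T). (h t)^2)"
proof -
 interpret sigma_finite_measure "tm T" by (rule sigma_finite_time_measure)
 interpret pair_sigma_finite "tm T" "tm T" ..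
 note [measurable] = L2D(1)[OF h] back_avg_measurable[OF L2D(1)[OF h], of eps]
 have wm: "(%(s, t). indicator {s - eps..<s} t * (h t)^2) \<in> borel_measurable (tm T \<Otimes>\<^sub>M tm T)"
  using measurable_window[of eps T] by (simp add: split_beta')
 have pt: "ennreal ((back_avg T eps h s)^2) \<le> ennreal (inverse eps) * (\<integral>\<^sup>+t. ennreal (indicator {s - eps..<s} t * (h t)^2) \<partial>tm T)" for s
 proof -
  define I where "I = {s - eps..<s}"
  have I: "I \<in> sets borel" by (simp add: I_def)
  note hI = L2_indicator_mult[OF h I]
  have sq: "(indicator I t * h t)^2 = indicator I t * (h t)^2" "(indicator I t)^2 = (indicator I t :: real)" for t
   by (auto simp: indicator_def)
  have "(LINT t|(tm T). indicator I t * h t)^2 = (LINT t|(tm T). indicator I t * (indicator I t * h t))^2"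
   by (intro arg_cong[where f = "%x. x^2"] Bochner_Integration.integral_cong) (auto simp: indicator_def)
  also have "\<dots> \<le> (LINT t|(tm T). (indicator I t)^2) * (LINT t|(tm T). (indicator I t * h t)^2)"
   by (rule L2_Cauchy_Schwarz[OF L2_indicator[OF I] hI])
  also have "\<dots> \<le> eps * (LINT t|(tm T). (indicator I t * h t)^2)"
  proof (rule mult_right_mono)
   have "(LINT t|(tm T). (indicator I t :: real)^2) = (LINT t|(tm T). indicator I t)" by (simp only: sq)
   also have "\<dots> \<le> s - (s - eps)" by (rule integral_window_le[OF I]) (use eps in \<open>auto simp: I_def\<close>)
   finally show "(LINT t|(tm T). (indicator I t)^2) \<le> eps" by simp
  qed simp
  finally have "(back_avg T eps h s)^2 \<le> inverse eps * (LINT t|(tm T). (indicator I t * h t)^2)"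
   using eps unfolding back_avg_def I_def power_mult_distrib by (simp add: power2_eq_square field_simps)
  then have "ennreal ((back_avg T eps h s)^2) \<le> ennreal (inverse eps) * ennreal (LINT t|(tm T). (indicator I t * h t)^2)"
   using eps by (simp add: ennreal_mult[symmetric] ennreal_leI)
  also have "ennreal (LINT t|(tm T). (indicator I t * h t)^2) = (\<integral>\<^sup>+t. ennreal (indicator I t * (h t)^2) \<partial>tm T)"
   using nn_integral_eq_integral[OF L2D(2)[OF hI]] by (simp add: sq)
  finally show ?thesis by (simp add: I_def)
 qed
 have "(\<integral>\<^sup>+s. ennreal ((back_avg T eps h s)^2) \<partial>tm T)
   \<le> (\<integral>\<^sup>+s. ennreal (inverse eps) * (\<integral>\<^sup>+t. ennreal (indicator {s - eps..<s} t * (h t)^2) \<partial>tm T) \<partial>tm T)"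
  by (intro nn_integral_mono pt)
 also have "\<dots> = ennreal (inverse eps) * (\<integral>\<^sup>+s. (\<integral>\<^sup>+t. ennreal (indicator {s - eps..<s} t * (h t)^2) \<partial>tm T) \<partial>tm T)"
  using wm by (intro nn_integral_cmult borel_measurable_nn_integral) (auto simp: split_beta')
 also have "(\<integral>\<^sup>+s. (\<integral>\<^sup>+t. ennreal (indicator {s - eps..<s} t * (h t)^2) \<partial>tm T) \<partial>tm T)
   = (\<integral>\<^sup>+t. (\<integral>\<^sup>+s. ennreal (indicator {s - eps..<s} t * (h t)^2) \<partial>tm T) \<partial>tm T)"
  using wm by (intro Fubini') (auto simp: split_beta')
 also have "\<dots> \<le> (\<integral>\<^sup>+t. ennreal eps * ennreal ((h t)^2) \<partial>tm T)"
 proof (rule nn_integral_mono)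
  fix t
  have "(\<integral>\<^sup>+s. ennreal (indicator {s - eps..<s} t * (h t)^2) \<partial>tm T)
    = (\<integral>\<^sup>+s. ennreal ((h t)^2) * indicator {t<..t + eps} s \<partial>tm T)"
   by (intro nn_integral_cong) (auto simp: indicator_def)
  also have "\<dots> = ennreal ((h t)^2) * (\<integral>\<^sup>+s. indicator {t<..t + eps} s \<partial>tm T)"
   by (rule nn_integral_cmult) (auto intro: measurable_time_measureI simp: time_measure_def intro!: measurable_restrict_space1)
  also have "\<dots> \<le> ennreal ((h t)^2) * ennreal eps"
  proof (rule mult_left_mono)
   have "(\<integral>\<^sup>+s. indicator {t<..t + eps} s \<partial>tm T) \<le> ennreal (t + eps - t)"
    by (rule nn_integral_time_measure_interval) (use eps in auto)
   then show "(\<integral>\<^sup>+s. indicator {t<..t + eps} s \<partial>tm T) \<le> ennreal eps" by simp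
  qed simp
  finally show "(\<integral>\<^sup>+s. ennreal (indicator {s - eps..<s} t * (h t)^2) \<partial>tm T) \<le> ennreal eps * ennreal ((h t)^2)"
   by (simp add: mult.commute)
 qed
 also have "\<dots> = ennreal eps * (\<integral>\<^sup>+t. ennreal ((h t)^2) \<partial>tm T)"
  by (rule nn_integral_cmult) auto
 also have "(\<integral>\<^sup>+t. ennreal ((h t)^2) \<partial>tm T) = ennreal (LINT t|(tm T). (h t)^2)"
  using L2D(2)[OF h] by (rule nn_integral_eq_integral) simp
 finally have main: "(\<integral>\<^sup>+s. ennreal ((back_avg T eps h s)^2) \<partial>tm T)
   \<le> ennreal (inverse eps) * (ennreal eps * ennreal (LINT t|(tm T). (h t)^2))"
  by (simp add: mult_left_mono)
 also have "\<dots> = ennreal (LINT t|(tm T). (h t)^2)"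
  using eps by (simp add: mult.assoc[symmetric] ennreal_mult[symmetric])
 finally have main: "(\<integral>\<^sup>+s. ennreal ((back_avg T eps h s)^2) \<partial>tm T) \<le> ennreal (LINT t|(tm T). (h t)^2)" .
 have I: "integrable (tm T) (%s. (back_avg T eps h s)^2)"
  using le_less_trans[OF main] by (intro integrableI_nonneg) auto
 then show "L2 (tm T) (back_avg T eps h)" by (simp add: square_integrable_def)
 show "(LINT s|(tm T). (back_avg T eps h s)^2) \<le> (LINT t|(tm T). (h t)^2)"
  using main nn_integral_eq_integral[OF I] by (simp add: ennreal_le_iff)
qed

lemma window_integrable:
 assumes "L2 (tm T) h" "A \<in> sets borel"
 shows "integrable (tm T) (%t. indicator A t * h t)"
 using L2_indicator_mult[OF assms]
 by (rule finite_measure.L2_integrable[OF finite_measure_time_measure])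

lemma back_avg_add:
 assumes "L2 (tm T) f" "L2 (tm T) g"
 shows "back_avg T eps (%t. f t + g t) s = back_avg T eps f s + back_avg T eps g s"
 using window_integrable[OF assms(1), of "{s - eps..<s}"] window_integrable[OF assms(2), of "{s - eps..<s}"]
 by (simp add: back_avg_def distrib_left)

lemma back_avg_cmult: "back_avg T eps (%t. c * f t) s = c * back_avg T eps f s"
 by (simp add: back_avg_def mult.left_commute)

lemma back_avg_diff:
 assumes "L2 (tm T) f" "L2 (tm T) g"
 shows "back_avg T eps (%t. f t - g t) s = back_avg T eps f s - back_avg T eps g s"
 using back_avg_add[OF assms(1) L2_cmult[OF assms(2), of "-1"]] back_avg_cmult[of T eps "-1" g s] by simp

lemma back_avg_sum:
 assumes "\<And>i. i \<in> I \<Longrightarrow> L2 (tm T) (f i)"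
 shows "back_avg T eps (%t. \<Sum>i\<in>I. c i * f i t) s = (\<Sum>i\<in>I. c i * back_avg T eps (f i) s)"
 using assms
proof (induction I rule: infinite_finite_induct)
 case (insert i I)
 have "back_avg T eps (%t. c i * f i t + (\<Sum>i\<in>I. c i * f i t)) s
   = back_avg T eps (%t. c i * f i t) s + back_avg T eps (%t. \<Sum>i\<in>I. c i * f i t) s"
  using insert.prems by (intro back_avg_add L2_cmult L2_sum) auto
 then show ?case using insert by (simp add: back_avg_cmult)
qed (simp_all add: back_avg_def)

lemma back_avg_interval_tendsto:
 assumes ab: "0 \<le> a" "a \<le> b" and s: "s \<in> {0..T}" 
  and eps: "eps > 0" and small: "a < s \<Longrightarrow> eps < s - a" "b < s \<Longrightarrow> eps < s - b"
 shows "back_avg T eps (indicator {a<..b}) s = indicator {a<..b} s"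
proof (cases "a < s \<and> s \<le> b")
 case True
 have "(LINT t|(tm T). (indicator {s - eps..<s} t * indicator {a<..b} t :: real)) = (LINT t|lborel. indicator {s - eps..<s} t)"
  unfolding integral_time_measure set_lebesgue_integral_def
  by (rule Bochner_Integration.integral_cong) (use True small s ab in \<open>auto simp: indicator_def\<close>)
 also have "\<dots> = eps" using eps by simp
 finally show ?thesis using True eps by (simp add: back_avg_def)
next
 case False
 have "(LINT t|(tm T). (indicator {s - eps..<s} t * indicator {a<..b} t :: real)) = (LINT t|(tm T). 0)"
  by (rule Bochner_Integration.integral_cong) (use False small s in \<open>auto simp: indicator_def\<close>)
 then show ?thesis using False by (auto simp: back_avg_def)
qed

lemma L2_converges_at_right_step:
 assumes xs: "steps_in T xs" and eps: "\<And>n. eps n > 0" "eps \<longlonglongrightarrow> 0"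
 shows "L2_converges (tm T) (%n. back_avg T (eps n) (step_fun xs)) (step_fun xs)"
 using xs
proof (induction xs)
 case Nil
 have "back_avg T e (step_fun []) = (%_. 0)" "step_fun [] = (%_. 0)" for e
  by (auto simp: back_avg_def fun_eq_iff)
 then show ?case by (simp add: L2_converges_const L2_zero)
next
 case (Cons x xs)
 obtain c a b where x: "x = (c, a, b)" by (cases x)
 have ab: "0 \<le> a" "a \<le> b" "b \<le> T" and xs: "steps_in T xs" using Cons(2) by (auto simp: x steps_in_def)
 have si: "L2 (tm T) (indicator {a<..b})" by (rule L2_indicator) simp
 have "L2_converges (tm T) (%n. back_avg T (eps n) (indicator {a<..b})) (indicator {a<..b})"
 proof (rule L2_converges_dominated[where g = "%_. 1"])
  show "back_avg T (eps n) (indicator {a<..b}) \<in> borel_measurable (tm T)" for n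
   by (rule back_avg_measurable[OF L2D(1)[OF si]])
  show "L2 (tm T) (%_. 1)"
   using finite_measure_time_measure[of T] by (simp add: square_integrable_def finite_measure.integrable_const)
  show "AE s in tm T. \<bar>back_avg T (eps n) (indicator {a<..b}) s\<bar> \<le> 1" for n
  proof (rule AE_I2)
   fix s
   have "(LINT t|(tm T). (indicator {s - eps n..<s} t * indicator {a<..b} t :: real)) \<le> (LINT t|(tm T). indicator {s - eps n..<s} t)"
    by (rule integral_mono[OF window_integrable[OF si] finite_measure.L2_integrable[OF finite_measure_time_measure L2_indicator]]) (auto simp: indicator_def)
   also have "\<dots> \<le> s - (s - eps n)" by (rule integral_window_le) (use eps(1)[of n] in auto)
   also have "\<dots> = eps n" by simp
   finally show "\<bar>back_avg T (eps n) (indicator {a<..b}) s\<bar> \<le> 1"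
    using eps(1)[of n] unfolding back_avg_def abs_mult by (simp add: field_simps integral_nonneg)
  qed
  show "AE s in tm T. (%n. back_avg T (eps n) (indicator {a<..b}) s) \<longlonglongrightarrow> indicator {a<..b} s"
  proof (rule AE_I2)
   fix s assume s: "s \<in> space (tm T)"
   have "\<forall>\<^sub>F n in sequentially. a < s \<longrightarrow> eps n < s - a" "\<forall>\<^sub>F n in sequentially. b < s \<longrightarrow> eps n < s - b"
    using order_tendstoD(2)[OF eps(2), of "s - a"] order_tendstoD(2)[OF eps(2), of "s - b"]
    by (cases "a < s"; cases "b < s"; simp)+
   then have "\<forall>\<^sub>F n in sequentially. back_avg T (eps n) (indicator {a<..b}) s = indicator {a<..b} s"
    by eventually_elim (rule back_avg_interval_tendsto, use ab s eps(1) in auto)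
   then show "(%n. back_avg T (eps n) (indicator {a<..b}) s) \<longlonglongrightarrow> indicator {a<..b} s" by (rule tendsto_eventually)
  qed
 qed (use L2D(1)[OF si] in simp)
 from L2_converges_add[OF L2_converges_cmult[OF this, of c] Cons(1)[OF xs]]
 have "L2_converges (tm T) (%n s. c * back_avg T (eps n) (indicator {a<..b}) s + back_avg T (eps n) (step_fun xs) s)
  (%s. c * indicator {a<..b} s + step_fun xs s)" .
 moreover have "back_avg T (eps n) (step_fun (x # xs)) = (%s. c * back_avg T (eps n) (indicator {a<..b}) s + back_avg T (eps n) (step_fun xs) s)" for n
  using back_avg_add[OF L2_cmult[OF si, of c] L2_step_fun, of "eps n" xs]
  by (simp add: fun_eq_iff x step_fun_Cons[abs_def] back_avg_cmult)
 moreover have "step_fun (x # xs) = (%s. c * indicator {a<..b} s + step_fun xs s)" by (simp add: fun_eq_iff x step_fun_Cons)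
 ultimately show ?case by simp
qed

text \<open>Averages converge for step functions by inspection, and the contraction property carries
 this over to the closure of the step functions, which is all of \<open>L^2\<close>.\<close>

lemma back_avg_tendsto:
 assumes h: "L2 (tm T) h" and T: "0 \<le> T" and eps: "\<And>n. eps n > 0" "eps \<longlonglongrightarrow> 0"
 shows "L2_converges (tm T) (%n. back_avg T (eps n) h) h"
 unfolding L2_converges_def
proof (intro conjI allI h back_avg_contraction(1)[OF h eps(1)])
 show "(%n. (LINT s|(tm T). (back_avg T (eps n) h s - h s)^2)) \<longlonglongrightarrow> 0"
 proof (rule LIMSEQ_I)
  fix e :: real assume "e > 0"
  then have e: "e / 16 > 0" by simp
  obtain xs where xs: "steps_in T xs" "(LINT t|(tm T). (step_fun xs t - h t)^2) < e / 16"
   using step_fun_dense[OF h T] e unfolding step_approx_def by meson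
  define g where "g = step_fun xs"
  have g: "L2 (tm T) g" unfolding g_def by (rule L2_step_fun)
  have "(%n. (LINT s|(tm T). (back_avg T (eps n) g s - g s)^2)) \<longlonglongrightarrow> 0"
   unfolding g_def by (rule L2_convergesD(3)[OF L2_converges_at_right_step[OF xs(1) eps]])
  from LIMSEQ_D[OF this e] obtain N where N: "\<And>n. n \<ge> N \<Longrightarrow> (LINT s|(tm T). (back_avg T (eps n) g s - g s)^2) < e / 16"
   by auto
  have "(LINT s|(tm T). (back_avg T (eps n) h s - h s)^2) < e" if "n \<ge> N" for n
  proof -
   note Ah = back_avg_contraction(1)[OF h eps(1)[of n]] and Ag = back_avg_contraction(1)[OF g eps(1)[of n]]
   have "(LINT s|(tm T). (back_avg T (eps n) g s - back_avg T (eps n) h s)^2) \<le> (LINT s|(tm T). (g s - h s)^2)"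
    using back_avg_contraction(2)[OF L2_diff[OF g h] eps(1)[of n]] by (simp add: back_avg_diff[OF g h])
   moreover have "(LINT s|(tm T). (back_avg T (eps n) h s - back_avg T (eps n) g s)^2)
     = (LINT s|(tm T). (back_avg T (eps n) g s - back_avg T (eps n) h s)^2)"
    by (simp add: power2_commute)
   moreover note L2_triangle[OF Ah Ag h] L2_triangle[OF Ag g h] N[OF that] xs(2)
   ultimately show ?thesis using \<open>e > 0\<close> unfolding g_def[symmetric] by linarith
  qed
  then show "\<exists>N. \<forall>n\<ge>N. norm ((LINT s|(tm T). (back_avg T (eps n) h s - h s)^2) - 0) < e" by auto
 qed
qed

section \<open>Smooth functions with bounded derivatives\<close>

lemma Cb_inftyD:
 assumes "f \<in> Cb_infty n"
 shows "\<And>x y. (\<And>i. i < n \<Longrightarrow> x i = y i) \<Longrightarrow> f x = f y"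
  and "continuous_on UNIV f" and "bounded (range f)"
  and "\<And>i x. i < n \<Longrightarrow> ((%y. f (x(i := y))) has_real_derivative pd i f x) (at (x i))"
  and "\<And>i. i < n \<Longrightarrow> pd i f \<in> Cb_infty n"
proof -
 show dep: "f x = f y" if "\<And>i. i < n \<Longrightarrow> x i = y i" for x y using assms that by (auto simp: Cb_infty_def)
 have nil: "set [] \<subseteq> {..<n}" by simp
 have all: "continuous_on UNIV (foldr pd \<alpha> f) \<and> bounded (range (foldr pd \<alpha> f)) \<and>
    (\<forall>i<n. \<forall>x. (%y. foldr pd \<alpha> f (x(i := y))) field_differentiable at (x i))" if "set \<alpha> \<subseteq> {..<n}" for \<alpha>
  using assms that unfolding Cb_infty_def by blast
 show "continuous_on UNIV f" "bounded (range f)" using all[OF nil] by auto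
 show "((%y. f (x(i := y))) has_real_derivative pd i f x) (at (x i))" if "i < n" for i x
  using all[OF nil] that unfolding partial_deriv_def by (auto simp: field_differentiable_derivI)
 show "pd i f \<in> Cb_infty n" if i: "i < n" for i
  unfolding Cb_infty_def
 proof (intro CollectI conjI allI impI)
  fix x y :: "nat \<Rightarrow> real" assume eq: "\<forall>i<n. x i = y i"
  then have "(%z. f (x(i := z))) = (%z. f (y(i := z)))" by (intro ext dep) auto
  then show "pd i f x = pd i f y" using eq i by (simp add: partial_deriv_def)
 next
  fix \<alpha> assume "set \<alpha> \<subseteq> {..<n}"
  then have "set (\<alpha> @ [i]) \<subseteq> {..<n}" using i by auto
  from all[OF this] show "continuous_on UNIV (foldr pd \<alpha> (pd i f))"
   "bounded (range (foldr pd \<alpha> (pd i f)))"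
   "\<And>j x. j < n \<Longrightarrow> (%y. foldr pd \<alpha> (pd i f) (x(j := y))) field_differentiable at (x j)"
   by auto
 qed
qed

lemma Cb_infty_coinduct:
 assumes "f \<in> C"
  and dep: "\<And>f x y. f \<in> C \<Longrightarrow> (\<And>i. i < n \<Longrightarrow> x i = y i) \<Longrightarrow> f x = f y"
  and cont: "\<And>f. f \<in> C \<Longrightarrow> continuous_on UNIV f"
  and bdd: "\<And>f. f \<in> C \<Longrightarrow> bounded (range f)"
  and deriv: "\<And>f i. f \<in> C \<Longrightarrow> i < n \<Longrightarrow>
   \<exists>g\<in>C. \<forall>x. ((%y. f (x(i := y))) has_real_derivative g x) (at (x i))"
 shows "f \<in> Cb_infty n"
proof -
 have pd: "pd i f \<in> C \<and> (\<forall>x. (%y. f (x(i := y))) field_differentiable at (x i))" if fi: "f \<in> C" "i < n" for f i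
 proof -
  obtain g where g: "g \<in> C" "\<And>x. ((%y. f (x(i := y))) has_real_derivative g x) (at (x i))"
   using deriv[OF fi] by blast
  then have "pd i f = g" by (auto simp: partial_deriv_def fun_eq_iff intro!: DERIV_imp_deriv)
  then show ?thesis using g by (auto simp: field_differentiable_def)
 qed
 have "foldr pd \<alpha> f \<in> C" if "set \<alpha> \<subseteq> {..<n}" for \<alpha>
  using that by (induction \<alpha>) (auto simp: pd \<open>f \<in> C\<close>)
 then show ?thesis
  unfolding Cb_infty_def using dep[OF \<open>f \<in> C\<close>] cont bdd pd by blast
qed

lemma Cb_infty_lincomb:
 assumes "f \<in> Cb_infty n" "g \<in> Cb_infty n"
 shows "(%x. a * f x + b * g x) \<in> Cb_infty n"
proof (rule Cb_infty_coinduct[where C = "{%x. a * f x + b * g x | f g. f \<in> Cb_infty n \<and> g \<in> Cb_infty n}"])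
 fix F assume "F \<in> {%x. a * f x + b * g x | f g. f \<in> Cb_infty n \<and> g \<in> Cb_infty n}"
 then obtain f g where F: "F = (%x. a * f x + b * g x)" and fg: "f \<in> Cb_infty n" "g \<in> Cb_infty n" by blast
 show "continuous_on UNIV F" unfolding F by (intro continuous_intros Cb_inftyD(2)[OF fg(1)] Cb_inftyD(2)[OF fg(2)])
 show "bounded (range F)" unfolding F
 proof -
  obtain A B where "\<And>x. \<bar>f x\<bar> \<le> A" "\<And>x. \<bar>g x\<bar> \<le> B"
   using Cb_inftyD(3)[OF fg(1)] Cb_inftyD(3)[OF fg(2)] unfolding bounded_iff by auto
  then have "\<bar>a * f x + b * g x\<bar> \<le> \<bar>a\<bar> * A + \<bar>b\<bar> * B" for x
   by (intro order_trans[OF abs_triangle_ineq] add_mono) (auto simp: abs_mult mult_left_mono)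
  then show "bounded (range (%x. a * f x + b * g x))" by (auto simp: bounded_iff)
 qed
 show "F x = F y" if "\<And>i. i < n \<Longrightarrow> x i = y i" for x y
  unfolding F using Cb_inftyD(1)[OF fg(1) that] Cb_inftyD(1)[OF fg(2) that] by simp
 fix i assume i: "i < n"
 show "\<exists>G\<in>{%x. a * f x + b * g x | f g. f \<in> Cb_infty n \<and> g \<in> Cb_infty n}.
   \<forall>x. ((%y. F (x(i := y))) has_real_derivative G x) (at (x i))"
 proof (rule bexI[of _ "%x. a * pd i f x + b * pd i g x"])
  show "\<forall>x. ((%y. F (x(i := y))) has_real_derivative a * pd i f x + b * pd i g x) (at (x i))"
   unfolding F using Cb_inftyD(4)[OF fg(1) i] Cb_inftyD(4)[OF fg(2) i]
   by (intro allI DERIV_add DERIV_cmult)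
 qed (use fg i Cb_inftyD(5) in blast)
qed (use assms in blast)

lemma Cb_infty_const: "(%_. c) \<in> Cb_infty n"
proof (rule Cb_infty_coinduct[where C = "range (%c _. c)"])
 fix f :: "(nat \<Rightarrow> real) \<Rightarrow> real" and i assume "f \<in> range (%c _. c)"
 then obtain c where f: "f = (%_. c)" by auto
 show "\<exists>g\<in>range (%c _. c). \<forall>x. ((%y. f (x(i := y))) has_real_derivative g x) (at (x i))"
  unfolding f by (rule bexI[of _ "%_. 0"]) auto
qed auto

lemma Cb_infty_sum:
 assumes "\<And>i. i \<in> I \<Longrightarrow> f i \<in> Cb_infty n"
 shows "(%x. \<Sum>i\<in>I. c i * f i x) \<in> Cb_infty n"
 using assms
proof (induction I rule: infinite_finite_induct)
 case (insert i I)
 have "(%x. c i * f i x + 1 * (\<Sum>i\<in>I. c i * f i x)) \<in> Cb_infty n"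
  by (rule Cb_infty_lincomb) (use insert in auto)
 then show ?case using insert by simp
qed (simp_all add: Cb_infty_const)

lemma partial_deriv_sum:
 assumes f: "\<And>i. i \<in> I \<Longrightarrow> f i \<in> Cb_infty n" and k: "k < n"
 shows "pd k (%x. \<Sum>i\<in>I. c i * f i x) x = (\<Sum>i\<in>I. c i * pd k (f i) x)"
 unfolding partial_deriv_def
 by (rule DERIV_imp_deriv, rule DERIV_sum, rule DERIV_cmult)
  (use Cb_inftyD(4)[OF f k] in \<open>auto simp: partial_deriv_def\<close>)

lemma continuous_on_shift: "continuous_on UNIV f \<Longrightarrow> continuous_on UNIV (%x. f (%j. x (n + j) :: real))"
 for f :: "(nat \<Rightarrow> real) \<Rightarrow> real"
proof -
 assume f: "continuous_on UNIV f"
 have "continuous_on UNIV (%x :: nat \<Rightarrow> real. (%j. x (n + j)))"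
  by (intro continuous_on_coordinatewise_then_product continuous_on_product_coordinates)
 from continuous_on_compose2[OF f this] show ?thesis by simp
qed

lemma deriv_tensor:
 assumes f: "f \<in> Cb_infty n" and g: "g \<in> Cb_infty m" and i: "i < n + m"
 shows "((%y. f (x(i := y)) * g (%j. (x(i := y)) (n + j))) has_real_derivative
  (if i < n then pd i f x * g (%j. x (n + j)) else f x * pd (i - n) g (%j. x (n + j)))) (at (x i))"
proof (cases "i < n")
 case True
 have "(%j. (x(i := y)) (n + j)) = (%j. x (n + j))" for y using True by auto
 then show ?thesis using DERIV_cmult_right[OF Cb_inftyD(4)[OF f True, of x]] True by simp
next
 case False
 have 1: "f (x(i := y)) = f x" for y by (rule Cb_inftyD(1)[OF f]) (use False in auto)
 have 2: "(%j. (x(i := y)) (n + j)) = (%j. x (n + j))(i - n := y)" for y using False by (auto simp: fun_eq_iff)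
 have "i - n < m" using False i by simp
 from DERIV_cmult[OF Cb_inftyD(4)[OF g this, of "%j. x (n + j)"], of "f x"] False
 show ?thesis unfolding 1 2 by simp
qed

text \<open>The product of two functions of disjoint groups of variables; a partial derivative acts on
 one factor only, so that products of this form are preserved.\<close>

lemma Cb_infty_tensor:
 assumes "f \<in> Cb_infty n" "g \<in> Cb_infty m"
 shows "(%x. f x * g (%j. x (n + j))) \<in> Cb_infty (n + m)"
proof (rule Cb_infty_coinduct[where C = "{%x. f x * g (%j. x (n + j)) | f g. f \<in> Cb_infty n \<and> g \<in> Cb_infty m}"])
 fix F assume "F \<in> {%x. f x * g (%j. x (n + j)) | f g. f \<in> Cb_infty n \<and> g \<in> Cb_infty m}"
 then obtain f g where F: "F = (%x. f x * g (%j. x (n + j)))" and fg: "f \<in> Cb_infty n" "g \<in> Cb_infty m" by blast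
 show "continuous_on UNIV F" unfolding F by (intro continuous_intros continuous_on_shift Cb_inftyD(2)[OF fg(1)] Cb_inftyD(2)[OF fg(2)])
 show "bounded (range F)" unfolding F
 proof -
  obtain A B where "\<And>x. \<bar>f x\<bar> \<le> A" "\<And>x. \<bar>g x\<bar> \<le> B"
   using Cb_inftyD(3)[OF fg(1)] Cb_inftyD(3)[OF fg(2)] unfolding bounded_iff by auto
  then have "\<bar>f x * g (%j. x (n + j))\<bar> \<le> A * B" for x
   unfolding abs_mult by (intro mult_mono) (auto intro: order_trans[OF abs_ge_zero])
  then show "bounded (range (%x. f x * g (%j. x (n + j))))" by (auto simp: bounded_iff)
 qed
 show "F x = F y" if "\<And>i. i < n + m \<Longrightarrow> x i = y i" for x y
 proof -
  have "f x = f y" by (rule Cb_inftyD(1)[OF fg(1)]) (use that in auto)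
  moreover have "g (%j. x (n + j)) = g (%j. y (n + j))" by (rule Cb_inftyD(1)[OF fg(2)]) (use that in auto)
  ultimately show ?thesis by (simp add: F)
 qed
 fix i assume i: "i < n + m"
 show "\<exists>G\<in>{%x. f x * g (%j. x (n + j)) | f g. f \<in> Cb_infty n \<and> g \<in> Cb_infty m}.
   \<forall>x. ((%y. F (x(i := y))) has_real_derivative G x) (at (x i))"
 proof (cases "i < n")
  case True
  then have "(%x. pd i f x * g (%j. x (n + j))) \<in> {%x. f x * g (%j. x (n + j)) | f g. f \<in> Cb_infty n \<and> g \<in> Cb_infty m}"
   using fg Cb_inftyD(5)[OF fg(1) True] by blast
  then show ?thesis using deriv_tensor[OF fg i] True unfolding F by (intro bexI) auto
 next
  case False
  then have "(%x. f x * pd (i - n) g (%j. x (n + j))) \<in> {%x. f x * g (%j. x (n + j)) | f g. f \<in> Cb_infty n \<and> g \<in> Cb_infty m}"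
   using fg(1) Cb_inftyD(5)[OF fg(2), of "i - n"] i by (intro CollectI exI conjI[OF refl]) auto
  then show ?thesis using deriv_tensor[OF fg i] False unfolding F by (intro bexI) auto
 qed
qed (use assms in blast)

lemma partial_deriv_tensor:
 assumes "f \<in> Cb_infty n" "g \<in> Cb_infty m" "i < n + m"
 shows "pd i (%x. f x * g (%j. x (n + j))) x =
  (if i < n then pd i f x * g (%j. x (n + j)) else f x * pd (i - n) g (%j. x (n + j)))"
 unfolding partial_deriv_def using DERIV_imp_deriv[OF deriv_tensor[OF assms, of x]] by (simp add: partial_deriv_def)

lemma Cb_infty_one_variable:
 assumes "g \<in> C"
  and bdd: "\<And>g. g \<in> C \<Longrightarrow> bounded (range g)"
  and der: "\<And>g. g \<in> C \<Longrightarrow> \<exists>g'\<in>C. \<forall>y. (g has_real_derivative g' y) (at y)"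
 shows "(%x. g (x 0)) \<in> Cb_infty 1"
proof (rule Cb_infty_coinduct[where C = "{%x. g (x 0) | g. g \<in> C}"])
 fix F :: "(nat \<Rightarrow> real) \<Rightarrow> real" assume "F \<in> {%x. g (x 0) | g. g \<in> C}"
 then obtain g where F: "F = (%x. g (x 0))" and g: "g \<in> C" by blast
 obtain g' where g': "g' \<in> C" "\<And>y. (g has_real_derivative g' y) (at y)" using der[OF g] by blast
 have "continuous_on UNIV g" using g'(2) by (auto intro!: continuous_at_imp_continuous_on DERIV_isCont)
 then show "continuous_on UNIV F" unfolding F
  by (rule continuous_on_compose2) (auto intro: continuous_on_product_coordinates)
 show "bounded (range F)" unfolding F using bdd[OF g] by (rule bounded_subset) auto
 show "F x = F y" if "\<And>i. i < 1 \<Longrightarrow> x i = y i" for x y using that[of 0] by (simp add: F)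
 fix i :: nat assume "i < 1"
 then show "\<exists>G\<in>{%x. g (x 0) | g. g \<in> C}. \<forall>x. ((%y. F (x(i := y))) has_real_derivative G x) (at (x i))"
  using g' by (intro bexI[of _ "%x. g' (x 0)"]) (auto simp: F)
qed (use assms(1) in blast)

lemma partial_deriv_one_variable:
 assumes "(g has_real_derivative d) (at (x 0))"
 shows "pd 0 (%x. g (x 0)) x = d"
 unfolding partial_deriv_def using DERIV_imp_deriv[OF assms] by simp

lemma Cb_infty_sin: "(%x. a * sin (b * x 0)) \<in> Cb_infty 1"
proof (rule Cb_infty_one_variable[where C = "range (%(a, c) y. a * sin (b * y) + c * cos (b * y))" and g = "%y. a * sin (b * y)"])
 show "(%y. a * sin (b * y)) \<in> range (%(a, c) y. a * sin (b * y) + c * cos (b * y))"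
  by (rule range_eqI[of _ _ "(a, 0)"]) auto
 fix g assume "g \<in> range (%(a, c) y. a * sin (b * y) + c * cos (b * y))"
 then obtain a c where g: "g = (%y. a * sin (b * y) + c * cos (b * y))" by auto
 have "\<bar>g y\<bar> \<le> \<bar>a\<bar> + \<bar>c\<bar>" for y
  unfolding g by (intro order_trans[OF abs_triangle_ineq] add_mono) (auto simp: abs_mult intro: mult_left_le)
 then show "bounded (range g)" by (auto simp: bounded_iff)
 show "\<exists>g'\<in>range (%(a, c) y. a * sin (b * y) + c * cos (b * y)). \<forall>y. (g has_real_derivative g' y) (at y)"
 proof (rule bexI[of _ "%y. (- (c * b)) * sin (b * y) + (a * b) * cos (b * y)"])
  show "\<forall>y. (g has_real_derivative (- (c * b)) * sin (b * y) + (a * b) * cos (b * y)) (at y)"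
   unfolding g by (auto intro!: derivative_eq_intros)
  show "(%y. (- (c * b)) * sin (b * y) + (a * b) * cos (b * y)) \<in> range (%(a, c) y. a * sin (b * y) + c * cos (b * y))"
   by (rule range_eqI[of _ _ "(- (c * b), a * b)"]) auto
 qed
qed

definition logistic :: "real \<Rightarrow> real" where "logistic y = inverse (1 + exp (- y))"

lemma logistic_bounds: "0 < logistic y" "logistic y < 1"
 by (auto simp: logistic_def add_pos_pos inverse_less_1_iff)

lemma logistic_deriv: "(logistic has_real_derivative logistic y * (1 - logistic y)) (at y)"
proof -
 have "1 + exp (- y) > 0" by (simp add: add_pos_pos)
 then have "((%y. inverse (1 + exp (- y))) has_real_derivative exp (- y) / (1 + exp (- y))^2) (at y)"
  by (auto intro!: derivative_eq_intros simp: power2_eq_square field_simps)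
 also have "exp (- y) / (1 + exp (- y))^2 = logistic y * (1 - logistic y)"
  using \<open>1 + exp (- y) > 0\<close> by (simp add: logistic_def power2_eq_square field_simps)
 finally show ?thesis by (simp add: logistic_def[abs_def])
qed

text \<open>All derivatives of the logistic function are polynomials in the function itself, hence
 bounded.\<close>

lemma Cb_infty_logistic: "(%x. logistic (c * x 0 + d)) \<in> Cb_infty 1"
proof (rule Cb_infty_one_variable[where C = "range (%p y. poly p (logistic (c * y + d)))" and g = "%y. logistic (c * y + d)"])
 show "(%y. logistic (c * y + d)) \<in> range (%p y. poly p (logistic (c * y + d)))"
  by (rule range_eqI[of _ _ "[:0, 1:]"]) auto
 fix g assume "g \<in> range (%p y. poly p (logistic (c * y + d)))"
 then obtain p where g: "g = (%y. poly p (logistic (c * y + d)))" by auto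
 have "compact (poly p ` {0..1})" by (intro compact_continuous_image continuous_intros) auto
 then have "bounded (poly p ` {0..1})" by (rule compact_imp_bounded)
 then show "bounded (range g)" unfolding g
  by (rule bounded_subset) (use logistic_bounds in \<open>force simp: less_imp_le\<close>)
 show "\<exists>g'\<in>range (%p y. poly p (logistic (c * y + d))). \<forall>y. (g has_real_derivative g' y) (at y)"
 proof (rule bexI[of _ "%y. poly (smult c (pderiv p * [:0, 1, -1:])) (logistic (c * y + d))"])
  show "\<forall>y. (g has_real_derivative poly (smult c (pderiv p * [:0, 1, -1:])) (logistic (c * y + d))) (at y)"
   unfolding g
   by (auto intro!: derivative_eq_intros poly_DERIV DERIV_chain2[OF logistic_deriv] DERIV_chain2[OF poly_DERIV] simp: algebra_simps)
 qed blast
qed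

lemma logistic_at_top: "(logistic \<longlongrightarrow> 1) at_top"
proof -
 have "((%y::real. inverse (1 + exp (- y))) \<longlongrightarrow> inverse (1 + 0)) at_top"
  by (intro tendsto_intros filterlim_compose[OF exp_at_bot] filterlim_uminus_at_bot_at_top) auto
 then show ?thesis by (simp add: logistic_def[abs_def])
qed

lemma logistic_at_bot: "(logistic \<longlongrightarrow> 0) at_bot"
proof -
 have "filterlim (%y::real. 1 + exp (- y)) at_infinity at_bot"
  by (intro filterlim_at_top_imp_at_infinity filterlim_tendsto_add_at_top[OF tendsto_const]
   filterlim_compose[OF exp_at_top] filterlim_uminus_at_top_at_bot)
 then show ?thesis unfolding logistic_def[abs_def] by (rule tendsto_inverse_0[THEN filterlim_compose])
qed

lemma Cb_infty_bound:
 assumes "f \<in> Cb_infty n"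
 obtains K where "K \<ge> 0" "\<And>x. \<bar>f x\<bar> \<le> K"
 using Cb_inftyD(3)[OF assms] unfolding bounded_iff by (metis rangeI real_norm_def abs_ge_zero order_trans)

lemma Cb_infty_partials_bound:
 assumes f: "f \<in> Cb_infty n"
 obtains K where "K \<ge> 0" "\<And>i x. i < n \<Longrightarrow> \<bar>pd i f x\<bar> \<le> K"
proof -
 have "\<exists>K\<ge>0. \<forall>x. \<bar>pd i f x\<bar> \<le> K" if "i < n" for i
  by (rule Cb_infty_bound[OF Cb_inftyD(5)[OF f that]]) blast
 then obtain K where K: "\<And>i. i < n \<Longrightarrow> K i \<ge> 0" "\<And>i x. i < n \<Longrightarrow> \<bar>pd i f x\<bar> \<le> K i" by metis
 show thesis
 proof (rule that[of "\<Sum>i<n. K i"])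
  show "0 \<le> (\<Sum>i<n. K i)" by (intro sum_nonneg) (use K in auto)
  show "\<bar>pd i f x\<bar> \<le> (\<Sum>i<n. K i)" if "i < n" for i x
   using K(2)[OF that, of x] member_le_sum[of i "{..<n}" K] that K(1) by (meson finite_lessThan lessThan_iff order_trans DiffD1)
 qed
qed

lemma Cb_infty_mvt:
 assumes f: "f \<in> Cb_infty n" and i: "i < n"
 obtains z where "\<bar>z - a\<bar> \<le> \<bar>b - a\<bar>" "f (x(i := b)) - f (x(i := a)) = (b - a) * pd i f (x(i := z))"
proof -
 have d: "((%y. f (x(i := y))) has_real_derivative pd i f (x(i := y))) (at y)" for y
  using Cb_inftyD(4)[OF f i, of "x(i := y)"] by simp
 show thesis
 proof (cases a b rule: linorder_cases)
  case less
  from MVT2[OF less d] obtain z where "a < z" "z < b" "f (x(i := b)) - f (x(i := a)) = (b - a) * pd i f (x(i := z))" by blast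
  then show thesis by (intro that) auto
 next
  case equal then show thesis by (intro that[of a]) auto
 next
  case greater
  from MVT2[OF greater d] obtain z where "b < z" "z < a" "f (x(i := a)) - f (x(i := b)) = (a - b) * pd i f (x(i := z))" by blast
  then show thesis by (intro that[of z]) (auto simp: algebra_simps)
 qed
qed

lemma telescope_coordinates:
 assumes f: "f \<in> Cb_infty n"
 defines "q \<equiv> %x y k i. if i < k then y i else (x i :: real)"
 shows "f y - f x = (\<Sum>k<n. f ((q x y k)(k := y k)) - f ((q x y k)(k := x k)))"
proof -
 have "(q x y k)(k := y k) = q x y (Suc k)" "(q x y k)(k := x k) = q x y k" for k
  by (auto simp: q_def fun_eq_iff less_Suc_eq)
 then have "(\<Sum>k<n. f ((q x y k)(k := y k)) - f ((q x y k)(k := x k))) = f (q x y n) - f (q x y 0)"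
  by (simp add: sum_lessThan_telescope[where f = "%k. f (q x y k)"])
 moreover have "f (q x y n) = f y" by (rule Cb_inftyD(1)[OF f]) (simp add: q_def)
 moreover have "q x y 0 = x" by (simp add: q_def)
 ultimately show ?thesis by simp
qed

lemma Cb_infty_Lipschitz:
 assumes f: "f \<in> Cb_infty n"
 obtains K where "K \<ge> 0" "\<And>x y. \<bar>f y - f x\<bar> \<le> K * (\<Sum>i<n. \<bar>y i - x i\<bar>)"
proof -
 obtain K where K: "K \<ge> 0" "\<And>i x. i < n \<Longrightarrow> \<bar>pd i f x\<bar> \<le> K" by (rule Cb_infty_partials_bound[OF f]) blast
 show thesis
 proof (rule that[OF K(1)])
  fix x y :: "nat \<Rightarrow> real"
  have "\<bar>f y - f x\<bar> \<le> (\<Sum>k<n. K * \<bar>y k - x k\<bar>)"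
   unfolding telescope_coordinates[OF f, of y x]
  proof (rule order_trans[OF sum_abs], rule sum_mono)
   fix k assume "k \<in> {..<n}" then have k: "k < n" by simp
   let ?q = "%i. if i < k then y i else x i"
   obtain z where "\<bar>z - x k\<bar> \<le> \<bar>y k - x k\<bar>" "f (?q(k := y k)) - f (?q(k := x k)) = (y k - x k) * pd k f (?q(k := z))"
    by (rule Cb_infty_mvt[OF f k])
   then show "\<bar>f (?q(k := y k)) - f (?q(k := x k))\<bar> \<le> K * \<bar>y k - x k\<bar>"
    using mult_left_mono[OF K(2)[OF k] abs_ge_zero[of "y k - x k"]] by (simp add: abs_mult mult.commute[of K])
  qed
  then show "\<bar>f y - f x\<bar> \<le> K * (\<Sum>i<n. \<bar>y i - x i\<bar>)" by (simp add: sum_distrib_left)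
 qed
qed

lemma Cb_infty_Taylor:
 assumes f: "f \<in> Cb_infty n"
 obtains K where "K \<ge> 0"
  "\<And>x y. \<bar>f y - f x - (\<Sum>i<n. pd i f x * (y i - x i))\<bar> \<le> K * (\<Sum>i<n. \<bar>y i - x i\<bar>)^2"
proof -
 have "\<exists>L\<ge>0. \<forall>x y. \<bar>pd i f y - pd i f x\<bar> \<le> L * (\<Sum>j<n. \<bar>y j - x j\<bar>)" if "i < n" for i
  by (rule Cb_infty_Lipschitz[OF Cb_inftyD(5)[OF f that]]) blast
 then obtain L where L: "\<And>i. i < n \<Longrightarrow> L i \<ge> 0"
  "\<And>i x y. i < n \<Longrightarrow> \<bar>pd i f y - pd i f x\<bar> \<le> L i * (\<Sum>j<n. \<bar>y j - x j\<bar>)" by metis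
 define K where "K = (\<Sum>i<n. L i)"
 have K: "K \<ge> 0" unfolding K_def by (intro sum_nonneg) (use L in auto)
 have LK: "L i \<le> K" if "i < n" for i
  unfolding K_def by (rule member_le_sum) (use that L in auto)
 show thesis
 proof (rule that[OF K])
  fix x y :: "nat \<Rightarrow> real"
  define S where "S = (\<Sum>j<n. \<bar>y j - x j\<bar>)"
  have S: "S \<ge> 0" by (simp add: S_def sum_nonneg)
  have "\<bar>f y - f x - (\<Sum>i<n. pd i f x * (y i - x i))\<bar> \<le> (\<Sum>k<n. (K * S) * \<bar>y k - x k\<bar>)"
   unfolding telescope_coordinates[OF f, of y x] sum_subtractf[symmetric]
  proof (rule order_trans[OF sum_abs], rule sum_mono)
   fix k assume "k \<in> {..<n}" then have k: "k < n" by simp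
   let ?q = "%i. if i < k then y i else x i"
   obtain z where z: "\<bar>z - x k\<bar> \<le> \<bar>y k - x k\<bar>" "f (?q(k := y k)) - f (?q(k := x k)) = (y k - x k) * pd k f (?q(k := z))"
    by (rule Cb_infty_mvt[OF f k])
   have "\<bar>pd k f (?q(k := z)) - pd k f x\<bar> \<le> L k * (\<Sum>j<n. \<bar>(?q(k := z)) j - x j\<bar>)"
    by (rule L(2)[OF k])
   also have "\<dots> \<le> L k * S"
    unfolding S_def using z(1) by (intro mult_left_mono sum_mono L k) auto
   also have "\<dots> \<le> K * S" using LK[OF k] S by (intro mult_right_mono)
   finally have le: "\<bar>pd k f (?q(k := z)) - pd k f x\<bar> \<le> K * S" .
   have "\<bar>(y k - x k) * (pd k f (?q(k := z)) - pd k f x)\<bar> \<le> K * S * \<bar>y k - x k\<bar>"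
    using mult_left_mono[OF le abs_ge_zero[of "y k - x k"]] by (simp only: abs_mult mult.commute[of "K * S"])
   then show "\<bar>f (?q(k := y k)) - f (?q(k := x k)) - pd k f x * (y k - x k)\<bar> \<le> K * S * \<bar>y k - x k\<bar>"
    unfolding z(2) by (simp add: algebra_simps)
  qed
  also have "\<dots> = K * S^2" by (simp add: sum_distrib_left[symmetric] S_def[symmetric] power2_eq_square)
  finally show "\<bar>f y - f x - (\<Sum>i<n. pd i f x * (y i - x i))\<bar> \<le> K * (\<Sum>i<n. \<bar>y i - x i\<bar>)^2"
   by (simp add: S_def)
 qed
qed

lemma Cb_infty_chain_rule:
 assumes f: "f \<in> Cb_infty n"
 shows "((%wt. f (%i. x i + wt * c i)) has_real_derivative (\<Sum>i<n. pd i f (%i. x i + z * c i) * c i)) (at z)"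
proof -
 obtain K where K: "K \<ge> 0"
  "\<And>x y. \<bar>f y - f x - (\<Sum>i<n. pd i f x * (y i - x i))\<bar> \<le> K * (\<Sum>i<n. \<bar>y i - x i\<bar>)^2"
  by (rule Cb_infty_Taylor[OF f]) blast
 define d where "d = (\<Sum>i<n. pd i f (%i. x i + z * c i) * c i)"
 define A where "A = (\<Sum>i<n. \<bar>c i\<bar>)"
 define g where "g wt = f (%i. x i + wt * c i)" for wt
 have q: "\<bar>g wt - g z - d * (wt - z)\<bar> \<le> K * A^2 * (wt - z)^2" for wt
 proof -
  have "(\<Sum>i<n. \<bar>(x i + wt * c i) - (x i + z * c i)\<bar>) = \<bar>wt - z\<bar> * A"
   unfolding A_def sum_distrib_left by (intro sum.cong) (auto simp: abs_mult[symmetric] algebra_simps)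
  moreover have "(\<Sum>i<n. pd i f (%i. x i + z * c i) * ((x i + wt * c i) - (x i + z * c i))) = d * (wt - z)"
   unfolding d_def sum_distrib_right by (intro sum.cong) (auto simp: algebra_simps)
  ultimately show ?thesis
   using K(2)[where y = "%i. x i + wt * c i" and x = "%i. x i + z * c i"]
   by (simp add: g_def power_mult_distrib mult.assoc mult.commute)
 qed
 have "((%wt. (g wt - g z) / (wt - z) - d) \<longlongrightarrow> 0) (at z)"
 proof (rule Lim_null_comparison)
  show "((%wt. K * A^2 * \<bar>wt - z\<bar>) \<longlongrightarrow> 0) (at z)" by (auto intro!: tendsto_eq_intros)
  show "\<forall>\<^sub>F wt in at z. norm ((g wt - g z) / (wt - z) - d) \<le> K * A^2 * \<bar>wt - z\<bar>"
  proof (rule eventually_at_topological[THEN iffD2], intro exI[of _ UNIV] conjI ballI impI)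
   fix wt assume "wt \<noteq> z"
   then have "(g wt - g z) / (wt - z) - d = (g wt - g z - d * (wt - z)) / (wt - z)" by (simp add: field_simps)
   then have "\<bar>(g wt - g z) / (wt - z) - d\<bar> \<le> (K * A^2 * (wt - z)^2) / \<bar>wt - z\<bar>"
    using q[of wt] by (simp add: divide_right_mono)
   also have "\<dots> = K * A^2 * \<bar>wt - z\<bar>"
   proof -
    have "v^2 / \<bar>v\<bar> = \<bar>v\<bar>" for v :: real by (cases "v = 0") (auto simp: power2_eq_square abs_if divide_simps)
    then show ?thesis by (simp only: times_divide_eq_right[symmetric])
   qed
   finally show "norm ((g wt - g z) / (wt - z) - d) \<le> K * A^2 * \<bar>wt - z\<bar>" by simp
  qed auto
 qed
 then have "((%wt. (g wt - g z) / (wt - z)) \<longlongrightarrow> d) (at z)" by (simp add: LIM_zero_iff)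
 then show ?thesis unfolding has_field_derivative_iff g_def[symmetric] d_def .
qed

text \<open>Schwarz's theorem: both mixed derivatives approximate the same second difference quotient.\<close>

lemma Cb_infty_Schwarz:
 assumes f: "f \<in> Cb_infty n" and i: "i < n" and j: "j < n"
 shows "pd i (pd j f) x = pd j (pd i f) x"
proof (cases "i = j")
 case False
 have key: "\<exists>K\<ge>0. \<forall>h>0. \<bar>(f (x(i := x i + h, j := x j + h)) - f (x(i := x i, j := x j + h))
   - (f (x(i := x i + h)) - f x)) / h^2 - pd j (pd i f) x\<bar> \<le> K * h"
  if ij: "i \<noteq> j" "i < n" "j < n" for i j
 proof -
  obtain K where K: "K \<ge> 0" "\<And>y z. \<bar>pd j (pd i f) z - pd j (pd i f) y\<bar> \<le> K * (\<Sum>i<n. \<bar>z i - y i\<bar>)"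
   by (rule Cb_infty_Lipschitz[OF Cb_inftyD(5)[OF Cb_inftyD(5)[OF f ij(2)] ij(3)]]) blast
  show ?thesis
  proof (intro exI[of _ "2 * K"] conjI allI impI)
   fix h :: real assume h: "h > 0"
   define \<phi> where "\<phi> y = f (x(i := y, j := x j + h)) - f (x(i := y))" for y
   have "(\<phi> has_real_derivative (pd i f (x(i := y, j := x j + h)) - pd i f (x(i := y)))) (at y)" for y
    unfolding \<phi>_def
   proof (rule DERIV_diff)
    show "((%y. f (x(i := y))) has_real_derivative pd i f (x(i := y))) (at y)"
     using Cb_inftyD(4)[OF f ij(2), of "x(i := y)"] by simp
    show "((%y. f (x(i := y, j := x j + h))) has_real_derivative pd i f (x(i := y, j := x j + h))) (at y)"
     using Cb_inftyD(4)[OF f ij(2), of "x(i := y, j := x j + h)"] ij(1) by (simp add: fun_upd_twist)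
   qed
   then obtain y where y: "x i < y" "y < x i + h"
    "\<phi> (x i + h) - \<phi> (x i) = h * (pd i f (x(i := y, j := x j + h)) - pd i f (x(i := y)))"
    using MVT2[of "x i" "x i + h" \<phi> "%y. pd i f (x(i := y, j := x j + h)) - pd i f (x(i := y))"] h by auto
   obtain z where z: "\<bar>z - x j\<bar> \<le> \<bar>x j + h - x j\<bar>"
    "pd i f (x(i := y, j := x j + h)) - pd i f (x(i := y, j := x j)) = (x j + h - x j) * pd j (pd i f) (x(i := y, j := z))"
    by (rule Cb_infty_mvt[OF Cb_inftyD(5)[OF f ij(2)] ij(3), where x = "x(i := y)" and a = "x j" and b = "x j + h"])
   have xj: "x(i := y, j := x j) = x(i := y)" using ij(1) by (auto simp: fun_eq_iff)
   have "(\<phi> (x i + h) - \<phi> (x i)) / h^2 = pd j (pd i f) (x(i := y, j := z))"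
    using y(3) z(2) h unfolding xj by (simp add: power2_eq_square)
   moreover have "\<bar>pd j (pd i f) (x(i := y, j := z)) - pd j (pd i f) x\<bar>
     \<le> K * (\<Sum>k<n. \<bar>(x(i := y, j := z)) k - x k\<bar>)" by (rule K(2))
   moreover have "(\<Sum>k<n. \<bar>(x(i := y, j := z)) k - x k\<bar>) \<le> 2 * h"
   proof -
    have "(\<Sum>k<n. \<bar>(x(i := y, j := z)) k - x k\<bar>) = (\<Sum>k\<in>{i, j}. \<bar>(x(i := y, j := z)) k - x k\<bar>)"
     by (rule sum.mono_neutral_right) (use ij in auto)
    also have "\<dots> \<le> 2 * h" using ij(1) y z(1) h by auto
    finally show ?thesis .
   qed
   ultimately have "\<bar>(\<phi> (x i + h) - \<phi> (x i)) / h^2 - pd j (pd i f) x\<bar> \<le> K * (2 * h)"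
    using mult_left_mono[OF _ K(1), of "\<Sum>k<n. \<bar>(x(i := y, j := z)) k - x k\<bar>" "2 * h"] by linarith
   then show "\<bar>(f (x(i := x i + h, j := x j + h)) - f (x(i := x i, j := x j + h))
   - (f (x(i := x i + h)) - f x)) / h^2 - pd j (pd i f) x\<bar> \<le> 2 * K * h"
    by (simp add: \<phi>_def algebra_simps)
  qed (use K in simp)
 qed
 obtain K where K: "K \<ge> 0" "\<And>h. h > 0 \<Longrightarrow> \<bar>(f (x(i := x i + h, j := x j + h)) - f (x(i := x i, j := x j + h))
   - (f (x(i := x i + h)) - f x)) / h^2 - pd j (pd i f) x\<bar> \<le> K * h"
  using key[OF False i j] by blast
 obtain L where L: "L \<ge> 0" "\<And>h. h > 0 \<Longrightarrow> \<bar>(f (x(j := x j + h, i := x i + h)) - f (x(j := x j, i := x i + h))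
   - (f (x(j := x j + h)) - f x)) / h^2 - pd i (pd j f) x\<bar> \<le> L * h"
  using key[of j i] False i j by blast
 have "\<bar>pd i (pd j f) x - pd j (pd i f) x\<bar> \<le> e" if "e > 0" for e
 proof -
  define h where "h = e / (K + L + 1)"
  have h: "h > 0" using that K(1) L(1) by (simp add: h_def)
  have tw: "x(j := x j + h, i := x i + h) = x(i := x i + h, j := x j + h)" using False by (simp add: fun_upd_twist)
  have sw: "f (x(j := x j, i := x i + h)) = f (x(i := x i + h))" "f (x(i := x i, j := x j + h)) = f (x(j := x j + h))" by simp_all
  have "\<bar>pd i (pd j f) x - pd j (pd i f) x\<bar> \<le> (K + L) * h"
  proof -
   define Q where "Q = (f (x(i := x i + h, j := x j + h)) - f (x(j := x j + h)) - (f (x(i := x i + h)) - f x)) / h^2"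
   have "Q = (f (x(i := x i + h, j := x j + h)) - f (x(i := x i + h)) - (f (x(j := x j + h)) - f x)) / h^2"
    unfolding Q_def by (simp add: algebra_simps)
   then have "\<bar>Q - pd i (pd j f) x\<bar> \<le> L * h" using L(2)[OF h] unfolding tw sw by simp
   moreover have "\<bar>Q - pd j (pd i f) x\<bar> \<le> K * h" using K(2)[OF h] unfolding sw Q_def .
   ultimately show ?thesis by (simp add: algebra_simps)
  qed
  also have "\<dots> \<le> e" using K(1) L(1) that unfolding h_def by (simp add: field_simps)
  finally show ?thesis .
 qed
 then show ?thesis using field_le_epsilon[of "\<bar>pd i (pd j f) x - pd j (pd i f) x\<bar>" 0] by simp
qed simp

section \<open>Gaussian integration by parts\<close>

lemma normal_density_tendsto_at_top: "s > 0 \<Longrightarrow> (normal_density 0 s \<longlongrightarrow> 0) at_top"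
proof -
 assume s: "s > 0"
 define C where "C = 1 / sqrt (2 * pi * s^2)"
 have C: "C \<ge> 0" by (simp add: C_def)
 show ?thesis
 proof (rule Lim_null_comparison)
  show "((%z. C * (2 * s^2) / z^2) \<longlongrightarrow> 0) at_top"
   by (rule tendsto_divide_0[OF tendsto_const]) (intro filterlim_at_top_imp_at_infinity filterlim_pow_at_top filterlim_ident, simp)
  show "\<forall>\<^sub>F z in at_top. norm (normal_density 0 s z) \<le> C * (2 * s^2) / z^2"
  proof (rule eventually_mono[OF eventually_gt_at_top[of 0]])
   fix z :: real assume z: "z > 0"
   define wt where "wt = z^2 / (2 * s^2)"
   have wt: "wt > 0" using z s by (simp add: wt_def)
   have "exp (- wt) = inverse (exp wt)" by (rule exp_minus)
   also have "\<dots> \<le> inverse wt" proof (rule le_imp_inverse_le)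
    show "wt \<le> exp wt" using exp_ge_add_one_self[of wt] by linarith
   qed (rule wt)
   finally have "C * exp (- wt) \<le> C * inverse wt" using C by (rule mult_left_mono)
   moreover have "normal_density 0 s z = C * exp (- wt)" by (simp add: normal_density_def C_def wt_def)
   ultimately show "norm (normal_density 0 s z) \<le> C * (2 * s^2) / z^2"
    using z s C by (simp add: wt_def abs_mult)
  qed
 qed
qed

lemma normal_density_tendsto_at_bot: "s > 0 \<Longrightarrow> (normal_density 0 s \<longlongrightarrow> 0) at_bot"
proof -
 assume s: "s > 0"
 have "(%z. normal_density 0 s (- z)) = normal_density 0 s" by (auto simp: normal_density_def)
 then show ?thesis unfolding filterlim_at_bot_mirror using normal_density_tendsto_at_top[OF s] by simp
qed

lemma normal_density_has_derivative:
 "s > 0 \<Longrightarrow> (normal_density 0 s has_real_derivative - (z / s^2) * normal_density 0 s z) (at z)"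
 unfolding normal_density_def by (auto intro!: derivative_eq_intros simp: power2_eq_square field_simps)

text \<open>The normal density \<open>\<phi>\<close> of variance \<open>s\<^sup>2\<close> satisfies \<open>z \<phi>(z) = - s\<^sup>2 \<phi>'(z)\<close>.\<close>

lemma normal_integration_by_parts:
 assumes s: "s > 0" and d: "\<And>z. (\<psi> has_real_derivative \<psi>' z) (at z)" and c: "\<And>z. isCont \<psi>' z"
  and B: "\<And>z. \<bar>\<psi> z\<bar> \<le> B" "\<And>z. \<bar>\<psi>' z\<bar> \<le> B"
 shows "(LINT z|lborel. normal_density 0 s z * (\<psi> z * z)) = s^2 * (LINT z|lborel. normal_density 0 s z * \<psi>' z)"
proof -
 let ?n = "normal_density 0 s"
 have "continuous_on UNIV \<psi>" using d by (auto intro!: continuous_at_imp_continuous_on DERIV_isCont)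
 then have m: "\<psi> \<in> borel_measurable borel" by (rule borel_measurable_continuous_onI)
 have "continuous_on UNIV \<psi>'" using c by (auto intro!: continuous_at_imp_continuous_on)
 then have m': "\<psi>' \<in> borel_measurable borel" by (rule borel_measurable_continuous_onI)
 note [measurable] = m m'
 have i1: "integrable lborel (%z. ?n z * \<psi>' z)"
 proof (rule Bochner_Integration.integrable_bound[of _ "%z. B * ?n z"])
  show "AE z in lborel. norm (?n z * \<psi>' z) \<le> norm (B * ?n z)"
   using B(2) by (intro AE_I2) (auto simp: abs_mult mult.commute intro!: mult_right_mono order_trans[OF B(2) abs_ge_self])
 qed (use integrable_normal_density[OF s] in auto)
 have i2: "integrable lborel (%z. ?n z * (\<psi> z * z))"
 proof (rule Bochner_Integration.integrable_bound[of _ "%z. B * (?n z * \<bar>z\<bar>)"])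
  show "integrable lborel (%z. B * (?n z * \<bar>z\<bar>))" using integrable_normal_moment_abs[of s 0 1] s by simp
  show "AE z in lborel. norm (?n z * (\<psi> z * z)) \<le> norm (B * (?n z * \<bar>z\<bar>))"
  proof (rule AE_I2)
   fix z
   have "\<bar>\<psi> z\<bar> * (?n z * \<bar>z\<bar>) \<le> \<bar>B\<bar> * (?n z * \<bar>z\<bar>)" by (intro mult_right_mono order_trans[OF B(1) abs_ge_self]) auto
   then show "norm (?n z * (\<psi> z * z)) \<le> norm (B * (?n z * \<bar>z\<bar>))" by (simp add: abs_mult mult_ac)
  qed
 qed auto
 have i: "integrable lborel (%z. ?n z * \<psi>' z - (1 / s^2) * (?n z * (\<psi> z * z)))" using i1 i2 by simp
 have cn: "isCont ?n z" for z using normal_density_has_derivative[OF s, of z] by (rule DERIV_isCont)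
 have lim: "((%z. \<psi> z * ?n z) \<longlongrightarrow> 0) F" if "(?n \<longlongrightarrow> 0) F" for F
 proof (rule Lim_null_comparison)
  show "((%z. \<bar>B\<bar> * ?n z) \<longlongrightarrow> 0) F" using tendsto_mult_left[OF that, of "\<bar>B\<bar>"] by simp
  show "\<forall>\<^sub>F z in F. norm (\<psi> z * ?n z) \<le> \<bar>B\<bar> * ?n z"
   by (intro always_eventually allI) (auto simp: abs_mult intro!: mult_right_mono order_trans[OF B(1) abs_ge_self])
 qed
 have "(LBINT z=-\<infinity>..\<infinity>. ?n z * \<psi>' z - (1 / s^2) * (?n z * (\<psi> z * z))) = 0 - 0"
 proof (rule interval_integral_FTC_integrable[where F = "%z. \<psi> z * ?n z"])
  show "((%z. \<psi> z * ?n z) has_vector_derivative ?n z * \<psi>' z - (1 / s^2) * (?n z * (\<psi> z * z))) (at z)" for z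
   unfolding has_real_derivative_iff_has_vector_derivative[symmetric]
   by (rule DERIV_cong[OF DERIV_mult[OF d normal_density_has_derivative[OF s]]]) (simp add: algebra_simps)
  show "isCont (%z. ?n z * \<psi>' z - (1 / s^2) * (?n z * (\<psi> z * z))) z" for z
   using cn c DERIV_isCont[OF d] by (intro continuous_intros) auto
  show "set_integrable lborel (einterval (-\<infinity>) \<infinity>) (%z. ?n z * \<psi>' z - (1 / s^2) * (?n z * (\<psi> z * z)))"
   using i by (simp add: set_integrable_def)
  show "(((%z. \<psi> z * ?n z) \<circ> real_of_ereal) \<longlongrightarrow> 0) (at_right (-\<infinity>))"
   unfolding ereal_tendsto_simps by (rule lim[OF normal_density_tendsto_at_bot[OF s]])
  show "(((%z. \<psi> z * ?n z) \<circ> real_of_ereal) \<longlongrightarrow> 0) (at_left \<infinity>)"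
   unfolding ereal_tendsto_simps by (rule lim[OF normal_density_tendsto_at_top[OF s]])
 qed simp
 then have "(LINT z|lborel. ?n z * \<psi>' z - (1 / s^2) * (?n z * (\<psi> z * z))) = 0"
  by (simp add: interval_lebesgue_integral_def set_lebesgue_integral_def)
 then have "(LINT z|lborel. ?n z * \<psi>' z) = (1 / s^2) * (LINT z|lborel. ?n z * (\<psi> z * z))"
  using i1 i2 by simp
 then show ?thesis using s by (simp add: field_simps)
qed

section \<open>Brownian motion\<close>

locale brownian = prob_space M for M :: "'a measure" +
 fixes T :: real and W :: "real \<Rightarrow> 'a \<Rightarrow> real"
 assumes T: "T > 0" and W: "brownian_motion M T W"
begin

abbreviation "time \<equiv> tm T"
abbreviation "\<F> \<equiv> augmented_filtration M T W"
abbreviation "TM \<equiv> time \<Otimes>\<^sub>M M"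
abbreviation "TTM \<equiv> time \<Otimes>\<^sub>M TM"
abbreviation "wiener \<equiv> has_wiener_integral M T W"
abbreviation "smooth \<equiv> smooth_functional M T W"
abbreviation "malliavin \<equiv> has_malliavin_deriv_process M T W"
abbreviation "skorohod \<equiv> has_skorohod_integral M T W"

lemma W_measurable: "t \<in> {0..T} \<Longrightarrow> W t \<in> borel_measurable M"
 using W by (auto simp: brownian_motion_def)

lemma W_continuous: "AE w in M. continuous_on {0..T} (%t. W t w)"
 using W by (auto simp: brownian_motion_def)

lemma W_increment:
 assumes "0 \<le> s" "s < t" "t \<le> T"
 shows "distributed M lborel (%w. W t w - W s w) (normal_density 0 (sqrt (t - s)))"
  and "indep_set (sets (\<F> s)) {(%w. W t w - W s w) -` A \<inter> space M |A. A \<in> sets borel}"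
 using W assms unfolding brownian_motion_def by blast+

lemma sets_M: "sets M = sets (\<F> T)"
 using W by (auto simp: brownian_motion_def)

definition null_pieces :: "'a set set" where
 "null_pieces = {N. \<exists>B\<in>sets (natural_filtration M W T). emeasure M B = 0 \<and> N \<subseteq> B}"

lemma space_natural: "space (natural_filtration M W t) = space M"
 unfolding natural_filtration_def by (rule space_measure_of) auto

lemma sets_natural: "sets (natural_filtration M W t) =
  sigma_sets (space M) (\<Union>s\<in>{0..t}. {W s -` A \<inter> space M |A. A \<in> sets borel})"
 unfolding natural_filtration_def by (rule sets_measure_of) auto

lemma null_pieces_subset: "null_pieces \<subseteq> Pow (space M)"
 using sets.sets_into_space[where M = "natural_filtration M W T"] by (fastforce simp: null_pieces_def space_natural)

lemma augmented_generator_subset: "sets (natural_filtration M W t) \<union> null_pieces \<subseteq> Pow (space M)"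
 using null_pieces_subset sets.sets_into_space[where M = "natural_filtration M W t"] by (auto simp: space_natural)

lemma space_augmented: "space (\<F> t) = space M"
 unfolding augmented_filtration_def null_pieces_def[symmetric]
 by (rule space_measure_of[OF augmented_generator_subset])

lemma sets_augmented: "sets (\<F> t) = sigma_sets (space M) (sets (natural_filtration M W t) \<union> null_pieces)"
 unfolding augmented_filtration_def null_pieces_def[symmetric]
 by (rule sets_measure_of[OF augmented_generator_subset])

lemma natural_subset_augmented: "sets (natural_filtration M W t) \<subseteq> sets (\<F> t)"
 unfolding sets_augmented by (auto intro: sigma_sets.Basic)

lemma natural_mono: "s \<le> t \<Longrightarrow> sets (natural_filtration M W s) \<subseteq> sets (natural_filtration M W t)"
 unfolding sets_natural by (intro sigma_sets_mono' UN_mono) auto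

lemma augmented_mono: "s \<le> t \<Longrightarrow> sets (\<F> s) \<subseteq> sets (\<F> t)"
 unfolding sets_augmented using natural_mono[of s t] by (intro sigma_sets_mono') auto

lemma augmented_subset: "t \<le> T \<Longrightarrow> sets (\<F> t) \<subseteq> sets M"
 using augmented_mono[of t T] by (simp add: sets_M)

lemma null_pieces_null: "N \<in> null_pieces \<Longrightarrow> N \<in> null_sets M"
proof -
 assume "N \<in> null_pieces"
 then obtain B where B: "B \<in> sets (natural_filtration M W T)" "emeasure M B = 0" "N \<subseteq> B" by (auto simp: null_pieces_def)
 have "N \<in> sets M" unfolding sets_M sets_augmented using \<open>N \<in> null_pieces\<close> by (auto intro: sigma_sets.Basic)
 moreover have "B \<in> sets M" using B(1) natural_subset_augmented[of T] sets_M by auto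
 ultimately show ?thesis using emeasure_mono[OF B(3), of M] B(2) by (auto simp: null_sets_def)
qed

lemma W_adapted:
 assumes "0 \<le> s" "s \<le> t"
 shows "W s \<in> borel_measurable (\<F> t)"
proof (rule measurableI)
 fix A :: "real set" assume "A \<in> sets borel"
 then have "W s -` A \<inter> space M \<in> sets (natural_filtration M W t)"
  unfolding sets_natural using assms by (intro sigma_sets.Basic UN_I[of s]) auto
 then show "W s -` A \<inter> space (\<F> t) \<in> sets (\<F> t)" using natural_subset_augmented by (auto simp: space_augmented)
qed simp

text \<open>The augmentation makes the probability space complete, so that random variables may be
 changed on null sets without losing measurability.\<close>

lemma null_set_subset:
 assumes N: "N \<in> null_sets M" and "S \<subseteq> N"
 shows "S \<in> sets M"
proof -
 have "\<exists>A'\<in>sets (natural_filtration M W T). \<exists>B\<in>sets (natural_filtration M W T). emeasure M B = 0 \<and> (A - A') \<union> (A' - A) \<subseteq> B"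
  if "A \<in> sigma_sets (space M) (sets (natural_filtration M W T) \<union> null_pieces)" for A
  using that
 proof induction
  case (Basic A)
  show ?case
  proof (cases "A \<in> sets (natural_filtration M W T)")
   case True then show ?thesis by (intro bexI[of _ A] bexI[of _ "{}"]) auto
  next
   case False
   then obtain B where "B \<in> sets (natural_filtration M W T)" "emeasure M B = 0" "A \<subseteq> B"
    using Basic by (auto simp: null_pieces_def)
   then show ?thesis by (intro bexI[of _ "{}"] bexI[of _ B]) auto
  qed
 next
  case Empty then show ?case by (intro bexI[of _ "{}"]) auto
 next
  case (Compl A)
  then obtain A' B where AB: "A' \<in> sets (natural_filtration M W T)" "B \<in> sets (natural_filtration M W T)"
   "emeasure M B = 0" "(A - A') \<union> (A' - A) \<subseteq> B" by blast
  have "space M - A' \<in> sets (natural_filtration M W T)"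
   using sets.compl_sets[OF AB(1)] by (simp add: space_natural)
  then show ?case using AB by (intro bexI[of _ "space M - A'"] bexI[of _ B]) auto
 next
  case (Union A)
  then obtain A' B where AB: "\<And>i::nat. A' i \<in> sets (natural_filtration M W T)" "\<And>i. B i \<in> sets (natural_filtration M W T)"
   "\<And>i. emeasure M (B i) = 0" "\<And>i. (A i - A' i) \<union> (A' i - A i) \<subseteq> B i" by metis
  have "B i \<in> null_sets M" for i using AB(2,3) natural_subset_augmented[of T] sets_M by (intro null_setsI) auto
  then have "emeasure M (\<Union>i. B i) = 0" by (intro null_setsD1 null_sets_UN)
  moreover have "(\<Union>i. A i) - (\<Union>i. A' i) \<union> ((\<Union>i. A' i) - (\<Union>i. A i)) \<subseteq> (\<Union>i. B i)" using AB(4) by blast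
  ultimately show ?case using AB(1,2) by (intro bexI[of _ "\<Union>i. A' i"] bexI[of _ "\<Union>i. B i"]) auto
 qed
 moreover have "N \<in> sigma_sets (space M) (sets (natural_filtration M W T) \<union> null_pieces)"
  using N sets_M sets_augmented[of T] by auto
 ultimately obtain N' B where NB: "N' \<in> sets (natural_filtration M W T)" "B \<in> sets (natural_filtration M W T)"
  "emeasure M B = 0" "(N - N') \<union> (N' - N) \<subseteq> B" by blast
 have sM: "N' \<in> sets M" "B \<in> sets M" using NB(1,2) natural_subset_augmented[of T] sets_M by auto
 have "N \<union> B \<in> null_sets M" using N NB(3) sM by (intro null_sets.Un) auto
 then have "N' \<union> B \<in> null_sets M" by (rule null_sets_subset) (use NB(4) sM in auto)
 then have "S \<in> null_pieces"
  unfolding null_pieces_def using NB \<open>S \<subseteq> N\<close> by (auto intro!: bexI[of _ "N' \<union> B"])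
 then show ?thesis by (auto dest: null_pieces_null)
qed

lemma measurable_cong_AE_complete:
 fixes f g :: "'a \<Rightarrow> real"
 assumes g: "g \<in> borel_measurable M" and eq: "AE w in M. f w = g w"
 shows "f \<in> borel_measurable M"
proof (rule measurableI)
 fix A :: "real set" assume A: "A \<in> sets borel"
 obtain N where N: "N \<in> null_sets M" "{w \<in> space M. f w \<noteq> g w} \<subseteq> N" using eq by (auto elim!: AE_E simp: null_sets_def)
 have "f -` A \<inter> space M = (g -` A \<inter> space M - N) \<union> (f -` A \<inter> space M \<inter> N)" using N(2) by auto
 moreover have "g -` A \<inter> space M - N \<in> sets M" using g A N by (auto intro: measurable_sets)
 moreover have "f -` A \<inter> space M \<inter> N \<in> sets M" by (rule null_set_subset[OF N(1)]) auto
 ultimately show "f -` A \<inter> space M \<in> sets M" by (metis sets.Un)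
qed simp

text \<open>A jointly measurable process with the same paths outside a null set, obtained as the limit
 of piecewise constant interpolations.\<close>

lemma joint_version:
 obtains V where "(case_prod V) \<in> borel_measurable (borel \<Otimes>\<^sub>M M)"
  "AE w in M. \<forall>t\<in>{0..T}. V t w = W t w"
proof -
 obtain N where N: "N \<in> null_sets M" "{w \<in> space M. \<not> continuous_on {0..T} (%t. W t w)} \<subseteq> N"
  using W_continuous by (auto elim!: AE_E simp: null_sets_def)
 define U where "U t w = (if w \<in> N \<or> t \<notin> {0..T} then 0 else W t w)" for t w
 have N_meas [measurable]: "Measurable.pred M (%w. w \<in> N)" using N(1) by (auto simp: null_sets_def)
 have U_meas [measurable]: "U t \<in> borel_measurable M" for t
 proof (cases "t \<in> {0..T}")
  case True
  note [measurable] = W_measurable[OF True]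
  show ?thesis unfolding U_def[abs_def] using True by simp
 qed (simp add: U_def[abs_def])
 define d where "d n t = real_of_int \<lfloor>t * 2 ^ n\<rfloor> / 2 ^ n" for n and t :: real
 have d: "d n t \<le> t" "t - (1/2)^n < d n t" "0 \<le> t \<Longrightarrow> 0 \<le> d n t" for n t
 proof -
  have "real_of_int \<lfloor>t * 2 ^ n\<rfloor> \<le> t * 2 ^ n" "t * 2 ^ n < real_of_int \<lfloor>t * 2 ^ n\<rfloor> + 1" by linarith+
  then have "real_of_int \<lfloor>t * 2 ^ n\<rfloor> / 2 ^ n \<le> t * 2 ^ n / 2 ^ n" "t * 2 ^ n / 2 ^ n < (real_of_int \<lfloor>t * 2 ^ n\<rfloor> + 1) / 2 ^ n"
   by (simp_all only: divide_right_mono divide_strict_right_mono zero_le_power zero_less_power zero_le_numeral zero_less_numeral)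
  then show "d n t \<le> t" "t - (1/2)^n < d n t" by (auto simp: d_def add_divide_distrib power_one_over)
  show "0 \<le> t \<Longrightarrow> 0 \<le> d n t" by (simp add: d_def)
 qed
 have d_lim: "(%n. d n t) \<longlonglongrightarrow> t" for t
 proof (rule tendsto_sandwich[of "%n. t - (1/2)^n" _ _ "%_. t"])
  have "(%n. t - (1/2)^n) \<longlonglongrightarrow> t - 0" by (intro tendsto_intros LIMSEQ_power_zero) auto
  then show "(%n. t - (1/2)^n) \<longlonglongrightarrow> t" by simp
  show "\<forall>\<^sub>F n in sequentially. t - (1/2)^n \<le> d n t" using d(2) by (intro always_eventually allI less_imp_le)
  show "\<forall>\<^sub>F n in sequentially. d n t \<le> t" using d(1) by (intro always_eventually allI)
 qed simp
 define V where "V t w = (if t \<in> {0..T} then U t w else 0)" for t w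
 have "(%p. if fst p \<in> {0..T} then U (d n (fst p)) (snd p) else 0) \<in> borel_measurable (borel \<Otimes>\<^sub>M M)" for n
 proof -
  have "(%p. (%k (p :: real \<times> 'a). U (real_of_int k / 2 ^ n) (snd p)) \<lfloor>fst p * 2 ^ n\<rfloor> p) \<in> borel_measurable (borel \<Otimes>\<^sub>M M)"
   by (rule measurable_compose_countable) measurable
  then have [measurable]: "(%p. U (d n (fst p)) (snd p)) \<in> borel_measurable (borel \<Otimes>\<^sub>M M)" by (simp add: d_def)
  show ?thesis by measurable
 qed
 moreover have "(%n. if fst p \<in> {0..T} then U (d n (fst p)) (snd p) else 0) \<longlonglongrightarrow> V (fst p) (snd p)"
  if "p \<in> space (borel \<Otimes>\<^sub>M M)" for p
 proof (cases "fst p \<in> {0..T} \<and> snd p \<notin> N")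
  case True
  have w: "snd p \<in> space M" using that by (auto simp: space_pair_measure)
  then have c: "continuous_on {0..T} (%t. W t (snd p))" using N(2) True by auto
  have r: "d n (fst p) \<in> {0..T}" for n using True d(1)[of n "fst p"] d(3)[of "fst p" n] by auto
  have "(%n. W (d n (fst p)) (snd p)) \<longlonglongrightarrow> W (fst p) (snd p)"
   by (rule continuous_on_tendsto_compose[OF c d_lim]) (use True r in simp_all)
  then show ?thesis using True r by (simp add: U_def V_def)
 next
  case False
  then have "(if fst p \<in> {0..T} then U (d n (fst p)) (snd p) else 0) = 0" "V (fst p) (snd p) = 0" for n
   by (simp_all add: U_def V_def)
  then show ?thesis by simp
 qed
 ultimately have "(%p. V (fst p) (snd p)) \<in> borel_measurable (borel \<Otimes>\<^sub>M M)"
  by (rule borel_measurable_LIMSEQ_metric)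
 then have m: "(case_prod V) \<in> borel_measurable (borel \<Otimes>\<^sub>M M)" by (simp add: split_beta')
 have "AE w in M. \<forall>t\<in>{0..T}. V t w = W t w"
  using AE_not_in[OF N(1)] by eventually_elim (auto simp: V_def U_def)
 with m show thesis by (rule that)
qed

section \<open>Integration by parts for step functions\<close>

lemma increments_indep:
 assumes t: "\<And>k. k < N \<Longrightarrow> t k < t (Suc k)" "0 \<le> t 0" "t N \<le> T"
 shows "indep_vars (%_. borel) (%k w. W (t (Suc k)) w - W (t k) w) {..<N}"
 using t
proof (induction N)
 case 0 show ?case by (simp add: indep_vars_def indep_sets_def)
next
 case (Suc N)
 have mono: "t i \<le> t j" if "i \<le> j" "j \<le> Suc N" for i j
  using that
 proof (induction j rule: dec_induct)
  case (step j)
  then show ?case using Suc.prems(1)[of j] by simp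
 qed simp
 have rng: "t i \<in> {0..T}" if "i \<le> Suc N" for i
  using mono[of 0 i] mono[of i "Suc N"] that Suc.prems by auto
 let ?\<Delta> = "%k w. W (t (Suc k)) w - W (t k) w"
 let ?F = "%k. {?\<Delta> k -` A \<inter> space M |A. A \<in> sets borel}"
 have rv: "?\<Delta> k \<in> borel_measurable M" if "k < Suc N" for k
  using that by (intro borel_measurable_diff W_measurable rng) auto
 have IH: "indep_sets ?F {..<N}"
  using Suc.IH Suc.prems rng[of N] by (auto simp: indep_vars_def2)
 have fin: "A \<in> sets (\<F> (t N))" if "k < N" "A \<in> ?F k" for k A
 proof -
  have "W (t (Suc k)) \<in> borel_measurable (\<F> (t N))" "W (t k) \<in> borel_measurable (\<F> (t N))"
   using that(1) rng[of k] rng[of "Suc k"] by (auto intro!: W_adapted mono)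
  then have "?\<Delta> k \<in> borel_measurable (\<F> (t N))" by (intro borel_measurable_diff)
  then show ?thesis using that(2) measurable_sets[of "?\<Delta> k" "\<F> (t N)" borel] by (auto simp: space_augmented)
 qed
 have "indep_sets ?F {..<Suc N}"
 proof (rule indep_setsI)
  fix i assume "i \<in> {..<Suc N}"
  then show "?F i \<subseteq> events" using rv[of i] by (auto intro: measurable_sets)
 next
  fix A J assume J: "J \<noteq> {}" "J \<subseteq> {..<Suc N}" "finite J" "\<forall>j\<in>J. A j \<in> ?F j"
  show "prob (\<Inter>j\<in>J. A j) = (\<Prod>j\<in>J. prob (A j))"
  proof (cases "N \<in> J")
   case False
   then have "J \<subseteq> {..<N}" using J(2) by (auto simp: less_Suc_eq)
   then show ?thesis using J by (intro indep_setsD[OF IH]) auto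
  next
   case True
   define J' where "J' = J - {N}"
   have J': "J = insert N J'" "N \<notin> J'" "finite J'" "J' \<subseteq> {..<N}" using True J(2,3) by (auto simp: J'_def less_Suc_eq)
   show ?thesis
   proof (cases "J' = {}")
    case True then show ?thesis using J' by simp
   next
    case False
    have "A j \<in> sets (\<F> (t N))" if "j \<in> J'" for j
     by (rule fin[of j]) (use J(4) J' that in auto)
    then have 1: "(\<Inter>j\<in>J'. A j) \<in> sets (\<F> (t N))"
     using J'(3) False by (intro sets.finite_INT) auto
    have "prob ((\<Inter>j\<in>J'. A j) \<inter> A N) = prob (\<Inter>j\<in>J'. A j) * prob (A N)"
     by (rule indep_setD[OF W_increment(2)[of "t N" "t (Suc N)"] 1]) (use rng[of N] Suc.prems J J' in auto)
    moreover have "prob (\<Inter>j\<in>J'. A j) = (\<Prod>j\<in>J'. prob (A j))"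
     using J J' False by (intro indep_setsD[OF IH]) auto
    ultimately show ?thesis using J' by (simp add: Int_commute mult.commute)
   qed
  qed
 qed
 then show ?case unfolding indep_vars_def2 using rv by auto
qed

end

lemma Cb_infty_measurable:
 assumes f: "f \<in> Cb_infty n" and X: "\<And>i. i < n \<Longrightarrow> X i \<in> borel_measurable N"
 shows "(%w. f (%i. X i w)) \<in> borel_measurable N"
proof -
 have "(%w. if i < n then X i w else 0) \<in> borel_measurable N" for i using X[of i] by (cases "i < n") auto
 then have "(%w i. if i < n then X i w else 0) \<in> borel_measurable N" by (rule measurable_coordinatewise_then_product)
 moreover have "f \<in> borel_measurable borel" using Cb_inftyD(2)[OF f] by (rule borel_measurable_continuous_onI)
 ultimately have "(%w. f (%i. if i < n then X i w else 0)) \<in> borel_measurable N" by (rule measurable_compose)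
 moreover have "f (%i. if i < n then X i w else 0) = f (%i. X i w)" for w by (rule Cb_inftyD(1)[OF f]) simp
 ultimately show ?thesis by simp
qed

lemma finite_set_grid:
 assumes "finite S" "S \<noteq> {}"
 obtains N and t :: "nat \<Rightarrow> real" where "t ` {..N} = S" "\<And>k. k < N \<Longrightarrow> t k < t (Suc k)"
proof -
 define l where "l = sorted_list_of_set S"
 have l: "set l = S" "sorted_wrt (<) l" "length l > 0" using assms by (auto simp: l_def)
 show thesis
 proof (rule that[of "%k. l ! k" "length l - 1"])
  have "{..length l - 1} = {..<length l}" using l(3) lessThan_Suc_atMost[of "length l - 1"] by simp
  then show "(!) l ` {..length l - 1} = S" using l(1) nth_image[of "length l" l] by (simp add: lessThan_atLeast0)
  show "l ! k < l ! Suc k" if "k < length l - 1" for k using sorted_wrt_nth_less[OF l(2), of k "Suc k"] that by simp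
 qed
qed

lemma telescope_indicator:
 fixes wt :: "nat \<Rightarrow> real"
 assumes t: "\<And>k. k < N \<Longrightarrow> t k < (t (Suc k) :: real)" and p: "p \<le> q" "q \<le> N"
 shows "(\<Sum>k<N. indicator {t p<..t q} (t (Suc k)) * (wt (Suc k) - wt k)) = wt q - wt p"
proof -
 have mono: "t i < t j" if "i < j" "j \<le> N" for i j
  using that
 proof (induction j)
  case (Suc j)
  then show ?case using t[of j] by (cases "i = j") auto
 qed simp
 have iff: "t (Suc k) \<in> {t p<..t q} \<longleftrightarrow> k \<in> {p..<q}" if k: "k < N" for k
 proof
  assume A: "t (Suc k) \<in> {t p<..t q}"
  have "\<not> k < p"
  proof
   assume "k < p"
   then have "t (Suc k) \<le> t p" using mono[of "Suc k" p] p by (cases "Suc k = p") auto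
   then show False using A by simp
  qed
  moreover have "\<not> q < Suc k" using mono[of q "Suc k"] A k by auto
  ultimately show "k \<in> {p..<q}" by auto
 next
  assume "k \<in> {p..<q}"
  moreover from this have "t (Suc k) \<le> t q" using mono[of "Suc k" q] p by (cases "Suc k = q") auto
  ultimately show "t (Suc k) \<in> {t p<..t q}" using mono[of p "Suc k"] k by auto
 qed
 have "(\<Sum>k<N. indicator {t p<..t q} (t (Suc k)) * (wt (Suc k) - wt k)) = (\<Sum>k\<in>{p..<q}. wt (Suc k) - wt k)"
  by (rule sum.mono_neutral_cong_right) (use p iff in \<open>auto simp: indicator_def\<close>)
 also have "\<dots> = wt q - wt p" using p(1) by (rule sum_Suc_diff')
 finally show ?thesis .
qed

lemma step_integral_Nil [simp]: "step_integral W [] w = 0" by (simp add: step_integral_def)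

lemma step_integral_append: "step_integral W (xs @ ys) w = step_integral W xs w + step_integral W ys w"
 by (simp add: step_integral_def)

lemma step_integral_scale: "step_integral W (map (%(c, ab). (k * c, ab)) xs) w = k * step_integral W xs w"
 by (induction xs) (auto simp: step_integral_def algebra_simps)

lemma step_integral_Cons: "step_integral W ((c, a, b) # xs) w = c * (W b w - W a w) + step_integral W xs w"
 by (simp add: step_integral_def)

text \<open>On a grid that contains the end points, a step function is determined by its values at the
 right end points of the cells.\<close>

lemma step_on_grid:
 assumes t: "\<And>k. k < N \<Longrightarrow> t k < (t (Suc k) :: real)"
  and xs: "\<And>c a b. (c, a, b) \<in> set xs \<Longrightarrow> a \<in> t ` {..N} \<and> b \<in> t ` {..N} \<and> a \<le> b"
 shows "step_fun xs s = (\<Sum>k<N. step_fun xs (t (Suc k)) * indicator {t k<..t (Suc k)} s)"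
  and "step_integral W xs w = (\<Sum>k<N. step_fun xs (t (Suc k)) * (W (t (Suc k)) w - W (t k) w))"
proof -
 have mono: "t i < t j" if "i < j" "j \<le> N" for i j
  using that
 proof (induction j)
  case (Suc j)
  then show ?case using t[of j] by (cases "i = j") auto
 qed simp
 have gen: "(\<Sum>k<N. step_fun xs (t (Suc k)) * (wt (t (Suc k)) - wt (t k))) = (\<Sum>(c, a, b)\<leftarrow>xs. c * (wt b - wt a))" for wt :: "real \<Rightarrow> real"
  using xs
 proof (induction xs)
  case (Cons x xs)
  obtain c a b where x: "x = (c, a, b)" by (cases x)
  obtain p q where pq: "a = t p" "b = t q" "p \<le> N" "q \<le> N" "a \<le> b" using Cons(2)[of c a b] by (auto simp: x)
  have "p \<le> q" using mono[of q p] pq by (cases "p \<le> q") auto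
  have "(\<Sum>k<N. indicator {a<..b} (t (Suc k)) * (wt (t (Suc k)) - wt (t k))) = wt b - wt a"
   unfolding pq(1,2) using telescope_indicator[where t = t and N = N and p = p and q = q and wt = "%k. wt (t k)", OF t \<open>p \<le> q\<close> pq(4)] by simp
  then have "(\<Sum>k<N. c * (indicator {a<..b} (t (Suc k)) * (wt (t (Suc k)) - wt (t k)))) = c * (wt b - wt a)"
   by (simp add: sum_distrib_left[symmetric])
  moreover have "(\<Sum>k<N. step_fun xs (t (Suc k)) * (wt (t (Suc k)) - wt (t k))) = (\<Sum>(c, a, b)\<leftarrow>xs. c * (wt b - wt a))"
   by (rule Cons(1)) (use Cons(2) in auto)
  ultimately show ?case
   by (simp add: x step_fun_Cons ring_distribs sum.distrib sum_subtractf mult.assoc)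
 qed simp
 show "step_integral W xs w = (\<Sum>k<N. step_fun xs (t (Suc k)) * (W (t (Suc k)) w - W (t k) w))"
  using gen[of "%s. W s w"] by (simp add: step_integral_def)
 have "(\<Sum>(c, a, b)\<leftarrow>xs. c * (indicator {s..} b - indicator {s..} a)) = step_fun xs s"
  unfolding step_fun_def using xs
 proof (intro arg_cong[of _ _ sum_list] map_cong refl)
  fix x assume "x \<in> set xs"
  obtain c a b where x: "x = (c, a, b)" by (cases x)
  then have "a \<le> b" using xs \<open>x \<in> set xs\<close> by auto
  then show "(case x of (c, a, b) \<Rightarrow> c * (indicator {s..} b - indicator {s..} a)) = (case x of (c, a, b) \<Rightarrow> c * indicator {a<..b} s)"
   by (auto simp: x indicator_def)
 qed
 moreover have "indicator {s..} (t (Suc k)) - indicator {s..} (t k) = (indicator {t k<..t (Suc k)} s :: real)" if "k < N" for k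
  using t[OF that] by (auto simp: indicator_def)
 ultimately show "step_fun xs s = (\<Sum>k<N. step_fun xs (t (Suc k)) * indicator {t k<..t (Suc k)} s)"
  using gen[of "indicator {s..}"] by simp
qed

lemma integral_time_interval:
 assumes "0 \<le> a" "a \<le> b" "b \<le> T"
 shows "(LINT s|(tm T). indicator {a<..b} s) = b - a"
proof -
 have "(LINT s|(tm T). indicator {a<..b} s) = (LINT s:{0..T}|lborel. indicator {a<..b} s :: real)"
  by (rule integral_time_measure)
 also have "\<dots> = (LINT s|lborel. indicator {a<..b} s)"
  unfolding set_lebesgue_integral_def
  by (rule Bochner_Integration.integral_cong) (use assms in \<open>auto simp: indicator_def\<close>)
 finally show ?thesis using assms by simp
qed

lemma step_fun_inner_grid:
 assumes t: "\<And>k. k < N \<Longrightarrow> t k < (t (Suc k) :: real)" and rng: "\<And>k. k \<le> N \<Longrightarrow> t k \<in> {0..T}"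
  and xs: "\<And>c a b. (c, a, b) \<in> set xs \<Longrightarrow> a \<in> t ` {..N} \<and> b \<in> t ` {..N} \<and> a \<le> b"
  and ys: "\<And>c a b. (c, a, b) \<in> set ys \<Longrightarrow> a \<in> t ` {..N} \<and> b \<in> t ` {..N} \<and> a \<le> b"
 shows "(LINT s|(tm T). step_fun xs s * step_fun ys s) = (\<Sum>k<N. step_fun xs (t (Suc k)) * step_fun ys (t (Suc k)) * (t (Suc k) - t k))"
proof -
 have mono: "t i < t j" if "i < j" "j \<le> N" for i j
  using that
 proof (induction j)
  case (Suc j)
  then show ?case using t[of j] by (cases "i = j") auto
 qed simp
 have disj: "indicator {t k<..t (Suc k)} s * indicator {t l<..t (Suc l)} s = (if k = l then indicator {t k<..t (Suc k)} s else (0 :: real))"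
  if "k < N" "l < N" for k l s
 proof (cases k l rule: linorder_cases)
  case less
  then have "t (Suc k) \<le> t l" using mono[of "Suc k" l] that by (cases "Suc k = l") auto
  then show ?thesis using less by (auto simp: indicator_def)
 next
  case greater
  then have "t (Suc l) \<le> t k" using mono[of "Suc l" k] that by (cases "Suc l = k") auto
  then show ?thesis using greater by (auto simp: indicator_def)
 qed (auto simp: indicator_def)
 have "step_fun xs s * step_fun ys s = (\<Sum>k<N. (step_fun xs (t (Suc k)) * step_fun ys (t (Suc k))) * indicator {t k<..t (Suc k)} s)" for s
 proof -
  have X: "step_fun xs s = (\<Sum>k<N. step_fun xs (t (Suc k)) * indicator {t k<..t (Suc k)} s)"
   by (rule step_on_grid(1)[OF t xs])
  have Y: "step_fun ys s = (\<Sum>k<N. step_fun ys (t (Suc k)) * indicator {t k<..t (Suc k)} s)"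
   by (rule step_on_grid(1)[OF t ys])
  have "step_fun xs s * step_fun ys s = (\<Sum>k<N. step_fun xs (t (Suc k)) * indicator {t k<..t (Suc k)} s) *
    (\<Sum>k<N. step_fun ys (t (Suc k)) * indicator {t k<..t (Suc k)} s)"
   using X Y by (rule arg_cong2)
  also have "\<dots> = (\<Sum>k<N. \<Sum>l<N. (step_fun xs (t (Suc k)) * step_fun ys (t (Suc l))) * (indicator {t k<..t (Suc k)} s * indicator {t l<..t (Suc l)} s))"
   unfolding sum_product by (intro sum.cong refl) (simp only: mult_ac)
  also have "\<dots> = (\<Sum>k<N. \<Sum>l<N. if k = l then (step_fun xs (t (Suc k)) * step_fun ys (t (Suc l))) * indicator {t k<..t (Suc k)} s else 0)"
   by (intro sum.cong refl) (simp add: disj)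
  also have "\<dots> = (\<Sum>k<N. (step_fun xs (t (Suc k)) * step_fun ys (t (Suc k))) * indicator {t k<..t (Suc k)} s)"
   by (intro sum.cong refl) simp
  finally show ?thesis .
 qed
 then have "(LINT s|(tm T). step_fun xs s * step_fun ys s)
   = (LINT s|(tm T). (\<Sum>k<N. (step_fun xs (t (Suc k)) * step_fun ys (t (Suc k))) * indicator {t k<..t (Suc k)} s))"
  by (intro lint_cong)
 also have "\<dots> = (\<Sum>k<N. (LINT s|(tm T). (step_fun xs (t (Suc k)) * step_fun ys (t (Suc k))) * indicator {t k<..t (Suc k)} s))"
 proof (rule Bochner_Integration.integral_sum)
  fix k
  have "integrable (tm T) (indicator {t k<..t (Suc k)} :: real \<Rightarrow> real)"
   by (rule finite_measure.L2_integrable[OF finite_measure_time_measure L2_indicator]) simp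
  then show "integrable (tm T) (%s. (step_fun xs (t (Suc k)) * step_fun ys (t (Suc k))) * indicator {t k<..t (Suc k)} s)"
   by (rule integrable_mult_right)
 qed
 also have "\<dots> = (\<Sum>k<N. step_fun xs (t (Suc k)) * step_fun ys (t (Suc k)) * (t (Suc k) - t k))"
 proof (rule sum.cong[OF refl])
  fix k assume "k \<in> {..<N}"
  then have "(LINT s|(tm T). indicator {t k<..t (Suc k)} s) = t (Suc k) - t k"
   using t[of k] rng[of k] rng[of "Suc k"] by (intro integral_time_interval) auto
  then show "(LINT s|(tm T). (step_fun xs (t (Suc k)) * step_fun ys (t (Suc k))) * indicator {t k<..t (Suc k)} s)
    = step_fun xs (t (Suc k)) * step_fun ys (t (Suc k)) * (t (Suc k) - t k)" by (simp only: Bochner_Integration.integral_mult_right_zero)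
 qed
 finally show ?thesis .
qed

context brownian begin

lemma W_increment_L2:
 assumes "0 \<le> a" "a \<le> b" "b \<le> T"
 shows "L2 M (%w. W b w - W a w)"
proof (cases "a = b")
 case False
 then have ab: "a < b" using assms by simp
 have m: "(%w. W b w - W a w) \<in> borel_measurable M" using assms by (intro borel_measurable_diff W_measurable) auto
 have "integrable lborel (%z. normal_density 0 (sqrt (b - a)) z * z^2)"
  using integrable_normal_moment[of "sqrt (b - a)" 0 2] ab by simp
 then have "integrable M (%w. (W b w - W a w)^2)"
  using distributed_integrable[OF W_increment(1)[OF assms(1) ab assms(3)], of "%z. z^2"] by simp
 then show ?thesis using m by (simp add: square_integrable_def)
qed (simp add: L2_zero)

lemma step_integral_L2: "steps_in T xs \<Longrightarrow> L2 M (step_integral W xs)"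
proof (induction xs)
 case Nil
 have "step_integral W [] = (%_. 0)" by auto
 then show ?case by (simp add: L2_zero)
next
 case (Cons x xs)
 obtain c a b where x: "x = (c, a, b)" by (cases x)
 have "L2 M (%w. c * (W b w - W a w) + step_integral W xs w)"
  using Cons by (intro L2_add L2_cmult W_increment_L2) (auto simp: x steps_in_def)
 then show ?case by (simp add: x step_integral_Cons[abs_def])
qed

text \<open>The increments over the cells of a grid are independent, so that Gaussian integration by parts
 applies to each of them with the others held fixed.\<close>

lemma increments_integration_by_parts:
 assumes t: "\<And>k. k < N \<Longrightarrow> t k < t (Suc k)" "\<And>k. k \<le> N \<Longrightarrow> t k \<in> {0..T}"
  and f: "f \<in> Cb_infty n" and k: "k < N"
 defines "\<Delta> \<equiv> %k w. W (t (Suc k)) w - W (t k) w"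
 shows "(LINT w|M. f (%i. \<Sum>k<N. c i k * \<Delta> k w) * \<Delta> k w)
  = (\<Sum>i<n. c i k * (LINT w|M. pd i f (%i. \<Sum>k<N. c i k * \<Delta> k w))) * (t (Suc k) - t k)"
proof -
 define Q where "Q = {..<N} - {k}"
 define Z where "Z w = restrict (%i. \<Delta> i w) {k}" for w
 define P' where "P' = PiM {k} (%_. borel :: real measure)"
 have Zk: "Z w k = \<Delta> k w" for w by (simp add: Z_def)
 define V where "V w = restrict (%k. \<Delta> k w) Q" for w
 define P where "P = PiM Q (%_. borel :: real measure)"
 define R where "R v i = (\<Sum>l\<in>Q. c i l * v l)" for v :: "nat \<Rightarrow> real" and i
 define \<tau> where "\<tau> = t (Suc k) - t k"
 have \<tau>: "\<tau> > 0" using t(1)[OF k] by (simp add: \<tau>_def)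
 have "indep_vars (%_. borel) \<Delta> {..<N}" unfolding \<Delta>_def using t(1) t(2)[of 0] t(2)[of N] by (intro increments_indep) auto
 from indep_var_restrict[OF this, of "{k}" Q] k
 have ind: "indep_var P' Z P V"
  unfolding P_def P'_def V_def[abs_def] Z_def[abs_def] by (auto simp: Q_def)
 have Zm [measurable]: "Z \<in> measurable M P'" and Vm [measurable]: "V \<in> measurable M P"
  and distr: "distr M P' Z \<Otimes>\<^sub>M distr M P V = distr M (P' \<Otimes>\<^sub>M P) (%w. (Z w, V w))"
  using ind unfolding indep_var_distribution_eq by auto
 have km [measurable]: "(%z. z k) \<in> borel_measurable P'"
  unfolding P'_def by (rule measurable_component_singleton) simp
 interpret D1: prob_space "distr M P' Z" by (rule prob_space_distr) fact
 interpret D2: prob_space "distr M P V" by (rule prob_space_distr) fact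
 interpret D: pair_sigma_finite "distr M P' Z" "distr M P V" ..
 have dens: "distributed M lborel (\<Delta> k) (normal_density 0 (sqrt \<tau>))"
  unfolding \<Delta>_def \<tau>_def using t(1)[OF k] t(2)[of k] t(2)[of "Suc k"] k by (intro W_increment) auto
 have split: "(%i. \<Sum>l<N. c i l * \<Delta> l w) = (%i. R (V w) i + Z w k * c i k)" for w
 proof
  fix i
  have "(\<Sum>l<N. c i l * \<Delta> l w) = c i k * \<Delta> k w + (\<Sum>l\<in>Q. c i l * \<Delta> l w)"
   unfolding Q_def using k by (intro sum.remove) auto
  also have "(\<Sum>l\<in>Q. c i l * \<Delta> l w) = R (V w) i" unfolding R_def V_def by (intro sum.cong) auto
  finally show "(\<Sum>l<N. c i l * \<Delta> l w) = R (V w) i + Z w k * c i k" by (simp add: Zk)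
 qed
 have comp [measurable]: "(%p. R (snd p) i + fst p k * c i k) \<in> borel_measurable (P' \<Otimes>\<^sub>M P)" for i
 proof -
  have [measurable]: "(%p. snd p l) \<in> borel_measurable (P' \<Otimes>\<^sub>M P)" if "l \<in> Q" for l
   using measurable_compose[OF measurable_snd measurable_component_singleton[OF that, of "%_. borel"]] by (simp add: P_def)
  have "(%p. \<Sum>l\<in>Q. c i l * snd p l) \<in> borel_measurable (P' \<Otimes>\<^sub>M P)" by (intro borel_measurable_sum) measurable
  then show ?thesis unfolding R_def by measurable
 qed
 have gm [measurable]: "(%p. g (%i. R (snd p) i + fst p k * c i k)) \<in> borel_measurable (P' \<Otimes>\<^sub>M P)" if "g \<in> Cb_infty n" for g
  by (rule Cb_infty_measurable[OF that]) (rule comp)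
 have Zi: "integrable M (%w. Z w k)"
  using L2_integrable[OF W_increment_L2[of "t k" "t (Suc k)"]] t k
  by (force simp: Zk \<Delta>_def less_imp_le)
 define G where "G z v = f (%i. R v i + z k * c i k) * z k" for z v
 define H where "H z v = (\<Sum>i<n. pd i f (%i. R v i + z k * c i k) * c i k)" for z v
 obtain B where B: "\<And>x. \<bar>f x\<bar> \<le> B" by (rule Cb_infty_bound[OF f]) blast
 obtain K where K: "\<And>i x. i < n \<Longrightarrow> \<bar>pd i f x\<bar> \<le> K" by (rule Cb_infty_partials_bound[OF f]) blast
 define L where "L = (\<Sum>i<n. K * \<bar>c i k\<bar>)"
 have HL: "\<bar>H z v\<bar> \<le> L" for z v
  unfolding H_def L_def by (intro order_trans[OF sum_abs] sum_mono) (auto simp: abs_mult intro: mult_right_mono K)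
 have Gm: "case_prod G \<in> borel_measurable (P' \<Otimes>\<^sub>M P)"
  using gm[OF f] by (simp add: G_def split_beta')
 have Hm: "case_prod H \<in> borel_measurable (P' \<Otimes>\<^sub>M P)"
  using gm[OF Cb_inftyD(5)[OF f]] by (simp add: H_def split_beta')
 have GI: "integrable (distr M P' Z \<Otimes>\<^sub>M distr M P V) (case_prod G)"
  unfolding distr
 proof (subst integrable_distr_eq)
  show "integrable M (%w. case_prod G (Z w, V w))"
  proof (rule Bochner_Integration.integrable_bound[of _ "%w. B * Z w k"])
   show "(%w. case_prod G (Z w, V w)) \<in> borel_measurable M"
    using measurable_compose[OF measurable_Pair[OF Zm Vm] Gm] .
   show "AE w in M. norm (case_prod G (Z w, V w)) \<le> norm (B * Z w k)"
    by (auto simp: G_def abs_mult intro!: mult_right_mono order_trans[OF B abs_ge_self])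
  qed (use Zi in simp)
 qed (use Gm in auto)
 have HI: "integrable (distr M P' Z \<Otimes>\<^sub>M distr M P V) (case_prod H)"
  unfolding distr
 proof (subst integrable_distr_eq)
  show "integrable M (%w. case_prod H (Z w, V w))"
  proof (rule integrable_const_bound[where B = L])
   show "(%w. case_prod H (Z w, V w)) \<in> borel_measurable M"
    using measurable_compose[OF measurable_Pair[OF Zm Vm] Hm] .
  qed (use HL in auto)
 qed (use Hm in auto)
 have inner: "(\<integral>z. G z v \<partial>distr M P' Z) = \<tau> * (\<integral>z. H z v \<partial>distr M P' Z)" if v: "v \<in> space P" for v
 proof -
  have 1: "(\<integral>z. g (z k) \<partial>distr M P' Z) = (LINT z|lborel. normal_density 0 (sqrt \<tau>) z * g z)"
   if g [measurable]: "g \<in> borel_measurable borel" for g :: "real \<Rightarrow> real"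
  proof -
   have "(\<integral>z. g (z k) \<partial>distr M P' Z) = (LINT w|M. g (\<Delta> k w))"
    by (subst integral_distr) (auto simp: Zk)
   then show ?thesis using distributed_integral[OF dens, of g] g by simp
  qed
  define \<psi> \<psi>' where "\<psi> z = f (%i. R v i + z * c i k)" and "\<psi>' z = (\<Sum>i<n. pd i f (%i. R v i + z * c i k) * c i k)" for z
  have \<psi>d: "(\<psi> has_real_derivative \<psi>' z) (at z)" for z
   unfolding \<psi>'_def \<psi>_def[abs_def] by (rule Cb_infty_chain_rule[OF f])
  have "isCont (%z. pd i f (%i. R v i + z * c i k)) z" if "i < n" for i z
   by (rule DERIV_isCont[OF Cb_infty_chain_rule[OF Cb_inftyD(5)[OF f that]]])
  then have \<psi>c: "isCont \<psi>' z" for z unfolding \<psi>'_def[abs_def] by (intro continuous_intros) auto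
  have \<psi>b: "\<bar>\<psi> z\<bar> \<le> max B L" "\<bar>\<psi>' z\<bar> \<le> max B L" for z
   using B[of "%i. R v i + z * c i k"] HL[of "%_. z" v] by (auto simp: \<psi>_def \<psi>'_def H_def)
  have "continuous_on UNIV \<psi>" using \<psi>d by (auto intro!: continuous_at_imp_continuous_on DERIV_isCont)
  then have m: "\<psi> \<in> borel_measurable borel" by (rule borel_measurable_continuous_onI)
  have "continuous_on UNIV \<psi>'" using \<psi>c by (auto intro!: continuous_at_imp_continuous_on)
  then have m': "\<psi>' \<in> borel_measurable borel" by (rule borel_measurable_continuous_onI)
  have "(LINT z|lborel. normal_density 0 (sqrt \<tau>) z * (\<psi> z * z))
    = (sqrt \<tau>)^2 * (LINT z|lborel. normal_density 0 (sqrt \<tau>) z * \<psi>' z)"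
   by (rule normal_integration_by_parts[OF _ \<psi>d \<psi>c \<psi>b]) (use \<tau> in simp)
  moreover have "(%z. \<psi> z * z) \<in> borel_measurable borel" using m by measurable
  ultimately show ?thesis using 1[of "%z. \<psi> z * z"] 1[OF m'] \<tau> by (simp add: G_def H_def \<psi>_def \<psi>'_def)
 qed
 have "(LINT w|M. f (%i. \<Sum>k<N. c i k * \<Delta> k w) * \<Delta> k w) = (LINT w|M. case_prod G (Z w, V w))"
  unfolding split by (simp add: G_def Zk)
 also have "\<dots> = (LINT p|(distr M P' Z \<Otimes>\<^sub>M distr M P V). case_prod G p)"
  unfolding distr by (rule integral_distr[symmetric]) (use Gm in auto)
 also have "\<dots> = (\<integral>v. (\<integral>z. G z v \<partial>distr M P' Z) \<partial>distr M P V)"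
  using D.integral_snd[OF GI] by simp
 also have "\<dots> = (\<integral>v. \<tau> * (\<integral>z. H z v \<partial>distr M P' Z) \<partial>distr M P V)"
  by (rule Bochner_Integration.integral_cong) (auto simp: inner)
 also have "\<dots> = \<tau> * (LINT p|(distr M P' Z \<Otimes>\<^sub>M distr M P V). case_prod H p)"
  using D.integral_snd[OF HI] by simp
 also have "(LINT p|(distr M P' Z \<Otimes>\<^sub>M distr M P V). case_prod H p) = (LINT w|M. case_prod H (Z w, V w))"
  unfolding distr by (rule integral_distr) (use Hm in auto)
 also have "\<dots> = (LINT w|M. (\<Sum>i<n. c i k * pd i f (%i. \<Sum>k<N. c i k * \<Delta> k w)))"
  unfolding split by (simp add: H_def mult.commute)
 also have "\<dots> = (\<Sum>i<n. c i k * (LINT w|M. pd i f (%i. \<Sum>k<N. c i k * \<Delta> k w)))"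
 proof (subst Bochner_Integration.integral_sum)
  fix i assume "i \<in> {..<n}"
  then have i: "i < n" by simp
  have "integrable M (%w. pd i f (%i. \<Sum>k<N. c i k * \<Delta> k w))"
  proof (rule integrable_const_bound[where B = K])
   show "(%w. pd i f (%i. \<Sum>k<N. c i k * \<Delta> k w)) \<in> borel_measurable M"
    unfolding split using measurable_compose[OF measurable_Pair[OF Zm Vm] gm[OF Cb_inftyD(5)[OF f i]]] by simp
  qed (use K[OF i] in auto)
  then show "integrable M (%w. c i k * pd i f (%i. \<Sum>k<N. c i k * \<Delta> k w))" by simp
 qed simp
 finally show ?thesis by (simp add: \<tau>_def mult.commute)
qed

text \<open>On a common grid, all the step integrals are linear functions of the increments.\<close>

lemma step_integration_by_parts:
 assumes f: "f \<in> Cb_infty n" and xs: "\<And>i. i < n \<Longrightarrow> steps_in T (xs i)" and ys: "steps_in T ys"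
 shows "(LINT w|M. f (%i. step_integral W (xs i) w) * step_integral W ys w)
  = (\<Sum>i<n. (LINT w|M. pd i f (%i. step_integral W (xs i) w)) * (LINT s|time. step_fun (xs i) s * step_fun ys s))"
proof -
 define ends where "ends l = (\<Union>(c, a, b)\<in>set l. {a, b})" for l :: "(real \<times> real \<times> real) list"
 define S where "S = {0, T} \<union> ends ys \<union> (\<Union>i<n. ends (xs i))"
 have "finite S" by (auto simp: S_def ends_def split_beta')
 moreover have "S \<noteq> {}" by (simp add: S_def)
 ultimately obtain N t where t: "t ` {..N} = S" "\<And>k. k < N \<Longrightarrow> t k < t (Suc k)" by (rule finite_set_grid) blast
 have end_in: "a \<in> ends l \<and> b \<in> ends l \<and> a \<le> b \<and> 0 \<le> a \<and> b \<le> T" if "steps_in T l" "(c, a, b) \<in> set l" for l c a b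
  using that by (force simp: ends_def steps_in_def)
 have ends: "ends l \<subseteq> {0..T}" if "steps_in T l" for l
 proof
  fix x assume "x \<in> ends l"
  then obtain c a b where "(c, a, b) \<in> set l" "x = a \<or> x = b" by (auto simp: ends_def)
  then show "x \<in> {0..T}" using end_in[OF that, of c a b] by auto
 qed
 have "S \<subseteq> {0..T}" using T ends[OF ys] ends[OF xs] by (auto simp: S_def)
 then have rng: "t k \<in> {0..T}" if "k \<le> N" for k using t(1) that by blast
 have gx: "a \<in> t ` {..N} \<and> b \<in> t ` {..N} \<and> a \<le> b" if "i < n" "(c, a, b) \<in> set (xs i)" for i c a b
  unfolding t(1) using that end_in[OF xs[OF that(1)] that(2)] by (auto simp: S_def)
 have gy: "a \<in> t ` {..N} \<and> b \<in> t ` {..N} \<and> a \<le> b" if "(c, a, b) \<in> set ys" for c a b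
  unfolding t(1) using end_in[OF ys that] by (auto simp: S_def)
 define \<Delta> where "\<Delta> k w = W (t (Suc k)) w - W (t k) w" for k w
 define c where "c i k = step_fun (xs i) (t (Suc k))" for i k
 define d where "d k = step_fun ys (t (Suc k))" for k
 have X: "g (%i. step_integral W (xs i) w) = g (%i. \<Sum>k<N. c i k * \<Delta> k w)" if g: "g \<in> Cb_infty n" for g w
  by (rule Cb_inftyD(1)[OF g]) (use step_on_grid(2)[where t = t and N = N, OF t(2) gx] in \<open>simp add: c_def \<Delta>_def\<close>)
 have Y: "step_integral W ys w = (\<Sum>k<N. d k * \<Delta> k w)" for w
  using step_on_grid(2)[where t = t and N = N, OF t(2) gy] by (simp add: d_def \<Delta>_def)
 have in_: "(LINT s|time. step_fun (xs i) s * step_fun ys s) = (\<Sum>k<N. c i k * d k * (t (Suc k) - t k))" if "i < n" for i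
  unfolding c_def d_def using step_fun_inner_grid[where t = t and N = N, OF t(2) rng gx[OF that] gy] by simp
 obtain B where B: "\<And>x. \<bar>f x\<bar> \<le> B" by (rule Cb_infty_bound[OF f]) blast
 have \<Delta>s: "L2 M (\<Delta> k)" if "k < N" for k
  unfolding \<Delta>_def[abs_def] using t(2)[OF that] rng[of k] rng[of "Suc k"] that by (intro W_increment_L2) auto
 have Sm: "(%w. \<Sum>k<N. c i k * \<Delta> k w) \<in> borel_measurable M" for i
  using \<Delta>s by (intro borel_measurable_sum borel_measurable_times borel_measurable_const) (auto simp: square_integrable_def)
 have int: "integrable M (%w. f (%i. \<Sum>k<N. c i k * \<Delta> k w) * \<Delta> k w)" if k: "k < N" for k
  by (rule integrable_mult_L2[OF L2_of_bounded \<Delta>s[OF k]])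
   (use B Cb_infty_measurable[OF f Sm] in auto)
 have "(LINT w|M. f (%i. step_integral W (xs i) w) * step_integral W ys w)
  = (LINT w|M. (\<Sum>k<N. d k * (f (%i. \<Sum>k<N. c i k * \<Delta> k w) * \<Delta> k w)))"
  unfolding X[OF f] Y by (rule lint_cong) (simp add: sum_distrib_left mult.left_commute)
 also have "\<dots> = (\<Sum>k<N. d k * (LINT w|M. f (%i. \<Sum>k<N. c i k * \<Delta> k w) * \<Delta> k w))"
  using int by (subst Bochner_Integration.integral_sum) auto
 also have "\<dots> = (\<Sum>k<N. d k * ((\<Sum>i<n. c i k * (LINT w|M. pd i f (%i. \<Sum>k<N. c i k * \<Delta> k w))) * (t (Suc k) - t k)))"
  using increments_integration_by_parts[where t = t and N = N, OF t(2) rng f] by (intro sum.cong) (auto simp: \<Delta>_def)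
 also have "\<dots> = (\<Sum>k<N. \<Sum>i<n. (LINT w|M. pd i f (%i. \<Sum>k<N. c i k * \<Delta> k w)) * (c i k * d k * (t (Suc k) - t k)))"
  by (intro sum.cong refl) (simp add: sum_distrib_left sum_distrib_right mult_ac)
 also have "\<dots> = (\<Sum>i<n. \<Sum>k<N. (LINT w|M. pd i f (%i. \<Sum>k<N. c i k * \<Delta> k w)) * (c i k * d k * (t (Suc k) - t k)))"
  by (rule sum.swap)
 also have "\<dots> = (\<Sum>i<n. (LINT w|M. pd i f (%i. step_integral W (xs i) w)) * (LINT s|time. step_fun (xs i) s * step_fun ys s))"
  using X[OF Cb_inftyD(5)[OF f]] by (intro sum.cong refl) (simp add: sum_distrib_left[symmetric] in_)
 finally show ?thesis .
qed

end

section \<open>Wiener integrals\<close>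

context brownian begin

lemma wienerE:
 assumes "wiener h X"
 obtains xs where "\<And>n. steps_in T (xs n)" "L2_converges time (%n. step_fun (xs n)) h"
  "L2_converges M (%n. step_integral W (xs n)) X"
 using assms unfolding has_wiener_integral_def steps_in_def by blast

lemma wienerI:
 assumes "\<And>n. steps_in T (xs n)" "L2_converges time (%n. step_fun (xs n)) h"
  "L2_converges M (%n. step_integral W (xs n)) X"
 shows "wiener h X"
 using assms unfolding has_wiener_integral_def steps_in_def by blast

lemma wienerD:
 assumes "wiener h X"
 shows "L2 time h" "L2 M X" "X \<in> borel_measurable M"
 using assms by (auto elim!: wienerE simp: L2_converges_def square_integrable_def)

lemma wiener_step: "steps_in T xs \<Longrightarrow> wiener (step_fun xs) (step_integral W xs)"
 by (rule wienerI[of "%_. xs"])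
  (auto intro: L2_converges_const L2_step_fun step_integral_L2)

lemma L2_converges_abs_diff:
 assumes "L2_converges N fs f"
 shows "L2_converges N (%n x. \<bar>fs n x - f x\<bar>) (%_. 0)"
 unfolding L2_converges_def
proof (intro conjI allI)
 show "L2 N (%x. \<bar>fs n x - f x\<bar>)" for n
  using L2_diff[OF L2_convergesD(1)[OF assms, of n] L2_convergesD(2)[OF assms]] by (auto simp: square_integrable_def)
 show "(%n. (LINT x|N. (\<bar>fs n x - f x\<bar> - 0)^2)) \<longlonglongrightarrow> 0" using L2_convergesD(3)[OF assms] by simp
qed (rule L2_zero)

lemma L2_Cb:
 assumes f: "f \<in> Cb_infty n" and X: "\<And>i. i < n \<Longrightarrow> X i \<in> borel_measurable M"
 shows "L2 M (%w. f (%i. X i w))"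
proof -
 obtain B where "\<And>x. \<bar>f x\<bar> \<le> B" by (rule Cb_infty_bound[OF f]) blast
 then show ?thesis by (intro L2_of_bounded[where C = B] Cb_infty_measurable[OF f X])
qed

lemma L2_converges_Cb:
 assumes f: "f \<in> Cb_infty n" and X: "\<And>i. i < n \<Longrightarrow> L2_converges M (Xs i) (X i)"
 shows "L2_converges M (%k w. f (%i. Xs i k w)) (%w. f (%i. X i w))"
proof -
 obtain K where K: "K \<ge> 0" "\<And>x y. \<bar>f y - f x\<bar> \<le> K * (\<Sum>i<n. \<bar>y i - x i\<bar>)"
  by (rule Cb_infty_Lipschitz[OF f]) blast
 have s1: "L2 M (%w. f (%i. Xs i k w))" for k
  by (rule L2_Cb[OF f]) (use L2_convergesD(1)[OF X] in \<open>auto simp: square_integrable_def\<close>)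
 have s2: "L2 M (%w. f (%i. X i w))"
  by (rule L2_Cb[OF f]) (use L2_convergesD(2)[OF X] in \<open>auto simp: square_integrable_def\<close>)
 have "L2_converges M (%k w. K * (\<Sum>i<n. \<bar>Xs i k w - X i w\<bar>)) (%_. K * (\<Sum>i<n. 0))"
  by (rule L2_converges_cmult, rule L2_converges_sum, rule L2_converges_abs_diff, rule X) simp
 then have Z: "L2_converges M (%k w. K * (\<Sum>i<n. \<bar>Xs i k w - X i w\<bar>)) (%_. 0)" by simp
 show ?thesis unfolding L2_converges_def
 proof (intro conjI allI s1 s2)
  show "(%k. (LINT w|M. (f (%i. Xs i k w) - f (%i. X i w))^2)) \<longlonglongrightarrow> 0"
  proof (rule tendsto_sandwich[OF _ _ tendsto_const])
   show "(%k. (LINT w|M. (K * (\<Sum>i<n. \<bar>Xs i k w - X i w\<bar>))^2)) \<longlonglongrightarrow> 0" using L2_convergesD(3)[OF Z] by simp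
   show "\<forall>\<^sub>F k in sequentially. (LINT w|M. (f (%i. Xs i k w) - f (%i. X i w))^2) \<le> (LINT w|M. (K * (\<Sum>i<n. \<bar>Xs i k w - X i w\<bar>))^2)"
   proof (intro always_eventually allI integral_mono)
    fix k w
    show "integrable M (%w. (f (%i. Xs i k w) - f (%i. X i w))^2)"
     by (rule L2D(2)[OF L2_diff[OF s1 s2]])
    show "integrable M (%w. (K * (\<Sum>i<n. \<bar>Xs i k w - X i w\<bar>))^2)"
     by (rule L2D(2)[OF L2_convergesD(1)[OF Z]])
    have "\<bar>f (%i. Xs i k w) - f (%i. X i w)\<bar> \<le> K * (\<Sum>i<n. \<bar>Xs i k w - X i w\<bar>)" by (rule K(2))
    then show "(f (%i. Xs i k w) - f (%i. X i w))^2 \<le> (K * (\<Sum>i<n. \<bar>Xs i k w - X i w\<bar>))^2"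
     using power_mono[OF _ abs_ge_zero, of _ _ 2] by fastforce
   qed
  qed simp
 qed
qed

lemma L2_converges_expectation:
 assumes "L2_converges M fs f"
 shows "(%n. (LINT w|M. fs n w)) \<longlonglongrightarrow> (LINT w|M. f w)"
 using L2_converges_inner[OF assms L2_converges_const[of M "%_. 1"]] by (simp add: square_integrable_def)

lemma wiener_integration_by_parts:
 assumes f: "f \<in> Cb_infty n" and X: "\<And>i. i < n \<Longrightarrow> wiener (h i) (X i)"
  and Y: "wiener g Y"
 shows "(LINT w|M. f (%i. X i w) * Y w)
  = (\<Sum>i<n. (LINT w|M. pd i f (%i. X i w)) * (LINT s|time. h i s * g s))"
proof -
 have "\<exists>xs. (\<forall>k. steps_in T (xs k)) \<and> L2_converges time (%k. step_fun (xs k)) (h i) \<and> L2_converges M (%k. step_integral W (xs k)) (X i)"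
  if "i < n" for i using wienerE[OF X[OF that]] by metis
 then obtain xs where xs: "\<And>i k. i < n \<Longrightarrow> steps_in T (xs i k)" "\<And>i. i < n \<Longrightarrow> L2_converges time (%k. step_fun (xs i k)) (h i)"
  "\<And>i. i < n \<Longrightarrow> L2_converges M (%k. step_integral W (xs i k)) (X i)" by metis
 obtain ys where ys: "\<And>k. steps_in T (ys k)" "L2_converges time (%k. step_fun (ys k)) g"
  "L2_converges M (%k. step_integral W (ys k)) Y" by (rule wienerE[OF Y]) blast
 have "(%k. (LINT w|M. f (%i. step_integral W (xs i k) w) * step_integral W (ys k) w)) \<longlonglongrightarrow> (LINT w|M. f (%i. X i w) * Y w)"
  by (rule L2_converges_inner[OF L2_converges_Cb[OF f, where Xs = "%i k. step_integral W (xs i k)"] ys(3)]) (rule xs(3))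
 moreover have "(%k. \<Sum>i<n. (LINT w|M. pd i f (%i. step_integral W (xs i k) w)) * (LINT s|time. step_fun (xs i k) s * step_fun (ys k) s))
  \<longlonglongrightarrow> (\<Sum>i<n. (LINT w|M. pd i f (%i. X i w)) * (LINT s|time. h i s * g s))"
 proof (rule tendsto_sum, rule tendsto_mult)
  fix i assume "i \<in> {..<n}"
  then have i: "i < n" by simp
  show "(%k. (LINT w|M. pd i f (%i. step_integral W (xs i k) w))) \<longlonglongrightarrow> (LINT w|M. pd i f (%i. X i w))"
   by (rule L2_converges_expectation[OF L2_converges_Cb[OF Cb_inftyD(5)[OF f i], where Xs = "%i k. step_integral W (xs i k)"]]) (rule xs(3))
  show "(%k. (LINT s|time. step_fun (xs i k) s * step_fun (ys k) s)) \<longlonglongrightarrow> (LINT s|time. h i s * g s)"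
   by (rule L2_converges_inner[OF xs(2)[OF i] ys(2)])
 qed
 moreover have "(LINT w|M. f (%i. step_integral W (xs i k) w) * step_integral W (ys k) w) =
  (\<Sum>i<n. (LINT w|M. pd i f (%i. step_integral W (xs i k) w)) * (LINT s|time. step_fun (xs i k) s * step_fun (ys k) s))" for k
  by (rule step_integration_by_parts[OF f xs(1) ys(1)])
 ultimately show ?thesis using LIMSEQ_unique by simp
qed

text \<open>Bounded smooth truncations \<open>n sin (X / n)\<close> of a Gaussian variable \<open>X\<close>.\<close>

definition sin_trunc :: "nat \<Rightarrow> real \<Rightarrow> real" where "sin_trunc n x = real (Suc n) * sin (inverse (real (Suc n)) * x)"

lemma sin_trunc_bound: "\<bar>sin_trunc n x\<bar> \<le> \<bar>x\<bar>"
proof -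
 have "\<bar>sin (inverse (real (Suc n)) * x)\<bar> \<le> \<bar>inverse (real (Suc n)) * x\<bar>" by (rule abs_sin_x_le_abs_x)
 then have "real (Suc n) * \<bar>sin (inverse (real (Suc n)) * x)\<bar> \<le> real (Suc n) * \<bar>inverse (real (Suc n)) * x\<bar>"
  by (intro mult_left_mono) auto
 also have "real (Suc n) * \<bar>inverse (real (Suc n)) * x\<bar> = \<bar>x\<bar>" by (simp add: abs_mult field_simps)
 finally show ?thesis by (simp add: sin_trunc_def abs_mult del: of_nat_Suc)
qed

lemma sin_trunc_tendsto: "(%n. sin_trunc n x) \<longlonglongrightarrow> x"
proof (cases "x = 0")
 case False
 have l: "(%n. inverse (real (Suc n)) * x) \<longlonglongrightarrow> 0 * x" by (intro tendsto_intros LIMSEQ_inverse_real_of_nat)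
 have "((%y::real. sin y / y) \<longlongrightarrow> 1) (at 0)"
  using DERIV_sin[of "0::real"] by (simp add: has_field_derivative_iff)
 moreover have "filterlim (%n. inverse (real (Suc n)) * x) (at 0) sequentially"
  using l False by (auto simp: filterlim_at)
 ultimately have "(%n. sin (inverse (real (Suc n)) * x) / (inverse (real (Suc n)) * x)) \<longlonglongrightarrow> 1"
  by (rule filterlim_compose)
 then have "(%n. x * (sin (inverse (real (Suc n)) * x) / (inverse (real (Suc n)) * x))) \<longlonglongrightarrow> x * 1" by (rule tendsto_mult_left)
 moreover have "x * (sin (inverse (real (Suc n)) * x) / (inverse (real (Suc n)) * x)) = sin_trunc n x" for n
  using False by (simp add: sin_trunc_def field_simps del: of_nat_Suc)
 ultimately show ?thesis by simp
qed (simp add: sin_trunc_def)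

lemma Cb_infty_sin_trunc: "(%x. sin_trunc n (x 0)) \<in> Cb_infty 1"
 unfolding sin_trunc_def by (rule Cb_infty_sin)

lemma partial_deriv_sin_trunc:
 "pd 0 (%x. sin_trunc n (x 0)) x = cos (inverse (real (Suc n)) * x 0)"
 by (rule partial_deriv_one_variable)
  (auto simp: sin_trunc_def intro!: derivative_eq_intros simp del: of_nat_Suc)

lemma L2_converges_sin_trunc:
 assumes "L2 M X"
 shows "L2_converges M (%n w. sin_trunc n (X w)) X"
proof (rule L2_converges_dominated[where g = "%w. \<bar>X w\<bar>"])
 note [measurable] = L2D(1)[OF assms]
 show "(%w. sin_trunc n (X w)) \<in> borel_measurable M" for n unfolding sin_trunc_def by measurable
 show "X \<in> borel_measurable M" by measurable
 show "L2 M (%w. \<bar>X w\<bar>)" using assms by (auto simp: square_integrable_def)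
qed (auto simp: sin_trunc_bound sin_trunc_tendsto)

lemma L2_converges_cos:
 assumes [measurable]: "X \<in> borel_measurable M"
 shows "L2_converges M (%n w. cos (inverse (real (Suc n)) * X w)) (%_. 1)"
proof (rule L2_converges_dominated[where g = "%_. 1"])
 show "AE w in M. (%n. cos (inverse (real (Suc n)) * X w)) \<longlonglongrightarrow> 1"
 proof (rule AE_I2)
  fix w
  have "(%n. cos (inverse (real (Suc n)) * X w)) \<longlonglongrightarrow> cos (0 * X w)" by (intro tendsto_intros LIMSEQ_inverse_real_of_nat)
  then show "(%n. cos (inverse (real (Suc n)) * X w)) \<longlonglongrightarrow> 1" by simp
 qed
qed (auto simp: square_integrable_def)

text \<open>Integration by parts with \<open>X\<close> itself in place of a bounded functional, through its truncations.\<close>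

lemma wiener_isometry:
 assumes X: "wiener h X" and Y: "wiener g Y"
 shows "(LINT w|M. X w * Y w) = (LINT s|time. h s * g s)"
proof -
 have "(LINT w|M. sin_trunc n (X w) * Y w) = (LINT w|M. cos (inverse (real (Suc n)) * X w)) * (LINT s|time. h s * g s)" for n
  using wiener_integration_by_parts[OF Cb_infty_sin_trunc[of n], where X = "%_. X" and h = "%_. h" and Y = Y and g = g] X Y
  by (simp add: partial_deriv_sin_trunc del: of_nat_Suc)
 moreover have "(%n. (LINT w|M. sin_trunc n (X w) * Y w)) \<longlonglongrightarrow> (LINT w|M. X w * Y w)"
  by (rule L2_converges_inner[OF L2_converges_sin_trunc[OF wienerD(2)[OF X]] L2_converges_const[OF wienerD(2)[OF Y]]])
 moreover have "(%n. (LINT w|M. cos (inverse (real (Suc n)) * X w)) * (LINT s|time. h s * g s)) \<longlonglongrightarrow> (LINT w|M. 1) * (LINT s|time. h s * g s)"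
  by (rule tendsto_mult_right[OF L2_converges_expectation[OF L2_converges_cos[OF wienerD(3)[OF X]]]])
 ultimately show ?thesis using LIMSEQ_unique by (simp add: prob_space)
qed

lemma wiener_add:
 assumes "wiener h X" "wiener g Y"
 shows "wiener (%s. h s + g s) (%w. X w + Y w)"
proof -
 obtain xs where xs: "\<And>n. steps_in T (xs n)" "L2_converges time (%n. step_fun (xs n)) h"
  "L2_converges M (%n. step_integral W (xs n)) X" by (rule wienerE[OF assms(1)]) blast
 obtain ys where ys: "\<And>n. steps_in T (ys n)" "L2_converges time (%n. step_fun (ys n)) g"
  "L2_converges M (%n. step_integral W (ys n)) Y" by (rule wienerE[OF assms(2)]) blast
 show ?thesis
 proof (rule wienerI[of "%n. xs n @ ys n"])
  show "steps_in T (xs n @ ys n)" for n using xs(1)[of n] ys(1)[of n] by (auto simp: steps_in_def)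
  show "L2_converges time (%n. step_fun (xs n @ ys n)) (%s. h s + g s)"
   using L2_converges_add[OF xs(2) ys(2)] by (simp add: step_fun_append[abs_def])
  show "L2_converges M (%n. step_integral W (xs n @ ys n)) (%w. X w + Y w)"
   using L2_converges_add[OF xs(3) ys(3)] by (simp add: step_integral_append[abs_def])
 qed
qed

lemma wiener_cmult:
 assumes "wiener h X"
 shows "wiener (%s. c * h s) (%w. c * X w)"
proof -
 obtain xs where xs: "\<And>n. steps_in T (xs n)" "L2_converges time (%n. step_fun (xs n)) h"
  "L2_converges M (%n. step_integral W (xs n)) X" by (rule wienerE[OF assms]) blast
 show ?thesis
 proof (rule wienerI[of "%n. map (%(k, ab). (c * k, ab)) (xs n)"])
  show "steps_in T (map (%(k, ab). (c * k, ab)) (xs n))" for n using xs(1)[of n] by (auto simp: steps_in_def)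
  show "L2_converges time (%n. step_fun (map (%(k, ab). (c * k, ab)) (xs n))) (%s. c * h s)"
   using L2_converges_cmult[OF xs(2)] by (simp add: step_fun_scale[abs_def])
  show "L2_converges M (%n. step_integral W (map (%(k, ab). (c * k, ab)) (xs n))) (%w. c * X w)"
   using L2_converges_cmult[OF xs(3)] by (simp add: step_integral_scale[abs_def])
 qed
qed

lemma wiener_diff:
 assumes "wiener h X" "wiener g Y"
 shows "wiener (%s. h s - g s) (%w. X w - Y w)"
 using wiener_add[OF assms(1) wiener_cmult[OF assms(2), of "-1"]] by simp

lemma wiener_cong_AE:
 assumes X: "wiener h X" and Y: "Y \<in> borel_measurable M" and eq: "AE w in M. X w = Y w"
 shows "wiener h Y"
proof -
 obtain xs where xs: "\<And>n. steps_in T (xs n)" "L2_converges time (%n. step_fun (xs n)) h"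
  "L2_converges M (%n. step_integral W (xs n)) X" by (rule wienerE[OF X]) blast
 note [measurable] = wienerD(3)[OF X] Y L2D(1)[OF L2_convergesD(1)[OF xs(3)]]
 have "integrable M (%w. (X w)^2) = integrable M (%w. (Y w)^2)"
  by (rule integrable_cong_AE) (use eq in auto)
 moreover have "(LINT w|M. (step_integral W (xs n) w - X w)^2) = (LINT w|M. (step_integral W (xs n) w - Y w)^2)" for n
  by (rule integral_cong_AE) (use eq in auto)
 ultimately have "L2_converges M (%n. step_integral W (xs n)) Y"
  using xs(3) Y by (simp add: L2_converges_def square_integrable_def)
 then show ?thesis using xs by (intro wienerI)
qed

lemma wiener_exists:
 assumes h: "L2 time h"
 shows "\<exists>X. wiener h X"
proof -
 have "\<exists>xs. steps_in T xs \<and> (LINT t|time. (step_fun xs t - h t)^2) < inverse (real (Suc n))" for n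
  using step_fun_dense[OF h] T unfolding step_approx_def by (metis less_imp_le inverse_positive_iff_positive of_nat_0_less_iff zero_less_Suc)
 then obtain xs where xs: "\<And>n. steps_in T (xs n)" "\<And>n. (LINT t|time. (step_fun (xs n) t - h t)^2) < inverse (real (Suc n))" by metis
 have lim: "L2_converges time (%n. step_fun (xs n)) h"
  unfolding L2_converges_def
 proof (intro conjI allI h L2_step_fun)
  show "(%n. (LINT t|time. (step_fun (xs n) t - h t)^2)) \<longlonglongrightarrow> 0"
   by (rule tendsto_sandwich[OF _ _ tendsto_const LIMSEQ_inverse_real_of_nat])
    (use xs(2) in \<open>auto intro!: always_eventually less_imp_le\<close>)
 qed
 have "\<exists>X. L2_converges M (%n. step_integral W (xs n)) X"
 proof (rule L2_complete)
  show "L2 M (step_integral W (xs n))" for n by (rule step_integral_L2[OF xs(1)])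
  fix e :: real assume "e > 0"
  then obtain N where N: "inverse (real (Suc N)) < e / 4" using reals_Archimedean[of "e / 4"] by auto
  show "\<exists>N. \<forall>i\<ge>N. \<forall>j\<ge>N. (LINT w|M. (step_integral W (xs i) w - step_integral W (xs j) w)^2) < e"
  proof (intro exI[of _ N] allI impI)
   fix i j assume ij: "N \<le> i" "N \<le> j"
   have small: "(LINT t|time. (step_fun (xs i) t - h t)^2) < e / 4" if "N \<le> i" for i
   proof -
    have "inverse (real (Suc i)) \<le> inverse (real (Suc N))" using that by (intro le_imp_inverse_le) auto
    then show ?thesis using xs(2)[of i] N by linarith
   qed
   have wt: "wiener (%s. step_fun (xs i) s - step_fun (xs j) s) (%w. step_integral W (xs i) w - step_integral W (xs j) w)"
    by (intro wiener_diff wiener_step xs(1))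
   have "(LINT w|M. (step_integral W (xs i) w - step_integral W (xs j) w)^2) = (LINT s|time. (step_fun (xs i) s - step_fun (xs j) s)^2)"
    using wiener_isometry[OF wt wt] by (simp add: power2_eq_square)
   also have "\<dots> \<le> 2 * (LINT s|time. (step_fun (xs i) s - h s)^2) + 2 * (LINT s|time. (h s - step_fun (xs j) s)^2)"
    by (intro L2_triangle L2_step_fun h)
   also have "(LINT s|time. (h s - step_fun (xs j) s)^2) = (LINT s|time. (step_fun (xs j) s - h s)^2)" by (simp add: power2_commute)
   finally show "(LINT w|M. (step_integral W (xs i) w - step_integral W (xs j) w)^2) < e"
    using small[OF ij(1)] small[OF ij(2)] by linarith
  qed
 qed
 then show ?thesis using wienerI[OF xs(1) lim] by blast
qed

lemma wiener_interval:
 assumes "0 \<le> a" "a \<le> b" "b \<le> T"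
 shows "wiener (indicator {a<..b}) (%w. W b w - W a w)"
proof -
 have "step_fun [(1, a, b)] = indicator {a<..b}" "step_integral W [(1, a, b)] = (%w. W b w - W a w)"
  by (auto simp: step_fun_def step_integral_def fun_eq_iff)
 then show ?thesis using wiener_step[of "[(1, a, b)]"] assms by (simp add: steps_in_def)
qed

section \<open>Smooth functionals\<close>

text \<open>The derivative in the direction \<open>h\<close>, that is \<open>\<langle>DF, h\<rangle>\<close>.\<close>

definition dir_deriv :: "(real \<Rightarrow> real) \<Rightarrow> (real \<Rightarrow> 'a \<Rightarrow> real) \<Rightarrow> 'a \<Rightarrow> real" where
 "dir_deriv h DF w = (LINT s|time. DF s w * h s)"

definition smooth_rep where
 "smooth_rep n f h X F DF \<longleftrightarrow> f \<in> Cb_infty n \<and> (\<forall>i<n. wiener (h i) (X i)) \<and>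
  (\<forall>w\<in>space M. F w = f (%i. X i w)) \<and>
  (\<forall>s\<in>{0..T}. \<forall>w\<in>space M. DF s w = (\<Sum>i<n. pd i f (%j. X j w) * h i s))"

lemma smooth_functional_rep:
 assumes "smooth F DF"
 obtains n f h X where "smooth_rep n f h X F DF"
 using assms unfolding smooth_functional_def smooth_rep_def[symmetric] by (elim exE)

lemma smooth_repD:
 assumes "smooth_rep n f h X F DF"
 shows "f \<in> Cb_infty n" "\<And>i. i < n \<Longrightarrow> wiener (h i) (X i)"
  "\<And>w. w \<in> space M \<Longrightarrow> F w = f (%i. X i w)"
  "\<And>s w. s \<in> {0..T} \<Longrightarrow> w \<in> space M \<Longrightarrow> DF s w = (\<Sum>i<n. pd i f (%j. X j w) * h i s)"
 using assms by (simp_all add: smooth_rep_def)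

lemma dir_deriv_rep:
 assumes h: "\<And>i. i < n \<Longrightarrow> L2 time (h i)" and g: "L2 time g"
  and D: "\<And>s. s \<in> {0..T} \<Longrightarrow> DF s w = (\<Sum>i<n. p i * h i s)"
 shows "dir_deriv g DF w = (\<Sum>i<n. p i * (LINT s|time. h i s * g s))"
proof -
 have "dir_deriv g DF w = (LINT s|time. (\<Sum>i<n. p i * (h i s * g s)))"
  unfolding dir_deriv_def
  by (rule lint_cong) (simp add: D sum_distrib_right mult.assoc)
 also have "\<dots> = (\<Sum>i<n. p i * (LINT s|time. h i s * g s))"
  using integrable_mult_L2[OF h g] by (subst Bochner_Integration.integral_sum) auto
 finally show ?thesis .
qed

lemma smooth_functional_bounded:
 assumes "smooth F DF"
 obtains C where "C \<ge> 0" "\<And>w. w \<in> space M \<Longrightarrow> \<bar>F w\<bar> \<le> C"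
proof -
 obtain n f h X where "smooth_rep n f h X F DF" by (rule smooth_functional_rep[OF assms])
 note r = smooth_repD[OF this]
 obtain B where "B \<ge> 0" "\<And>x. \<bar>f x\<bar> \<le> B" by (rule Cb_infty_bound[OF r(1)]) blast
 then show thesis using r(3) by (intro that[of B]) auto
qed

lemma smooth_functional_measurable:
 assumes "smooth F DF"
 shows "F \<in> borel_measurable M"
proof -
 obtain n f h X where "smooth_rep n f h X F DF" by (rule smooth_functional_rep[OF assms])
 note r = smooth_repD[OF this]
 have "(%w. f (%i. X i w)) \<in> borel_measurable M"
  by (rule Cb_infty_measurable[OF r(1)]) (rule wienerD(3)[OF r(2)])
 then show ?thesis using measurable_cong[of M F "%w. f (%i. X i w)" borel] r(3) by blast
qed

lemma smooth_functional_L2: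
 assumes "smooth F DF"
 shows "L2 M F"
proof -
 obtain C where "\<And>w. w \<in> space M \<Longrightarrow> \<bar>F w\<bar> \<le> C" by (rule smooth_functional_bounded[OF assms]) blast
 then show ?thesis by (intro L2_of_bounded smooth_functional_measurable[OF assms])
qed

lemma smooth_functional_derivative:
 assumes "smooth F DF"
 shows "(case_prod DF) \<in> borel_measurable TM"
  and "\<exists>K. L2 time K \<and> (\<forall>s\<in>{0..T}. \<forall>w\<in>space M. \<bar>DF s w\<bar> \<le> K s)"
  and "\<And>w. w \<in> space M \<Longrightarrow> L2 time (%s. DF s w)"
proof -
 obtain n f h X where "smooth_rep n f h X F DF" by (rule smooth_functional_rep[OF assms])
 note r = smooth_repD[OF this]
 note h = wienerD(1)[OF r(2)]
 have m: "(%w. pd i f (%j. X j w)) \<in> borel_measurable M" if "i < n" for i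
  by (rule Cb_infty_measurable[OF Cb_inftyD(5)[OF r(1) that]]) (rule wienerD(3)[OF r(2)])
 have "(%p. \<Sum>i<n. pd i f (%j. X j (snd p)) * h i (fst p)) \<in> borel_measurable TM"
 proof (rule borel_measurable_sum)
  fix i assume "i \<in> {..<n}"
  then have i: "i < n" by simp
  show "(%p. pd i f (%j. X j (snd p)) * h i (fst p)) \<in> borel_measurable TM"
   by (rule borel_measurable_times[OF measurable_compose[OF measurable_snd m[OF i]] measurable_compose[OF measurable_fst L2D(1)[OF h[OF i]]]])
 qed
 moreover have "case_prod DF p = (\<Sum>i<n. pd i f (%j. X j (snd p)) * h i (fst p))" if "p \<in> space TM" for p
  using that r(4)[of "fst p" "snd p"] by (auto simp: space_pair_measure)
 ultimately show "(case_prod DF) \<in> borel_measurable TM"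
  using measurable_cong[of "TM" "%(s, w). DF s w" "%p. \<Sum>i<n. pd i f (%j. X j (snd p)) * h i (fst p)" borel] by blast
 obtain B where B: "\<And>i x. i < n \<Longrightarrow> \<bar>pd i f x\<bar> \<le> B" by (rule Cb_infty_partials_bound[OF r(1)]) blast
 show "\<exists>K. L2 time K \<and> (\<forall>s\<in>{0..T}. \<forall>w\<in>space M. \<bar>DF s w\<bar> \<le> K s)"
 proof (intro exI[of _ "%s. \<Sum>i<n. B * \<bar>h i s\<bar>"] conjI ballI)
  show "L2 time (%s. \<Sum>i<n. B * \<bar>h i s\<bar>)"
  proof (rule L2_sum, rule L2_cmult)
   fix i assume "i \<in> {..<n}"
   then have "L2 time (h i)" using h by simp
   then show "L2 time (%s. \<bar>h i s\<bar>)" by (auto simp: square_integrable_def)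
  qed
  fix s w assume "s \<in> {0..T}" "w \<in> space M"
  then show "\<bar>DF s w\<bar> \<le> (\<Sum>i<n. B * \<bar>h i s\<bar>)"
   unfolding r(4)[OF \<open>s \<in> {0..T}\<close> \<open>w \<in> space M\<close>]
   by (intro order_trans[OF sum_abs] sum_mono) (auto simp: abs_mult intro!: mult_right_mono B)
 qed
 fix w assume w: "w \<in> space M"
 have "L2 time (%s. \<Sum>i<n. pd i f (%j. X j w) * h i s)"
  by (rule L2_sum, rule L2_cmult) (use h in auto)
 then show "L2 time (%s. DF s w)"
  using L2_cong[of time "%s. DF s w" "%s. \<Sum>i<n. pd i f (%j. X j w) * h i s"] r(4) w by simp
qed

text \<open>The Wiener integrals of the two factors are listed one after the other.\<close>

lemma smooth_functional_product:
 assumes F: "smooth F DF" and G: "smooth G DG"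
 shows "smooth (%w. F w * G w) (%s w. G w * DF s w + F w * DG s w)"
proof -
 obtain n f h X where "smooth_rep n f h X F DF" by (rule smooth_functional_rep[OF F])
 note r = smooth_repD[OF this]
 obtain m g k Y where "smooth_rep m g k Y G DG" by (rule smooth_functional_rep[OF G])
 note q = smooth_repD[OF this]
 define Z where "Z i = (if i < n then X i else Y (i - n))" for i
 define l where "l i = (if i < n then h i else k (i - n))" for i
 define fg where "fg x = f x * g (%j. x (n + j))" for x
 have fX: "\<phi> (%i. Z i w) = \<phi> (%i. X i w)" if "\<phi> \<in> Cb_infty n" for \<phi> w
  by (rule Cb_inftyD(1)[OF that]) (simp add: Z_def)
 have gY: "(%j. Z (n + j) w) = (%j. Y j w)" for w by (simp add: Z_def)
 show ?thesis
  unfolding smooth_functional_def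
 proof (intro exI conjI allI impI ballI)
  show "fg \<in> Cb_infty (n + m)" unfolding fg_def[abs_def] by (rule Cb_infty_tensor[OF r(1) q(1)])
  show "wiener (l i) (Z i)" if "i < n + m" for i
   using that r(2)[of i] q(2)[of "i - n"] by (auto simp: l_def Z_def)
  fix w assume w: "w \<in> space M"
  show "F w * G w = fg (%i. Z i w)" using r(3)[OF w] q(3)[OF w] by (simp add: fg_def fX[OF r(1)] gY)
 next
  fix s w assume s: "s \<in> {0..T}" and w: "w \<in> space M"
  have "(\<Sum>i<n + m. pd i fg (%j. Z j w) * l i s)
   = (\<Sum>i<n. pd i fg (%j. Z j w) * l i s) + (\<Sum>i<m. pd (n + i) fg (%j. Z j w) * l (n + i) s)"
   by (simp add: sum.lessThan_Suc lessThan_atLeast0 sum.atLeastLessThan_concat[symmetric, of 0 n "n + m"] sum.shift_bounds_nat_ivl[of _ 0 n m, simplified add.commute[of _ n], simplified])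
  also have "(\<Sum>i<n. pd i fg (%j. Z j w) * l i s) = G w * DF s w"
   unfolding r(4)[OF s w] sum_distrib_left
  proof (rule sum.cong[OF refl])
   fix i assume "i \<in> {..<n}"
   then have i: "i < n" by simp
   have "pd i fg (%j. Z j w) = pd i f (%j. X j w) * G w"
    unfolding fg_def[abs_def] using partial_deriv_tensor[OF r(1) q(1), of i "%j. Z j w"] i
    by (simp add: gY fX[OF Cb_inftyD(5)[OF r(1) i]] q(3)[OF w])
   then show "pd i fg (%j. Z j w) * l i s = G w * (pd i f (%j. X j w) * h i s)"
    using i by (simp add: l_def)
  qed
  also have "(\<Sum>i<m. pd (n + i) fg (%j. Z j w) * l (n + i) s) = F w * DG s w"
   unfolding q(4)[OF s w] sum_distrib_left
  proof (rule sum.cong[OF refl])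
   fix i assume "i \<in> {..<m}"
   then have i: "i < m" by simp
   have "pd (n + i) fg (%j. Z j w) = F w * pd i g (%j. Y j w)"
    unfolding fg_def[abs_def] using partial_deriv_tensor[OF r(1) q(1), of "n + i" "%j. Z j w"] i
    by (simp add: gY fX[OF r(1)] r(3)[OF w])
   then show "pd (n + i) fg (%j. Z j w) * l (n + i) s = F w * (pd i g (%j. Y j w) * k i s)"
    by (simp add: l_def)
  qed
  finally show "G w * DF s w + F w * DG s w = (\<Sum>i<n + m. pd i fg (%j. Z j w) * l i s)" by simp
 qed
qed

text \<open>The derivative of a smooth functional in a direction is smooth again, and derivatives in two
 directions commute. The isometry of the Skorohod integral rests on this symmetry.\<close>

lemma smooth_functional_second_derivative:
 assumes "smooth F DF"
 obtains D2 where "\<And>h. L2 time h \<Longrightarrow> smooth (dir_deriv h DF) (D2 h)"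
  "\<And>g h w. L2 time g \<Longrightarrow> L2 time h \<Longrightarrow> w \<in> space M \<Longrightarrow>
   dir_deriv g (D2 h) w = dir_deriv h (D2 g) w"
proof -
 obtain n f e X where "smooth_rep n f e X F DF" by (rule smooth_functional_rep[OF assms])
 note r = smooth_repD[OF this]
 note e = wienerD(1)[OF r(2)]
 define c where "c h i = (LINT s|time. e i s * h s)" for h i
 define f' where "f' h x = (\<Sum>i<n. c h i * pd i f x)" for h x
 have f': "f' h \<in> Cb_infty n" for h
  unfolding f'_def[abs_def] by (rule Cb_infty_sum) (use Cb_inftyD(5)[OF r(1)] in auto)
 have f'': "pd j (f' h) x = (\<Sum>i<n. c h i * pd j (pd i f) x)" if "j < n" for j h x
  unfolding f'_def[abs_def] using Cb_inftyD(5)[OF r(1)] that by (intro partial_deriv_sum) auto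
 define D2 where "D2 h s w = (\<Sum>j<n. pd j (f' h) (%j. X j w) * e j s)" for h s w
 show thesis
 proof (rule that[of D2])
  fix h assume h: "L2 time h"
  show "smooth (dir_deriv h DF) (D2 h)"
   unfolding smooth_functional_def
  proof (intro exI[of _ n] exI[of _ "f' h"] exI[of _ e] exI[of _ X] conjI allI impI ballI)
   show "dir_deriv h DF w = f' h (%j. X j w)" if "w \<in> space M" for w
    using dir_deriv_rep[where n = n and h = e and g = h and DF = DF and w = w and p = "%i. pd i f (%j. X j w)", OF e h r(4)[OF _ that]] by (simp add: f'_def c_def mult.commute)
  qed (use f' r(2) in \<open>auto simp: D2_def\<close>)
  fix g w assume g: "L2 time g" and w: "w \<in> space M"
  have D: "dir_deriv k (D2 l) w = (\<Sum>j<n. \<Sum>i<n. c l i * c k j * pd j (pd i f) (%j. X j w))"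
   if k: "L2 time k" for k l
  proof -
   have "dir_deriv k (D2 l) w = (\<Sum>j<n. pd j (f' l) (%j. X j w) * c k j)"
    unfolding c_def by (rule dir_deriv_rep[OF e k]) (simp_all add: D2_def)
   also have "\<dots> = (\<Sum>j<n. \<Sum>i<n. c l i * c k j * pd j (pd i f) (%j. X j w))"
    by (intro sum.cong refl) (simp add: f'' sum_distrib_left mult_ac)
   finally show ?thesis .
  qed
  have "(\<Sum>j<n. \<Sum>i<n. c h i * c g j * pd j (pd i f) (%j. X j w))
   = (\<Sum>i<n. \<Sum>j<n. c h i * c g j * pd j (pd i f) (%j. X j w))" by (rule sum.swap)
  also have "\<dots> = (\<Sum>i<n. \<Sum>j<n. c g j * c h i * pd i (pd j f) (%j. X j w))"
   using Cb_infty_Schwarz[OF r(1)] by (intro sum.cong refl) (simp add: mult_ac)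
  finally show "dir_deriv g (D2 h) w = dir_deriv h (D2 g) w" unfolding D[OF g] D[OF h] .
 qed
qed

lemma smooth_integration_by_parts:
 assumes F: "smooth F DF" and Y: "wiener h Y"
 shows "(LINT w|M. F w * Y w) = (LINT w|M. dir_deriv h DF w)"
proof -
 obtain n f e X where "smooth_rep n f e X F DF" by (rule smooth_functional_rep[OF F])
 note r = smooth_repD[OF this]
 note e = wienerD(1)[OF r(2)]
 have i: "integrable M (%w. pd i f (%j. X j w))" if "i < n" for i
  by (rule L2_integrable[OF L2_Cb[OF Cb_inftyD(5)[OF r(1) that]]]) (rule wienerD(3)[OF r(2)])
 have "(LINT w|M. F w * Y w) = (LINT w|M. f (%i. X i w) * Y w)"
  by (rule Bochner_Integration.integral_cong) (auto simp: r(3))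
 also have "\<dots> = (\<Sum>i<n. (LINT w|M. pd i f (%i. X i w)) * (LINT s|time. e i s * h s))"
  by (rule wiener_integration_by_parts[OF r(1,2) Y])
 also have "\<dots> = (LINT w|M. (\<Sum>i<n. pd i f (%i. X i w) * (LINT s|time. e i s * h s)))"
  using i by (subst Bochner_Integration.integral_sum) auto
 also have "\<dots> = (LINT w|M. dir_deriv h DF w)"
 proof (rule lint_cong)
  fix w assume "w \<in> space M"
  from dir_deriv_rep[where n = n and h = e and g = h and DF = DF and w = w and p = "%i. pd i f (%j. X j w)",
    OF e wienerD(1)[OF Y] r(4)[OF _ this]]
  show "(\<Sum>i<n. pd i f (%i. X i w) * (LINT s|time. e i s * h s)) = dir_deriv h DF w" by simp
 qed
 finally show ?thesis .
qed

lemma smooth_functional_one_variable: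
 assumes g: "(%x. g (x 0)) \<in> Cb_infty 1" and d: "\<And>y. (g has_real_derivative g' y) (at y)"
  and X: "wiener h X"
 shows "smooth (%w. g (X w)) (%s w. g' (X w) * h s)"
 unfolding smooth_functional_def
proof (intro exI conjI allI impI ballI)
 show "(%x. g (x 0)) \<in> Cb_infty 1" by fact
 show "wiener h X" by fact
 show "g' (X w) * h s = (\<Sum>i<1. pd i (%x. g (x 0)) (%j. X w) * h s)" for s w
  using partial_deriv_one_variable[OF d] by simp
qed simp

lemma dir_deriv_product:
 assumes F: "smooth F DF" and G: "smooth G DG"
  and h: "L2 time h" and w: "w \<in> space M"
 shows "dir_deriv h (%s w. G w * DF s w + F w * DG s w) w = G w * dir_deriv h DF w + F w * dir_deriv h DG w"
 using integrable_mult_L2[OF smooth_functional_derivative(3)[OF F w] h]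
  integrable_mult_L2[OF smooth_functional_derivative(3)[OF G w] h]
 by (simp add: dir_deriv_def distrib_right mult.assoc)

end

lemma tensor_integral:
 fixes a :: "'b \<Rightarrow> real" and b :: "'c \<Rightarrow> real"
 assumes "sigma_finite_measure N1" "sigma_finite_measure N2" and a: "integrable N1 a" and b: "integrable N2 b"
 shows "integrable (N1 \<Otimes>\<^sub>M N2) (%p. a (fst p) * b (snd p))"
  and "(LINT p|(N1 \<Otimes>\<^sub>M N2). a (fst p) * b (snd p)) = (LINT x|N1. a x) * (LINT y|N2. b y)"
proof -
 interpret N1: sigma_finite_measure N1 by fact
 interpret N2: sigma_finite_measure N2 by fact
 interpret pair_sigma_finite N1 N2 ..
 note [measurable] = borel_measurable_integrable[OF a] borel_measurable_integrable[OF b]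
 have i: "integrable (N1 \<Otimes>\<^sub>M N2) (%(x, y). a x * b y)"
 proof (rule Fubini_integrable)
  show "integrable N1 (%x. (LINT y|N2. norm (case (x, y) of (x, y) \<Rightarrow> a x * b y)))"
   using a by (simp add: abs_mult)
  show "AE x in N1. integrable N2 (%y. case (x, y) of (x, y) \<Rightarrow> a x * b y)" using b by simp
 qed measurable
 then show "integrable (N1 \<Otimes>\<^sub>M N2) (%p. a (fst p) * b (snd p))" by (simp add: split_beta')
 show "(LINT p|(N1 \<Otimes>\<^sub>M N2). a (fst p) * b (snd p)) = (LINT x|N1. a x) * (LINT y|N2. b y)"
  using integral_fst[OF i] by (simp add: split_beta')
qed

lemma tensor_L2:
 assumes s: "sigma_finite_measure N1" "sigma_finite_measure N2" and a: "L2 N1 a" and b: "L2 N2 b"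
 shows "L2 (N1 \<Otimes>\<^sub>M N2) (%p. a (fst p) * b (snd p))"
 using tensor_integral(1)[OF s L2D(2)[OF a] L2D(2)[OF b]]
  borel_measurable_times[OF measurable_compose[OF measurable_fst L2D(1)[OF a]] measurable_compose[OF measurable_snd L2D(1)[OF b]]]
 by (simp add: square_integrable_def power_mult_distrib)

text \<open>The function \<open>a(s, t) = \<Sum>\<^sub>i p\<^sub>i(s) q\<^sub>i(t)\<close> and its transpose satisfy
 \<open>\<langle>a, a\<^sup>*\<rangle> \<le> \<parallel>a\<parallel>^2\<close>, since \<open>\<parallel>a - a\<^sup>*\<parallel>^2 \<ge> 0\<close>.\<close>

lemma Gram_transpose_le:
 fixes m :: nat
 assumes "sigma_finite_measure N" and p: "\<And>i. i < m \<Longrightarrow> L2 N (p i)" and q: "\<And>i. i < m \<Longrightarrow> L2 N (q i)"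
 shows "(\<Sum>i<m. \<Sum>j<m. (LINT x|N. p i x * q j x) * (LINT x|N. p j x * q i x))
  \<le> (\<Sum>i<m. \<Sum>j<m. (LINT x|N. p i x * p j x) * (LINT x|N. q i x * q j x))"
proof -
 note sf = assms(1) assms(1)
 let ?NN = "N \<Otimes>\<^sub>M N"
 define a where "a z = (\<Sum>i<m. p i (fst z) * q i (snd z))" for z
 define b where "b z = (\<Sum>i<m. q i (fst z) * p i (snd z))" for z
 have S: "L2 ?NN a" "L2 ?NN b"
  unfolding a_def[abs_def] b_def[abs_def]
  by (rule L2_sum, rule tensor_L2[OF sf], use p q in auto)+
 have E: "(LINT z|?NN. (\<Sum>i<m. f i (fst z) * g i (snd z)) * (\<Sum>j<m. f' j (fst z) * g' j (snd z)))
   = (\<Sum>i<m. \<Sum>j<m. (LINT x|N. f i x * f' j x) * (LINT x|N. g i x * g' j x))"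
  if sq: "\<And>i. i < m \<Longrightarrow> L2 N (f i)" "\<And>i. i < m \<Longrightarrow> L2 N (g i)"
   "\<And>i. i < m \<Longrightarrow> L2 N (f' i)" "\<And>i. i < m \<Longrightarrow> L2 N (g' i)" for f g f' g'
 proof -
  note ii = integrable_mult_L2
  have "(LINT z|?NN. (\<Sum>i<m. f i (fst z) * g i (snd z)) * (\<Sum>j<m. f' j (fst z) * g' j (snd z)))
   = (LINT z|?NN. (\<Sum>i<m. \<Sum>j<m. (f i (fst z) * f' j (fst z)) * (g i (snd z) * g' j (snd z))))"
   unfolding sum_product by (intro lint_cong sum.cong refl) (simp only: mult_ac)
  also have "\<dots> = (\<Sum>i<m. (LINT z|?NN. (\<Sum>j<m. (f i (fst z) * f' j (fst z)) * (g i (snd z) * g' j (snd z)))))"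
   by (rule Bochner_Integration.integral_sum, rule Bochner_Integration.integrable_sum, rule tensor_integral(1)[OF sf ii[OF sq(1,3)] ii[OF sq(2,4)]]) auto
  also have "\<dots> = (\<Sum>i<m. \<Sum>j<m. (LINT z|?NN. (f i (fst z) * f' j (fst z)) * (g i (snd z) * g' j (snd z))))"
   by (rule sum.cong[OF refl], rule Bochner_Integration.integral_sum, rule tensor_integral(1)[OF sf ii[OF sq(1,3)] ii[OF sq(2,4)]]) auto
  also have "\<dots> = (\<Sum>i<m. \<Sum>j<m. (LINT x|N. f i x * f' j x) * (LINT x|N. g i x * g' j x))"
   by (intro sum.cong refl, rule tensor_integral(2)[OF sf ii[OF sq(1,3)] ii[OF sq(2,4)]]) auto
  finally show ?thesis .
 qed
 have "0 \<le> (LINT z|?NN. (a z - b z)^2)" by simp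
 also have "\<dots> = (LINT z|?NN. a z * a z - 2 * (a z * b z) + b z * b z)"
  by (rule lint_cong) (simp add: power2_eq_square algebra_simps)
 also have "\<dots> = (LINT z|?NN. a z * a z) - 2 * (LINT z|?NN. a z * b z) + (LINT z|?NN. b z * b z)"
  using integrable_mult_L2[OF S(1,1)] integrable_mult_L2[OF S] integrable_mult_L2[OF S(2,2)] by simp
 also have "(LINT z|?NN. a z * a z) = (\<Sum>i<m. \<Sum>j<m. (LINT x|N. p i x * p j x) * (LINT x|N. q i x * q j x))"
  unfolding a_def by (rule E[OF p q p q])
 also have "(LINT z|?NN. b z * b z) = (\<Sum>i<m. \<Sum>j<m. (LINT x|N. q i x * q j x) * (LINT x|N. p i x * p j x))"
  unfolding b_def by (rule E[OF q p q p])
 also have "(LINT z|?NN. a z * b z) = (\<Sum>i<m. \<Sum>j<m. (LINT x|N. p i x * q j x) * (LINT x|N. q i x * p j x))"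
  unfolding a_def b_def by (rule E[OF p q q p])
 finally show ?thesis by (simp add: mult.commute)
qed

context brownian begin

lemma smooth_mult_L2:
 assumes F: "smooth F DF" and Y: "L2 M Y"
 shows "L2 M (%w. F w * Y w)"
proof -
 obtain C where C: "\<And>w. w \<in> space M \<Longrightarrow> \<bar>F w\<bar> \<le> C" by (rule smooth_functional_bounded[OF F]) blast
 show ?thesis
  by (rule L2_bound[OF Y, where C = C])
   (use C smooth_functional_measurable[OF F] L2D(1)[OF Y] in \<open>auto simp: abs_mult mult_right_mono\<close>)
qed

text \<open>The product \<open>F X\<close> is not a bounded functional; again \<open>X\<close> is truncated.\<close>

lemma smooth_two_wiener:
 assumes F: "smooth F DF" and X: "wiener g X" and Y: "wiener h Y"
 shows "(LINT w|M. (F w * X w) * Y w) = (LINT w|M. dir_deriv h DF w * X w) + (LINT w|M. F w) * (LINT s|time. g s * h s)"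
proof -
 note h = wienerD(1)[OF Y] and g = wienerD(1)[OF X]
 obtain D2 where D2: "\<And>h. L2 time h \<Longrightarrow> smooth (dir_deriv h DF) (D2 h)"
  by (rule smooth_functional_second_derivative[OF F]) blast
 have aS: "L2 M (dir_deriv h DF)" by (rule smooth_functional_L2[OF D2[OF h]])
 have FS: "L2 M F" by (rule smooth_functional_L2[OF F])
 note Xn = L2_converges_sin_trunc[OF wienerD(2)[OF X]]
 note Cn = L2_converges_cos[OF wienerD(3)[OF X]]
 let ?C = "%n w. cos (inverse (real (Suc n)) * X w)"
 have G: "smooth (%w. sin_trunc n (X w)) (%s w. ?C n w * g s)" for n
  by (rule smooth_functional_one_variable[OF Cb_infty_sin_trunc _ X])
   (auto simp: sin_trunc_def intro!: derivative_eq_intros simp del: of_nat_Suc)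
 have "(LINT w|M. sin_trunc n (X w) * (F w * Y w)) = (LINT w|M. sin_trunc n (X w) * dir_deriv h DF w) + (LINT w|M. ?C n w * F w) * (LINT s|time. g s * h s)" for n
 proof -
  have "(LINT w|M. sin_trunc n (X w) * (F w * Y w)) = (LINT w|M. (F w * sin_trunc n (X w)) * Y w)"
   by (simp only: mult_ac)
  also have "\<dots> = (LINT w|M. dir_deriv h (%s w. sin_trunc n (X w) * DF s w + F w * (?C n w * g s)) w)"
   by (rule smooth_integration_by_parts[OF smooth_functional_product[OF F G] Y])
  also have "\<dots> = (LINT w|M. sin_trunc n (X w) * dir_deriv h DF w + (?C n w * F w) * (LINT s|time. g s * h s))"
  proof (rule lint_cong)
   fix w assume w: "w \<in> space M"
   have "dir_deriv h (%s w. ?C n w * g s) w = ?C n w * (LINT s|time. g s * h s)"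
    by (simp add: dir_deriv_def mult.assoc)
   then show "dir_deriv h (%s w. sin_trunc n (X w) * DF s w + F w * (?C n w * g s)) w
     = sin_trunc n (X w) * dir_deriv h DF w + (?C n w * F w) * (LINT s|time. g s * h s)"
    using dir_deriv_product[OF F G h w] by simp
  qed
  also have "\<dots> = (LINT w|M. sin_trunc n (X w) * dir_deriv h DF w) + (LINT w|M. ?C n w * F w) * (LINT s|time. g s * h s)"
   using integrable_mult_L2[OF L2_convergesD(1)[OF Xn] aS] integrable_mult_L2[OF L2_convergesD(1)[OF Cn] FS]
   by (subst Bochner_Integration.integral_add) auto
  finally show ?thesis .
 qed
 moreover have "(%n. (LINT w|M. sin_trunc n (X w) * (F w * Y w))) \<longlonglongrightarrow> (LINT w|M. X w * (F w * Y w))"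
  by (rule L2_converges_inner[OF Xn L2_converges_const[OF smooth_mult_L2[OF F wienerD(2)[OF Y]]]])
 moreover have "(%n. (LINT w|M. sin_trunc n (X w) * dir_deriv h DF w) + (LINT w|M. ?C n w * F w) * (LINT s|time. g s * h s))
   \<longlonglongrightarrow> (LINT w|M. X w * dir_deriv h DF w) + (LINT w|M. 1 * F w) * (LINT s|time. g s * h s)"
  by (rule tendsto_add[OF L2_converges_inner[OF Xn L2_converges_const[OF aS]] tendsto_mult_right[OF L2_converges_inner[OF Cn L2_converges_const[OF FS]]]])
 ultimately have "(LINT w|M. X w * (F w * Y w)) = (LINT w|M. X w * dir_deriv h DF w) + (LINT w|M. 1 * F w) * (LINT s|time. g s * h s)"
  using LIMSEQ_unique by simp
 then show ?thesis by (simp add: mult_ac)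
qed

section \<open>The Skorohod integral of smooth processes\<close>

text \<open>\<open>\<delta>(F h) = F W(h) - \<langle>DF, h\<rangle>\<close>, where \<open>Y\<close> stands for \<open>W(h)\<close>.\<close>

definition elem_skorohod :: "('a \<Rightarrow> real) \<Rightarrow> (real \<Rightarrow> 'a \<Rightarrow> real) \<Rightarrow> (real \<Rightarrow> real) \<Rightarrow> ('a \<Rightarrow> real) \<Rightarrow> 'a \<Rightarrow> real" where
 "elem_skorohod F DF h Y w = F w * Y w - dir_deriv h DF w"

lemma elem_skorohod_L2:
 assumes F: "smooth F DF" and Y: "wiener h Y"
 shows "L2 M (elem_skorohod F DF h Y)"
proof -
 obtain D2 where D2: "\<And>h. L2 time h \<Longrightarrow> smooth (dir_deriv h DF) (D2 h)"
  by (rule smooth_functional_second_derivative[OF F]) blast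
 show ?thesis
  unfolding elem_skorohod_def[abs_def]
  by (rule L2_diff[OF smooth_mult_L2[OF F wienerD(2)[OF Y]]
    smooth_functional_L2[OF D2[OF wienerD(1)[OF Y]]]])
qed

text \<open>Integration by parts for the product \<open>G F\<close>, whose derivative is \<open>G DF + F DG\<close>.\<close>

lemma elem_skorohod_duality:
 assumes F: "smooth F DF" and Y: "wiener h Y" and G: "smooth G DG"
 shows "(LINT w|M. G w * elem_skorohod F DF h Y w) = (LINT w|M. F w * dir_deriv h DG w)"
proof -
 note h = wienerD(1)[OF Y]
 obtain D2 where D2: "\<And>h. L2 time h \<Longrightarrow> smooth (dir_deriv h DF) (D2 h)"
  by (rule smooth_functional_second_derivative[OF F]) blast
 obtain D2G where D2G: "\<And>h. L2 time h \<Longrightarrow> smooth (dir_deriv h DG) (D2G h)"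
  by (rule smooth_functional_second_derivative[OF G]) blast
 note GF = smooth_functional_product[OF G F]
 have i1: "integrable M (%w. (G w * F w) * Y w)"
  by (rule L2_integrable[OF smooth_mult_L2[OF GF wienerD(2)[OF Y]]])
 have i2: "integrable M (%w. G w * dir_deriv h DF w)"
  by (rule L2_integrable[OF smooth_mult_L2[OF G smooth_functional_L2[OF D2[OF h]]]])
 have i3: "integrable M (%w. F w * dir_deriv h DG w)"
  by (rule L2_integrable[OF smooth_mult_L2[OF F smooth_functional_L2[OF D2G[OF h]]]])
 have "(LINT w|M. G w * elem_skorohod F DF h Y w) = (LINT w|M. (G w * F w) * Y w - G w * dir_deriv h DF w)"
  by (simp add: elem_skorohod_def right_diff_distrib mult.assoc)
 also have "\<dots> = (LINT w|M. (G w * F w) * Y w) - (LINT w|M. G w * dir_deriv h DF w)"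
  by (rule Bochner_Integration.integral_diff[OF i1 i2])
 also have "(LINT w|M. (G w * F w) * Y w) = (LINT w|M. dir_deriv h (%s w. F w * DG s w + G w * DF s w) w)"
  by (rule smooth_integration_by_parts[OF GF Y])
 also have "\<dots> = (LINT w|M. F w * dir_deriv h DG w + G w * dir_deriv h DF w)"
  by (rule lint_cong) (rule dir_deriv_product[OF G F h])
 also have "\<dots> = (LINT w|M. F w * dir_deriv h DG w) + (LINT w|M. G w * dir_deriv h DF w)"
  by (rule Bochner_Integration.integral_add[OF i3 i2])
 finally show ?thesis by simp
qed

text \<open>The polarised isometry formula, for elementary processes \<open>F h\<close> and \<open>G g\<close>.\<close>

lemma elem_skorohod_inner:
 assumes F: "smooth F DF" and Y: "wiener h Y"
  and G: "smooth G DG" and Z: "wiener g Z"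
 shows "(LINT w|M. elem_skorohod F DF h Y w * elem_skorohod G DG g Z w)
  = (LINT w|M. F w * G w) * (LINT s|time. h s * g s) + (LINT w|M. dir_deriv g DF w * dir_deriv h DG w)"
proof -
 note h = wienerD(1)[OF Y] and g = wienerD(1)[OF Z]
 note Ys = wienerD(2)[OF Y] and Zs = wienerD(2)[OF Z]
 obtain D2F where D2F: "\<And>h. L2 time h \<Longrightarrow> smooth (dir_deriv h DF) (D2F h)"
  by (rule smooth_functional_second_derivative[OF F]) blast
 obtain D2G where D2G: "\<And>h. L2 time h \<Longrightarrow> smooth (dir_deriv h DG) (D2G h)"
  and sym: "\<And>g h w. L2 time g \<Longrightarrow> L2 time h \<Longrightarrow> w \<in> space M \<Longrightarrow> dir_deriv g (D2G h) w = dir_deriv h (D2G g) w"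
  by (rule smooth_functional_second_derivative[OF G]) blast
 note a = D2F[OF h] and a' = D2F[OF g] and b = D2G[OF g] and b' = D2G[OF h]
 obtain D3 where D3: "\<And>l. L2 time l \<Longrightarrow> smooth (dir_deriv l (D2G h)) (D3 l)"
  by (rule smooth_functional_second_derivative[OF b']) blast
 obtain D4 where D4: "\<And>l. L2 time l \<Longrightarrow> smooth (dir_deriv l (D2G g)) (D4 l)"
  by (rule smooth_functional_second_derivative[OF b]) blast
 let ?a = "dir_deriv h DF" and ?a' = "dir_deriv g DF" and ?b = "dir_deriv g DG" and ?b' = "dir_deriv h DG"
 note FG = smooth_functional_product[OF F G] and Fb = smooth_functional_product[OF F b] and Fb' = smooth_functional_product[OF F b']
  and Ga = smooth_functional_product[OF G a]
 note si = L2_integrable and sm = smooth_mult_L2 and ss = smooth_functional_L2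
 have i1: "integrable M (%w. ((F w * G w) * Z w) * Y w)" by (rule integrable_mult_L2[OF sm[OF FG Zs] Ys])
 have i2: "integrable M (%w. (F w * ?b w) * Y w)" by (rule si[OF sm[OF Fb Ys]])
 have i3: "integrable M (%w. (G w * ?a w) * Z w)" by (rule si[OF sm[OF Ga Zs]])
 have i4: "integrable M (%w. ?b w * ?a w)" by (rule si[OF sm[OF b ss[OF a]]])
 have i5: "integrable M (%w. (F w * ?b' w) * Z w)" by (rule si[OF sm[OF Fb' Zs]])
 have i6: "integrable M (%w. ?b' w * ?a' w)" by (rule si[OF sm[OF b' ss[OF a']]])
 have i7: "integrable M (%w. F w * dir_deriv g (D2G h) w)" by (rule si[OF sm[OF F ss[OF D3[OF g]]]])
 have i8: "integrable M (%w. F w * dir_deriv h (D2G g) w)" by (rule si[OF sm[OF F ss[OF D4[OF h]]]])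
 have "(LINT w|M. elem_skorohod F DF h Y w * elem_skorohod G DG g Z w)
  = (LINT w|M. (((F w * G w) * Z w) * Y w - (F w * ?b w) * Y w) - (G w * ?a w) * Z w + ?b w * ?a w)"
  by (rule lint_cong) (simp add: elem_skorohod_def algebra_simps)
 also have "\<dots> = (LINT w|M. ((F w * G w) * Z w) * Y w) - (LINT w|M. (F w * ?b w) * Y w)
   - (LINT w|M. (G w * ?a w) * Z w) + (LINT w|M. ?b w * ?a w)"
  using i1 i2 i3 i4 by simp
 also have "(LINT w|M. ((F w * G w) * Z w) * Y w)
   = (LINT w|M. dir_deriv h (%s w. G w * DF s w + F w * DG s w) w * Z w) + (LINT w|M. F w * G w) * (LINT s|time. g s * h s)"
  by (rule smooth_two_wiener[OF FG Z Y])
 also have "(LINT w|M. dir_deriv h (%s w. G w * DF s w + F w * DG s w) w * Z w)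
   = (LINT w|M. (G w * ?a w) * Z w + (F w * ?b' w) * Z w)"
  by (rule lint_cong) (simp add: dir_deriv_product[OF F G h] distrib_right)
 also have "\<dots> = (LINT w|M. (G w * ?a w) * Z w) + (LINT w|M. (F w * ?b' w) * Z w)"
  by (rule Bochner_Integration.integral_add[OF i3 i5])
 also have "(LINT w|M. (F w * ?b' w) * Z w) = (LINT w|M. ?b' w * ?a' w + F w * dir_deriv g (D2G h) w)"
  unfolding smooth_integration_by_parts[OF Fb' Z]
  by (rule lint_cong) (rule dir_deriv_product[OF F b' g])
 also have "\<dots> = (LINT w|M. ?b' w * ?a' w) + (LINT w|M. F w * dir_deriv g (D2G h) w)"
  by (rule Bochner_Integration.integral_add[OF i6 i7])
 also have "(LINT w|M. (F w * ?b w) * Y w) = (LINT w|M. ?b w * ?a w + F w * dir_deriv h (D2G g) w)"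
  unfolding smooth_integration_by_parts[OF Fb Y]
  by (rule lint_cong) (rule dir_deriv_product[OF F b h])
 also have "\<dots> = (LINT w|M. ?b w * ?a w) + (LINT w|M. F w * dir_deriv h (D2G g) w)"
  by (rule Bochner_Integration.integral_add[OF i4 i8])
 also have "(LINT w|M. F w * dir_deriv g (D2G h) w) = (LINT w|M. F w * dir_deriv h (D2G g) w)"
  by (rule lint_cong) (simp add: sym[OF g h])
 finally show ?thesis by (simp add: mult.commute)
qed

lemma sigma_finite_time: "sigma_finite_measure time" by (rule sigma_finite_time_measure)

lemma sigma_finite_M: "sigma_finite_measure M" by unfold_locales

lemma sigma_finite_time_M: "sigma_finite_measure TM"
 using finite_measure_pair_measure[OF finite_measure_axioms finite_measure_time_measure[of T]] by (simp add: finite_measure_def)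

lemma smooth_derivative_L2:
 assumes "smooth F DF"
 shows "L2 TM (case_prod DF)"
proof -
 obtain K where K: "L2 time K" "\<And>s w. s \<in> {0..T} \<Longrightarrow> w \<in> space M \<Longrightarrow> \<bar>DF s w\<bar> \<le> K s"
  using smooth_functional_derivative(2)[OF assms] by blast
 have "L2 TM (%p. K (fst p) * 1)"
  by (rule tensor_L2[OF sigma_finite_time sigma_finite_M K(1)]) (simp add: square_integrable_def)
 then show ?thesis
 proof (rule L2_bound[OF _ smooth_functional_derivative(1)[OF assms], where C = 1])
  fix p assume "p \<in> space TM"
  then have "\<bar>DF (fst p) (snd p)\<bar> \<le> K (fst p)" by (intro K(2)) (auto simp: space_pair_measure)
  then show "\<bar>case p of (s, w) \<Rightarrow> DF s w\<bar> \<le> 1 * \<bar>K (fst p) * 1\<bar>" by (simp add: split_beta')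
 qed
qed

lemma smooth_process_L2:
 fixes m :: nat
 assumes F: "\<And>j. j < m \<Longrightarrow> smooth (F j) (DF j)" and h: "\<And>j. j < m \<Longrightarrow> L2 time (h j)"
 shows "L2 TM (%(t, w). \<Sum>j<m. F j w * h j t)"
  and "L2 TTM (%(s, t, w). \<Sum>j<m. DF j s w * h j t)"
proof -
 have "L2 TM (%p. \<Sum>j<m. h j (fst p) * F j (snd p))"
  by (rule L2_sum, rule tensor_L2[OF sigma_finite_time sigma_finite_M])
   (use h smooth_functional_L2[OF F] in auto)
 then show "L2 TM (%(t, w). \<Sum>j<m. F j w * h j t)"
  by (simp add: split_beta' mult.commute)
 have "L2 TTM (%p. \<Sum>j<m. DF j (fst p) (snd (snd p)) * h j (fst (snd p)))"
 proof (rule L2_sum)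
  fix j assume "j \<in> {..<m}"
  then have j: "j < m" by simp
  obtain K where K: "L2 time K" "\<And>s w. s \<in> {0..T} \<Longrightarrow> w \<in> space M \<Longrightarrow> \<bar>DF j s w\<bar> \<le> K s"
   using smooth_functional_derivative(2)[OF F[OF j]] by blast
  have "L2 TM (%p. h j (fst p) * 1)"
   by (rule tensor_L2[OF sigma_finite_time sigma_finite_M h[OF j]]) (simp add: square_integrable_def)
  from tensor_L2[OF sigma_finite_time sigma_finite_time_M K(1) this]
  have S: "L2 TTM (%p. K (fst p) * (h j (fst (snd p)) * 1))" .
  have "(%p. (fst p, snd (snd p))) \<in> measurable TTM TM" by measurable
  from measurable_compose[OF this smooth_functional_derivative(1)[OF F[OF j]]]
  have "(%p. DF j (fst p) (snd (snd p))) \<in> borel_measurable TTM" by simp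
  moreover have "(%p. h j (fst (snd p))) \<in> borel_measurable TTM"
   using measurable_compose[OF measurable_compose[OF measurable_snd measurable_fst] L2D(1)[OF h[OF j]]] .
  ultimately have m: "(%p. DF j (fst p) (snd (snd p)) * h j (fst (snd p))) \<in> borel_measurable TTM"
   by (rule borel_measurable_times)
  show "L2 TTM (%p. DF j (fst p) (snd (snd p)) * h j (fst (snd p)))"
  proof (rule L2_bound[OF S m, where C = 1])
   fix p assume "p \<in> space TTM"
   then have "fst p \<in> {0..T}" "snd (snd p) \<in> space M" by (auto simp: space_pair_measure)
   then have "\<bar>DF j (fst p) (snd (snd p))\<bar> \<le> \<bar>K (fst p)\<bar>" using K(2)[of "fst p" "snd (snd p)"] by linarith
   then show "\<bar>DF j (fst p) (snd (snd p)) * h j (fst (snd p))\<bar> \<le> 1 * \<bar>K (fst p) * (h j (fst (snd p)) * 1)\<bar>"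
    by (simp add: abs_mult mult_right_mono)
  qed
 qed
 then show "L2 TTM (%(s, t, w). \<Sum>j<m. DF j s w * h j t)"
  by (simp add: split_beta')
qed


lemma integral_triple:
 fixes f :: "real \<times> real \<times> 'a \<Rightarrow> real"
 assumes f: "integrable TTM f"
 shows "integrable M (%w. (LINT t|time. (LINT s|time. f (s, t, w))))"
  and "(LINT p|TTM. f p) = (LINT w|M. (LINT t|time. (LINT s|time. f (s, t, w))))"
proof -
 interpret A: pair_sigma_finite time M
  using sigma_finite_time sigma_finite_M by (simp add: pair_sigma_finite_def)
 interpret B: pair_sigma_finite time "TM"
  using sigma_finite_time sigma_finite_time_M by (simp add: pair_sigma_finite_def)
 have f': "integrable TTM (%(s, q). f (s, q))" using f by simp
 have g: "integrable TM (%q. (LINT s|time. f (s, q)))" by (rule B.integrable_snd[where f = "%s q. f (s, q)", OF f'])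
 then have g': "integrable TM (%(t, w). (LINT s|time. f (s, t, w)))" by (simp add: split_beta')
 show "integrable M (%w. (LINT t|time. (LINT s|time. f (s, t, w))))" by (rule A.integrable_snd[where f = "%t w. (LINT s|time. f (s, t, w))", OF g'])
 have "(LINT p|TTM. f p) = (LINT q|TM. (LINT s|time. f (s, q)))"
  using B.integral_snd[where f = "%s q. f (s, q)", OF f'] by simp
 also have "\<dots> = (LINT w|M. (LINT t|time. (LINT s|time. f (s, t, w))))"
  using A.integral_snd[where f = "%t w. (LINT s|time. f (s, t, w))", OF g'] by (simp add: split_beta')
 finally show "(LINT p|TTM. f p) = (LINT w|M. (LINT t|time. (LINT s|time. f (s, t, w))))" .
qed

lemma integral_time_M:
 fixes f :: "real \<times> 'a \<Rightarrow> real"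
 assumes f: "integrable TM f"
 shows "integrable M (%w. (LINT t|time. f (t, w)))"
  and "(LINT p|TM. f p) = (LINT w|M. (LINT t|time. f (t, w)))"
proof -
 interpret A: pair_sigma_finite time M
  using sigma_finite_time sigma_finite_M by (simp add: pair_sigma_finite_def)
 have f': "integrable TM (%(t, w). f (t, w))" using f by simp
 show "integrable M (%w. (LINT t|time. f (t, w)))" by (rule A.integrable_snd[where f = "%s q. f (s, q)", OF f'])
 show "(LINT p|TM. f p) = (LINT w|M. (LINT t|time. f (t, w)))" using A.integral_snd[where f = "%s q. f (s, q)", OF f'] by simp
qed

lemma square_of_sum: "(\<Sum>i<(m::nat). a i)^2 = (\<Sum>i<m. \<Sum>j<m. a i * (a j :: real))"
 by (simp add: power2_eq_square sum_product)

lemma integral_sum2: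
 fixes f :: "nat \<Rightarrow> nat \<Rightarrow> 'b \<Rightarrow> real"
 assumes "\<And>i j. i < m \<Longrightarrow> j < m \<Longrightarrow> integrable N (f i j)"
 shows "(LINT x|N. (\<Sum>i<m. \<Sum>j<m. f i j x)) = (\<Sum>i<m. \<Sum>j<m. (LINT x|N. f i j x))"
  and "integrable N (%x. \<Sum>i<m. \<Sum>j<m. f i j x)"
proof -
 have "(LINT x|N. (\<Sum>i<m. \<Sum>j<m. f i j x)) = (\<Sum>i<m. (LINT x|N. (\<Sum>j<m. f i j x)))"
  by (rule Bochner_Integration.integral_sum, rule Bochner_Integration.integrable_sum) (use assms in auto)
 also have "\<dots> = (\<Sum>i<m. \<Sum>j<m. (LINT x|N. f i j x))"
  by (rule sum.cong[OF refl], rule Bochner_Integration.integral_sum) (use assms in auto)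
 finally show "(LINT x|N. (\<Sum>i<m. \<Sum>j<m. f i j x)) = (\<Sum>i<m. \<Sum>j<m. (LINT x|N. f i j x))" .
 show "integrable N (%x. \<Sum>i<m. \<Sum>j<m. f i j x)"
  by (rule Bochner_Integration.integrable_sum, rule Bochner_Integration.integrable_sum) (use assms in auto)
qed

text \<open>The isometry formula \<open>E \<delta>(v)^2 = \<parallel>v\<parallel>^2 + E \<integral>\<integral> D\<^sub>s v\<^sub>t D\<^sub>t v\<^sub>s ds dt\<close> bounds the Skorohod
 integral by the norm of \<open>\<L>\<^sup>1\<^sup>,\<^sup>2\<close>.\<close>

lemma elem_skorohod_sum_bound:
 fixes m :: nat
 assumes F: "\<And>j. j < m \<Longrightarrow> smooth (F j) (DF j)"
  and Y: "\<And>j. j < m \<Longrightarrow> wiener (h j) (Y j)"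
 shows "(LINT w|M. (\<Sum>j<m. elem_skorohod (F j) (DF j) (h j) (Y j) w)^2)
  \<le> (LINT (t, w)|TM. (\<Sum>j<m. F j w * h j t)^2)
   + (LINT (s, t, w)|TTM. (\<Sum>j<m. DF j s w * h j t)^2)"
proof -
 note h = wienerD(1)[OF Y]
 note ii = integrable_mult_L2
 let ?U = "%j. elem_skorohod (F j) (DF j) (h j) (Y j)"
 let ?d = "%k j. dir_deriv (h k) (DF j)"
 have U: "L2 M (?U j)" if "j < m" for j by (rule elem_skorohod_L2[OF F[OF that] Y[OF that]])
 have dS: "L2 M (?d k j)" if "j < m" "k < m" for j k
 proof -
  have Fj: "smooth (F j) (DF j)" using F that by simp
  obtain D2 where D2: "\<And>h. L2 time h \<Longrightarrow> smooth (dir_deriv h (DF j)) (D2 h)"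
   by (rule smooth_functional_second_derivative[OF Fj]) blast
  show ?thesis by (rule smooth_functional_L2[OF D2[OF h[OF that(2)]]])
 qed
 have FS: "L2 M (F j)" if "j < m" for j by (rule smooth_functional_L2[OF F[OF that]])
 have "(LINT w|M. (\<Sum>j<m. ?U j w)^2) = (LINT w|M. (\<Sum>j<m. \<Sum>k<m. ?U j w * ?U k w))"
  by (simp only: square_of_sum)
 also have "\<dots> = (\<Sum>j<m. \<Sum>k<m. (LINT w|M. ?U j w * ?U k w))"
  by (rule integral_sum2(1)[where f = "%j k w. ?U j w * ?U k w"]) (rule ii[OF U U])
 also have "\<dots> = (\<Sum>j<m. \<Sum>k<m. (LINT w|M. F j w * F k w) * (LINT s|time. h j s * h k s)) + (\<Sum>j<m. \<Sum>k<m. (LINT w|M. ?d k j w * ?d j k w))"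
  unfolding sum.distrib[symmetric]
  by (intro sum.cong refl, rule elem_skorohod_inner[OF F Y F Y]) auto
 also have "(\<Sum>j<m. \<Sum>k<m. (LINT w|M. F j w * F k w) * (LINT s|time. h j s * h k s)) = (LINT (t, w)|TM. (\<Sum>j<m. F j w * h j t)^2)"
 proof -
  note ti = tensor_integral[OF sigma_finite_time sigma_finite_M ii[OF h h] ii[OF FS FS]]
  have "(LINT (t, w)|TM. (\<Sum>j<m. F j w * h j t)^2)
    = (LINT p|TM. (\<Sum>j<m. \<Sum>k<m. (h j (fst p) * h k (fst p)) * (F j (snd p) * F k (snd p))))"
   unfolding square_of_sum split_beta' by (intro lint_cong sum.cong refl) (simp only: mult_ac)
  also have "\<dots> = (\<Sum>j<m. \<Sum>k<m. (LINT p|TM. (h j (fst p) * h k (fst p)) * (F j (snd p) * F k (snd p))))"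
   by (rule integral_sum2(1)) (rule ti(1))
  also have "\<dots> = (\<Sum>j<m. \<Sum>k<m. (LINT s|time. h j s * h k s) * (LINT w|M. F j w * F k w))"
   by (intro sum.cong refl, rule ti(2)) auto
  finally show ?thesis by (simp only: mult.commute)
 qed
 also have "(\<Sum>j<m. \<Sum>k<m. (LINT w|M. ?d k j w * ?d j k w)) = (LINT w|M. (\<Sum>j<m. \<Sum>k<m. ?d k j w * ?d j k w))"
  by (rule integral_sum2(1)[symmetric]) (rule ii[OF dS dS])
 also have "\<dots> \<le> (LINT w|M. (LINT t|time. (LINT s|time. (\<Sum>j<m. DF j s w * h j t)^2)))"
 proof (rule integral_mono)
  show "integrable M (%w. \<Sum>j<m. \<Sum>k<m. ?d k j w * ?d j k w)"
   by (rule integral_sum2(2)) (rule ii[OF dS dS])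
  have "integrable TTM (%p. ((%(s, t, w). \<Sum>j<m. DF j s w * h j t) p)^2)"
   by (rule L2D(2)[OF smooth_process_L2(2)[OF F h]])
  from integral_triple(1)[OF this] show "integrable M (%w. (LINT t|time. (LINT s|time. (\<Sum>j<m. DF j s w * h j t)^2)))" by simp
  fix w assume w: "w \<in> space M"
  note p = smooth_functional_derivative(3)[OF F w]
  have "(\<Sum>j<m. \<Sum>k<m. ?d k j w * ?d j k w)
    = (\<Sum>j<m. \<Sum>k<m. (LINT s|time. DF j s w * h k s) * (LINT s|time. DF k s w * h j s))" by (simp add: dir_deriv_def)
  also have "\<dots> \<le> (\<Sum>j<m. \<Sum>k<m. (LINT s|time. DF j s w * DF k s w) * (LINT s|time. h j s * h k s))"
   by (rule Gram_transpose_le[OF sigma_finite_time p h])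
  also have "\<dots> = (LINT t|time. (LINT s|time. (\<Sum>j<m. DF j s w * h j t)^2))"
  proof -
   have "(LINT s|time. (\<Sum>j<m. DF j s w * h j t)^2) = (\<Sum>j<m. \<Sum>k<m. (LINT s|time. DF j s w * DF k s w) * (h j t * h k t))" for t
   proof -
    have "(LINT s|time. (\<Sum>j<m. DF j s w * h j t)^2) = (LINT s|time. (\<Sum>j<m. \<Sum>k<m. (DF j s w * DF k s w) * (h j t * h k t)))"
     unfolding square_of_sum by (intro lint_cong sum.cong refl) (simp only: mult_ac)
    also have "\<dots> = (\<Sum>j<m. \<Sum>k<m. (LINT s|time. (DF j s w * DF k s w) * (h j t * h k t)))"
     by (rule integral_sum2(1), rule integrable_mult_left) (rule ii[OF p p])
    also have "\<dots> = (\<Sum>j<m. \<Sum>k<m. (LINT s|time. DF j s w * DF k s w) * (h j t * h k t))" by simp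
    finally show ?thesis .
   qed
   then have "(LINT t|time. (LINT s|time. (\<Sum>j<m. DF j s w * h j t)^2))
     = (LINT t|time. (\<Sum>j<m. \<Sum>k<m. (LINT s|time. DF j s w * DF k s w) * (h j t * h k t)))" by simp
   also have "\<dots> = (\<Sum>j<m. \<Sum>k<m. (LINT s|time. DF j s w * DF k s w) * (LINT t|time. h j t * h k t))"
    by (subst integral_sum2(1), rule integrable_mult_right, rule ii[OF h h]) simp_all
   finally show ?thesis by simp
  qed
  finally show "(\<Sum>j<m. \<Sum>k<m. ?d k j w * ?d j k w) \<le> (LINT t|time. (LINT s|time. (\<Sum>j<m. DF j s w * h j t)^2))" .
 qed
 also have "\<dots> = (LINT (s, t, w)|TTM. (\<Sum>j<m. DF j s w * h j t)^2)"
 proof -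
  have "integrable TTM (%p. ((%(s, t, w). \<Sum>j<m. DF j s w * h j t) p)^2)"
   by (rule L2D(2)[OF smooth_process_L2(2)[OF F h]])
  from integral_triple(2)[OF this] show ?thesis by (simp add: split_beta')
 qed
 finally show ?thesis by simp
qed

text \<open>\<open>X\<close> is the Skorohod integral \<open>\<Sum>\<^sub>j (F\<^sub>j W(h\<^sub>j) - \<langle>DF\<^sub>j, h\<^sub>j\<rangle>)\<close> of a smooth process.\<close>

definition smooth_skorohod where
 "smooth_skorohod v Dv X \<longleftrightarrow> (\<exists>(m::nat) F DF h Y. (\<forall>j<m. smooth (F j) (DF j) \<and> wiener (h j) (Y j)) \<and>
  (\<forall>t\<in>{0..T}. \<forall>w\<in>space M. v t w = (\<Sum>j<m. F j w * h j t)) \<and>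
  (\<forall>s\<in>{0..T}. \<forall>t\<in>{0..T}. \<forall>w\<in>space M. Dv s t w = (\<Sum>j<m. DF j s w * h j t)) \<and>
  X = (%w. \<Sum>j<m. elem_skorohod (F j) (DF j) (h j) (Y j) w))"

lemma smooth_process_skorohod:
 assumes "smooth_process M T W v Dv"
 obtains X where "smooth_skorohod v Dv X"
proof -
 obtain m :: nat and F DF h where r: "(\<forall>j<m. smooth (F j) (DF j) \<and> L2 time (h j))"
  "(\<forall>t\<in>{0..T}. \<forall>w\<in>space M. v t w = (\<Sum>j<m. F j w * h j t))"
  "(\<forall>s\<in>{0..T}. \<forall>t\<in>{0..T}. \<forall>w\<in>space M. Dv s t w = (\<Sum>j<m. DF j s w * h j t))"
  using assms unfolding smooth_process_def by (elim exE conjE)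
 have "\<forall>j. \<exists>Y. j < m \<longrightarrow> wiener (h j) Y" using r(1) wiener_exists by blast
 then obtain Y where Y: "\<And>j. j < m \<Longrightarrow> wiener (h j) (Y j)" by metis
 show thesis
  by (rule that[of "%w. \<Sum>j<m. elem_skorohod (F j) (DF j) (h j) (Y j) w"], unfold smooth_skorohod_def,
    rule exI[of _ m], rule exI[of _ F], rule exI[of _ DF], rule exI[of _ h], rule exI[of _ Y])
   (use r Y in blast)
qed

lemma smooth_skorohodE:
 assumes "smooth_skorohod v Dv X"
 obtains m :: nat and F DF h Y where "\<forall>j<m. smooth (F j) (DF j) \<and> wiener (h j) (Y j)"
  "\<forall>t\<in>{0..T}. \<forall>w\<in>space M. v t w = (\<Sum>j<m. F j w * h j t)"
  "\<forall>s\<in>{0..T}. \<forall>t\<in>{0..T}. \<forall>w\<in>space M. Dv s t w = (\<Sum>j<m. DF j s w * h j t)"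
  "X = (%w. \<Sum>j<m. elem_skorohod (F j) (DF j) (h j) (Y j) w)"
 using assms unfolding smooth_skorohod_def by (elim exE conjE)

lemma smooth_skorohod_L2:
 assumes "smooth_skorohod v Dv X"
 shows "L2 TM (case_prod v)"
  and "L2 TTM (case_triple Dv)"
  and "L2 M X"
  and "(LINT w|M. (X w)^2) \<le> (LINT (t, w)|TM. (v t w)^2) + (LINT (s, t, w)|TTM. (Dv s t w)^2)"
proof -
 obtain m :: nat and F DF h Y where r: "\<forall>j<m. smooth (F j) (DF j) \<and> wiener (h j) (Y j)"
  "\<forall>t\<in>{0..T}. \<forall>w\<in>space M. v t w = (\<Sum>j<m. F j w * h j t)"
  "\<forall>s\<in>{0..T}. \<forall>t\<in>{0..T}. \<forall>w\<in>space M. Dv s t w = (\<Sum>j<m. DF j s w * h j t)"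
  "X = (%w. \<Sum>j<m. elem_skorohod (F j) (DF j) (h j) (Y j) w)" by (rule smooth_skorohodE[OF assms])
 have F: "smooth (F j) (DF j)" and Y: "wiener (h j) (Y j)" if "j < m" for j using r(1) that by auto
 note h = wienerD(1)[OF Y]
 have v: "case_prod v p = (case p of (t, w) \<Rightarrow> \<Sum>j<m. F j w * h j t)" if "p \<in> space TM" for p
  using that r(2) by (auto simp: space_pair_measure)
 have Dv: "case_triple Dv p = (case p of (s, t, w) \<Rightarrow> \<Sum>j<m. DF j s w * h j t)" if "p \<in> space TTM" for p
  using that r(3) by (auto simp: space_pair_measure)
 show "L2 TM (case_prod v)"
  by (subst L2_cong, rule v, assumption, rule smooth_process_L2(1)[where DF = DF and F = F, OF F h])
 show "L2 TTM (case_triple Dv)"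
  by (subst L2_cong, rule Dv, assumption, rule smooth_process_L2(2)[where DF = DF and F = F, OF F h])
 show "L2 M X" unfolding r(4)
  by (rule L2_sum) (use elem_skorohod_L2[OF F Y] in auto)
 have "(LINT (t, w)|TM. (v t w)^2) = (LINT (t, w)|TM. (\<Sum>j<m. F j w * h j t)^2)"
  by (rule lint_cong) (use v in \<open>auto simp: split_beta'\<close>)
 moreover have "(LINT (s, t, w)|TTM. (Dv s t w)^2) = (LINT (s, t, w)|TTM. (\<Sum>j<m. DF j s w * h j t)^2)"
  by (rule lint_cong) (use Dv in \<open>auto simp: split_beta'\<close>)
 ultimately show "(LINT w|M. (X w)^2) \<le> (LINT (t, w)|TM. (v t w)^2) + (LINT (s, t, w)|TTM. (Dv s t w)^2)"
  unfolding r(4) using elem_skorohod_sum_bound[OF F Y] by simp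
qed

lemma smooth_skorohod_duality:
 assumes X: "smooth_skorohod v Dv X" and G: "smooth G DG"
 shows "(LINT w|M. G w * X w) = (LINT (s, w)|TM. DG s w * v s w)"
proof -
 obtain m :: nat and F DF h Y where r: "\<forall>j<m. smooth (F j) (DF j) \<and> wiener (h j) (Y j)"
  "\<forall>t\<in>{0..T}. \<forall>w\<in>space M. v t w = (\<Sum>j<m. F j w * h j t)"
  "\<forall>s\<in>{0..T}. \<forall>t\<in>{0..T}. \<forall>w\<in>space M. Dv s t w = (\<Sum>j<m. DF j s w * h j t)"
  "X = (%w. \<Sum>j<m. elem_skorohod (F j) (DF j) (h j) (Y j) w)" by (rule smooth_skorohodE[OF X])
 have F: "smooth (F j) (DF j)" and Y: "wiener (h j) (Y j)" if "j < m" for j using r(1) that by auto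
 note h = wienerD(1)[OF Y]
 obtain D2 where D2: "\<And>h. L2 time h \<Longrightarrow> smooth (dir_deriv h DG) (D2 h)"
  by (rule smooth_functional_second_derivative[OF G]) blast
 note GS = smooth_functional_L2[OF G]
 have i: "integrable M (%w. F j w * dir_deriv (h j) DG w)" if "j < m" for j
  by (rule integrable_mult_L2[OF smooth_functional_L2[OF F[OF that]] smooth_functional_L2[OF D2[OF h[OF that]]]])
 have "(LINT w|M. G w * X w) = (\<Sum>j<m. (LINT w|M. G w * elem_skorohod (F j) (DF j) (h j) (Y j) w))"
  unfolding r(4) sum_distrib_left
  by (rule Bochner_Integration.integral_sum) (use integrable_mult_L2[OF GS elem_skorohod_L2[OF F Y]] in auto)
 also have "\<dots> = (\<Sum>j<m. (LINT w|M. F j w * dir_deriv (h j) DG w))"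
  by (intro sum.cong refl, rule elem_skorohod_duality[OF F Y G]) auto
 also have "\<dots> = (LINT w|M. (\<Sum>j<m. F j w * dir_deriv (h j) DG w))"
  by (rule Bochner_Integration.integral_sum[symmetric]) (use i in auto)
 also have "\<dots> = (LINT w|M. (LINT s|time. DG s w * v s w))"
 proof (rule lint_cong)
  fix w assume w: "w \<in> space M"
  have "(LINT s|time. DG s w * v s w) = (LINT s|time. (\<Sum>j<m. F j w * (DG s w * h j s)))"
   by (rule lint_cong) (use r(2) w in \<open>simp add: sum_distrib_left mult.left_commute\<close>)
  also have "\<dots> = (\<Sum>j<m. F j w * dir_deriv (h j) DG w)"
   unfolding dir_deriv_def
   using integrable_mult_L2[OF smooth_functional_derivative(3)[OF G w] h] by (simp add: Bochner_Integration.integral_sum)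
  finally show "(\<Sum>j<m. F j w * dir_deriv (h j) DG w) = (LINT s|time. DG s w * v s w)" by simp
 qed
 also have "\<dots> = (LINT (s, w)|TM. DG s w * v s w)"
  using integral_time_M(2)[OF integrable_mult_L2[OF smooth_derivative_L2[OF G] smooth_skorohod_L2(1)[OF X]]]
  by (simp add: split_beta')
 finally show ?thesis .
qed

lemma smooth_skorohod_diff:
 assumes X: "smooth_skorohod v Dv X" and X': "smooth_skorohod v' Dv' X'"
 shows "smooth_skorohod (%t w. v t w - v' t w) (%s t w. Dv s t w - Dv' s t w) (%w. X w - X' w)"
proof -
 obtain m :: nat and F DF h Y where r: "\<forall>j<m. smooth (F j) (DF j) \<and> wiener (h j) (Y j)"
  "\<forall>t\<in>{0..T}. \<forall>w\<in>space M. v t w = (\<Sum>j<m. F j w * h j t)"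
  "\<forall>s\<in>{0..T}. \<forall>t\<in>{0..T}. \<forall>w\<in>space M. Dv s t w = (\<Sum>j<m. DF j s w * h j t)"
  "X = (%w. \<Sum>j<m. elem_skorohod (F j) (DF j) (h j) (Y j) w)" by (rule smooth_skorohodE[OF X])
 obtain m' :: nat and F' DF' h' Y' where r': "\<forall>j<m'. smooth (F' j) (DF' j) \<and> wiener (h' j) (Y' j)"
  "\<forall>t\<in>{0..T}. \<forall>w\<in>space M. v' t w = (\<Sum>j<m'. F' j w * h' j t)"
  "\<forall>s\<in>{0..T}. \<forall>t\<in>{0..T}. \<forall>w\<in>space M. Dv' s t w = (\<Sum>j<m'. DF' j s w * h' j t)"
  "X' = (%w. \<Sum>j<m'. elem_skorohod (F' j) (DF' j) (h' j) (Y' j) w)" by (rule smooth_skorohodE[OF X'])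
 define G where "G j = (if j < m then F j else F' (j - m))" for j
 define DG where "DG j = (if j < m then DF j else DF' (j - m))" for j
 define k where "k j = (if j < m then h j else (%s. (-1) * h' (j - m) s))" for j
 define Z where "Z j = (if j < m then Y j else (%w. (-1) * Y' (j - m) w))" for j
 have split: "(\<Sum>j<m + m'. f j) = (\<Sum>j<m. f j) + (\<Sum>j<m'. f (m + j))" for f :: "nat \<Rightarrow> real"
  by (induction m') (auto simp: add.assoc)
 have neg: "elem_skorohod F DF (%s. - h s) (%w. - Y w) w = - elem_skorohod F DF h Y w" for F DF h Y w
  by (simp add: elem_skorohod_def dir_deriv_def)
 show ?thesis
  unfolding smooth_skorohod_def
 proof (rule exI[of _ "m + m'"], rule exI[of _ G], rule exI[of _ DG], rule exI[of _ k], rule exI[of _ Z], intro conjI allI impI ballI)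
  fix j assume j: "j < m + m'"
  then show "smooth (G j) (DG j)" using r(1) r'(1) by (auto simp: G_def DG_def)
  show "wiener (k j) (Z j)"
  proof (cases "j < m")
   case False
   then have "wiener (h' (j - m)) (Y' (j - m))" using r'(1) j by auto
   from wiener_cmult[OF this, of "-1"] show ?thesis using False by (simp add: k_def Z_def)
  qed (use r(1) in \<open>auto simp: k_def Z_def\<close>)
 next
  fix t w assume "t \<in> {0..T}" "w \<in> space M"
  then show "v t w - v' t w = (\<Sum>j<m + m'. G j w * k j t)"
   using r(2) r'(2) unfolding split by (simp add: G_def k_def sum_negf)
 next
  fix s t w assume "s \<in> {0..T}" "t \<in> {0..T}" "w \<in> space M"
  then show "Dv s t w - Dv' s t w = (\<Sum>j<m + m'. DG j s w * k j t)"
   using r(3) r'(3) unfolding split by (simp add: DG_def k_def sum_negf)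
 next
  show "(%w. X w - X' w) = (%w. \<Sum>j<m + m'. elem_skorohod (G j) (DG j) (k j) (Z j) w)"
   unfolding split r(4) r'(4) by (simp add: G_def DG_def k_def Z_def neg sum_negf)
 qed
qed

lemma L2_converges_Cauchy:
 assumes f: "L2_converges N fs f" and e: "e > 0"
 shows "\<exists>K. \<forall>i\<ge>K. \<forall>j\<ge>K. (LINT x|N. (fs i x - fs j x)^2) < e"
proof -
 obtain K where K: "\<And>n. n \<ge> K \<Longrightarrow> (LINT x|N. (fs n x - f x)^2) < e / 4"
  using order_tendstoD(2)[OF L2_convergesD(3)[OF f], of "e / 4"] e by (auto simp: eventually_sequentially)
 show ?thesis
 proof (intro exI[of _ K] allI impI)
  fix i j assume ij: "K \<le> i" "K \<le> j"
  have "(LINT x|N. (f x - fs j x)^2) = (LINT x|N. (fs j x - f x)^2)" by (simp add: power2_commute)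
  then show "(LINT x|N. (fs i x - fs j x)^2) < e"
   using L2_triangle[OF L2_convergesD(1)[OF f, of i] L2_convergesD(2)[OF f] L2_convergesD(1)[OF f, of j]] K[OF ij(1)] K[OF ij(2)] by linarith
 qed
qed

text \<open>The bound makes the Skorohod integrals of smooth approximations converge; the duality
 relation passes to the limit.\<close>

lemma skorohod_limit:
 assumes X: "\<And>n. smooth_skorohod (vs n) (Dvs n) (Xs n)"
  and v: "L2_converges TM (%n. case_prod (vs n)) (case_prod v)"
  and Dv: "L2_converges TTM (%n. case_triple (Dvs n)) (case_triple Dv)"
 obtains S where "L2_converges M Xs S" "skorohod v S"
proof -
 have "\<exists>S. L2_converges M Xs S"
 proof (rule L2_complete[OF smooth_skorohod_L2(3)[OF X]])
  fix e :: real assume "e > 0"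
  then have e: "e / 2 > 0" by simp
  obtain K where K: "\<And>i j. i \<ge> K \<Longrightarrow> j \<ge> K \<Longrightarrow> (LINT (t, w)|TM. (vs i t w - vs j t w)^2) < e / 2"
   using L2_converges_Cauchy[OF v e] by (auto simp: split_beta')
  obtain L where L: "\<And>i j. i \<ge> L \<Longrightarrow> j \<ge> L \<Longrightarrow> (LINT (s, t, w)|TTM. (Dvs i s t w - Dvs j s t w)^2) < e / 2"
   using L2_converges_Cauchy[OF Dv e] by (auto simp: split_beta')
  show "\<exists>N. \<forall>i\<ge>N. \<forall>j\<ge>N. (LINT w|M. (Xs i w - Xs j w)^2) < e"
  proof (intro exI[of _ "max K L"] allI impI)
   fix i j assume "max K L \<le> i" "max K L \<le> j"
   then show "(LINT w|M. (Xs i w - Xs j w)^2) < e"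
    using smooth_skorohod_L2(4)[OF smooth_skorohod_diff[OF X X], of i j] K[of i j] L[of i j] by linarith
  qed
 qed
 then obtain S where S: "L2_converges M Xs S" by blast
 have "skorohod v S"
  unfolding has_skorohod_integral_def
 proof (intro conjI allI impI)
  show "L2 TM (case_prod v)" by (rule L2_convergesD(2)[OF v])
  show "L2 M S" by (rule L2_convergesD(2)[OF S])
  fix F DF assume "has_malliavin_deriv M T W F DF"
  then obtain Fs DFs where Fs: "\<And>n. smooth (Fs n) (DFs n)" "L2_converges M Fs F"
   "L2_converges TM (%n (s, w). DFs n s w) (case_prod DF)"
   unfolding has_malliavin_deriv_def by blast
  have "(%n. (LINT w|M. Fs n w * Xs n w)) \<longlonglongrightarrow> (LINT w|M. F w * S w)" by (rule L2_converges_inner[OF Fs(2) S])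
  moreover have "(%n. (LINT (s, w)|TM. DFs n s w * vs n s w)) \<longlonglongrightarrow> (LINT (s, w)|TM. DF s w * v s w)"
   using L2_converges_inner[OF Fs(3) v] by (simp add: split_beta')
  ultimately show "(LINT w|M. F w * S w) = (LINT (s, w)|TM. DF s w * v s w)"
   unfolding smooth_skorohod_duality[OF X Fs(1)] by (rule LIMSEQ_unique)
 qed
 with S show thesis by (rule that)
qed

lemma malliavin_process_smooth_approx:
 assumes "malliavin v Dv"
 obtains vs Dvs Xs where "\<And>n. smooth_skorohod (vs n) (Dvs n) (Xs n)"
  "L2_converges TM (%n. case_prod (vs n)) (case_prod v)"
  "L2_converges TTM (%n. case_triple (Dvs n)) (case_triple Dv)"
proof -
 obtain vs Dvs where r: "\<And>n. smooth_process M T W (vs n) (Dvs n)"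
  "L2_converges TM (%n. case_prod (vs n)) (case_prod v)"
  "L2_converges TTM (%n. case_triple (Dvs n)) (case_triple Dv)"
  using assms unfolding has_malliavin_deriv_process_def by blast
 have "\<exists>X. smooth_skorohod (vs n) (Dvs n) X" for n by (rule smooth_process_skorohod[OF r(1)]) blast
 then obtain Xs where "\<And>n. smooth_skorohod (vs n) (Dvs n) (Xs n)" by metis
 then show thesis using r(2,3) by (rule that)
qed

end

section \<open>Density of smooth functionals\<close>

context brownian begin

definition logistic_step :: "nat \<Rightarrow> real \<Rightarrow> real \<Rightarrow> real" where
 "logistic_step n a x = logistic ((real n)^2 * x + (real n - (real n)^2 * a))"

lemma logistic_step_tendsto: "(%n. logistic_step n a x) \<longlonglongrightarrow> (if a \<le> x then 1 else 0)"
proof (cases "a \<le> x")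
 case True
 have "real n \<le> (real n)^2 * x + (real n - (real n)^2 * a)" for n
  using mult_left_mono[OF True, of "(real n)^2"] by simp
 then have "filterlim (%n. (real n)^2 * x + (real n - (real n)^2 * a)) at_top sequentially"
  by (intro filterlim_at_top_mono[OF filterlim_real_sequentially]) auto
 from filterlim_compose[OF logistic_at_top this] show ?thesis using True by (simp add: logistic_step_def)
next
 case False
 then have "a - x > 0" by simp
 have "\<forall>\<^sub>F n in sequentially. (real n)^2 * x + (real n - (real n)^2 * a) \<le> - real n"
 proof (rule eventually_mono[OF eventually_ge_at_top[of "nat \<lceil>2 / (a - x)\<rceil>"]])
  fix n assume "nat \<lceil>2 / (a - x)\<rceil> \<le> n"
  then have "2 / (a - x) \<le> real n" by linarith
  then have "2 \<le> real n * (a - x)" using \<open>a - x > 0\<close> by (simp add: field_simps)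
  then have "real n * 2 \<le> real n * (real n * (a - x))" by (intro mult_left_mono) auto
  then show "(real n)^2 * x + (real n - (real n)^2 * a) \<le> - real n" by (simp add: power2_eq_square algebra_simps)
 qed
 moreover have "filterlim (%n. - real n) at_bot sequentially"
  by (rule filterlim_compose[OF filterlim_uminus_at_bot_at_top filterlim_real_sequentially])
 ultimately have "filterlim (%n. (real n)^2 * x + (real n - (real n)^2 * a)) at_bot sequentially"
  by (rule filterlim_at_bot_mono[rotated])
 from filterlim_compose[OF logistic_at_bot this] show ?thesis using False by (simp add: logistic_step_def)
qed

definition test_functional :: "nat \<Rightarrow> (real \<times> real) list \<Rightarrow> 'a \<Rightarrow> real" where
 "test_functional n l w = (\<Prod>(s, a)\<leftarrow>l. logistic_step n a (W s w - W 0 w))"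

lemma test_functional_smooth:
 assumes "t \<le> T" "\<And>s a. (s, a) \<in> set l \<Longrightarrow> 0 \<le> s \<and> s \<le> t"
 shows "\<exists>DH. smooth (test_functional n l) DH \<and> (\<forall>r. t < r \<longrightarrow> (\<forall>w\<in>space M. DH r w = 0))"
 using assms(2)
proof (induction l)
 case Nil
 have "smooth (test_functional n []) (%_ _. 0)"
  unfolding smooth_functional_def test_functional_def
  by (rule exI[of _ 0], rule exI[of _ "%_. 1"]) (auto simp: Cb_infty_const)
 then show ?case by auto
next
 case (Cons x l)
 obtain s a where x: "x = (s, a)" by (cases x)
 have s: "0 \<le> s" "s \<le> t" using Cons(2)[of s a] by (auto simp: x)
 obtain DH where DH: "smooth (test_functional n l) DH" "\<And>r w. t < r \<Longrightarrow> w \<in> space M \<Longrightarrow> DH r w = 0"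
  using Cons by force
 let ?X = "%w. W s w - W 0 w"
 have X: "wiener (indicator {0<..s}) ?X"
  using s \<open>t \<le> T\<close> by (intro wiener_interval) auto
 let ?g' = "%y. logistic ((real n)^2 * y + (real n - (real n)^2 * a)) * (1 - logistic ((real n)^2 * y + (real n - (real n)^2 * a))) * (real n)^2"
 have "smooth (%w. logistic_step n a (?X w)) (%r w. ?g' (?X w) * indicator {0<..s} r)"
 proof (rule smooth_functional_one_variable[OF _ _ X])
  show "(%x. logistic_step n a (x 0)) \<in> Cb_infty 1" unfolding logistic_step_def by (rule Cb_infty_logistic)
  show "(logistic_step n a has_real_derivative ?g' y) (at y)" for y
   unfolding logistic_step_def[abs_def]
   by (rule DERIV_chain2[OF logistic_deriv]) (auto intro!: derivative_eq_intros)
 qed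
 moreover have "test_functional n (x # l) = (%w. logistic_step n a (?X w) * test_functional n l w)"
  by (simp add: x test_functional_def fun_eq_iff)
 ultimately have "smooth (test_functional n (x # l))
  (%r w. test_functional n l w * (?g' (?X w) * indicator {0<..s} r) + logistic_step n a (?X w) * DH r w)"
  using smooth_functional_product[OF _ DH(1)] by (simp only:)
 moreover have "test_functional n l w * (?g' (?X w) * indicator {0<..s} r) + logistic_step n a (?X w) * DH r w = 0"
  if "t < r" "w \<in> space M" for r w using DH(2)[OF that] that s by simp
 ultimately show ?case by blast
qed

lemma test_functional_tendsto:
 "(%n. test_functional n l w) \<longlonglongrightarrow> (if \<forall>(s, a)\<in>set l. a \<le> W s w - W 0 w then 1 else 0)"
proof (induction l)
 case Nil then show ?case by (simp add: test_functional_def)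
next
 case (Cons x l)
 obtain s a where x: "x = (s, a)" by (cases x)
 have "(if a \<le> W s w - W 0 w then 1 else 0) * (if \<forall>(s, a)\<in>set l. a \<le> W s w - W 0 w then 1 else 0)
   = (if \<forall>(s, a)\<in>set (x # l). a \<le> W s w - W 0 w then 1 else (0 :: real))" by (auto simp: x)
 moreover have "logistic_step n a (W s w - W 0 w) * test_functional n l w = test_functional n (x # l) w" for n
  by (simp add: x test_functional_def)
 ultimately show ?case using tendsto_mult[OF logistic_step_tendsto[of a "W s w - W 0 w"] Cons] by (simp only:)
qed

lemma test_functional_bound: "\<bar>test_functional n l w\<bar> \<le> 1"
proof (induction l)
 case Nil then show ?case by (simp add: test_functional_def)
next
 case (Cons x l)
 obtain s a where x: "x = (s, a)" by (cases x)
 have "\<bar>logistic_step n a (W s w - W 0 w)\<bar> \<le> 1"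
  using logistic_bounds[of "(real n)^2 * (W s w - W 0 w) + (real n - (real n)^2 * a)"] by (simp add: logistic_step_def)
 from mult_mono[OF this Cons] show ?case by (simp add: x test_functional_def abs_mult)
qed

definition cylinders :: "real \<Rightarrow> 'a set set" where
 "cylinders t = {{w\<in>space M. \<forall>(s, a)\<in>set l. a \<le> W s w} | l. \<forall>(s, a)\<in>set l. 0 \<le> s \<and> s \<le> t}"

lemma cylinders_sets: "t \<le> T \<Longrightarrow> cylinders t \<subseteq> sets M"
proof
 fix A assume "t \<le> T" "A \<in> cylinders t"
 then obtain l where l: "A = {w\<in>space M. \<forall>(s, a)\<in>set l. a \<le> W s w}" "\<forall>(s, a)\<in>set l. 0 \<le> s \<and> s \<le> t"
  unfolding cylinders_def by blast
 have "{w\<in>space M. \<forall>p\<in>set l. snd p \<le> W (fst p) w} \<in> sets M"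
 proof (rule sets.sets_Collect_finite_All[OF _ finite_set])
  fix p assume "p \<in> set l"
  then have "fst p \<in> {0..T}" using l(2) \<open>t \<le> T\<close> by auto
  note [measurable] = W_measurable[OF this]
  show "{w\<in>space M. snd p \<le> W (fst p) w} \<in> sets M" by measurable
 qed
 then show "A \<in> sets M" unfolding l(1) by (simp add: split_beta')
qed

lemma augmented_generated_by_cylinders:
 "sets (\<F> t) \<subseteq> sigma_sets (space M) (cylinders t \<union> null_pieces)"
proof -
 have P: "cylinders t \<union> null_pieces \<subseteq> Pow (space M)"
  using null_pieces_subset by (auto simp: cylinders_def)
 define \<Sigma> where "\<Sigma> = sigma (space M) (cylinders t \<union> null_pieces)"
 have \<Sigma>: "sets \<Sigma> = sigma_sets (space M) (cylinders t \<union> null_pieces)" "space \<Sigma> = space M"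
  unfolding \<Sigma>_def using P by (auto simp: sets_measure_of space_measure_of)
 have "W s \<in> borel_measurable \<Sigma>" if "s \<in> {0..t}" for s
  unfolding borel_measurable_iff_ge
 proof
  fix a
  have "{w\<in>space M. \<forall>(s, a)\<in>set [(s, a)]. a \<le> W s w} \<in> cylinders t"
   unfolding cylinders_def using that by (intro CollectI exI[of _ "[(s, a)]"] conjI refl) auto
  then show "{w\<in>space \<Sigma>. a \<le> W s w} \<in> sets \<Sigma>" unfolding \<Sigma> by (auto intro: sigma_sets.Basic)
 qed
 then have "W s -` A \<inter> space M \<in> sets \<Sigma>" if "s \<in> {0..t}" "A \<in> sets borel" for s A
  using that measurable_sets[of "W s" \<Sigma> borel A] \<Sigma>(2) by simp
 then have "(\<Union>s\<in>{0..t}. {W s -` A \<inter> space M |A. A \<in> sets borel}) \<subseteq> sets \<Sigma>" by auto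
 then have "sets (natural_filtration M W t) \<subseteq> sets \<Sigma>"
  unfolding sets_natural using sets.sigma_sets_subset[of _ \<Sigma>] \<Sigma>(2) by simp
 moreover have "null_pieces \<subseteq> sets \<Sigma>" unfolding \<Sigma> by (auto intro: sigma_sets.Basic)
 ultimately show ?thesis
  unfolding sets_augmented using sets.sigma_sets_subset[of "sets (natural_filtration M W t) \<union> null_pieces" \<Sigma>] \<Sigma> by simp
qed

text \<open>Products of logistic functions of \<open>W\<close> at finitely many times approximate the indicators of
 the cylinder sets, and these generate the filtration.\<close>

lemma orthogonal_to_tests:
 assumes t: "0 \<le> t" "t \<le> T" and Y: "integrable M Y"
  and orth: "\<And>H DH. smooth H DH \<Longrightarrow> (\<forall>r. t < r \<longrightarrow> (\<forall>w\<in>space M. DH r w = 0)) \<Longrightarrow> (LINT w|M. H w * Y w) = 0"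
  and A: "A \<in> sets (\<F> t)"
 shows "(LINT w:A|M. Y w) = 0"
proof (rule set_integral_zero_Dynkin[OF Y])
 note [measurable] = borel_measurable_integrable[OF Y]
 have W0: "AE w in M. W 0 w = 0" using W by (auto simp: brownian_motion_def)
 have cyl: "(LINT w:A|M. Y w) = 0" if "A \<in> cylinders t" for A
 proof -
  obtain l where l: "A = {w\<in>space M. \<forall>(s, a)\<in>set l. a \<le> W s w}" "\<forall>(s, a)\<in>set l. 0 \<le> s \<and> s \<le> t"
   using \<open>A \<in> cylinders t\<close> unfolding cylinders_def by blast
  have A: "A \<in> sets M" using that cylinders_sets[OF t(2)] by blast
  have "\<exists>DH. smooth (test_functional n l) DH \<and> (\<forall>r. t < r \<longrightarrow> (\<forall>w\<in>space M. DH r w = 0))" for n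
   by (rule test_functional_smooth[OF t(2)]) (use l(2) in auto)
  then obtain DH where DH: "\<And>n. smooth (test_functional n l) (DH n)" "\<And>n. \<forall>r. t < r \<longrightarrow> (\<forall>w\<in>space M. DH n r w = 0)" by metis
  have [measurable]: "test_functional n l \<in> borel_measurable M" for n by (rule smooth_functional_measurable[OF DH(1)])
  have "(%n. (LINT w|M. test_functional n l w * Y w)) \<longlonglongrightarrow> (LINT w|M. indicator A w * Y w)"
  proof (rule integral_dominated_convergence[where w = "%w. \<bar>Y w\<bar>"])
   have "AE w in M. w \<in> space M" by simp
   then show "AE w in M. (%n. test_functional n l w * Y w) \<longlonglongrightarrow> indicator A w * Y w"
    using W0
   proof eventually_elim
    case (elim w)
    have "(if \<forall>(s, a)\<in>set l. a \<le> W s w - W 0 w then 1 else 0) = (indicator A w :: real)"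
     using elim by (auto simp: l(1) indicator_def)
    then have "(%n. test_functional n l w) \<longlonglongrightarrow> indicator A w"
     using test_functional_tendsto[of l w] by (simp only:)
    then show ?case by (rule tendsto_mult_right)
   qed
   show "AE w in M. norm (test_functional n l w * Y w) \<le> \<bar>Y w\<bar>" for n
    using test_functional_bound[of n l] by (intro AE_I2) (auto simp: abs_mult intro!: mult_left_le_one_le)
   show "(%w. indicator A w * Y w) \<in> borel_measurable M" using A by measurable
  qed (use Y in auto)
  moreover have "(LINT w|M. test_functional n l w * Y w) = 0" for n by (rule orth[OF DH])
  ultimately have "(LINT w|M. indicator A w * Y w) = 0" by (simp add: LIMSEQ_const_iff)
  then show ?thesis by (simp add: set_lebesgue_integral_def)
 qed
 show "(LINT w:A|M. Y w) = 0" if "A \<in> cylinders t \<union> null_pieces" for A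
 proof (cases "A \<in> cylinders t")
  case False
  then have "A \<in> null_sets M" using that null_pieces_null by blast
  from AE_not_in[OF this] have "AE w in M. indicator A w *\<^sub>R Y w = 0" by eventually_elim simp
  then show ?thesis unfolding set_lebesgue_integral_def by (rule integral_eq_zero_AE)
 qed (rule cyl)
 have "{w\<in>space M. \<forall>(s, a)\<in>set []. a \<le> W s w} \<in> cylinders t" unfolding cylinders_def by (intro CollectI exI[of _ "[]"]) auto
 from cyl[OF this] show "(LINT w|M. Y w) = 0" using set_integral_space[OF Y] by simp
 show "Int_stable (cylinders t \<union> null_pieces)"
 proof (rule Int_stableI)
  fix A B assume AB: "A \<in> cylinders t \<union> null_pieces" "B \<in> cylinders t \<union> null_pieces"
  show "A \<inter> B \<in> cylinders t \<union> null_pieces"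
  proof (cases "A \<in> null_pieces \<or> B \<in> null_pieces")
   case True
   then show ?thesis unfolding null_pieces_def by blast
  next
   case False
   then obtain l k where l: "A = {w\<in>space M. \<forall>(s, a)\<in>set l. a \<le> W s w}" "\<forall>(s, a)\<in>set l. 0 \<le> s \<and> s \<le> t"
    and k: "B = {w\<in>space M. \<forall>(s, a)\<in>set k. a \<le> W s w}" "\<forall>(s, a)\<in>set k. 0 \<le> s \<and> s \<le> t"
    using AB unfolding cylinders_def by blast
   have "A \<inter> B = {w\<in>space M. \<forall>(s, a)\<in>set (l @ k). a \<le> W s w}" unfolding l(1) k(1) by auto
   moreover have "\<forall>(s, a)\<in>set (l @ k). 0 \<le> s \<and> s \<le> t" using l(2) k(2) by auto
   ultimately have "A \<inter> B \<in> cylinders t" unfolding cylinders_def by blast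
   then show ?thesis by simp
  qed
 qed
 show "cylinders t \<union> null_pieces \<subseteq> sets M" using cylinders_sets[OF t(2)] null_pieces_null by auto
 show "A \<in> sigma_sets (space M) (cylinders t \<union> null_pieces)" using A augmented_generated_by_cylinders by blast
qed

text \<open>Such a \<open>Y\<close> has integral zero over the cylinder sets, hence over all measurable sets.\<close>

lemma orthogonal_to_smooth:
 assumes Y: "integrable M Y" and orth: "\<And>H DH. smooth H DH \<Longrightarrow> (LINT w|M. H w * Y w) = 0"
 shows "AE w in M. Y w = 0"
 using T by (intro density_zero[OF Y] orthogonal_to_tests[OF _ _ Y orth]) (auto simp: sets_M)

lemma smooth_has_malliavin_deriv:
 assumes "smooth F DF"
 shows "has_malliavin_deriv M T W F DF"
 unfolding has_malliavin_deriv_def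
 by (rule exI[of _ "%_. F"], rule exI[of _ "%_. DF"])
  (intro conjI allI assms L2_converges_const smooth_functional_L2[OF assms] smooth_derivative_L2[OF assms])

text \<open>Both have the same pairing with every smooth functional.\<close>

lemma skorohod_unique:
 assumes S: "skorohod v S" and S': "skorohod v S'"
 shows "AE w in M. S w = S' w"
proof -
 have sq: "L2 M S" "L2 M S'" using S S' by (auto simp: has_skorohod_integral_def)
 have "AE w in M. S w - S' w = 0"
 proof (rule orthogonal_to_smooth)
  show "integrable M (%w. S w - S' w)" by (rule L2_integrable[OF L2_diff[OF sq]])
  fix H DH assume H: "smooth H DH"
  note HS = smooth_functional_L2[OF H]
  have "(LINT w|M. H w * (S w - S' w)) = (LINT w|M. H w * S w) - (LINT w|M. H w * S' w)"
   using integrable_mult_L2[OF HS sq(1)] integrable_mult_L2[OF HS sq(2)] by (simp add: right_diff_distrib)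
  moreover have "(LINT w|M. H w * S w) = (LINT w|M. H w * S' w)"
   using S S' smooth_has_malliavin_deriv[OF H] unfolding has_skorohod_integral_def by metis
  ultimately show "(LINT w|M. H w * (S w - S' w)) = 0" by simp
 qed
 then show ?thesis by eventually_elim simp
qed

section \<open>The derivative of an adapted process\<close>

text \<open>If \<open>g\<close> lives after time \<open>t\<close>, the Skorohod integral \<open>\<delta>(G g)\<close> is orthogonal to all
 functionals of the past.\<close>

lemma elem_skorohod_orthogonal_past:
 assumes G: "smooth G DG" and Y: "wiener g Y"
  and g: "\<And>r. r \<in> {0..t} \<Longrightarrow> g r = 0" and t: "0 \<le> t" "t \<le> T" and X: "X \<in> borel_measurable (\<F> t)"
 shows "(LINT w|M. X w * elem_skorohod G DG g Y w) = 0"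
proof -
 let ?U = "elem_skorohod G DG g Y"
 have U: "integrable M ?U" by (rule L2_integrable[OF elem_skorohod_L2[OF G Y]])
 have sub: "subalgebra M (\<F> t)" using augmented_subset[OF t(2)] by (simp add: subalgebra_def space_augmented)
 interpret finite_measure_subalgebra M "\<F> t" by unfold_locales (fact sub)
 have orth: "(LINT w:A|M. ?U w) = 0" if "A \<in> sets (\<F> t)" for A
 proof (rule orthogonal_to_tests[OF t U _ that])
  fix H DH assume H: "smooth H DH" "\<forall>r. t < r \<longrightarrow> (\<forall>w\<in>space M. DH r w = 0)"
  have "(LINT w|M. H w * ?U w) = (LINT w|M. G w * dir_deriv g DH w)" by (rule elem_skorohod_duality[OF G Y H(1)])
  also have "\<dots> = (LINT w|M. 0)"
  proof (rule lint_cong)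
   fix w assume "w \<in> space M"
   then have "DH s w * g s = 0" if "s \<in> {0..T}" for s
    using that g[of s] H(2) by (cases "s \<le> t") auto
   then have "dir_deriv g DH w = (LINT s|time. 0)" unfolding dir_deriv_def by (intro lint_cong) simp
   then show "G w * dir_deriv g DH w = 0" by simp
  qed
  finally show "(LINT w|M. H w * ?U w) = 0" by simp
 qed
 have ce: "AE w in M. real_cond_exp M (\<F> t) ?U w = 0"
  by (rule real_cond_exp_charact) (use U orth in \<open>auto simp: set_lebesgue_integral_def\<close>)
 show ?thesis
 proof (cases "integrable M (%w. X w * ?U w)")
  case True
  have "(LINT w|M. X w * ?U w) = (LINT w|M. X w * real_cond_exp M (\<F> t) ?U w)"
   using real_cond_exp_intg(2)[OF True X] U by simp
  also have "\<dots> = 0" by (rule integral_eq_zero_AE) (use ce in \<open>auto elim!: eventually_mono\<close>)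
  finally show ?thesis .
 qed (rule not_integrable_integral_eq)
qed

lemma time_sets_indicator_L2: "A \<in> sets time \<Longrightarrow> L2 time (indicator A)"
 by (rule L2_indicator) (use sets_time_measureD in blast)

text \<open>For \<open>t \<le> q\<close>, duality turns the pairing of \<open>D\<^sub>s \<sigma>\<^sub>t\<close> with \<open>1\<^sub>A(s) G\<close> into \<open>E(\<sigma>\<^sub>t \<delta>(1\<^sub>A G))\<close>. This
 vanishes, as \<open>\<sigma>\<^sub>t\<close> belongs to the past of \<open>q\<close> and \<open>1\<^sub>A\<close> lives after \<open>q\<close>.\<close>

lemma adapted_derivative_rectangle:
 assumes \<sigma>: "malliavin \<sigma> D\<sigma>"
  and adapted: "\<forall>t\<in>{0..T}. \<sigma> t \<in> borel_measurable (\<F> t)"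
  and q: "0 \<le> q" "q \<le> T" and A: "A \<in> sets time" "A \<subseteq> {q<..}" and B: "B \<in> sets time" "B \<subseteq> {..q}"
  and G: "smooth G DG"
 shows "(LINT (s, t, w)|TTM. D\<sigma> s t w * (indicator A s * (indicator B t * G w))) = 0"
proof -
 obtain vs Dvs Xs where v: "\<And>n. smooth_skorohod (vs n) (Dvs n) (Xs n)"
  "L2_converges TM (%n. case_prod (vs n)) (case_prod \<sigma>)"
  "L2_converges TTM (%n. case_triple (Dvs n)) (case_triple D\<sigma>)"
  by (rule malliavin_process_smooth_approx[OF \<sigma>]) (rule that)
 note iA = time_sets_indicator_L2[OF A(1)] and iB = time_sets_indicator_L2[OF B(1)]
 obtain Y where Y: "wiener (indicator A) Y" using wiener_exists[OF iA] by blast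
 let ?U = "elem_skorohod G DG (indicator A) Y"
 have US: "L2 M ?U" by (rule elem_skorohod_L2[OF G Y])
 note GS = smooth_functional_L2[OF G]
 have BG: "L2 TM (%p. indicator B (fst p) * G (snd p))"
  by (rule tensor_L2[OF sigma_finite_time sigma_finite_M iB GS])
 have ABG: "L2 TTM (%p. indicator A (fst p) * (indicator B (fst (snd p)) * G (snd (snd p))))"
  using tensor_L2[OF sigma_finite_time sigma_finite_time_M iA BG] .
 have BU: "L2 TM (%p. indicator B (fst p) * ?U (snd p))"
  by (rule tensor_L2[OF sigma_finite_time sigma_finite_M iB US])
 have eq: "(LINT p|TTM. case_triple (Dvs n) p * (indicator A (fst p) * (indicator B (fst (snd p)) * G (snd (snd p)))))
   = (LINT p|TM. case_prod (vs n) p * (indicator B (fst p) * ?U (snd p)))" for n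
 proof -
  obtain m :: nat and F DF h Z where r: "\<forall>j<m. smooth (F j) (DF j) \<and> wiener (h j) (Z j)"
   "\<forall>t\<in>{0..T}. \<forall>w\<in>space M. vs n t w = (\<Sum>j<m. F j w * h j t)"
   "\<forall>s\<in>{0..T}. \<forall>t\<in>{0..T}. \<forall>w\<in>space M. Dvs n s t w = (\<Sum>j<m. DF j s w * h j t)"
   "Xs n = (%w. \<Sum>j<m. elem_skorohod (F j) (DF j) (h j) (Z j) w)" by (rule smooth_skorohodE[OF v(1)[of n]])
  have F: "smooth (F j) (DF j)" and Z: "wiener (h j) (Z j)" if "j < m" for j using r(1) that by auto
  note h = wienerD(1)[OF Z]
  have Bh: "integrable time (%t. h j t * indicator B t)" if "j < m" for j by (rule integrable_mult_L2[OF h[OF that] iB])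
  have FU: "integrable M (%w. F j w * ?U w)" if "j < m" for j
   by (rule integrable_mult_L2[OF smooth_functional_L2[OF F[OF that]] US])
  have dG: "integrable M (%w. G w * dir_deriv (indicator A) (DF j) w)" if "j < m" for j
  proof -
   have Fj: "smooth (F j) (DF j)" by (rule F[OF that])
   obtain D2 where D2: "\<And>h. L2 time h \<Longrightarrow> smooth (dir_deriv h (DF j)) (D2 h)"
    by (rule smooth_functional_second_derivative[OF Fj]) blast
   show ?thesis by (rule integrable_mult_L2[OF GS smooth_functional_L2[OF D2[OF iA]]])
  qed
  have "(LINT p|TTM. case_triple (Dvs n) p * (indicator A (fst p) * (indicator B (fst (snd p)) * G (snd (snd p)))))
   = (LINT w|M. (LINT t|time. (LINT s|time. Dvs n s t w * (indicator A s * (indicator B t * G w)))))"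
   using integral_triple(2)[OF integrable_mult_L2[OF smooth_skorohod_L2(2)[OF v(1)] ABG]] by simp
  also have "\<dots> = (LINT w|M. (\<Sum>j<m. (LINT t|time. h j t * indicator B t) * (G w * dir_deriv (indicator A) (DF j) w)))"
  proof (rule lint_cong)
   fix w assume w: "w \<in> space M"
   have "(LINT s|time. Dvs n s t w * (indicator A s * (indicator B t * G w)))
     = (\<Sum>j<m. (h j t * indicator B t) * (G w * dir_deriv (indicator A) (DF j) w))" if t: "t \<in> {0..T}" for t
   proof -
    have "(LINT s|time. Dvs n s t w * (indicator A s * (indicator B t * G w)))
      = (LINT s|time. (\<Sum>j<m. (DF j s w * indicator A s) * (h j t * indicator B t * G w)))"
     by (rule lint_cong) (use r(3) t w in \<open>simp add: sum_distrib_left mult_ac\<close>)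
    also have "\<dots> = (\<Sum>j<m. (LINT s|time. (DF j s w * indicator A s) * (h j t * indicator B t * G w)))"
     by (rule Bochner_Integration.integral_sum, rule integrable_mult_left, rule integrable_mult_L2[OF smooth_functional_derivative(3)[OF F w] iA]) simp
    also have "\<dots> = (\<Sum>j<m. dir_deriv (indicator A) (DF j) w * (h j t * indicator B t * G w))"
     by (simp only: dir_deriv_def Bochner_Integration.integral_mult_left_zero)
    also have "\<dots> = (\<Sum>j<m. (h j t * indicator B t) * (G w * dir_deriv (indicator A) (DF j) w))"
     by (simp only: mult_ac)
    finally show ?thesis .
   qed
   then have "(LINT t|time. (LINT s|time. Dvs n s t w * (indicator A s * (indicator B t * G w))))
     = (LINT t|time. (\<Sum>j<m. (h j t * indicator B t) * (G w * dir_deriv (indicator A) (DF j) w)))"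
    by (intro lint_cong) simp
   also have "\<dots> = (\<Sum>j<m. (LINT t|time. (h j t * indicator B t) * (G w * dir_deriv (indicator A) (DF j) w)))"
    by (rule Bochner_Integration.integral_sum, rule integrable_mult_left, rule Bh) simp
   finally show "(LINT t|time. (LINT s|time. Dvs n s t w * (indicator A s * (indicator B t * G w))))
     = (\<Sum>j<m. (LINT t|time. h j t * indicator B t) * (G w * dir_deriv (indicator A) (DF j) w))" by simp
  qed
  also have "\<dots> = (\<Sum>j<m. (LINT t|time. h j t * indicator B t) * (LINT w|M. G w * dir_deriv (indicator A) (DF j) w))"
   by (subst Bochner_Integration.integral_sum, rule integrable_mult_right, rule dG) simp_all
  also have "\<dots> = (\<Sum>j<m. (LINT t|time. h j t * indicator B t) * (LINT w|M. F j w * ?U w))"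
   by (intro sum.cong refl arg_cong2[where f = "(*)"] elem_skorohod_duality[symmetric, OF G Y F]) auto
  also have "\<dots> = (\<Sum>j<m. (LINT p|TM. (h j (fst p) * indicator B (fst p)) * (F j (snd p) * ?U (snd p))))"
   by (intro sum.cong refl tensor_integral(2)[symmetric, OF sigma_finite_time sigma_finite_M Bh FU]) auto
  also have "\<dots> = (LINT p|TM. (\<Sum>j<m. (h j (fst p) * indicator B (fst p)) * (F j (snd p) * ?U (snd p))))"
   by (rule Bochner_Integration.integral_sum[symmetric], rule tensor_integral(1)[OF sigma_finite_time sigma_finite_M Bh FU]) auto
  also have "\<dots> = (LINT p|TM. case_prod (vs n) p * (indicator B (fst p) * ?U (snd p)))"
   by (rule lint_cong)
    (use r(2) in \<open>auto simp: space_pair_measure sum_distrib_left mult_ac\<close>)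
  finally show ?thesis .
 qed
 have lim1: "(%n. (LINT p|TTM. case_triple (Dvs n) p * (indicator A (fst p) * (indicator B (fst (snd p)) * G (snd (snd p))))))
  \<longlonglongrightarrow> (LINT p|TTM. case_triple D\<sigma> p * (indicator A (fst p) * (indicator B (fst (snd p)) * G (snd (snd p)))))"
  by (rule L2_converges_inner[OF v(3) L2_converges_const[OF ABG]])
 have lim2: "(%n. (LINT p|TM. case_prod (vs n) p * (indicator B (fst p) * ?U (snd p))))
  \<longlonglongrightarrow> (LINT p|TM. case_prod \<sigma> p * (indicator B (fst p) * ?U (snd p)))"
  by (rule L2_converges_inner[OF v(2) L2_converges_const[OF BU]])
 interpret TM: pair_sigma_finite time M
  using sigma_finite_time sigma_finite_M by (simp add: pair_sigma_finite_def)
 have ii: "integrable TM (%(t, w). \<sigma> t w * (indicator B t * ?U w))"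
  using integrable_mult_L2[OF L2_convergesD(2)[OF v(2)] BU] by (simp add: split_beta')
 have "(LINT p|TM. case_prod \<sigma> p * (indicator B (fst p) * ?U (snd p)))
   = (LINT t|time. (LINT w|M. \<sigma> t w * (indicator B t * ?U w)))"
  using TM.integral_fst[OF ii] by (simp add: split_beta')
 also have "\<dots> = (LINT t|time. 0)"
 proof (rule lint_cong)
  fix t assume "t \<in> space time"
  then have t: "t \<in> {0..T}" by simp
  show "(LINT w|M. \<sigma> t w * (indicator B t * ?U w)) = 0"
  proof (cases "t \<in> B")
   case True
   then have tq: "t \<le> q" using B by auto
   have "subalgebra (\<F> q) (\<F> t)" using augmented_mono[OF tq] by (simp add: subalgebra_def space_augmented)
   moreover have "\<sigma> t \<in> borel_measurable (\<F> t)" using adapted t by blast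
   ultimately have "\<sigma> t \<in> borel_measurable (\<F> q)" by (rule measurable_from_subalg)
   from elem_skorohod_orthogonal_past[OF G Y _ q this] have "(LINT w|M. \<sigma> t w * ?U w) = 0"
    by (rule meta_mp) (use A(2) in \<open>auto simp: indicator_def\<close>)
   then show ?thesis using True by simp
  qed simp
 qed
 finally have "(LINT p|TM. case_prod \<sigma> p * (indicator B (fst p) * ?U (snd p))) = 0" by simp
 then have "(LINT p|TTM. case_triple D\<sigma> p * (indicator A (fst p) * (indicator B (fst (snd p)) * G (snd (snd p))))) = 0"
  using LIMSEQ_unique[OF lim1 lim2[folded eq]] by simp
 then show ?thesis by (simp add: split_beta')
qed

end

lemma AE_snd:
 assumes "sigma_finite_measure N1" "sigma_finite_measure N2" and P: "AE q in N2. P q"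
 shows "AE p in N1 \<Otimes>\<^sub>M N2. P (snd p)"
proof -
 interpret N1: sigma_finite_measure N1 by fact
 interpret N2: sigma_finite_measure N2 by fact
 obtain N where N: "{q \<in> space N2. \<not> P q} \<subseteq> N" "N \<in> null_sets N2" using P by (auto elim!: AE_E simp: null_sets_def)
 show ?thesis
 proof (rule AE_I[where N = "space N1 \<times> N"])
  show "{p \<in> space (N1 \<Otimes>\<^sub>M N2). \<not> P (snd p)} \<subseteq> space N1 \<times> N" using N(1) by (auto simp: space_pair_measure)
  show "emeasure (N1 \<Otimes>\<^sub>M N2) (space N1 \<times> N) = 0" using N(2) by (subst N2.emeasure_pair_measure_Times) auto
  show "space N1 \<times> N \<in> sets (N1 \<Otimes>\<^sub>M N2)" using N(2) by auto
 qed
qed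

lemma AE_fst:
 assumes "sigma_finite_measure N1" "sigma_finite_measure N2" and P: "AE q in N1. P q"
 shows "AE p in N1 \<Otimes>\<^sub>M N2. P (fst p)"
proof -
 interpret N1: sigma_finite_measure N1 by fact
 interpret N2: sigma_finite_measure N2 by fact
 obtain N where N: "{q \<in> space N1. \<not> P q} \<subseteq> N" "N \<in> null_sets N1" using P by (auto elim!: AE_E simp: null_sets_def)
 show ?thesis
 proof (rule AE_I[where N = "N \<times> space N2"])
  show "{p \<in> space (N1 \<Otimes>\<^sub>M N2). \<not> P (fst p)} \<subseteq> N \<times> space N2" using N(1) by (auto simp: space_pair_measure)
  show "emeasure (N1 \<Otimes>\<^sub>M N2) (N \<times> space N2) = 0" using N(2) by (subst N2.emeasure_pair_measure_Times) auto
  show "N \<times> space N2 \<in> sets (N1 \<Otimes>\<^sub>M N2)" using N(2) by auto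
 qed
qed

context brownian begin

text \<open>The rectangles \<open>t \<le> q < s\<close> with rational \<open>q\<close> cover the triangle \<open>t < s\<close>.\<close>

lemma adapted_derivative_zero:
 assumes \<sigma>: "malliavin \<sigma> D\<sigma>"
  and adapted: "\<forall>t\<in>{0..T}. \<sigma> t \<in> borel_measurable (\<F> t)"
 shows "AE (s, t, w) in TTM. t < s \<longrightarrow> D\<sigma> s t w = 0"
proof -
 let ?T3 = "TTM"
 define D where "D = (case_triple D\<sigma>)"
 have DS: "L2 ?T3 D"
  using \<sigma> unfolding has_malliavin_deriv_process_def L2_converges_def D_def by blast
 have finT: "finite_measure time" by (rule finite_measure_time_measure)
 have finTM: "finite_measure TM" by (rule finite_measure_pair_measure[OF finite_measure_axioms finT])
 have cS: "L2 M (indicator C :: _ \<Rightarrow> real)" if "C \<in> sets M" for C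
  by (rule L2_of_bounded[where C = 1]) (use that in \<open>auto simp: indicator_def\<close>)
 have rect: "(LINT p|?T3. D p * (indicator A (fst p) * (indicator B (fst (snd p)) * indicator C (snd (snd p))))) = 0"
  if q: "0 \<le> q" "q \<le> T" and A: "A \<in> sets time" "A \<subseteq> {q<..}" and B: "B \<in> sets time" "B \<subseteq> {..q}" and C: "C \<in> sets M" for q A B C
 proof -
  note iA = time_sets_indicator_L2[OF A(1)] and iB = time_sets_indicator_L2[OF B(1)]
  define Y where "Y w = (LINT t|time. (LINT s|time. D (s, t, w) * (indicator A s * indicator B t)))" for w
  have S: "L2 ?T3 (%p. indicator A (fst p) * (indicator B (fst (snd p)) * g (snd (snd p))))" if "L2 M g" for g
   using tensor_L2[OF sigma_finite_time sigma_finite_time_M iA tensor_L2[OF sigma_finite_time sigma_finite_M iB that]] .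
  have I: "integrable M (%w. g w * Y w)" "(LINT p|?T3. D p * (indicator A (fst p) * (indicator B (fst (snd p)) * g (snd (snd p))))) = (LINT w|M. g w * Y w)"
   if g: "L2 M g" for g
  proof -
   have e: "(LINT t|time. (LINT s|time. D (s, t, w) * (indicator A s * (indicator B t * g w)))) = g w * Y w" for w
    unfolding Y_def by (simp add: mult.assoc[symmetric] mult.commute[of "g w"])
   note f = integrable_mult_L2[OF DS S[OF g]]
   show "integrable M (%w. g w * Y w)" using integral_triple(1)[OF f] by (simp add: e)
   show "(LINT p|?T3. D p * (indicator A (fst p) * (indicator B (fst (snd p)) * g (snd (snd p))))) = (LINT w|M. g w * Y w)"
    using integral_triple(2)[OF f] by (simp add: e)
  qed
  have "AE w in M. Y w = 0"
  proof (rule orthogonal_to_smooth)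
   have "L2 M (%_. 1)" by (simp add: square_integrable_def)
   from I(1)[OF this] show "integrable M Y" by simp
   fix H DH assume H: "smooth H DH"
   have "(LINT p|?T3. D p * (indicator A (fst p) * (indicator B (fst (snd p)) * H (snd (snd p))))) = 0"
    using adapted_derivative_rectangle[OF \<sigma> adapted q A B H] by (simp add: D_def split_beta')
   then show "(LINT w|M. H w * Y w) = 0" using I(2)[OF smooth_functional_L2[OF H]] by simp
  qed
  then have "(LINT w|M. indicator C w * Y w) = 0" by (intro integral_eq_zero_AE) (auto elim!: eventually_mono)
  then show ?thesis using I(2)[OF cS[OF C]] by simp
 qed
 have zero: "AE p in ?T3. D p * (indicator {q<..T} (fst p) * indicator {0..q} (fst (snd p))) = 0" if q: "0 \<le> q" "q \<le> T" for q
 proof -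
  have Q: "{q<..T} \<in> sets time" "{0..q} \<in> sets time" using q by (auto intro!: sets_time_measure_subset)
  define f where "f p = D p * (indicator {q<..T} (fst p) * indicator {0..q} (fst (snd p)))" for p
  have one: "L2 M (%_. 1)" by (simp add: square_integrable_def)
  have fI: "integrable ?T3 f"
   using integrable_mult_L2[OF DS tensor_L2[OF sigma_finite_time sigma_finite_time_M time_sets_indicator_L2[OF Q(1)]
    tensor_L2[OF sigma_finite_time sigma_finite_M time_sets_indicator_L2[OF Q(2)] one]]]
   by (simp add: f_def[abs_def])
  have "AE p in ?T3. f p = 0"
  proof (rule AE_zero_rectangles[OF finT finTM fI])
   fix A E assume A: "A \<in> sets time" and E: "E \<in> sets TM"
   define fA where "fA z = (LINT s|time. indicator A s * f (s, z))" for z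
   interpret P2: pair_sigma_finite time "TM"
    using sigma_finite_time sigma_finite_time_M by (simp add: pair_sigma_finite_def)
   have Am: "(%p. indicator A (fst p) :: real) \<in> borel_measurable ?T3"
    using measurable_compose[OF measurable_fst borel_measurable_indicator[OF A]] .
   have AfI: "integrable ?T3 (%(s, z). indicator A s * f (s, z))"
    by (rule Bochner_Integration.integrable_bound[OF fI])
     (use Am borel_measurable_integrable[OF fI] in \<open>auto simp: split_beta' abs_mult indicator_def intro!: borel_measurable_times\<close>)
   have fAI: "integrable TM fA"
    unfolding fA_def[abs_def] by (rule P2.integrable_snd[OF AfI])
   have conv: "(LINT p|?T3. indicator A (fst p) * g (snd p) * f p) = (LINT z|TM. g z * fA z)"
    if g: "g \<in> borel_measurable TM" "\<And>z. \<bar>g z\<bar> \<le> 1" for g :: "real \<times> 'a \<Rightarrow> real"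
   proof -
    have gI: "integrable ?T3 (%(s, z). g z * (indicator A s * f (s, z)))"
    proof (rule Bochner_Integration.integrable_bound[OF AfI])
     show "(%(s, z). g z * (indicator A s * f (s, z))) \<in> borel_measurable ?T3"
      using borel_measurable_times[OF measurable_compose[OF measurable_snd g(1)] borel_measurable_integrable[OF AfI]] by (simp add: split_beta')
     show "AE p in ?T3. norm (case p of (s, z) \<Rightarrow> g z * (indicator A s * f (s, z))) \<le> norm (case p of (s, z) \<Rightarrow> indicator A s * f (s, z))"
      using g(2) by (intro AE_I2) (auto simp: abs_mult intro!: mult_left_le_one_le)
    qed
    show ?thesis using P2.integral_snd[OF gI] by (simp add: fA_def split_beta' mult_ac)
   qed
   have "AE z in TM. fA z = 0"
   proof (rule AE_zero_rectangles[OF finT finite_measure_axioms fAI])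
    fix B C assume B: "B \<in> sets time" and C: "C \<in> sets M"
    have m: "(%z. indicator (B \<times> C) z :: real) \<in> borel_measurable TM" using B C by (intro borel_measurable_indicator) auto
    have "(LINT z:B \<times> C|TM. fA z) = (LINT z|TM. indicator (B \<times> C) z * fA z)" by (simp add: set_lebesgue_integral_def)
    also have "\<dots> = (LINT p|?T3. indicator A (fst p) * indicator (B \<times> C) (snd p) * f p)"
     by (rule conv[symmetric, OF m]) (auto simp: indicator_def)
    also have "\<dots> = (LINT p|?T3. D p * (indicator (A \<inter> {q<..T}) (fst p) * (indicator (B \<inter> {0..q}) (fst (snd p)) * indicator C (snd (snd p)))))"
     by (rule lint_cong) (auto simp: f_def indicator_def)
    also have "\<dots> = 0" by (rule rect[OF q]) (use A B C Q in auto)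
    finally show "(LINT z:B \<times> C|TM. fA z) = 0" .
   qed
   then have "(LINT z|TM. indicator E z * fA z) = 0" by (intro integral_eq_zero_AE) (auto elim!: eventually_mono)
   moreover have "(LINT p:A \<times> E|?T3. f p) = (LINT p|?T3. indicator A (fst p) * indicator E (snd p) * f p)"
    unfolding set_lebesgue_integral_def by (intro lint_cong) (auto simp: indicator_def)
   ultimately show "(LINT p:A \<times> E|?T3. f p) = 0"
    using conv[of "indicator E"] E by (simp add: indicator_def)
  qed
  then show ?thesis by (simp add: f_def)
 qed
 have "AE p in ?T3. \<forall>q\<in>\<rat> \<inter> {0..T}. D p * (indicator {q<..T} (fst p) * indicator {0..q} (fst (snd p))) = 0"
  using zero countable_rat by (subst AE_ball_countable) (auto intro: countable_Int1)
 then show ?thesis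
 proof (rule AE_mp, intro AE_I2 impI)
  fix p assume p: "p \<in> space ?T3" and z: "\<forall>q\<in>\<rat> \<inter> {0..T}. D p * (indicator {q<..T} (fst p) * indicator {0..q} (fst (snd p))) = 0"
  obtain s t w where st: "p = (s, t, w)" by (cases p) auto
  have rng: "s \<in> {0..T}" "t \<in> {0..T}" using p by (auto simp: st space_pair_measure)
  have "t < s \<longrightarrow> D\<sigma> s t w = 0"
  proof
   assume "t < s"
   then obtain q where q: "q \<in> \<rat>" "t < q" "q < s" using Rats_dense_in_real by blast
   then have "q \<in> \<rat> \<inter> {0..T}" using rng by auto
   from z[rule_format, OF this] show "D\<sigma> s t w = 0" using q rng by (simp add: st D_def)
  qed
  then show "case p of (s, t, w) \<Rightarrow> t < s \<longrightarrow> D\<sigma> s t w = 0" by (simp add: st)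
 qed
qed

end

section \<open>Products\<close>

lemma L2_bound_AE:
 assumes "L2 N g" "f \<in> borel_measurable N" "AE x in N. \<bar>f x\<bar> \<le> \<bar>g x\<bar>"
 shows "L2 N f"
 unfolding square_integrable_def
proof
 show "integrable N (%x. (f x)^2)"
 proof (rule Bochner_Integration.integrable_bound[OF L2D(2)[OF assms(1)]])
  show "(%x. (f x)^2) \<in> borel_measurable N" using assms(2) by (rule borel_measurable_power)
  show "AE x in N. norm ((f x)^2) \<le> norm ((g x)^2)" using assms(3) by eventually_elim (simp add: abs_le_square_iff)
 qed
qed fact

lemma L2_converges_le:
 assumes g: "L2_converges N gs g" and h: "\<And>n. hs n \<in> borel_measurable N" "L2 N h"
  and le: "\<And>n. AE x in N. \<bar>hs n x - h x\<bar> \<le> \<bar>gs n x - g x\<bar>"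
 shows "L2_converges N hs h"
proof -
 have d: "L2 N (%x. hs n x - h x)" for n
  by (rule L2_bound_AE[OF L2_diff[OF L2_convergesD(1)[OF g, of n] L2_convergesD(2)[OF g]] _ le])
   (rule borel_measurable_diff[OF h(1) L2D(1)[OF h(2)]])
 have hs: "L2 N (hs n)" for n
  using L2_add[OF d[of n] h(2)] by simp
 show ?thesis
  unfolding L2_converges_def
 proof (intro conjI allI hs h(2))
  show "(%n. (LINT x|N. (hs n x - h x)^2)) \<longlonglongrightarrow> 0"
  proof (rule tendsto_sandwich[OF _ _ tendsto_const L2_convergesD(3)[OF g]])
   show "\<forall>\<^sub>F n in sequentially. (LINT x|N. (hs n x - h x)^2) \<le> (LINT x|N. (gs n x - g x)^2)"
   proof (rule always_eventually, rule allI, rule integral_mono_AE)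
    fix n
    show "integrable N (%x. (hs n x - h x)^2)" by (rule L2D(2)[OF d])
    show "integrable N (%x. (gs n x - g x)^2)"
     by (rule L2D(2)[OF L2_diff[OF L2_convergesD(1)[OF g, of n] L2_convergesD(2)[OF g]]])
    show "AE x in N. (hs n x - h x)^2 \<le> (gs n x - g x)^2" using le[of n] by eventually_elim (simp add: abs_le_square_iff)
   qed
  qed simp
 qed
qed

lemma L2_converges_tensor:
 assumes s: "sigma_finite_measure N1" "sigma_finite_measure N2" and a: "L2 N1 a" and f: "L2_converges N2 fs f"
 shows "L2_converges (N1 \<Otimes>\<^sub>M N2) (%n p. a (fst p) * fs n (snd p)) (%p. a (fst p) * f (snd p))"
 unfolding L2_converges_def
proof (intro conjI allI tensor_L2[OF s a] L2_convergesD[OF f])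
 have "(LINT p|(N1 \<Otimes>\<^sub>M N2). (a (fst p) * fs n (snd p) - a (fst p) * f (snd p))^2) = (LINT x|N1. (a x)^2) * (LINT y|N2. (fs n y - f y)^2)" for n
  using tensor_integral(2)[OF s L2D(2)[OF a] L2D(2)[OF L2_diff[OF L2_convergesD(1)[OF f, of n] L2_convergesD(2)[OF f]]]]
  by (simp add: right_diff_distrib[symmetric] power_mult_distrib)
 then show "(%n. (LINT p|(N1 \<Otimes>\<^sub>M N2). (a (fst p) * fs n (snd p) - a (fst p) * f (snd p))^2)) \<longlonglongrightarrow> 0"
  using tendsto_mult_left[OF L2_convergesD(3)[OF f], of "(LINT x|N1. (a x)^2)"] by simp
qed

lemma choice_pair:
 assumes "\<And>n. \<exists>a b. P n a b"
 obtains f g where "\<And>n. P n (f n) (g n)"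
 using assms by metis

context brownian begin


lemma malliavin_L2:
 assumes "malliavin v Dv"
 shows "L2 TM (case_prod v)" "L2 TTM (case_triple Dv)"
 using assms unfolding has_malliavin_deriv_process_def L2_converges_def by blast+

lemma L2_convergesI_inverse:
 assumes "\<And>n. L2 N (fs n)" "L2 N f" "\<And>n. (LINT x|N. (fs n x - f x)^2) < c * inverse (real (Suc n))"
 shows "L2_converges N fs f"
 unfolding L2_converges_def
proof (intro conjI allI assms(1,2))
 have l: "(%n. c * inverse (real (Suc n))) \<longlonglongrightarrow> 0"
  using tendsto_mult_left[OF LIMSEQ_inverse_real_of_nat, of c] by simp
 show "(%n. (LINT x|N. (fs n x - f x)^2)) \<longlonglongrightarrow> 0"
  by (rule tendsto_sandwich[OF _ _ tendsto_const l]) (use assms(3) in \<open>auto intro!: always_eventually less_imp_le\<close>)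
qed

text \<open>Closedness of the derivative: a limit of limits of smooth processes is one, by a diagonal choice.\<close>

lemma malliavin_process_closed:
 assumes vn: "\<And>n. malliavin (vn n) (Dvn n)"
  and v: "L2_converges TM (%n. case_prod (vn n)) (case_prod v)"
  and Dv: "L2_converges TTM (%n. case_triple (Dvn n)) (case_triple Dv)"
 shows "malliavin v Dv"
proof -
 have step: "\<exists>u Du. smooth_process M T W u Du \<and>
   L2 TM (case_prod u) \<and> L2 TTM (case_triple Du) \<and>
   (LINT p|TM. (case_prod u p - case_prod v p)^2) < 4 * e \<and>
   (LINT p|TTM. (case_triple Du p - case_triple Dv p)^2) < 4 * e" if e: "e > 0" for e
 proof -
  have "\<forall>\<^sub>F n in sequentially. (LINT p|TM. (case_prod (vn n) p - case_prod v p)^2) < e"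
   "\<forall>\<^sub>F n in sequentially. (LINT p|TTM. (case_triple (Dvn n) p - case_triple Dv p)^2) < e"
   using order_tendstoD(2)[OF L2_convergesD(3)[OF v] e] order_tendstoD(2)[OF L2_convergesD(3)[OF Dv] e] by auto
  then have "\<forall>\<^sub>F n in sequentially. (LINT p|TM. (case_prod (vn n) p - case_prod v p)^2) < e \<and>
   (LINT p|TTM. (case_triple (Dvn n) p - case_triple Dv p)^2) < e" by (rule eventually_conj)
  then obtain n where n: "(LINT p|TM. (case_prod (vn n) p - case_prod v p)^2) < e"
   "(LINT p|TTM. (case_triple (Dvn n) p - case_triple Dv p)^2) < e"
   using eventually_happens'[OF sequentially_bot] by blast
  obtain us Dus where r: "\<And>k. smooth_process M T W (us k) (Dus k)"
   "L2_converges TM (%k. case_prod (us k)) (case_prod (vn n))"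
   "L2_converges TTM (%k. case_triple (Dus k)) (case_triple (Dvn n))"
   using vn[of n] unfolding has_malliavin_deriv_process_def by blast
  have "\<forall>\<^sub>F k in sequentially. (LINT p|TM. (case_prod (us k) p - case_prod (vn n) p)^2) < e"
   "\<forall>\<^sub>F k in sequentially. (LINT p|TTM. (case_triple (Dus k) p - case_triple (Dvn n) p)^2) < e"
   using order_tendstoD(2)[OF L2_convergesD(3)[OF r(2)] e] order_tendstoD(2)[OF L2_convergesD(3)[OF r(3)] e] by auto
  then have "\<forall>\<^sub>F k in sequentially. (LINT p|TM. (case_prod (us k) p - case_prod (vn n) p)^2) < e \<and>
   (LINT p|TTM. (case_triple (Dus k) p - case_triple (Dvn n) p)^2) < e" by (rule eventually_conj)
  then obtain k where k: "(LINT p|TM. (case_prod (us k) p - case_prod (vn n) p)^2) < e"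
   "(LINT p|TTM. (case_triple (Dus k) p - case_triple (Dvn n) p)^2) < e"
   using eventually_happens'[OF sequentially_bot] by blast
  have "(LINT p|TM. (case_prod (us k) p - case_prod v p)^2) < 4 * e"
   using L2_triangle[OF L2_convergesD(1)[OF r(2), of k] L2_convergesD(2)[OF r(2)] L2_convergesD(2)[OF v]] n(1) k(1) by linarith
  moreover have "(LINT p|TTM. (case_triple (Dus k) p - case_triple Dv p)^2) < 4 * e"
   using L2_triangle[OF L2_convergesD(1)[OF r(3), of k] L2_convergesD(2)[OF r(3)] L2_convergesD(2)[OF Dv]] n(2) k(2) by linarith
  ultimately show ?thesis using r(1)[of k] L2_convergesD(1)[OF r(2), of k] L2_convergesD(1)[OF r(3), of k] by blast
 qed
 let ?P = "%n u Du. smooth_process M T W u Du \<and>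
   L2 TM (case_prod u) \<and> L2 TTM (case_triple Du) \<and>
   (LINT p|TM. (case_prod u p - case_prod v p)^2) < 4 * inverse (real (Suc n)) \<and>
   (LINT p|TTM. (case_triple Du p - case_triple Dv p)^2) < 4 * inverse (real (Suc n))"
 have "\<exists>u Du. ?P n u Du" for n
  by (rule step) simp
 then obtain us Dus where "\<And>n. ?P n (us n) (Dus n)"
  by (rule choice_pair[where P = ?P]) blast
 then have r: "smooth_process M T W (us n) (Dus n)"
   "L2 TM (case_prod (us n))" "L2 TTM (case_triple (Dus n))"
   "(LINT p|TM. (case_prod (us n) p - case_prod v p)^2) < 4 * inverse (real (Suc n))"
   "(LINT p|TTM. (case_triple (Dus n) p - case_triple Dv p)^2) < 4 * inverse (real (Suc n))" for n
  by blast+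
 show ?thesis
  unfolding has_malliavin_deriv_process_def
  using r(1) L2_convergesI_inverse[OF r(2) L2_convergesD(2)[OF v] r(4)] L2_convergesI_inverse[OF r(3) L2_convergesD(2)[OF Dv] r(5)] by blast
qed

lemma malliavin_process_cong_AE:
 assumes v: "malliavin v Dv"
  and m: "(case_triple Dv') \<in> borel_measurable TTM"
  and eq: "AE (s, t, w) in TTM. Dv s t w = Dv' s t w"
 shows "malliavin v Dv'"
proof (rule malliavin_process_closed[where vn = "%_. v" and Dvn = "%_. Dv", OF v])
 note s = malliavin_L2[OF v]
 show "L2_converges TM (%n. case_prod v) (case_prod v)" by (rule L2_converges_const[OF s(1)])
 have "AE p in TTM. \<bar>case p of (s, t, w) \<Rightarrow> Dv' s t w\<bar> \<le> \<bar>case p of (s, t, w) \<Rightarrow> Dv s t w\<bar>"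
  using eq by eventually_elim auto
 then have s': "L2 TTM (case_triple Dv')" by (rule L2_bound_AE[OF s(2) m])
 show "L2_converges TTM (%n. case_triple Dv) (case_triple Dv')"
 proof (rule L2_converges_le[OF L2_converges_const[OF s(2)] L2D(1)[OF s(2)] s'])
  show "AE p in TTM. \<bar>case_triple Dv p - case_triple Dv' p\<bar> \<le> \<bar>case_triple Dv p - case_triple Dv p\<bar>"
   using eq by eventually_elim auto
 qed
qed

lemma malliavin_process_time_mult:
 assumes v: "malliavin v Dv"
  and k: "k \<in> borel_measurable time" "\<And>t. \<bar>k t\<bar> \<le> 1"
 shows "malliavin (%t w. v t w * k t) (%s t w. Dv s t w * k t)"
proof -
 obtain us Dus where r: "\<And>n. smooth_process M T W (us n) (Dus n)"
  "L2_converges TM (%n. case_prod (us n)) (case_prod v)"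
  "L2_converges TTM (%n. case_triple (Dus n)) (case_triple Dv)"
  using v unfolding has_malliavin_deriv_process_def by blast
 have sm: "smooth_process M T W (%t w. us n t w * k t) (%s t w. Dus n s t w * k t)" for n
 proof -
  obtain m :: nat and F DF h where q: "(\<forall>j<m. smooth (F j) (DF j) \<and> L2 time (h j))"
   "(\<forall>t\<in>{0..T}. \<forall>w\<in>space M. us n t w = (\<Sum>j<m. F j w * h j t))"
   "(\<forall>s\<in>{0..T}. \<forall>t\<in>{0..T}. \<forall>w\<in>space M. Dus n s t w = (\<Sum>j<m. DF j s w * h j t))"
   using r(1)[of n] unfolding smooth_process_def by (elim exE conjE)
  show ?thesis
   unfolding smooth_process_def
  proof (rule exI[of _ m], rule exI[of _ F], rule exI[of _ DF], rule exI[of _ "%j t. h j t * k t"], intro conjI allI impI ballI)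
   fix j assume "j < m"
   then have h: "L2 time (h j)" using q(1) by simp
   show "L2 time (%t. h j t * k t)"
    by (rule L2_bound[OF h, where C = 1])
     (use k borel_measurable_times[OF L2D(1)[OF h] k(1)] in \<open>auto simp: abs_mult intro!: mult_right_le_one_le\<close>)
  qed (use q in \<open>auto simp: sum_distrib_right mult.assoc\<close>)
 qed
 have km: "(%p. k (fst p)) \<in> borel_measurable TM" "(%p. k (fst (snd p))) \<in> borel_measurable TTM"
  using measurable_compose[OF measurable_fst k(1)] measurable_compose[OF measurable_compose[OF measurable_snd measurable_fst] k(1)] by auto
 have le: "\<bar>a * k t - b * k t\<bar> \<le> \<bar>a - b\<bar>" "\<bar>a * k t\<bar> \<le> \<bar>a\<bar>" for a b t
  using k(2)[of t] by (simp_all add: left_diff_distrib[symmetric] abs_mult mult_right_le_one_le)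
 have m1: "(%(t, w). f t w * k t) \<in> borel_measurable TM" if "L2 TM (case_prod f)" for f
  using borel_measurable_times[OF L2D(1)[OF that] km(1)] by (simp add: split_beta')
 have m2: "(%(s, t, w). f s t w * k t) \<in> borel_measurable TTM" if "L2 TTM (case_triple f)" for f
  using borel_measurable_times[OF L2D(1)[OF that] km(2)] by (simp add: split_beta')
 have s1: "L2 TM (%(t, w). v t w * k t)"
  by (rule L2_bound[OF L2_convergesD(2)[OF r(2)] m1[OF L2_convergesD(2)[OF r(2)]], where C = 1]) (use le in auto)
 have s2: "L2 TTM (%(s, t, w). Dv s t w * k t)"
  by (rule L2_bound[OF L2_convergesD(2)[OF r(3)] m2[OF L2_convergesD(2)[OF r(3)]], where C = 1]) (use le in auto)
 have "L2_converges TM (%n (t, w). us n t w * k t) (%(t, w). v t w * k t)"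
  by (rule L2_converges_le[OF r(2) m1[OF L2_convergesD(1)[OF r(2)]] s1]) (use le in auto)
 moreover have "L2_converges TTM (%n (s, t, w). Dus n s t w * k t) (%(s, t, w). Dv s t w * k t)"
  by (rule L2_converges_le[OF r(3) m2[OF L2_convergesD(1)[OF r(3)]] s2]) (use le in auto)
 ultimately show ?thesis
  unfolding has_malliavin_deriv_process_def
  by (intro exI[of _ "%n t w. us n t w * k t"] exI[of _ "%n s t w. Dus n s t w * k t"] conjI allI sm)
qed

lemma sum_div_mod: "(\<Sum>i<m * k. f (i div k) (i mod k)) = (\<Sum>a<m. \<Sum>b<k. f a (b::nat))" for f :: "nat \<Rightarrow> nat \<Rightarrow> real"
proof (cases "k = 0")
 case False
 have "(\<Sum>i<m * k. f (i div k) (i mod k)) = (\<Sum>a<m. sum (%i. f (i div k) (i mod k)) {a * k..<a * k + k})"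
  by (rule sum.nat_group[symmetric])
 also have "\<dots> = (\<Sum>a<m. \<Sum>b<k. f a b)"
 proof (rule sum.cong[OF refl])
  fix a
  have "sum (%i. f (i div k) (i mod k)) {a * k..<a * k + k} = sum (%i. f ((i + a * k) div k) ((i + a * k) mod k)) {0..<k}"
   using sum.shift_bounds_nat_ivl[of "%i. f (i div k) (i mod k)" 0 "a * k" k] by (simp add: add.commute)
  then show "sum (%i. f (i div k) (i mod k)) {a * k..<a * k + k} = (\<Sum>b<k. f a b)"
   using False by (simp add: lessThan_atLeast0)
 qed
 finally show ?thesis .
qed simp

text \<open>Smooth processes whose functions of time are bounded; they are dense, by truncation.\<close>

definition bounded_smooth :: "(real \<Rightarrow> 'a \<Rightarrow> real) \<Rightarrow> (real \<Rightarrow> real \<Rightarrow> 'a \<Rightarrow> real) \<Rightarrow> bool" where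
 "bounded_smooth v Dv \<longleftrightarrow> (\<exists>(m::nat) F DF h c. (\<forall>j<m. smooth (F j) (DF j) \<and> L2 time (h j) \<and> (\<forall>t. \<bar>h j t\<bar> \<le> c)) \<and>
  v = (%t w. \<Sum>j<m. F j w * h j t) \<and> Dv = (%s t w. \<Sum>j<m. DF j s w * h j t))"

lemma bounded_smooth_dense:
 assumes u: "malliavin u Du"
 obtains us Dus where "\<And>n. bounded_smooth (us n) (Dus n)"
  "L2_converges TM (%n. case_prod (us n)) (case_prod u)"
  "L2_converges TTM (%n. case_triple (Dus n)) (case_triple Du)"
proof -
 obtain vs Dvs where r: "\<And>n. smooth_process M T W (vs n) (Dvs n)"
  "L2_converges TM (%n. case_prod (vs n)) (case_prod u)"
  "L2_converges TTM (%n. case_triple (Dvs n)) (case_triple Du)"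
  using u unfolding has_malliavin_deriv_process_def by blast
 have step: "\<exists>b Db. bounded_smooth b Db \<and> L2 TM (case_prod b) \<and> L2 TTM (case_triple Db) \<and>
   (LINT p|TM. (case_prod b p - case_prod (vs n) p)^2) < e \<and>
   (LINT p|TTM. (case_triple Db p - case_triple (Dvs n) p)^2) < e" if e: "e > 0" for e n
 proof -
  obtain m :: nat and F DF h where q: "(\<forall>j<m. smooth (F j) (DF j) \<and> L2 time (h j))"
   "(\<forall>t\<in>{0..T}. \<forall>w\<in>space M. vs n t w = (\<Sum>j<m. F j w * h j t))"
   "(\<forall>s\<in>{0..T}. \<forall>t\<in>{0..T}. \<forall>w\<in>space M. Dvs n s t w = (\<Sum>j<m. DF j s w * h j t))"
   using r(1)[of n] unfolding smooth_process_def by (elim exE conjE)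
  have F: "smooth (F j) (DF j)" and h: "L2 time (h j)" if "j < m" for j using q(1) that by auto
  define hk where "hk k j t = (if \<bar>h j t\<bar> \<le> real k then h j t else 0)" for k j t
  have hk_le: "\<bar>hk k j t\<bar> \<le> \<bar>h j t\<bar>" "\<bar>hk k j t\<bar> \<le> real k" for k j t by (auto simp: hk_def)
  have hk: "L2 time (hk k j)" if "j < m" for k j
  proof (rule L2_bound[OF h[OF that], where C = 1])
   note [measurable] = L2D(1)[OF h[OF that]]
   show "hk k j \<in> borel_measurable time" unfolding hk_def[abs_def] by measurable
  qed (use hk_le in auto)
  have hk_lim: "(%k. hk k j t) \<longlonglongrightarrow> h j t" for j t
  proof (rule tendsto_eventually)
   show "\<forall>\<^sub>F k in sequentially. hk k j t = h j t"
    using eventually_ge_at_top[of "nat \<lceil>\<bar>h j t\<bar>\<rceil>"]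
   proof eventually_elim
    case (elim k)
    then have "\<bar>h j t\<bar> \<le> real k" by linarith
    then show ?case by (simp add: hk_def)
   qed
  qed
  have bs: "bounded_smooth (%t w. \<Sum>j<m. F j w * hk k j t) (%s t w. \<Sum>j<m. DF j s w * hk k j t)" for k
   unfolding bounded_smooth_def using F hk hk_le by (intro exI[of _ m] exI[of _ F] exI[of _ DF] exI[of _ "hk k"] exI[of _ "real k"]) auto
  have S: "L2 TM (%p. F j (snd p) * h j (fst p))" "L2 TTM (%p. DF j (fst p) (snd (snd p)) * h j (fst (snd p)))" if "j < m" for j
   using smooth_process_L2[of 1 "%_. F j" "%_. DF j" "%_. h j"] F[OF that] h[OF that] by (auto simp: split_beta')
  have Sk: "L2 TM (%p. F j (snd p) * hk k j (fst p))" "L2 TTM (%p. DF j (fst p) (snd (snd p)) * hk k j (fst (snd p)))" if "j < m" for j k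
   using smooth_process_L2[of 1 "%_. F j" "%_. DF j" "%_. hk k j"] F[OF that] hk[OF that] by (auto simp: split_beta')
  have abs: "L2 N (%x. \<bar>f x\<bar>)" if "L2 N f" for N and f :: "'b \<Rightarrow> real"
   using that by (auto simp: square_integrable_def)
  have "L2_converges TM (%k p. \<Sum>j<m. F j (snd p) * hk k j (fst p)) (%p. \<Sum>j<m. F j (snd p) * h j (fst p))"
  proof (rule L2_converges_sum)
   fix j assume "j \<in> {..<m}"
   then have j: "j < m" by simp
   show "L2_converges TM (%k p. F j (snd p) * hk k j (fst p)) (%p. F j (snd p) * h j (fst p))"
    by (rule L2_converges_dominated[OF L2D(1)[OF Sk(1)[OF j]] L2D(1)[OF S(1)[OF j]] abs[OF S(1)[OF j]]])
     (auto intro!: AE_I2 tendsto_mult_left hk_lim mult_left_mono hk_le simp: abs_mult)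
  qed
  then have l1: "L2_converges TM (%k (t, w). \<Sum>j<m. F j w * hk k j t) (%(t, w). \<Sum>j<m. F j w * h j t)" by (simp add: split_beta')
  have "L2_converges TTM (%k p. \<Sum>j<m. DF j (fst p) (snd (snd p)) * hk k j (fst (snd p))) (%p. \<Sum>j<m. DF j (fst p) (snd (snd p)) * h j (fst (snd p)))"
  proof (rule L2_converges_sum)
   fix j assume "j \<in> {..<m}"
   then have j: "j < m" by simp
   show "L2_converges TTM (%k p. DF j (fst p) (snd (snd p)) * hk k j (fst (snd p))) (%p. DF j (fst p) (snd (snd p)) * h j (fst (snd p)))"
    by (rule L2_converges_dominated[OF L2D(1)[OF Sk(2)[OF j]] L2D(1)[OF S(2)[OF j]] abs[OF S(2)[OF j]]])
     (auto intro!: AE_I2 tendsto_mult_left hk_lim mult_left_mono hk_le simp: abs_mult)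
  qed
  then have l2: "L2_converges TTM (%k (s, t, w). \<Sum>j<m. DF j s w * hk k j t) (%(s, t, w). \<Sum>j<m. DF j s w * h j t)" by (simp add: split_beta')
  obtain k where k: "(LINT p|TM. ((case p of (t, w) \<Rightarrow> \<Sum>j<m. F j w * hk k j t) - (case p of (t, w) \<Rightarrow> \<Sum>j<m. F j w * h j t))^2) < e"
   "(LINT p|TTM. ((case p of (s, t, w) \<Rightarrow> \<Sum>j<m. DF j s w * hk k j t) - (case p of (s, t, w) \<Rightarrow> \<Sum>j<m. DF j s w * h j t))^2) < e"
   using eventually_happens'[OF sequentially_bot eventually_conj[OF order_tendstoD(2)[OF L2_convergesD(3)[OF l1] e] order_tendstoD(2)[OF L2_convergesD(3)[OF l2] e]]] by blast
  have "(LINT p|TM. ((case p of (t, w) \<Rightarrow> \<Sum>j<m. F j w * hk k j t) - case_prod (vs n) p)^2) =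
   (LINT p|TM. ((case p of (t, w) \<Rightarrow> \<Sum>j<m. F j w * hk k j t) - (case p of (t, w) \<Rightarrow> \<Sum>j<m. F j w * h j t))^2)"
   by (rule lint_cong) (use q(2) in \<open>auto simp: space_pair_measure\<close>)
  moreover have "(LINT p|TTM. ((case p of (s, t, w) \<Rightarrow> \<Sum>j<m. DF j s w * hk k j t) - case_triple (Dvs n) p)^2) =
   (LINT p|TTM. ((case p of (s, t, w) \<Rightarrow> \<Sum>j<m. DF j s w * hk k j t) - (case p of (s, t, w) \<Rightarrow> \<Sum>j<m. DF j s w * h j t))^2)"
   by (rule lint_cong) (use q(3) in \<open>auto simp: space_pair_measure\<close>)
  ultimately show ?thesis
   by (intro exI[of _ "%t w. \<Sum>j<m. F j w * hk k j t"] exI[of _ "%s t w. \<Sum>j<m. DF j s w * hk k j t"] conjI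
    bs[of k] L2_convergesD(1)[OF l1, of k] L2_convergesD(1)[OF l2, of k]) (simp_all only: k)
 qed
 let ?P = "%n b Db. bounded_smooth b Db \<and> L2 TM (case_prod b) \<and> L2 TTM (case_triple Db) \<and>
   (LINT p|TM. (case_prod b p - case_prod (vs n) p)^2) < inverse (real (Suc n)) \<and>
   (LINT p|TTM. (case_triple Db p - case_triple (Dvs n) p)^2) < inverse (real (Suc n))"
 have "\<exists>b Db. ?P n b Db" for n
  by (rule step) simp
 then obtain us Dus where "\<And>n. ?P n (us n) (Dus n)"
  by (rule choice_pair[where P = ?P]) blast
 then have b: "bounded_smooth (us n) (Dus n)" "L2 TM (case_prod (us n))"
   "L2 TTM (case_triple (Dus n))"
   "(LINT p|TM. (case_prod (us n) p - case_prod (vs n) p)^2) < inverse (real (Suc n))"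
   "(LINT p|TTM. (case_triple (Dus n) p - case_triple (Dvs n) p)^2) < inverse (real (Suc n))" for n
  by blast+
 have comb: "L2_converges N as c" if a: "\<And>n. L2 N (as n)" and ab: "\<And>n. (LINT x|N. (as n x - bs n x)^2) < inverse (real (Suc n))"
  and bc: "L2_converges N bs c" for N and as bs :: "nat \<Rightarrow> 'b \<Rightarrow> real" and c
  unfolding L2_converges_def
 proof (intro conjI allI a L2_convergesD(2)[OF bc])
  show "(%n. (LINT x|N. (as n x - c x)^2)) \<longlonglongrightarrow> 0"
  proof (rule tendsto_sandwich[OF _ _ tendsto_const])
   show "(%n. 2 * inverse (real (Suc n)) + 2 * (LINT x|N. (bs n x - c x)^2)) \<longlonglongrightarrow> 0"
    using tendsto_add[OF tendsto_mult_left[OF LIMSEQ_inverse_real_of_nat, of 2] tendsto_mult_left[OF L2_convergesD(3)[OF bc], of 2]] by simp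
   show "\<forall>\<^sub>F n in sequentially. (LINT x|N. (as n x - c x)^2) \<le> 2 * inverse (real (Suc n)) + 2 * (LINT x|N. (bs n x - c x)^2)"
   proof (intro always_eventually allI)
    fix n
    show "(LINT x|N. (as n x - c x)^2) \<le> 2 * inverse (real (Suc n)) + 2 * (LINT x|N. (bs n x - c x)^2)"
     using L2_triangle[OF a[of n] L2_convergesD(1)[OF bc, of n] L2_convergesD(2)[OF bc]] ab[of n] by linarith
   qed
  qed simp
 qed
 show thesis
  by (rule that[OF b(1) comb[OF b(2) b(4) r(2)] comb[OF b(3) b(5) r(3)]])
qed

end

lemma abs_mult_right_le:
 fixes a b c k :: real
 assumes "\<bar>b\<bar> \<le> \<bar>k\<bar>"
 shows "\<bar>a * b - c * b\<bar> \<le> \<bar>k * a - k * c\<bar>" "\<bar>a * b\<bar> \<le> \<bar>k * a\<bar>"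
proof -
 have "a * b - c * b = b * (a - c)" "k * a - k * c = k * (a - c)" by (simp_all add: algebra_simps)
 then show "\<bar>a * b - c * b\<bar> \<le> \<bar>k * a - k * c\<bar>" using assms by (simp only: abs_mult) (rule mult_right_mono, auto)
 show "\<bar>a * b\<bar> \<le> \<bar>k * a\<bar>" using mult_right_mono[OF assms, of "\<bar>a\<bar>"] by (simp add: abs_mult mult.commute)
qed

context brownian begin

lemma bounded_smooth_L2:
 assumes "bounded_smooth v Dv"
 shows "L2 TM (case_prod v)" "L2 TTM (case_triple Dv)"
proof -
 obtain m :: nat and F DF h c where q: "\<forall>j<m. smooth (F j) (DF j) \<and> L2 time (h j) \<and> (\<forall>t. \<bar>h j t\<bar> \<le> c)"
  "v = (%t w. \<Sum>j<m. F j w * h j t)" "Dv = (%s t w. \<Sum>j<m. DF j s w * h j t)"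
  using assms unfolding bounded_smooth_def by (elim exE conjE)
 show "L2 TM (case_prod v)" "L2 TTM (case_triple Dv)"
  unfolding q(2,3) by (rule smooth_process_L2; use q(1) in blast)+
qed

lemma bounded_smooth_bounds:
 assumes "bounded_smooth v Dv"
 obtains c \<kappa> where "\<And>t w. w \<in> space M \<Longrightarrow> \<bar>v t w\<bar> \<le> c" "L2 time \<kappa>"
  "\<And>s t w. s \<in> {0..T} \<Longrightarrow> w \<in> space M \<Longrightarrow> \<bar>Dv s t w\<bar> \<le> \<kappa> s"
proof -
 obtain m :: nat and F DF h c where q: "\<forall>j<m. smooth (F j) (DF j) \<and> L2 time (h j) \<and> (\<forall>t. \<bar>h j t\<bar> \<le> c)"
  "v = (%t w. \<Sum>j<m. F j w * h j t)" "Dv = (%s t w. \<Sum>j<m. DF j s w * h j t)"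
  using assms unfolding bounded_smooth_def by (elim exE conjE)
 have "\<forall>j. \<exists>C. j < m \<longrightarrow> (\<forall>w\<in>space M. \<bar>F j w\<bar> \<le> C)"
  using q(1) by (metis smooth_functional_bounded)
 from choice[OF this] obtain C where C: "\<And>j w. j < m \<Longrightarrow> w \<in> space M \<Longrightarrow> \<bar>F j w\<bar> \<le> C j" by blast
 have "\<forall>j. \<exists>K. j < m \<longrightarrow> L2 time K \<and> (\<forall>s\<in>{0..T}. \<forall>w\<in>space M. \<bar>DF j s w\<bar> \<le> K s)"
 proof
  fix j
  show "\<exists>K. j < m \<longrightarrow> L2 time K \<and> (\<forall>s\<in>{0..T}. \<forall>w\<in>space M. \<bar>DF j s w\<bar> \<le> K s)"
  proof (cases "j < m")
   case True
   then have "smooth (F j) (DF j)" using q(1) by blast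
   from smooth_functional_derivative(2)[OF this] show ?thesis by blast
  qed simp
 qed
 from choice[OF this] obtain K where K: "\<And>j. j < m \<Longrightarrow> L2 time (K j)"
  "\<And>j s w. j < m \<Longrightarrow> s \<in> {0..T} \<Longrightarrow> w \<in> space M \<Longrightarrow> \<bar>DF j s w\<bar> \<le> K j s" by blast
 have h: "\<bar>h j t\<bar> \<le> c" if "j < m" for j t using q(1) that by blast
 show thesis
 proof (rule that)
  fix t w assume w: "w \<in> space M"
  have "\<bar>v t w\<bar> \<le> (\<Sum>j<m. \<bar>F j w * h j t\<bar>)" unfolding q(2) by (rule sum_abs)
  also have "\<dots> \<le> (\<Sum>j<m. \<bar>C j\<bar> * \<bar>c\<bar>)"
   by (rule sum_mono) (use C[OF _ w] h in \<open>auto simp: abs_mult intro!: mult_mono order_trans[OF C[OF _ w]] order_trans[OF h]\<close>)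
  finally show "\<bar>v t w\<bar> \<le> (\<Sum>j<m. \<bar>C j\<bar> * \<bar>c\<bar>)" .
 next
  show "L2 time (%s. \<Sum>j<m. \<bar>c\<bar> * K j s)"
   using K(1) by (intro L2_sum L2_cmult) auto
 next
  fix s t w assume s: "s \<in> {0..T}" and w: "w \<in> space M"
  have "\<bar>Dv s t w\<bar> \<le> (\<Sum>j<m. \<bar>DF j s w * h j t\<bar>)" unfolding q(3) by (rule sum_abs)
  also have "\<dots> \<le> (\<Sum>j<m. \<bar>c\<bar> * K j s)"
  proof (rule sum_mono)
   fix j assume "j \<in> {..<m}"
   then have j: "j < m" by simp
   have "\<bar>DF j s w * h j t\<bar> = \<bar>h j t\<bar> * \<bar>DF j s w\<bar>" by (simp add: abs_mult mult.commute)
   also have "\<dots> \<le> \<bar>c\<bar> * K j s" by (rule mult_mono) (use h[OF j, of t] K(2)[OF j s w] in auto)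
   finally show "\<bar>DF j s w * h j t\<bar> \<le> \<bar>c\<bar> * K j s" .
  qed
  finally show "\<bar>Dv s t w\<bar> \<le> (\<Sum>j<m. \<bar>c\<bar> * K j s)" .
 qed
qed

text \<open>The coefficient functions of the product are the products \<open>h\<^sub>j g\<^sub>k\<close>; they are square integrable because
 the \<open>h\<^sub>j\<close> are bounded.\<close>

lemma bounded_smooth_mult_smooth:
 assumes v: "bounded_smooth v Dv" and \<sigma>: "smooth_process M T W \<sigma> D\<sigma>"
 shows "smooth_process M T W (%t w. v t w * \<sigma> t w) (%s t w. \<sigma> t w * Dv s t w + v t w * D\<sigma> s t w)"
proof -
 obtain m :: nat and F DF h c where q: "\<forall>j<m. smooth (F j) (DF j) \<and> L2 time (h j) \<and> (\<forall>t. \<bar>h j t\<bar> \<le> c)"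
  "v = (%t w. \<Sum>j<m. F j w * h j t)" "Dv = (%s t w. \<Sum>j<m. DF j s w * h j t)"
  using v unfolding bounded_smooth_def by (elim exE conjE)
 obtain l :: nat and G DG g where r: "\<forall>k<l. smooth (G k) (DG k) \<and> L2 time (g k)"
  "\<forall>t\<in>{0..T}. \<forall>w\<in>space M. \<sigma> t w = (\<Sum>k<l. G k w * g k t)"
  "\<forall>s\<in>{0..T}. \<forall>t\<in>{0..T}. \<forall>w\<in>space M. D\<sigma> s t w = (\<Sum>k<l. DG k s w * g k t)"
  using \<sigma> unfolding smooth_process_def by (elim exE conjE)
 define F' where "F' i w = F (i div l) w * G (i mod l) w" for i w
 define DF' where "DF' i s w = G (i mod l) w * DF (i div l) s w + F (i div l) w * DG (i mod l) s w" for i s w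
 define h' where "h' i t = h (i div l) t * g (i mod l) t" for i t
 show ?thesis
  unfolding smooth_process_def
 proof (rule exI[of _ "m * l"], rule exI[of _ F'], rule exI[of _ DF'], rule exI[of _ h'], intro conjI allI impI ballI)
  fix i assume "i < m * l"
  then have i: "i div l < m" "i mod l < l" by (auto simp: less_mult_imp_div_less intro!: mod_less_divisor gr0I)
  show "smooth (F' i) (DF' i)"
   unfolding F'_def[abs_def] DF'_def[abs_def] using q(1) r(1) i by (intro smooth_functional_product) auto
  have H: "L2 time (h (i div l))" "L2 time (g (i mod l))" "\<And>t. \<bar>h (i div l) t\<bar> \<le> c" using q(1) r(1) i by auto
  show "L2 time (h' i)"
   unfolding h'_def[abs_def]
   by (rule L2_bound[OF H(2), where C = c])
    (use H(3) borel_measurable_times[OF L2D(1)[OF H(1)] L2D(1)[OF H(2)]] in \<open>auto simp: abs_mult intro!: mult_right_mono\<close>)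
 next
  fix t w assume "t \<in> {0..T}" "w \<in> space M"
  then have "v t w * \<sigma> t w = (\<Sum>a<m. \<Sum>b<l. (F a w * h a t) * (G b w * g b t))" by (simp add: q(2) r(2) sum_product)
  also have "\<dots> = (\<Sum>i<m * l. (F (i div l) w * h (i div l) t) * (G (i mod l) w * g (i mod l) t))" by (rule sum_div_mod[symmetric])
  finally show "v t w * \<sigma> t w = (\<Sum>i<m * l. F' i w * h' i t)" by (simp add: F'_def h'_def mult_ac)
 next
  fix s t w assume A: "s \<in> {0..T}" "t \<in> {0..T}" "w \<in> space M"
  have "Dv s t w * \<sigma> t w = (\<Sum>a<m. \<Sum>b<l. (DF a s w * h a t) * (G b w * g b t))"
   using A by (simp add: q(3) r(2) sum_product)
  then have "\<sigma> t w * Dv s t w = (\<Sum>a<m. \<Sum>b<l. (DF a s w * h a t) * (G b w * g b t))" by (simp add: mult.commute)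
  moreover have "v t w * D\<sigma> s t w = (\<Sum>a<m. \<Sum>b<l. (F a w * h a t) * (DG b s w * g b t))" using A by (simp add: q(2) r(3) sum_product)
  ultimately have "\<sigma> t w * Dv s t w + v t w * D\<sigma> s t w = (\<Sum>a<m. \<Sum>b<l. (DF a s w * h a t) * (G b w * g b t) + (F a w * h a t) * (DG b s w * g b t))"
   by (simp add: sum.distrib)
  also have "\<dots> = (\<Sum>i<m * l. (DF (i div l) s w * h (i div l) t) * (G (i mod l) w * g (i mod l) t) + (F (i div l) w * h (i div l) t) * (DG (i mod l) s w * g (i mod l) t))"
   by (rule sum_div_mod[symmetric])
  finally show "\<sigma> t w * Dv s t w + v t w * D\<sigma> s t w = (\<Sum>i<m * l. DF' i s w * h' i t)"
   by (simp add: DF'_def h'_def algebra_simps)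
 qed
qed

lemma TTM_measurable_snd: "f \<in> borel_measurable TM \<Longrightarrow> (%p. f (snd p)) \<in> borel_measurable TTM"
 by (rule measurable_compose[OF measurable_snd])

text \<open>A process in \<open>bounded_smooth\<close> is bounded, and its derivative \<open>D\<^sub>s v\<^sub>t\<close> is dominated by a square integrable
 function of \<open>s\<close>; so the product rule survives the approximation of \<open>\<sigma>\<close> by smooth processes.\<close>

lemma malliavin_process_mult_smooth:
 assumes v: "bounded_smooth v Dv" and \<sigma>: "malliavin \<sigma> D\<sigma>"
 shows "malliavin (%t w. v t w * \<sigma> t w) (%s t w. \<sigma> t w * Dv s t w + v t w * D\<sigma> s t w)"
proof -
 obtain us Dus where r: "\<And>n. smooth_process M T W (us n) (Dus n)"
  "L2_converges TM (%n. case_prod (us n)) (case_prod \<sigma>)"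
  "L2_converges TTM (%n. case_triple (Dus n)) (case_triple D\<sigma>)"
  using \<sigma> unfolding has_malliavin_deriv_process_def by blast
 obtain c \<kappa> where b: "\<And>t w. w \<in> space M \<Longrightarrow> \<bar>v t w\<bar> \<le> c" "L2 time \<kappa>"
  "\<And>s t w. s \<in> {0..T} \<Longrightarrow> w \<in> space M \<Longrightarrow> \<bar>Dv s t w\<bar> \<le> \<kappa> s" by (rule bounded_smooth_bounds[OF v]) blast
 define V where "V = (%p. v (fst p) (snd p))"
 define DV where "DV = (%p. Dv (fst p) (fst (snd p)) (snd (snd p)))"
 define U where "U n = (%p. us n (fst p) (snd p))" for n
 define DU where "DU n = (%p. Dus n (fst p) (fst (snd p)) (snd (snd p)))" for n
 define S where "S = (%p. \<sigma> (fst p) (snd p))"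
 define DS where "DS = (%p. D\<sigma> (fst p) (fst (snd p)) (snd (snd p)))"
 have U: "L2_converges TM U S" using r(2) by (simp add: U_def[abs_def] S_def split_beta')
 have DU: "L2_converges TTM DU DS" using r(3) by (simp add: DU_def[abs_def] DS_def split_beta')
 have mV: "V \<in> borel_measurable TM" "DV \<in> borel_measurable TTM"
  using bounded_smooth_L2[OF v, THEN L2D(1)] by (simp_all add: V_def DV_def split_beta')
 have bV: "\<bar>V p\<bar> \<le> c" if "p \<in> space TM" for p using that b(1) by (auto simp: V_def space_pair_measure)
 have bDV: "\<bar>DV p\<bar> \<le> \<kappa> (fst p)" if "p \<in> space TTM" for p using that b(3) by (auto simp: DV_def space_pair_measure)
 have snd: "snd p \<in> space TM" if "p \<in> space TTM" for p using that by (auto simp: space_pair_measure)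
 note cU = L2_converges_cmult[OF U, of c] and cDU = L2_converges_cmult[OF DU, of c]
 note kU = L2_converges_tensor[OF sigma_finite_time sigma_finite_time_M b(2) U]
 have c1: "L2_converges TM (%n p. V p * U n p) (%p. V p * S p)"
 proof (rule L2_converges_le[OF cU])
  show "(%p. V p * U n p) \<in> borel_measurable TM" for n by (rule borel_measurable_times[OF mV(1) L2D(1)[OF L2_convergesD(1)[OF U]]])
  show "L2 TM (%p. V p * S p)"
   by (rule L2_bound[OF L2_convergesD(2)[OF U] borel_measurable_times[OF mV(1) L2D(1)[OF L2_convergesD(2)[OF U]]], where C = c])
    (use bV in \<open>auto simp: abs_mult intro!: mult_right_mono\<close>)
  show "AE p in TM. \<bar>V p * U n p - V p * S p\<bar> \<le> \<bar>c * U n p - c * S p\<bar>" for n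
   by (rule AE_I2) (use bV in \<open>force simp: abs_mult right_diff_distrib[symmetric] intro!: mult_right_mono\<close>)
 qed
 have c2: "L2_converges TTM (%n p. U n (snd p) * DV p) (%p. S (snd p) * DV p)"
 proof (rule L2_converges_le[OF kU])
  show "(%p. U n (snd p) * DV p) \<in> borel_measurable TTM" for n
   by (rule borel_measurable_times[OF TTM_measurable_snd[OF L2D(1)[OF L2_convergesD(1)[OF U]]] mV(2)])
  show "L2 TTM (%p. S (snd p) * DV p)"
  proof (rule L2_bound[OF L2_convergesD(2)[OF kU] borel_measurable_times[OF TTM_measurable_snd[OF L2D(1)[OF L2_convergesD(2)[OF U]]] mV(2)], where C = 1])
   fix p assume "p \<in> space TTM"
   from bDV[OF this] have "\<bar>DV p\<bar> \<le> \<bar>\<kappa> (fst p)\<bar>" by linarith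
   then show "\<bar>S (snd p) * DV p\<bar> \<le> 1 * \<bar>\<kappa> (fst p) * S (snd p)\<bar>" using mult_right_mono[of "\<bar>DV p\<bar>" "\<bar>\<kappa> (fst p)\<bar>" "\<bar>S (snd p)\<bar>"] by (simp add: abs_mult mult.commute)
  qed
  show "AE p in TTM. \<bar>U n (snd p) * DV p - S (snd p) * DV p\<bar> \<le> \<bar>\<kappa> (fst p) * U n (snd p) - \<kappa> (fst p) * S (snd p)\<bar>" for n
  proof (rule AE_I2)
   fix p assume "p \<in> space TTM"
   from bDV[OF this] have "\<bar>DV p\<bar> \<le> \<bar>\<kappa> (fst p)\<bar>" by linarith
   then show "\<bar>U n (snd p) * DV p - S (snd p) * DV p\<bar> \<le> \<bar>\<kappa> (fst p) * U n (snd p) - \<kappa> (fst p) * S (snd p)\<bar>"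
    by (rule abs_mult_right_le)
  qed
 qed
 have c3: "L2_converges TTM (%n p. V (snd p) * DU n p) (%p. V (snd p) * DS p)"
 proof (rule L2_converges_le[OF cDU])
  show "(%p. V (snd p) * DU n p) \<in> borel_measurable TTM" for n by (rule borel_measurable_times[OF TTM_measurable_snd[OF mV(1)] L2D(1)[OF L2_convergesD(1)[OF DU]]])
  show "L2 TTM (%p. V (snd p) * DS p)"
   by (rule L2_bound[OF L2_convergesD(2)[OF DU] borel_measurable_times[OF TTM_measurable_snd[OF mV(1)] L2D(1)[OF L2_convergesD(2)[OF DU]]], where C = c])
    (use bV[OF snd] in \<open>auto simp: abs_mult intro!: mult_right_mono\<close>)
  show "AE p in TTM. \<bar>V (snd p) * DU n p - V (snd p) * DS p\<bar> \<le> \<bar>c * DU n p - c * DS p\<bar>" for n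
   by (rule AE_I2) (use bV[OF snd] in \<open>force simp: abs_mult right_diff_distrib[symmetric] intro!: mult_right_mono\<close>)
 qed
 show ?thesis
  unfolding has_malliavin_deriv_process_def
 proof (intro exI[of _ "%n t w. v t w * us n t w"] exI[of _ "%n s t w. us n t w * Dv s t w + v t w * Dus n s t w"] conjI allI)
  show "smooth_process M T W (%t w. v t w * us n t w) (%s t w. us n t w * Dv s t w + v t w * Dus n s t w)" for n
   by (rule bounded_smooth_mult_smooth[OF v r(1)])
  show "L2_converges TM (%n (t, w). v t w * us n t w) (%(t, w). v t w * \<sigma> t w)"
   using c1 by (simp add: V_def U_def S_def split_beta')
  show "L2_converges TTM (%n (s, t, w). us n t w * Dv s t w + v t w * Dus n s t w) (%(s, t, w). \<sigma> t w * Dv s t w + v t w * D\<sigma> s t w)"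
   using L2_converges_add[OF c2 c3] by (simp add: V_def U_def S_def DV_def DU_def DS_def split_beta')
 qed
qed

text \<open>Once \<open>\<sigma>\<close> is general, its bounds and those of its derivative allow the approximation of \<open>u\<close> by
 processes in \<open>bounded_smooth\<close>.\<close>

lemma malliavin_process_mult:
 assumes u: "malliavin u Du" and \<sigma>: "malliavin \<sigma> D\<sigma>"
  and C: "AE (t, w) in TM. \<bar>\<sigma> t w\<bar> \<le> C" and D: "AE (s, t, w) in TTM. \<bar>D\<sigma> s t w\<bar> \<le> C'"
 shows "malliavin (%t w. u t w * \<sigma> t w) (%s t w. \<sigma> t w * Du s t w + u t w * D\<sigma> s t w)"
proof -
 obtain us Dus where r: "\<And>n. bounded_smooth (us n) (Dus n)"
  "L2_converges TM (%n. case_prod (us n)) (case_prod u)"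
  "L2_converges TTM (%n. case_triple (Dus n)) (case_triple Du)"
  by (rule bounded_smooth_dense[OF u]) blast
 define U where "U n = (%p. us n (fst p) (snd p))" for n
 define DU where "DU n = (%p. Dus n (fst p) (fst (snd p)) (snd (snd p)))" for n
 define V where "V = (%p. u (fst p) (snd p))"
 define DV where "DV = (%p. Du (fst p) (fst (snd p)) (snd (snd p)))"
 define S where "S = (%p. \<sigma> (fst p) (snd p))"
 define DS where "DS = (%p. D\<sigma> (fst p) (fst (snd p)) (snd (snd p)))"
 have U: "L2_converges TM U V" using r(2) by (simp add: U_def[abs_def] V_def split_beta')
 have DU: "L2_converges TTM DU DV" using r(3) by (simp add: DU_def[abs_def] DV_def split_beta')
 have mS: "S \<in> borel_measurable TM" "DS \<in> borel_measurable TTM"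
  using malliavin_L2[OF \<sigma>, THEN L2D(1)] by (simp_all add: S_def DS_def split_beta')
 have bS: "AE p in TM. \<bar>S p\<bar> \<le> C" using C by eventually_elim (auto simp: S_def)
 have bS2: "AE p in TTM. \<bar>S (snd p)\<bar> \<le> C" by (rule AE_snd[OF sigma_finite_time sigma_finite_time_M bS])
 have bDS: "AE p in TTM. \<bar>DS p\<bar> \<le> C'" using D by eventually_elim (auto simp: DS_def)
 have le: "\<bar>a * b - c * b\<bar> \<le> \<bar>k * a - k * c\<bar>" "\<bar>a * b\<bar> \<le> \<bar>k * a\<bar>" if "\<bar>b\<bar> \<le> k" for a b c k :: real
  using that by (auto intro!: abs_mult_right_le)
 note cU = L2_converges_cmult[OF U, of C] and cDU = L2_converges_cmult[OF DU, of C]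
 have oneS: "L2 time (%_. C')"
  by (rule finite_measure.L2_of_bounded[OF finite_measure_time_measure, where C = "\<bar>C'\<bar>"]) auto
 note kU = L2_converges_tensor[OF sigma_finite_time sigma_finite_time_M oneS U]
 have c1: "L2_converges TM (%n p. U n p * S p) (%p. V p * S p)"
 proof (rule L2_converges_le[OF cU])
  show "(%p. U n p * S p) \<in> borel_measurable TM" for n by (rule borel_measurable_times[OF L2D(1)[OF L2_convergesD(1)[OF U]] mS(1)])
  show "L2 TM (%p. V p * S p)"
  proof (rule L2_bound_AE[OF L2_convergesD(2)[OF cU] borel_measurable_times[OF L2D(1)[OF L2_convergesD(2)[OF U]] mS(1)]])
   show "AE p in TM. \<bar>V p * S p\<bar> \<le> \<bar>C * V p\<bar>" using bS by eventually_elim (rule le)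
  qed
  show "AE p in TM. \<bar>U n p * S p - V p * S p\<bar> \<le> \<bar>C * U n p - C * V p\<bar>" for n using bS by eventually_elim (rule le)
 qed
 have c2: "L2_converges TTM (%n p. DU n p * S (snd p)) (%p. DV p * S (snd p))"
 proof (rule L2_converges_le[OF cDU])
  show "(%p. DU n p * S (snd p)) \<in> borel_measurable TTM" for n by (rule borel_measurable_times[OF L2D(1)[OF L2_convergesD(1)[OF DU]] TTM_measurable_snd[OF mS(1)]])
  show "L2 TTM (%p. DV p * S (snd p))"
  proof (rule L2_bound_AE[OF L2_convergesD(2)[OF cDU] borel_measurable_times[OF L2D(1)[OF L2_convergesD(2)[OF DU]] TTM_measurable_snd[OF mS(1)]]])
   show "AE p in TTM. \<bar>DV p * S (snd p)\<bar> \<le> \<bar>C * DV p\<bar>" using bS2 by eventually_elim (rule le)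
  qed
  show "AE p in TTM. \<bar>DU n p * S (snd p) - DV p * S (snd p)\<bar> \<le> \<bar>C * DU n p - C * DV p\<bar>" for n using bS2 by eventually_elim (rule le)
 qed
 have c3: "L2_converges TTM (%n p. U n (snd p) * DS p) (%p. V (snd p) * DS p)"
 proof (rule L2_converges_le[OF kU])
  show "(%p. U n (snd p) * DS p) \<in> borel_measurable TTM" for n by (rule borel_measurable_times[OF TTM_measurable_snd[OF L2D(1)[OF L2_convergesD(1)[OF U]]] mS(2)])
  show "L2 TTM (%p. V (snd p) * DS p)"
  proof (rule L2_bound_AE[OF L2_convergesD(2)[OF kU] borel_measurable_times[OF TTM_measurable_snd[OF L2D(1)[OF L2_convergesD(2)[OF U]]] mS(2)]])
   show "AE p in TTM. \<bar>V (snd p) * DS p\<bar> \<le> \<bar>C' * V (snd p)\<bar>" using bDS by eventually_elim (rule le)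
  qed
  show "AE p in TTM. \<bar>U n (snd p) * DS p - V (snd p) * DS p\<bar> \<le> \<bar>C' * U n (snd p) - C' * V (snd p)\<bar>" for n using bDS by eventually_elim (rule le)
 qed
 show ?thesis
 proof (rule malliavin_process_closed[where vn = "%n t w. us n t w * \<sigma> t w" and Dvn = "%n s t w. \<sigma> t w * Dus n s t w + us n t w * D\<sigma> s t w"])
  show "malliavin (%t w. us n t w * \<sigma> t w) (%s t w. \<sigma> t w * Dus n s t w + us n t w * D\<sigma> s t w)" for n
   by (rule malliavin_process_mult_smooth[OF r(1) \<sigma>])
  show "L2_converges TM (%n (t, w). us n t w * \<sigma> t w) (%(t, w). u t w * \<sigma> t w)"
   using c1 by (simp add: V_def U_def S_def split_beta')
  show "L2_converges TTM (%n (s, t, w). \<sigma> t w * Dus n s t w + us n t w * D\<sigma> s t w) (%(s, t, w). \<sigma> t w * Du s t w + u t w * D\<sigma> s t w)"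
   using L2_converges_add[OF c2 c3] by (simp add: V_def U_def S_def DV_def DU_def DS_def split_beta' mult.commute)
 qed
qed

end

section \<open>The operator \<open>D\<^sup>-\<close> on products\<close>

text \<open>For a nonmeasurable function, the nonnegative integral is the lower integral, which need
 not be subadditive; it is if one of the summands is measurable.\<close>

lemma nn_integral_le_linear:
 fixes F f g :: "'b \<Rightarrow> ennreal"
 assumes le: "\<And>x. x \<in> space N \<Longrightarrow> F x \<le> ennreal c * f x + g x" and g: "g \<in> borel_measurable N" and c: "c > 0"
 shows "(\<integral>\<^sup>+x. F x \<partial>N) \<le> ennreal c * (\<integral>\<^sup>+x. f x \<partial>N) + (\<integral>\<^sup>+x. g x \<partial>N)"
 unfolding nn_integral_def_finite[of N F]
proof (safe intro!: SUP_least)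
 fix h assume h: "simple_function N h" "h \<le> F" "\<forall>x. h x < top"
 note [measurable] = borel_measurable_simple_function[OF h(1)] g
 have cc: "ennreal (inverse c) * ennreal c = 1" using c by (simp flip: ennreal_mult')
 have k: "ennreal (inverse c) * (h x - g x) \<le> f x" if x: "x \<in> space N" for x
 proof -
  have "h x \<le> g x + ennreal c * f x" using le_funD[OF h(2), of x] le[OF x] by (simp add: add.commute order_trans)
  then have "h x - g x \<le> ennreal c * f x" unfolding ennreal_minus_le_iff using h(3) by (metis less_irrefl)
  then have "ennreal (inverse c) * (h x - g x) \<le> ennreal (inverse c) * (ennreal c * f x)" by (rule mult_left_mono) simp
  then show ?thesis using cc by (simp add: mult.assoc[symmetric])
 qed
 have e: "ennreal c * (\<integral>\<^sup>+x. ennreal (inverse c) * (h x - g x) \<partial>N) = (\<integral>\<^sup>+x. h x - g x \<partial>N)"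
  using cc by (subst nn_integral_cmult) (auto simp: mult.assoc[symmetric] mult.commute[of "ennreal c"])
 have "integral\<^sup>S N h = (\<integral>\<^sup>+x. h x \<partial>N)" by (rule nn_integral_eq_simple_integral[OF h(1), symmetric])
 also have "\<dots> \<le> (\<integral>\<^sup>+x. (h x - g x) + g x \<partial>N)" by (rule nn_integral_mono) (auto simp: diff_add_self_ennreal not_le less_imp_le)
 also have "\<dots> = (\<integral>\<^sup>+x. h x - g x \<partial>N) + (\<integral>\<^sup>+x. g x \<partial>N)" by (rule nn_integral_add) measurable
 also have "\<dots> \<le> ennreal c * (\<integral>\<^sup>+x. f x \<partial>N) + (\<integral>\<^sup>+x. g x \<partial>N)"
  unfolding e[symmetric] by (intro add_right_mono mult_left_mono nn_integral_mono k) auto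
 finally show "integral\<^sup>S N h \<le> ennreal c * (\<integral>\<^sup>+x. f x \<partial>N) + (\<integral>\<^sup>+x. g x \<partial>N)" .
qed

lemma Young_small: "x * y \<le> \<delta> * x^2 + inverse \<delta> * y^2" if "\<delta> > 0" for x y \<delta> :: real
proof -
 have "0 \<le> (sqrt \<delta> * x - sqrt (inverse \<delta>) * y)^2" by simp
 also have "\<dots> = \<delta> * x^2 + inverse \<delta> * y^2 - 2 * (sqrt \<delta> * sqrt (inverse \<delta>)) * (x * y)"
  using that by (simp add: power2_diff power_mult_distrib algebra_simps)
 also have "sqrt \<delta> * sqrt (inverse \<delta>) = 1" using that by (simp flip: real_sqrt_mult)
 finally have "2 * (x * y) \<le> \<delta> * x^2 + inverse \<delta> * y^2" by simp
 moreover have "0 \<le> \<delta> * x^2 + inverse \<delta> * y^2" using that by simp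
 ultimately show ?thesis by linarith
qed

text \<open>The shape of the estimate that Young's inequality gives: the first term is small with \<open>\<delta>\<close>, the second one,
 for fixed \<open>\<delta>\<close>, with \<open>\<epsilon>\<close>.\<close>

lemma tendsto_0_Young:
 fixes X Y :: "real \<Rightarrow> ennreal"
 assumes le: "\<And>\<delta> eps. \<delta> > 0 \<Longrightarrow> eps > 0 \<Longrightarrow> X eps \<le> ennreal \<delta> * K + ennreal (inverse \<delta>) * Y eps"
  and K: "K < \<infinity>" and Y: "(Y \<longlongrightarrow> 0) (at_right 0)"
 shows "(X \<longlongrightarrow> 0) (at_right 0)"
proof (rule order_tendstoI)
 fix a :: ennreal assume "0 < a"
 then obtain b where b: "0 < b" "b < a" using dense by blast
 then obtain e where e: "e > 0" "ennreal e < a" by (cases b) (auto simp: top.extremum_strict)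
 obtain k where k: "K = ennreal k" "k \<ge> 0" using K by (cases K) auto
 define \<delta> where "\<delta> = e / (2 * (k + 1))"
 have \<delta>: "\<delta> > 0" "\<delta> * k \<le> e / 2" using e k by (auto simp: \<delta>_def field_simps)
 have "\<forall>\<^sub>F eps in at_right 0. Y eps < ennreal (\<delta> * e / 2)"
  by (rule order_tendstoD(2)[OF Y]) (use e \<delta> in simp)
 moreover have "\<forall>\<^sub>F eps in at_right 0. eps > (0::real)" by (rule eventually_at_right_less)
 ultimately show "\<forall>\<^sub>F eps in at_right 0. X eps < a"
 proof eventually_elim
  case (elim eps)
  have "X eps \<le> ennreal \<delta> * K + ennreal (inverse \<delta>) * Y eps" by (rule le[OF \<delta>(1) elim(2)])
  also have "\<dots> \<le> ennreal (e / 2) + ennreal (inverse \<delta>) * ennreal (\<delta> * e / 2)"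
   using elim(1) \<delta> k by (intro add_mono mult_left_mono) (auto simp flip: ennreal_mult intro!: ennreal_leI)
  also have "\<dots> = ennreal e" using \<delta>(1) e by (simp add: mult.assoc[symmetric] flip: ennreal_mult ennreal_plus)
  finally show ?case using e(2) by simp
 qed
qed simp

context brownian begin

lemma L2_bounded_const:
 assumes "L2_bounded M T \<sigma>"
 obtains K where "K < \<infinity>" "\<And>t. t \<in> {0..T} \<Longrightarrow> (\<integral>\<^sup>+w. ennreal ((\<sigma> t w)^2) \<partial>M) \<le> K"
 using assms unfolding L2_bounded_def by (intro that) (auto intro: SUP_upper)

lemma nn_integral_square_diff_le:
 assumes [measurable]: "f \<in> borel_measurable M" "g \<in> borel_measurable M" "h \<in> borel_measurable M"
 shows "(\<integral>\<^sup>+w. ennreal ((f w - h w)^2) \<partial>M) \<le> 2 * (\<integral>\<^sup>+w. ennreal ((f w - g w)^2) \<partial>M) + 2 * (\<integral>\<^sup>+w. ennreal ((g w - h w)^2) \<partial>M)"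
proof -
 have "(\<integral>\<^sup>+w. ennreal ((f w - h w)^2) \<partial>M) \<le> (\<integral>\<^sup>+w. 2 * ennreal ((f w - g w)^2) + 2 * ennreal ((g w - h w)^2) \<partial>M)"
 proof (rule nn_integral_mono)
  fix w
  have "(f w - h w)^2 \<le> 2 * (f w - g w)^2 + 2 * (g w - h w)^2" using square_sum_le[of "f w - g w" "g w - h w"] by simp
  then have "ennreal ((f w - h w)^2) \<le> ennreal (2 * (f w - g w)^2 + 2 * (g w - h w)^2)" by (rule ennreal_leI)
  then show "ennreal ((f w - h w)^2) \<le> 2 * ennreal ((f w - g w)^2) + 2 * ennreal ((g w - h w)^2)"
   by (simp add: ennreal_mult')
 qed
 also have "\<dots> = 2 * (\<integral>\<^sup>+w. ennreal ((f w - g w)^2) \<partial>M) + 2 * (\<integral>\<^sup>+w. ennreal ((g w - h w)^2) \<partial>M)"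
  by (simp add: nn_integral_add nn_integral_cmult)
 finally show ?thesis .
qed

text \<open>The oscillation of \<open>\<sigma>\<close> just before \<open>s\<close>. By left-continuity, rational times suffice, which
 makes it measurable in \<open>s\<close>; the window \<open>2 \<epsilon>\<close> leaves room for a rational time before \<open>s - \<epsilon>\<close>.\<close>

definition left_osc :: "(real \<Rightarrow> 'a \<Rightarrow> real) \<Rightarrow> real \<Rightarrow> real \<Rightarrow> ennreal" where
 "left_osc \<sigma> eps s = (SUP q\<in>\<rat> \<inter> {0<..T}. if s - 2 * eps < q \<and> q < s then \<integral>\<^sup>+w. ennreal ((\<sigma> q w - \<sigma> s w)^2) \<partial>M else 0)"

lemma left_osc_measurable:
 assumes J: "(case_prod \<sigma>) \<in> borel_measurable TM" and m: "\<And>t. t \<in> {0..T} \<Longrightarrow> \<sigma> t \<in> borel_measurable M"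
 shows "left_osc \<sigma> eps \<in> borel_measurable time"
 unfolding left_osc_def[abs_def]
proof (rule borel_measurable_SUP)
 show "countable (\<rat> \<inter> {0<..T})" using countable_rat by (rule countable_Int1)
 fix q assume "q \<in> \<rat> \<inter> {0<..T}"
 then have q: "\<sigma> q \<in> borel_measurable M" by (intro m) auto
 have id: "(%s. s) \<in> borel_measurable time" by (rule measurable_time_measureI) simp
 have d: "(%p. ennreal ((\<sigma> q (snd p) - \<sigma> (fst p) (snd p))^2)) \<in> borel_measurable TM"
  using borel_measurable_diff[OF measurable_compose[OF measurable_snd q] J] by (auto simp: split_beta')
 have "(%s. \<integral>\<^sup>+w. ennreal ((\<sigma> q w - \<sigma> s w)^2) \<partial>M) \<in> borel_measurable time"
  using sigma_finite_measure.borel_measurable_nn_integral_fst[OF sigma_finite_M d] by simp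
 then show "(%s. if s - 2 * eps < q \<and> q < s then \<integral>\<^sup>+w. ennreal ((\<sigma> q w - \<sigma> s w)^2) \<partial>M else 0) \<in> borel_measurable time"
  using id by measurable
qed

lemma left_osc_upper:
 assumes m: "\<And>t. t \<in> {0..T} \<Longrightarrow> \<sigma> t \<in> borel_measurable M" and lc: "L2_left_continuous M T \<sigma>"
  and t: "0 < t" "s - eps \<le> t" "t < s" "s \<le> T" and eps: "eps > 0"
 shows "(\<integral>\<^sup>+w. ennreal ((\<sigma> t w - \<sigma> s w)^2) \<partial>M) \<le> 2 * left_osc \<sigma> eps s"
proof (rule ennreal_le_epsilon)
 fix e :: real assume e: "e > 0"
 have "((%r. \<integral>\<^sup>+w. ennreal ((\<sigma> r w - \<sigma> t w)^2) \<partial>M) \<longlongrightarrow> 0) (at_left t)"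
  using lc t unfolding L2_left_continuous_def by auto
 from order_tendstoD(2)[OF this, of "ennreal (e / 2)"] e
 have "\<forall>\<^sub>F r in at_left t. (\<integral>\<^sup>+w. ennreal ((\<sigma> r w - \<sigma> t w)^2) \<partial>M) < ennreal (e / 2)" by simp
 then obtain b where b: "b < t" "\<And>r. b < r \<Longrightarrow> r < t \<Longrightarrow> (\<integral>\<^sup>+w. ennreal ((\<sigma> r w - \<sigma> t w)^2) \<partial>M) < ennreal (e / 2)"
  unfolding eventually_at_left_field by blast
 have "max b (max 0 (s - 2 * eps)) < t" using b(1) t eps by simp
 then obtain q where q: "q \<in> \<rat>" "max b (max 0 (s - 2 * eps)) < q" "q < t" using Rats_dense_in_real by blast
 have rng: "q \<in> {0..T}" "t \<in> {0..T}" "s \<in> {0..T}" using q t by auto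
 have "(\<integral>\<^sup>+w. ennreal ((\<sigma> q w - \<sigma> s w)^2) \<partial>M) = (if s - 2 * eps < q \<and> q < s then \<integral>\<^sup>+w. ennreal ((\<sigma> q w - \<sigma> s w)^2) \<partial>M else 0)"
  using q t by simp
 also have "\<dots> \<le> left_osc \<sigma> eps s" unfolding left_osc_def by (rule SUP_upper) (use q t in auto)
 finally have qs: "(\<integral>\<^sup>+w. ennreal ((\<sigma> q w - \<sigma> s w)^2) \<partial>M) \<le> left_osc \<sigma> eps s" .
 have "(\<integral>\<^sup>+w. ennreal ((\<sigma> t w - \<sigma> s w)^2) \<partial>M) \<le> 2 * (\<integral>\<^sup>+w. ennreal ((\<sigma> t w - \<sigma> q w)^2) \<partial>M) + 2 * (\<integral>\<^sup>+w. ennreal ((\<sigma> q w - \<sigma> s w)^2) \<partial>M)"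
  by (rule nn_integral_square_diff_le[OF m[OF rng(2)] m[OF rng(1)] m[OF rng(3)]])
 also have "\<dots> \<le> 2 * ennreal (e / 2) + 2 * left_osc \<sigma> eps s"
  using b(2)[of q] q qs by (intro add_mono mult_left_mono) (auto simp: power2_commute intro: less_imp_le)
 also have "2 * ennreal (e / 2) = ennreal e" using e ennreal_mult'[of 2 "e / 2"] by simp
 finally show "(\<integral>\<^sup>+w. ennreal ((\<sigma> t w - \<sigma> s w)^2) \<partial>M) \<le> 2 * left_osc \<sigma> eps s + ennreal e" by (simp add: add.commute)
qed

lemma left_osc_tendsto:
 assumes J: "(case_prod \<sigma>) \<in> borel_measurable TM" and m: "\<And>t. t \<in> {0..T} \<Longrightarrow> \<sigma> t \<in> borel_measurable M"
  and lc: "L2_left_continuous M T \<sigma>" and bd: "L2_bounded M T \<sigma>"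
 shows "((%eps. \<integral>\<^sup>+s. left_osc \<sigma> eps s \<partial>time) \<longlongrightarrow> 0) (at_right 0)"
proof (rule tendsto_at_right_sequentially[of _ 1])
 fix eps :: "nat \<Rightarrow> real" assume eps: "\<And>n. 0 < eps n" "eps \<longlonglongrightarrow> 0"
 obtain K where K: "K < \<infinity>" "\<And>t. t \<in> {0..T} \<Longrightarrow> (\<integral>\<^sup>+w. ennreal ((\<sigma> t w)^2) \<partial>M) \<le> K" by (rule L2_bounded_const[OF bd]) blast
 have finT: "emeasure time (space time) < \<infinity>" using finite_measure.emeasure_finite[OF finite_measure_time_measure, of T] by (simp add: less_top)
 have "(%n. \<integral>\<^sup>+s. left_osc \<sigma> (eps n) s \<partial>time) \<longlonglongrightarrow> (\<integral>\<^sup>+s. 0 \<partial>time)"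
 proof (rule nn_integral_dominated_convergence[where w = "%_. 4 * K"])
  show "left_osc \<sigma> (eps n) \<in> borel_measurable time" for n by (rule left_osc_measurable[OF J m])
  show "AE s in time. left_osc \<sigma> (eps n) s \<le> 4 * K" for n
  proof (rule AE_I2)
   fix s assume s: "s \<in> space time"
   show "left_osc \<sigma> (eps n) s \<le> 4 * K"
    unfolding left_osc_def
   proof (rule SUP_least)
    fix q assume q: "q \<in> \<rat> \<inter> {0<..T}"
    have sT: "s \<in> {0..T}" and qT: "q \<in> {0..T}" using s q by auto
    have "(\<integral>\<^sup>+w. ennreal ((\<sigma> q w - \<sigma> s w)^2) \<partial>M) \<le> 2 * (\<integral>\<^sup>+w. ennreal ((\<sigma> q w - 0)^2) \<partial>M) + 2 * (\<integral>\<^sup>+w. ennreal ((0 - \<sigma> s w)^2) \<partial>M)"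
     by (rule nn_integral_square_diff_le[OF m[OF qT] _ m[OF sT]]) simp
    also have "\<dots> \<le> 2 * K + 2 * K" using K(2)[OF sT] K(2)[OF qT] by (intro add_mono mult_left_mono) auto
    also have "\<dots> = 4 * K" by (simp flip: distrib_right)
    finally show "(if s - 2 * eps n < q \<and> q < s then \<integral>\<^sup>+w. ennreal ((\<sigma> q w - \<sigma> s w)^2) \<partial>M else 0) \<le> 4 * K" by simp
   qed
  qed
  show "(\<integral>\<^sup>+s. 4 * K \<partial>time) < \<infinity>" using K(1) finT by (simp add: ennreal_mult_less_top)
  show "AE s in time. (%n. left_osc \<sigma> (eps n) s) \<longlonglongrightarrow> 0"
   using AE_time_measure_neq[of 0]
  proof (rule AE_mp, intro AE_I2 impI)
   fix s assume "s \<in> space time" "s \<noteq> 0"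
   then have s: "0 < s" "s \<le> T" by auto
   show "(%n. left_osc \<sigma> (eps n) s) \<longlonglongrightarrow> 0"
   proof (rule order_tendstoI)
    fix a :: ennreal assume "0 < a"
    then obtain a' where a': "0 < a'" "a' < a" using dense by blast
    have "((%r. \<integral>\<^sup>+w. ennreal ((\<sigma> r w - \<sigma> s w)^2) \<partial>M) \<longlongrightarrow> 0) (at_left s)"
     using lc s unfolding L2_left_continuous_def by auto
    from order_tendstoD(2)[OF this a'(1)]
    obtain b where b: "b < s" "\<And>r. b < r \<Longrightarrow> r < s \<Longrightarrow> (\<integral>\<^sup>+w. ennreal ((\<sigma> r w - \<sigma> s w)^2) \<partial>M) < a'"
     unfolding eventually_at_left_field by blast
    have "\<forall>\<^sub>F n in sequentially. eps n < (s - b) / 2" by (rule order_tendstoD(2)[OF eps(2)]) (use b in simp)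
    then show "\<forall>\<^sub>F n in sequentially. left_osc \<sigma> (eps n) s < a"
    proof eventually_elim
     case (elim n)
     have "left_osc \<sigma> (eps n) s \<le> a'"
      unfolding left_osc_def
     proof (rule SUP_least)
      fix q
      show "(if s - 2 * eps n < q \<and> q < s then \<integral>\<^sup>+w. ennreal ((\<sigma> q w - \<sigma> s w)^2) \<partial>M else 0) \<le> a'"
       using b(2)[of q] elim by (auto simp: field_simps intro: less_imp_le)
     qed
     then show ?case using a'(2) by simp
    qed
   qed simp
  qed
 qed auto
 then show "(%n. \<integral>\<^sup>+s. left_osc \<sigma> (eps n) s \<partial>time) \<longlonglongrightarrow> 0" by simp
qed simp


text \<open>For \<open>t < s\<close> the derivative of the product is \<open>\<sigma>\<^sub>t D\<^sub>s u\<^sub>t\<close>, and its distance from the limit is split as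
 \<open>\<sigma>\<^sub>t (D\<^sub>s u\<^sub>t - (D\<^sup>-u)\<^sub>s) + (D\<^sup>-u)\<^sub>s (\<sigma>\<^sub>t - \<sigma>\<^sub>s)\<close>. Young's inequality turns the products into squares,
 for which the assumption on \<open>u\<close> and the left-continuity of \<open>\<sigma>\<close> are made.\<close>

lemma Dminus_mult:
 assumes u: "malliavin u Du" and Dmu: "L2 TM (case_prod Dmu)"
  and lim: "((%eps. \<integral>\<^sup>+s. (SUP t\<in>{max (s - eps) 0..<s}. \<integral>\<^sup>+w. ennreal ((Du s t w - Dmu s w)^2) \<partial>M) \<partial>time) \<longlongrightarrow> 0) (at_right 0)"
  and \<sigma>: "malliavin \<sigma> D\<sigma>" and adapted: "\<forall>t\<in>{0..T}. \<sigma> t \<in> borel_measurable (\<F> t)"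
  and bd: "L2_bounded M T \<sigma>" and lc: "L2_left_continuous M T \<sigma>"
  and C: "AE (t, w) in TM. \<bar>\<sigma> t w\<bar> \<le> C" and D: "AE (s, t, w) in TTM. \<bar>D\<sigma> s t w\<bar> \<le> C'"
 obtains E where "malliavin (%t w. u t w * \<sigma> t w) E"
  "((%eps. \<integral>\<^sup>+s. (SUP t\<in>{max (s - eps) 0..<s}. \<integral>\<^sup>+w. ennreal \<bar>E s t w - Dmu s w * \<sigma> s w\<bar> \<partial>M) \<partial>time) \<longlongrightarrow> 0) (at_right 0)"
proof -
 interpret pair_sigma_finite time M using sigma_finite_time sigma_finite_M by (simp add: pair_sigma_finite_def)
 have m\<sigma>: "\<sigma> t \<in> borel_measurable M" if "t \<in> {0..T}" for t
 proof (rule measurableI)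
  fix A :: "real set" assume A: "A \<in> sets borel"
  have "\<sigma> t -` A \<inter> space (\<F> t) \<in> sets (\<F> t)" using adapted that A by (intro measurable_sets[of _ _ borel]) auto
  then show "\<sigma> t -` A \<inter> space M \<in> sets M" using augmented_subset[of t] space_augmented[of t] that by auto
 qed simp
 have "AE t in time. AE w in M. \<bar>\<sigma> t w\<bar> \<le> C" using AE_pair[OF C] by simp
 then have "AE t in time. t \<noteq> 0 \<and> (AE w in M. \<bar>\<sigma> t w\<bar> \<le> C)" using AE_time_measure_neq[of 0] by eventually_elim simp
 from this obtain N where N0: "{t \<in> space time. \<not> (t \<noteq> 0 \<and> (AE w in M. \<bar>\<sigma> t w\<bar> \<le> C))} \<subseteq> N" "emeasure time N = 0" "N \<in> sets time"
  by (rule AE_E)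
 then have N: "{t \<in> space time. \<not> (t \<noteq> 0 \<and> (AE w in M. \<bar>\<sigma> t w\<bar> \<le> C))} \<subseteq> N" "N \<in> null_sets time" by auto
 have good: "t \<noteq> 0" "AE w in M. \<bar>\<sigma> t w\<bar> \<le> C" if "t \<in> {0..T}" "t \<notin> N" for t using N(1) that by auto
 define D0 where "D0 s t w = \<sigma> t w * Du s t w + u t w * D\<sigma> s t w" for s t w
 \<comment> \<open>The condition on \<open>D\<^sup>-\<close> is about every \<open>t\<close>, so the version of the derivative matters: on the null set
   \<open>N\<close>, where \<open>\<sigma>\<^sub>t\<close> may be unbounded or left-continuity is not available, it is put equal to the limit.\<close>
 define E where "E s t w = (if t < s then (if t \<in> N then Dmu s w * \<sigma> s w else \<sigma> t w * Du s t w) else D0 s t w)" for s t w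
 note prod = malliavin_process_mult[OF u \<sigma> C D]
 have J: "(case_prod \<sigma>) \<in> borel_measurable TM" by (rule L2D(1)[OF malliavin_L2(1)[OF \<sigma>]])
 have J': "(%p. \<sigma> (fst p) (snd p)) \<in> borel_measurable TM" using J by (simp add: split_beta')
 have DmuM: "(%p. Dmu (fst p) (snd p)) \<in> borel_measurable TM" using L2D(1)[OF Dmu] by (simp add: split_beta')
 have DuM: "(%p. Du (fst p) (fst (snd p)) (snd (snd p))) \<in> borel_measurable TTM"
  using L2D(1)[OF malliavin_L2(2)[OF u]] by (simp add: split_beta')
 have D0M: "(%p. D0 (fst p) (fst (snd p)) (snd (snd p))) \<in> borel_measurable TTM"
  using L2D(1)[OF malliavin_L2(2)[OF prod]] by (simp add: D0_def split_beta')
 have pr: "(%p. (fst p, snd (snd p))) \<in> measurable TTM TM" by measurable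
 have VM: "(%p. Dmu (fst p) (snd (snd p)) * \<sigma> (fst p) (snd (snd p))) \<in> borel_measurable TTM"
  using measurable_compose[OF pr borel_measurable_times[OF DmuM J']] by simp
 have time_id: "(%s. s) \<in> borel_measurable time" by (rule measurable_time_measureI) simp
 have f1: "(%p. fst p) \<in> borel_measurable TTM" by (rule measurable_compose[OF measurable_fst time_id])
 have f2: "(%p. fst (snd p)) \<in> borel_measurable TTM" by (rule measurable_compose[OF measurable_compose[OF measurable_snd measurable_fst] time_id])
 have lt: "{p \<in> space TTM. fst (snd p) < fst p} \<in> sets TTM" using f1 f2 by measurable
 have inN: "{p \<in> space TTM. fst (snd p) \<in> N} \<in> sets TTM"
  using measurable_sets[OF measurable_compose[OF measurable_snd measurable_fst], of N time time M] N(2)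
  by (auto simp: vimage_def Int_def conj_commute null_setsD2)
 have EM: "(case_triple E) \<in> borel_measurable TTM"
 proof -
  have s1: "(%p. \<sigma> (fst (snd p)) (snd (snd p)) * Du (fst p) (fst (snd p)) (snd (snd p))) \<in> borel_measurable TTM"
   by (rule borel_measurable_times[OF TTM_measurable_snd[OF J'] DuM])
  have "(%p. if fst (snd p) < fst p then (if fst (snd p) \<in> N then Dmu (fst p) (snd (snd p)) * \<sigma> (fst p) (snd (snd p))
    else \<sigma> (fst (snd p)) (snd (snd p)) * Du (fst p) (fst (snd p)) (snd (snd p))) else D0 (fst p) (fst (snd p)) (snd (snd p))) \<in> borel_measurable TTM"
   by (rule measurable_If[OF measurable_If[OF VM s1 inN] D0M lt])
  then show ?thesis by (simp add: E_def split_beta')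
 qed
 have "AE t in time. t \<notin> N" by (rule AE_not_in[OF N(2)])
 from AE_fst[OF sigma_finite_time sigma_finite_M this] have "AE q in TM. fst q \<notin> N" .
 from AE_snd[OF sigma_finite_time sigma_finite_time_M this] have notN: "AE p in TTM. fst (snd p) \<notin> N" .
 have Emall: "malliavin (%t w. u t w * \<sigma> t w) E"
 proof (rule malliavin_process_cong_AE[OF prod EM])
  show "AE (s, t, w) in TTM. \<sigma> t w * Du s t w + u t w * D\<sigma> s t w = E s t w"
   using notN adapted_derivative_zero[OF \<sigma> adapted] by eventually_elim (auto simp: E_def D0_def)
 qed
 define A where "A eps s = (SUP t\<in>{max (s - eps) 0..<s}. \<integral>\<^sup>+w. ennreal ((Du s t w - Dmu s w)^2) \<partial>M)" for eps s
 define B where "B eps s = (SUP t\<in>{max (s - eps) 0..<s}. \<integral>\<^sup>+w. ennreal \<bar>E s t w - Dmu s w * \<sigma> s w\<bar> \<partial>M)" for eps s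
 define a where "a s = ennreal (C^2) + (\<integral>\<^sup>+w. ennreal ((Dmu s w)^2) \<partial>M)" for s
 have am: "a \<in> borel_measurable time"
 proof -
  have "(%s. \<integral>\<^sup>+w. ennreal ((Dmu s w)^2) \<partial>M) \<in> borel_measurable time"
   using sigma_finite_measure.borel_measurable_nn_integral_fst[OF sigma_finite_M, of "%p. ennreal ((Dmu (fst p) (snd p))^2)" time] DmuM by simp
  then show ?thesis unfolding a_def[abs_def] by measurable
 qed
 have aI: "(\<integral>\<^sup>+s. a s \<partial>time) < \<infinity>"
 proof -
  have "(\<integral>\<^sup>+s. (\<integral>\<^sup>+w. ennreal ((Dmu s w)^2) \<partial>M) \<partial>time) = (\<integral>\<^sup>+p. ennreal ((Dmu (fst p) (snd p))^2) \<partial>TM)"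
   using sigma_finite_measure.nn_integral_fst[OF sigma_finite_M, of "%p. ennreal ((Dmu (fst p) (snd p))^2)" time] DmuM by simp
  also have "\<dots> < \<infinity>"
   using L2D(2)[OF Dmu] by (auto simp: integrable_iff_bounded split_beta')
  finally have f: "(\<integral>\<^sup>+s. (\<integral>\<^sup>+w. ennreal ((Dmu s w)^2) \<partial>M) \<partial>time) < \<infinity>" .
  have m: "(%s. \<integral>\<^sup>+w. ennreal ((Dmu s w)^2) \<partial>M) \<in> borel_measurable time"
   using sigma_finite_measure.borel_measurable_nn_integral_fst[OF sigma_finite_M, of "%p. ennreal ((Dmu (fst p) (snd p))^2)" time] DmuM by simp
  have "(\<integral>\<^sup>+s. a s \<partial>time) = (\<integral>\<^sup>+s. ennreal (C^2) \<partial>time) + (\<integral>\<^sup>+s. (\<integral>\<^sup>+w. ennreal ((Dmu s w)^2) \<partial>M) \<partial>time)"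
   unfolding a_def by (rule nn_integral_add) (use m in auto)
  also have "\<dots> < \<infinity>"
   using f finite_measure.emeasure_finite[OF finite_measure_time_measure, of T "space time"] by (auto simp: ennreal_mult_less_top less_top)
  finally show ?thesis .
 qed
 note om = left_osc_measurable[OF J m\<sigma>]
 have step: "B eps s \<le> ennreal (inverse \<delta>) * A eps s + (ennreal \<delta> * a s + ennreal (inverse \<delta>) * (2 * left_osc \<sigma> eps s))"
  if \<delta>: "\<delta> > 0" and eps: "eps > 0" and s: "s \<in> space time" for \<delta> eps s
  unfolding B_def
 proof (rule SUP_least)
  fix t assume t: "t \<in> {max (s - eps) 0..<s}"
  have rng: "s \<in> {0..T}" "t \<in> {0..T}" using s t by auto
  show "(\<integral>\<^sup>+w. ennreal \<bar>E s t w - Dmu s w * \<sigma> s w\<bar> \<partial>M) \<le> ennreal (inverse \<delta>) * A eps s + (ennreal \<delta> * a s + ennreal (inverse \<delta>) * (2 * left_osc \<sigma> eps s))"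
  proof (cases "t \<in> N")
   case True
   then have "E s t w - Dmu s w * \<sigma> s w = 0" for w using t by (simp add: E_def)
   then show ?thesis by simp
  next
   case False
   note [measurable] = m\<sigma>[OF rng(1)] m\<sigma>[OF rng(2)]
   have [measurable]: "Dmu s \<in> borel_measurable M" using measurable_compose[OF measurable_Pair1'[OF s] DmuM] by simp
   have tt: "t \<in> space time" using rng by simp
   have [measurable]: "Du s t \<in> borel_measurable M"
    using measurable_compose[OF measurable_compose[OF measurable_Pair1'[OF tt] measurable_Pair1'[OF s]] DuM] by simp
   have "(\<integral>\<^sup>+w. ennreal \<bar>E s t w - Dmu s w * \<sigma> s w\<bar> \<partial>M)
    \<le> (\<integral>\<^sup>+w. ennreal \<delta> * (ennreal (C^2) + ennreal ((Dmu s w)^2)) + ennreal (inverse \<delta>) * (ennreal ((Du s t w - Dmu s w)^2) + ennreal ((\<sigma> t w - \<sigma> s w)^2)) \<partial>M)"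
   proof (rule nn_integral_mono_AE)
    show "AE w in M. ennreal \<bar>E s t w - Dmu s w * \<sigma> s w\<bar> \<le> ennreal \<delta> * (ennreal (C^2) + ennreal ((Dmu s w)^2)) + ennreal (inverse \<delta>) * (ennreal ((Du s t w - Dmu s w)^2) + ennreal ((\<sigma> t w - \<sigma> s w)^2))"
     using good(2)[OF rng(2) False]
    proof eventually_elim
     case (elim w)
     let ?x = "\<bar>Du s t w - Dmu s w\<bar>" and ?y = "\<bar>\<sigma> t w - \<sigma> s w\<bar>"
     have "E s t w - Dmu s w * \<sigma> s w = \<sigma> t w * (Du s t w - Dmu s w) + Dmu s w * (\<sigma> t w - \<sigma> s w)"
      using t False by (simp add: E_def algebra_simps)
     then have "\<bar>E s t w - Dmu s w * \<sigma> s w\<bar> \<le> \<bar>\<sigma> t w\<bar> * ?x + \<bar>Dmu s w\<bar> * ?y"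
      by (simp add: abs_mult[symmetric] abs_triangle_ineq)
     also have "\<dots> \<le> C * ?x + \<bar>Dmu s w\<bar> * ?y" using elim by (intro add_right_mono mult_right_mono) auto
     also have "\<dots> \<le> \<delta> * (C^2 + (Dmu s w)^2) + inverse \<delta> * ((Du s t w - Dmu s w)^2 + (\<sigma> t w - \<sigma> s w)^2)"
      using Young_small[OF \<delta>, of C ?x] Young_small[OF \<delta>, of "\<bar>Dmu s w\<bar>" ?y] by (simp add: distrib_left)
     finally have "ennreal \<bar>E s t w - Dmu s w * \<sigma> s w\<bar> \<le> ennreal (\<delta> * (C^2 + (Dmu s w)^2) + inverse \<delta> * ((Du s t w - Dmu s w)^2 + (\<sigma> t w - \<sigma> s w)^2))" by (rule ennreal_leI)
     then show ?case using \<delta> by (simp add: ennreal_mult)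
    qed
   qed
   also have "\<dots> = ennreal \<delta> * a s + ennreal (inverse \<delta>) * ((\<integral>\<^sup>+w. ennreal ((Du s t w - Dmu s w)^2) \<partial>M) + (\<integral>\<^sup>+w. ennreal ((\<sigma> t w - \<sigma> s w)^2) \<partial>M))"
    by (simp add: nn_integral_add nn_integral_cmult a_def emeasure_space_1)
   also have "\<dots> \<le> ennreal \<delta> * a s + ennreal (inverse \<delta>) * (A eps s + 2 * left_osc \<sigma> eps s)"
   proof (intro add_left_mono mult_left_mono add_mono)
    show "(\<integral>\<^sup>+w. ennreal ((Du s t w - Dmu s w)^2) \<partial>M) \<le> A eps s" unfolding A_def by (rule SUP_upper[OF t])
    show "(\<integral>\<^sup>+w. ennreal ((\<sigma> t w - \<sigma> s w)^2) \<partial>M) \<le> 2 * left_osc \<sigma> eps s"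
     by (rule left_osc_upper[OF m\<sigma> lc _ _ _ _ eps]) (use good(1)[OF rng(2) False] t s in auto)
   qed simp
   finally show ?thesis by (simp add: distrib_left add_ac)
  qed
 qed
 have "((%eps. \<integral>\<^sup>+s. B eps s \<partial>time) \<longlongrightarrow> 0) (at_right 0)"
 proof (rule tendsto_0_Young[where K = "\<integral>\<^sup>+s. a s \<partial>time" and Y = "%eps. (\<integral>\<^sup>+s. A eps s \<partial>time) + 2 * (\<integral>\<^sup>+s. left_osc \<sigma> eps s \<partial>time)"])
  fix \<delta> eps :: real assume \<delta>: "\<delta> > 0" and eps: "eps > 0"
  have "(\<integral>\<^sup>+s. B eps s \<partial>time) \<le> ennreal (inverse \<delta>) * (\<integral>\<^sup>+s. A eps s \<partial>time) + (\<integral>\<^sup>+s. ennreal \<delta> * a s + ennreal (inverse \<delta>) * (2 * left_osc \<sigma> eps s) \<partial>time)"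
   by (rule nn_integral_le_linear[OF step[OF \<delta> eps]]) (use am om[of eps] \<delta> in \<open>auto\<close>)
  also have "(\<integral>\<^sup>+s. ennreal \<delta> * a s + ennreal (inverse \<delta>) * (2 * left_osc \<sigma> eps s) \<partial>time)
    = ennreal \<delta> * (\<integral>\<^sup>+s. a s \<partial>time) + ennreal (inverse \<delta>) * (2 * (\<integral>\<^sup>+s. left_osc \<sigma> eps s \<partial>time))"
   using am om[of eps] by (simp add: nn_integral_add nn_integral_cmult)
  finally show "(\<integral>\<^sup>+s. B eps s \<partial>time) \<le> ennreal \<delta> * (\<integral>\<^sup>+s. a s \<partial>time) + ennreal (inverse \<delta>) * ((\<integral>\<^sup>+s. A eps s \<partial>time) + 2 * (\<integral>\<^sup>+s. left_osc \<sigma> eps s \<partial>time))"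
   by (simp add: distrib_left add_ac)
 next
  show "(\<integral>\<^sup>+s. a s \<partial>time) < \<infinity>" by (rule aI)
  have "((%eps. 2 * (\<integral>\<^sup>+s. left_osc \<sigma> eps s \<partial>time)) \<longlongrightarrow> 2 * 0) (at_right 0)"
   by (rule ennreal_tendsto_cmult[OF _ left_osc_tendsto[OF J m\<sigma> lc bd]]) simp
  from tendsto_add[OF lim[folded A_def] this] show "((%eps. (\<integral>\<^sup>+s. A eps s \<partial>time) + 2 * (\<integral>\<^sup>+s. left_osc \<sigma> eps s \<partial>time)) \<longlongrightarrow> 0) (at_right 0)" by simp
 qed
 then show thesis unfolding B_def by (rule that[OF Emall])
qed


section \<open>Forward increments as Wiener integrals\<close>

lemma section_L2:
 assumes f: "L2 TM (case_prod f)"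
 shows "AE w in M. L2 time (%t. f t w)"
proof -
 interpret pair_sigma_finite time M using sigma_finite_time sigma_finite_M by (simp add: pair_sigma_finite_def)
 have "integrable TM (%(t, w). (f t w)^2)" using L2D(2)[OF f] by (simp add: split_beta')
 from AE_integrable_snd[OF this] show ?thesis
 proof (rule AE_mp, intro AE_I2 impI)
  fix w assume w: "w \<in> space M" and i: "integrable time (%t. (f t w)^2)"
  have "(%t. f t w) \<in> borel_measurable time"
   using measurable_compose[OF measurable_Pair2'[OF w] L2D(1)[OF f]] by simp
  with i show "L2 time (%t. f t w)" by (simp add: square_integrable_def)
 qed
qed

text \<open>Fubini: \<open>t\<close> lies in the window of \<open>s\<close> if and only if \<open>t < s \<le> t + \<epsilon>\<close>.\<close>

lemma back_avg_dual:
 assumes h: "L2 time h" and g: "L2 time g"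
 shows "inverse eps * (LINT t|time. h t * (LINT s|time. indicator {s - eps..<s} t * g s)) = (LINT s|time. g s * back_avg T eps h s)"
  and "integrable time (%t. h t * (LINT s|time. indicator {s - eps..<s} t * g s))"
proof -
 interpret P: pair_sigma_finite time time using sigma_finite_time by (simp add: pair_sigma_finite_def)
 define f where "f = (%(s, t). indicator {s - eps..<s} t * (g s * h t))"
 have gh: "integrable (time \<Otimes>\<^sub>M time) (%p. g (fst p) * h (snd p))"
  by (rule tensor_integral(1)[OF sigma_finite_time sigma_finite_time])
   (use h g in \<open>auto intro!: finite_measure.L2_integrable[OF finite_measure_time_measure]\<close>)
 have wt: "(%p. indicator {fst p - eps..<fst p} (snd p) :: real) \<in> borel_measurable (time \<Otimes>\<^sub>M time)"
  using measurable_window[of eps T] by (simp add: split_beta')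
 have f: "integrable (time \<Otimes>\<^sub>M time) f"
  by (rule Bochner_Integration.integrable_bound[OF gh])
   (use borel_measurable_times[OF wt borel_measurable_integrable[OF gh]] in \<open>auto simp: f_def split_beta' abs_mult indicator_def\<close>)
 have e: "(%t. h t * (LINT s|time. indicator {s - eps..<s} t * g s)) = (%t. (LINT s|time. f (s, t)))"
  by (simp add: f_def mult_ac flip: integral_mult_right_zero)
 show "integrable time (%t. h t * (LINT s|time. indicator {s - eps..<s} t * g s))"
  unfolding e using P.integrable_snd[of "%s t. f (s, t)"] f by simp
 have "(LINT t|time. h t * (LINT s|time. indicator {s - eps..<s} t * g s)) = (LINT t|time. (LINT s|time. f (s, t)))"
  by (simp only: e)
 also have "\<dots> = (LINT s|time. (LINT t|time. f (s, t)))"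
  using P.Fubini_integral[of "%s t. f (s, t)"] f by (simp add: split_beta')
 also have "inverse eps * \<dots> = (LINT s|time. g s * back_avg T eps h s)"
  by (simp add: f_def back_avg_def mult_ac flip: integral_mult_right_zero)
 finally show "inverse eps * (LINT t|time. h t * (LINT s|time. indicator {s - eps..<s} t * g s)) = (LINT s|time. g s * back_avg T eps h s)" .
qed

text \<open>A jointly measurable version of \<open>(t, w) \<mapsto> W\<^bsub>(t+\<epsilon>)\<and>T\<^esub> - W\<^sub>t\<close>.\<close>

definition increment_version :: "real \<Rightarrow> (real \<Rightarrow> 'a \<Rightarrow> real) \<Rightarrow> bool" where
 "increment_version eps D \<longleftrightarrow> L2 TM (case_prod D) \<and>
  (AE w in M. \<forall>t\<in>{0..T}. D t w = W (min (t + eps) T) w - W t w) \<and>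
  (\<forall>t\<in>{0..T}. wiener (indicator {t<..min (t + eps) T}) (D t))"

lemma increment_version_exists:
 assumes eps: "eps > 0"
 obtains D where "increment_version eps D"
proof -
 obtain V where V: "(case_prod V) \<in> borel_measurable (borel \<Otimes>\<^sub>M M)" "AE w in M. \<forall>t\<in>{0..T}. V t w = W t w"
  by (rule joint_version) blast
 define D where "D t w = V (min (t + eps) T) w - V t w" for t w
 have V': "(%p. V (fst p) (snd p)) \<in> borel_measurable (borel \<Otimes>\<^sub>M M)" using V(1) by (simp add: split_beta')
 have id: "(%t. t) \<in> borel_measurable time" "(%t. min (t + eps) T) \<in> borel_measurable time" by (rule measurable_time_measureI, simp)+
 have p: "(%p. (fst p, snd p)) \<in> measurable TM (borel \<Otimes>\<^sub>M M)" "(%p. (min (fst p + eps) T, snd p)) \<in> measurable TM (borel \<Otimes>\<^sub>M M)"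
  by (rule measurable_Pair[OF measurable_compose[OF measurable_fst id(1)] measurable_snd] measurable_Pair[OF measurable_compose[OF measurable_fst id(2)] measurable_snd])+
 have DM: "(%p. D (fst p) (snd p)) \<in> borel_measurable TM"
  unfolding D_def using borel_measurable_diff[OF measurable_compose[OF p(2) V'] measurable_compose[OF p(1) V']] by simp
 have eq: "AE w in M. \<forall>t\<in>{0..T}. D t w = W (min (t + eps) T) w - W t w"
  using V(2) by eventually_elim (use eps T in \<open>auto simp: D_def\<close>)
 have DW: "wiener (indicator {t<..min (t + eps) T}) (D t)" if t: "t \<in> {0..T}" for t
 proof (rule wiener_cong_AE[OF wiener_interval])
  have "t \<in> space time" using t by simp
  then show "D t \<in> borel_measurable M" using measurable_compose[OF measurable_Pair1' DM] by simp
  show "AE w in M. W (min (t + eps) T) w - W t w = D t w" using eq by eventually_elim (use t in auto)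
 qed (use t eps in auto)
 have fin: "(\<integral>\<^sup>+p. ennreal ((D (fst p) (snd p))^2) \<partial>TM) < \<infinity>"
 proof -
  have "(\<integral>\<^sup>+p. ennreal ((D (fst p) (snd p))^2) \<partial>TM) = (\<integral>\<^sup>+t. (\<integral>\<^sup>+w. ennreal ((D t w)^2) \<partial>M) \<partial>time)"
   using sigma_finite_measure.nn_integral_fst[OF sigma_finite_M, of "%p. ennreal ((D (fst p) (snd p))^2)" time] DM by simp
  also have "\<dots> \<le> (\<integral>\<^sup>+t. ennreal eps \<partial>time)"
  proof (rule nn_integral_mono)
   fix t assume "t \<in> space time"
   then have t: "t \<in> {0..T}" by simp
   note d = wienerD(2)[OF DW[OF t]]
   have "(LINT w|M. D t w * D t w) = (LINT s|time. indicator {t<..min (t + eps) T} s * indicator {t<..min (t + eps) T} s)"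
    by (rule wiener_isometry[OF DW[OF t] DW[OF t]])
   also have "\<dots> = (LINT s|time. indicator {t<..min (t + eps) T} s)" by (rule Bochner_Integration.integral_cong) (auto simp: indicator_def)
   also have "\<dots> \<le> eps" using integral_time_interval[of t "min (t + eps) T" T] t eps by auto
   finally have "(LINT w|M. (D t w)^2) \<le> eps" by (simp add: power2_eq_square)
   then show "(\<integral>\<^sup>+w. ennreal ((D t w)^2) \<partial>M) \<le> ennreal eps"
    using nn_integral_eq_integral[OF L2D(2)[OF d]] by (simp add: ennreal_leI)
  qed
  also have "\<dots> < \<infinity>" using finite_measure.emeasure_finite[OF finite_measure_time_measure, of T "space time"] by (auto simp: ennreal_mult_less_top less_top)
  finally show ?thesis .
 qed
 have "L2 TM (case_prod D)"
  unfolding square_integrable_def using DM fin by (auto simp: split_beta' integrable_iff_bounded)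
 then show thesis using eq DW by (intro that[of D]) (simp add: increment_version_def)
qed

text \<open>The forward approximation, for a version \<open>D\<close> of the increments.\<close>

definition fwd :: "real \<Rightarrow> (real \<Rightarrow> 'a \<Rightarrow> real) \<Rightarrow> (real \<Rightarrow> 'a \<Rightarrow> real) \<Rightarrow> 'a \<Rightarrow> real" where
 "fwd eps D v w = inverse eps * (LINT t|time. v t w * D t w)"

lemma fwd_pairing:
 assumes D: "increment_version eps D" and h: "L2 time h" and Z: "L2 M Z"
 shows "(LINT w|M. fwd eps D (%t _. h t) w * Z w) = inverse eps * (LINT t|time. h t * (LINT w|M. D t w * Z w))"
  and "fwd eps D (%t _. h t) \<in> borel_measurable M"
proof -
 interpret pair_sigma_finite time M using sigma_finite_time sigma_finite_M by (simp add: pair_sigma_finite_def)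
 have DS: "L2 TM (case_prod D)" using D by (simp add: increment_version_def)
 have I: "integrable TM (%(t, w). h t * Z w * D t w)" if "L2 M Z" for Z
  using integrable_mult_L2[OF tensor_L2[OF sigma_finite_time sigma_finite_M h that] DS] by (simp add: split_beta')
 have one: "L2 M (%_. 1)" by (simp add: square_integrable_def)
 show "fwd eps D (%t _. h t) \<in> borel_measurable M"
  using borel_measurable_integrable[OF integral_time_M(1)[OF I[OF one]]] unfolding fwd_def[abs_def] by simp
 have "(LINT w|M. (LINT t|time. h t * Z w * D t w)) = (LINT t|time. (LINT w|M. h t * Z w * D t w))"
  using Fubini_integral[OF I[OF Z]] by simp
 moreover have "fwd eps D (%t _. h t) w * Z w = inverse eps * (LINT t|time. h t * Z w * D t w)" for w
 proof -
  have "(LINT t|time. h t * Z w * D t w) = (LINT t|time. Z w * (h t * D t w))" by (simp add: mult_ac)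
  then show ?thesis by (simp add: fwd_def)
 qed
 moreover have "(LINT w|M. h t * Z w * D t w) = h t * (LINT w|M. D t w * Z w)" for t
 proof -
  have "(LINT w|M. h t * Z w * D t w) = (LINT w|M. h t * (D t w * Z w))" by (simp add: mult_ac)
  then show ?thesis by simp
 qed
 ultimately show "(LINT w|M. fwd eps D (%t _. h t) w * Z w) = inverse eps * (LINT t|time. h t * (LINT w|M. D t w * Z w))"
  by simp
qed

lemma fwd_L2:
 assumes D: "increment_version eps D" and h: "L2 time h"
 shows "L2 M (fwd eps D (%t _. h t))"
proof -
 have DS: "L2 TM (case_prod D)" using D by (simp add: increment_version_def)
 have one: "L2 M (%_. 1)" by (simp add: square_integrable_def)
 define c where "c = (inverse eps)^2 * (LINT t|time. (h t)^2)"
 have DI: "integrable TM (%p. (D (fst p) (snd p))^2)" using L2D(2)[OF DS] by (simp add: split_beta')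
 have I: "integrable M (%w. c * (LINT t|time. (D t w)^2))" using integral_time_M(1)[OF DI] by simp
 note m = fwd_pairing(2)[OF D h one]
 have "integrable M (%w. (fwd eps D (%t _. h t) w)^2)"
 proof (rule Bochner_Integration.integrable_bound[OF I borel_measurable_power[OF m]])
  show "AE w in M. norm ((fwd eps D (%t _. h t) w)^2) \<le> norm (c * (LINT t|time. (D t w)^2))"
   using section_L2[OF DS]
  proof eventually_elim
   case (elim w)
   have "(fwd eps D (%t _. h t) w)^2 = (inverse eps)^2 * (LINT t|time. h t * D t w)^2" by (simp add: fwd_def power_mult_distrib)
   also have "\<dots> \<le> (inverse eps)^2 * ((LINT t|time. (h t)^2) * (LINT t|time. (D t w)^2))" by (rule mult_left_mono[OF L2_Cauchy_Schwarz[OF h elim]]) simp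
   finally show ?case by (simp add: c_def mult_ac)
  qed
 qed
 with m show ?thesis by (simp add: square_integrable_def)
qed

lemma increment_window: "t \<in> {0..T} \<Longrightarrow> s \<in> {0..T} \<Longrightarrow> indicator {t<..min (t + eps) T} s = (indicator {s - eps..<s} t :: real)"
 by (auto simp: indicator_def)

text \<open>Moments up to order two identify the Wiener integral: with \<open>A = \<epsilon>\<^sup>-\<^sup>1 \<integral> h\<^sub>t (W\<^bsub>t+\<epsilon>\<^esub> - W\<^sub>t) dt\<close>,
 \<open>b\<close> the backward average of \<open>h\<close> and \<open>Y\<close> the Wiener integral of \<open>b\<close>, one has \<open>E(A - Y)^2 = 0\<close>.\<close>

lemma fwd_wiener_integral:
 assumes D: "increment_version eps D" and h: "L2 time h" and eps: "eps > 0"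
 shows "wiener (back_avg T eps h) (fwd eps D (%t _. h t))"
proof -
 define A where "A = fwd eps D (%t _. h t)"
 define b where "b = back_avg T eps h"
 note bS = back_avg_contraction(1)[OF h eps, folded b_def]
 have AS: "L2 M A" unfolding A_def by (rule fwd_L2[OF D h])
 obtain Y where Y: "wiener b Y" using wiener_exists[OF bS] by blast
 note YS = wienerD(2)[OF Y]
 have DW: "wiener (indicator {t<..min (t + eps) T}) (D t)" if "t \<in> {0..T}" for t using D that by (simp add: increment_version_def)
 have pair: "(LINT w|M. A w * Z w) = (LINT s|time. g s * b s)"
  if Z: "L2 M Z" and g: "L2 time g"
   and DZ: "\<And>t. t \<in> {0..T} \<Longrightarrow> (LINT w|M. D t w * Z w) = (LINT s|time. indicator {t<..min (t + eps) T} s * g s)" for Z g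
 proof -
  have "(LINT w|M. A w * Z w) = inverse eps * (LINT t|time. h t * (LINT w|M. D t w * Z w))" unfolding A_def by (rule fwd_pairing(1)[OF D h Z])
  also have "(LINT t|time. h t * (LINT w|M. D t w * Z w)) = (LINT t|time. h t * (LINT s|time. indicator {s - eps..<s} t * g s))"
  proof (rule lint_cong)
   fix t assume "t \<in> space time"
   then have t: "t \<in> {0..T}" by simp
   have "(LINT s|time. indicator {t<..min (t + eps) T} s * g s) = (LINT s|time. indicator {s - eps..<s} t * g s)"
    by (rule lint_cong) (use increment_window[OF t] in simp)
   then show "h t * (LINT w|M. D t w * Z w) = h t * (LINT s|time. indicator {s - eps..<s} t * g s)" by (simp add: DZ[OF t])
  qed
  finally show ?thesis unfolding b_def back_avg_dual(1)[OF h g] .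
 qed
 have AY: "(LINT w|M. A w * Y w) = (LINT s|time. b s * b s)"
  by (rule pair[OF YS bS wiener_isometry[OF DW Y]])
 have AA: "(LINT w|M. A w * A w) = (LINT s|time. b s * b s)"
 proof (rule pair[OF AS bS])
  fix t assume t: "t \<in> {0..T}"
  note wt = DW[OF t]
  have "(LINT w|M. A w * D t w) = (LINT s|time. indicator {t<..min (t + eps) T} s * b s)"
   by (rule pair[OF wienerD(2)[OF wt] wienerD(1)[OF wt] wiener_isometry[OF DW wt]])
  then show "(LINT w|M. D t w * A w) = (LINT s|time. indicator {t<..min (t + eps) T} s * b s)" by (simp add: mult.commute)
 qed
 have "(LINT w|M. (A w - Y w)^2) = (LINT w|M. A w * A w - 2 * (A w * Y w) + Y w * Y w)"
  by (rule Bochner_Integration.integral_cong) (auto simp: power2_eq_square algebra_simps)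
 also have "\<dots> = 0"
  using integrable_mult_L2[OF AS AS] integrable_mult_L2[OF AS YS] integrable_mult_L2[OF YS YS]
   AA AY wiener_isometry[OF Y Y] by simp
 finally have z: "(LINT w|M. (A w - Y w)^2) = 0" .
 have "AE w in M. (A w - Y w)^2 = 0"
  using integral_nonneg_eq_0_iff_AE[OF L2D(2)[OF L2_diff[OF AS YS]]] z by simp
 then have "AE w in M. Y w = A w" by eventually_elim simp
 from wiener_cong_AE[OF Y L2D(1)[OF AS] this] show ?thesis unfolding A_def b_def .
qed


section \<open>Forward approximation and Skorohod integral\<close>

text \<open>The difference is an elementary Skorohod integral with the function \<open>k\<^sub>n - h\<close>, of norm at most a multiple of its norm.\<close>

lemma elem_skorohod_converges:
 assumes F: "smooth F DF" and Z: "\<And>n. wiener (k n) (Z n)" and Y: "wiener h Y"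
  and k: "L2_converges time k h"
 shows "L2_converges M (%n. elem_skorohod F DF (k n) (Z n)) (elem_skorohod F DF h Y)"
 unfolding L2_converges_def
proof (intro conjI allI elem_skorohod_L2[OF F Z] elem_skorohod_L2[OF F Y])
 obtain K where K: "L2 time K" "\<forall>s\<in>{0..T}. \<forall>w\<in>space M. \<bar>DF s w\<bar> \<le> K s"
  using smooth_functional_derivative(2)[OF F] by blast
 have one: "integrable M (%_. 1 :: real)" by simp
 define c where "c = (LINT w|M. (F w)^2) + (LINT s|time. (K s)^2)"
 have le: "(LINT w|M. (elem_skorohod F DF (k n) (Z n) w - elem_skorohod F DF h Y w)^2) \<le> c * (LINT t|time. (k n t - h t)^2)" for n
 proof -
  let ?k = "%t. k n t - h t"
  note wt = wiener_diff[OF Z[of n] Y]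
  note kS = wienerD(1)[OF wt]
  have "(LINT w|M. (elem_skorohod F DF (k n) (Z n) w - elem_skorohod F DF h Y w)^2)
   = (LINT w|M. (\<Sum>j<(1::nat). elem_skorohod F DF ?k (%w. Z n w - Y w) w)^2)"
  proof (rule lint_cong)
   fix w assume w: "w \<in> space M"
   note s = smooth_functional_derivative(3)[OF F w]
   have "dir_deriv ?k DF w = dir_deriv (k n) DF w - dir_deriv h DF w"
    using integrable_mult_L2[OF s wienerD(1)[OF Z[of n]]] integrable_mult_L2[OF s wienerD(1)[OF Y]]
    by (simp add: dir_deriv_def right_diff_distrib)
   then have "elem_skorohod F DF (k n) (Z n) w - elem_skorohod F DF h Y w = elem_skorohod F DF ?k (%w. Z n w - Y w) w"
    unfolding elem_skorohod_def right_diff_distrib by linarith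
   then show "(elem_skorohod F DF (k n) (Z n) w - elem_skorohod F DF h Y w)^2 = (\<Sum>j<(1::nat). elem_skorohod F DF ?k (%w. Z n w - Y w) w)^2"
    by simp
  qed
  also have "\<dots> \<le> (LINT (t, w)|TM. (\<Sum>j<(1::nat). F w * ?k t)^2) + (LINT (s, t, w)|TTM. (\<Sum>j<(1::nat). DF s w * ?k t)^2)"
   by (rule elem_skorohod_sum_bound) (rule F, rule wt)
  also have "(LINT (t, w)|TM. (\<Sum>j<(1::nat). F w * ?k t)^2) = (LINT w|M. (F w)^2) * (LINT t|time. (?k t)^2)"
   using tensor_integral(2)[OF sigma_finite_time sigma_finite_M L2D(2)[OF kS] L2D(2)[OF smooth_functional_L2[OF F]]]
   by (simp add: split_beta' power_mult_distrib mult.commute)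
  also have "(LINT (s, t, w)|TTM. (\<Sum>j<(1::nat). DF s w * ?k t)^2) \<le> (LINT s|time. (K s)^2) * (LINT t|time. (?k t)^2)"
  proof -
   have d: "integrable TTM (%p. (DF (fst p) (snd (snd p)) * ?k (fst (snd p)))^2)"
    using smooth_process_L2(2)[of 1 "%_. F" "%_. DF" "%_. ?k", OF F kS] by (simp add: square_integrable_def split_beta')
   note q = tensor_integral[OF sigma_finite_time sigma_finite_M L2D(2)[OF kS] one]
   note p = tensor_integral[OF sigma_finite_time sigma_finite_time_M L2D(2)[OF K(1)] q(1)]
   have "(LINT (s, t, w)|TTM. (\<Sum>j<(1::nat). DF s w * ?k t)^2) = (LINT p|TTM. (DF (fst p) (snd (snd p)) * ?k (fst (snd p)))^2)"
    by (simp add: split_beta')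
   also have "\<dots> \<le> (LINT p|TTM. (K (fst p))^2 * ((?k (fst (snd p)))^2 * 1))"
   proof (rule integral_mono[OF d p(1)])
    fix p assume "p \<in> space TTM"
    then have "\<bar>DF (fst p) (snd (snd p))\<bar> \<le> K (fst p)" using K(2) by (auto simp: space_pair_measure)
    then have "\<bar>DF (fst p) (snd (snd p))\<bar>^2 \<le> (K (fst p))^2" by (intro power_mono) auto
    then show "(DF (fst p) (snd (snd p)) * ?k (fst (snd p)))^2 \<le> (K (fst p))^2 * ((?k (fst (snd p)))^2 * 1)"
     by (simp add: power_mult_distrib mult_right_mono)
   qed
   finally show ?thesis using p(2) q(2) by (simp add: prob_space)
  qed
  finally show ?thesis by (simp add: c_def distrib_right)
 qed
 show "(%n. (LINT w|M. (elem_skorohod F DF (k n) (Z n) w - elem_skorohod F DF h Y w)^2)) \<longlonglongrightarrow> 0"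
 proof (rule tendsto_sandwich[OF _ _ tendsto_const])
  show "(%n. c * (LINT t|time. (k n t - h t)^2)) \<longlonglongrightarrow> 0" using tendsto_mult_left[OF L2_convergesD(3)[OF k], of c] by simp
 qed (use le in \<open>auto intro!: always_eventually\<close>)
qed

text \<open>The trace term \<open>\<epsilon>\<^sup>-\<^sup>1 \<integral>\<integral> 1\<^bsub>t < s \<le> t+\<epsilon>\<^esub> D\<^sub>s v\<^sub>t ds dt\<close>.\<close>

definition trace_avg :: "real \<Rightarrow> (real \<Rightarrow> real \<Rightarrow> 'a \<Rightarrow> real) \<Rightarrow> 'a \<Rightarrow> real" where
 "trace_avg eps Dv w = inverse eps * (LINT t|time. (LINT s|time. indicator {s - eps..<s} t * Dv s t w))"

lemma back_avg_cong: "(\<And>t. t \<in> {0..T} \<Longrightarrow> f t = g t) \<Longrightarrow> back_avg T eps f s = back_avg T eps g s"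
 unfolding back_avg_def by (intro arg_cong2[where f = "(*)"] refl Bochner_Integration.integral_cong) auto

text \<open>\<open>R\<close> is the Skorohod integral of the averaged process, computed in two ways: as \<open>\<Sum>\<^sub>j \<delta>(F\<^sub>j B h\<^sub>j)\<close>, and
 by the rule \<open>\<delta>(F g) = F W(g) - \<langle>DF, g\<rangle>\<close> with the Wiener integral of \<open>B h\<^sub>j\<close> found above.\<close>

lemma smooth_forward:
 assumes X: "smooth_skorohod v Dv X"
 obtains R where
  "\<And>eps D. eps > 0 \<Longrightarrow> increment_version eps D \<Longrightarrow>
   smooth_skorohod (%t w. back_avg T eps (%r. v r w) t) (%s t w. back_avg T eps (%r. Dv s r w) t) (R eps D)"
  "\<And>eps D. eps > 0 \<Longrightarrow> increment_version eps D \<Longrightarrow> AE w in M. R eps D w = fwd eps D v w - trace_avg eps Dv w"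
  "\<And>eps D. (\<And>n. eps n > 0) \<Longrightarrow> (\<And>n. increment_version (eps n) (D n)) \<Longrightarrow> eps \<longlonglongrightarrow> 0 \<Longrightarrow> L2_converges M (%n. R (eps n) (D n)) X"
proof -
 obtain m :: nat and F DF h Y where q: "\<forall>j<m. smooth (F j) (DF j) \<and> wiener (h j) (Y j)"
  "\<forall>t\<in>{0..T}. \<forall>w\<in>space M. v t w = (\<Sum>j<m. F j w * h j t)"
  "\<forall>s\<in>{0..T}. \<forall>t\<in>{0..T}. \<forall>w\<in>space M. Dv s t w = (\<Sum>j<m. DF j s w * h j t)"
  "X = (%w. \<Sum>j<m. elem_skorohod (F j) (DF j) (h j) (Y j) w)" by (rule smooth_skorohodE[OF X]) blast
 have F: "smooth (F j) (DF j)" and Y: "wiener (h j) (Y j)" and h: "L2 time (h j)" if "j < m" for j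
  using q(1) that wienerD(1) by auto
 define R where "R eps D w = (\<Sum>j<m. elem_skorohod (F j) (DF j) (back_avg T eps (h j)) (fwd eps D (%t _. h j t)) w)" for eps D w
 show thesis
 proof (rule that[of R])
  fix eps :: real and D assume eps: "eps > 0" and D: "increment_version eps D"
  show "smooth_skorohod (%t w. back_avg T eps (%r. v r w) t) (%s t w. back_avg T eps (%r. Dv s r w) t) (R eps D)"
   unfolding smooth_skorohod_def
  proof (rule exI[of _ m], rule exI[of _ F], rule exI[of _ DF], rule exI[of _ "%j. back_avg T eps (h j)"], rule exI[of _ "%j. fwd eps D (%t _. h j t)"],
    intro conjI allI impI ballI)
   fix j assume j: "j < m"
   show "smooth (F j) (DF j)" by (rule F[OF j])
   show "wiener (back_avg T eps (h j)) (fwd eps D (%t _. h j t))" by (rule fwd_wiener_integral[OF D h[OF j] eps])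
  next
   fix t w assume "w \<in> space M"
   then have "back_avg T eps (%r. v r w) t = back_avg T eps (%r. \<Sum>j<m. F j w * h j r) t" using q(2) by (intro back_avg_cong) auto
   then show "back_avg T eps (%r. v r w) t = (\<Sum>j<m. F j w * back_avg T eps (h j) t)"
    using back_avg_sum[of "{..<m}" T h eps "%j. F j w" t] h by simp
  next
   fix s t w assume "s \<in> {0..T}" "w \<in> space M"
   then have "back_avg T eps (%r. Dv s r w) t = back_avg T eps (%r. \<Sum>j<m. DF j s w * h j r) t" using q(3) by (intro back_avg_cong) auto
   then show "back_avg T eps (%r. Dv s r w) t = (\<Sum>j<m. DF j s w * back_avg T eps (h j) t)"
    using back_avg_sum[of "{..<m}" T h eps "%j. DF j s w" t] h by simp
  qed (simp add: R_def[abs_def])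
  have DS: "L2 TM (case_prod D)" using D by (simp add: increment_version_def)
  show "AE w in M. R eps D w = fwd eps D v w - trace_avg eps Dv w"
   using section_L2[OF DS] AE_space
  proof eventually_elim
   case (elim w)
   note w = elim(2)
   have hD: "integrable time (%t. h j t * D t w)" if "j < m" for j using integrable_mult_L2[OF h[OF that] elim(1)] .
   have "fwd eps D v w = inverse eps * (LINT t|time. (\<Sum>j<m. F j w * (h j t * D t w)))"
    unfolding fwd_def by (intro arg_cong2[where f = "(*)"] refl Bochner_Integration.integral_cong)
     (use q(2) w in \<open>auto simp: sum_distrib_right mult.assoc\<close>)
   also have "(LINT t|time. (\<Sum>j<m. F j w * (h j t * D t w))) = (\<Sum>j<m. F j w * (LINT t|time. h j t * D t w))"
    using hD by (subst Bochner_Integration.integral_sum) auto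
   also have "inverse eps * \<dots> = (\<Sum>j<m. F j w * fwd eps D (%t _. h j t) w)"
    by (simp add: fwd_def sum_distrib_left mult_ac)
   finally have f: "fwd eps D v w = (\<Sum>j<m. F j w * fwd eps D (%t _. h j t) w)" .
   let ?wt = "%s t. indicator {s - eps..<s} t :: real"
   have wt: "?wt s t = indicator {t<..t + eps} s" for s t by (auto simp: indicator_def)
   note DF = smooth_functional_derivative(3)[OF F w]
   have inner: "(LINT s|time. ?wt s t * Dv s t w) = (\<Sum>j<m. h j t * (LINT s|time. ?wt s t * DF j s w))" if t: "t \<in> {0..T}" for t
   proof -
    have "(LINT s|time. ?wt s t * Dv s t w) = (LINT s|time. (\<Sum>j<m. h j t * (?wt s t * DF j s w)))"
     by (rule lint_cong) (use q(3) w t in \<open>auto simp: sum_distrib_left mult_ac\<close>)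
    also have "\<dots> = (\<Sum>j<m. h j t * (LINT s|time. ?wt s t * DF j s w))"
     unfolding wt using window_integrable[OF DF, of _ "{t<..t + eps}"] by (subst Bochner_Integration.integral_sum) auto
    finally show ?thesis .
   qed
   have "(LINT t|time. (LINT s|time. ?wt s t * Dv s t w)) = (LINT t|time. (\<Sum>j<m. h j t * (LINT s|time. ?wt s t * DF j s w)))"
    by (rule lint_cong) (use inner in auto)
   also have "\<dots> = (\<Sum>j<m. (LINT t|time. h j t * (LINT s|time. ?wt s t * DF j s w)))"
    by (rule Bochner_Integration.integral_sum) (use back_avg_dual(2)[OF h DF] in auto)
   finally have "trace_avg eps Dv w = (\<Sum>j<m. inverse eps * (LINT t|time. h j t * (LINT s|time. ?wt s t * DF j s w)))"
    by (simp add: trace_avg_def sum_distrib_left)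
   also have "\<dots> = (\<Sum>j<m. dir_deriv (back_avg T eps (h j)) (DF j) w)"
    unfolding dir_deriv_def by (rule sum.cong[OF refl]) (use back_avg_dual(1)[OF h DF] in auto)
   finally show "R eps D w = fwd eps D v w - trace_avg eps Dv w"
    unfolding f R_def elem_skorohod_def by (simp add: sum_subtractf)
  qed
 next
  fix eps :: "nat \<Rightarrow> real" and D assume eps: "\<And>n. eps n > 0" and D: "\<And>n. increment_version (eps n) (D n)" and l: "eps \<longlonglongrightarrow> 0"
  show "L2_converges M (%n. R (eps n) (D n)) X"
   unfolding q(4) R_def
  proof (rule L2_converges_sum)
   fix j assume "j \<in> {..<m}"
   then have j: "j < m" by simp
   show "L2_converges M (%n w. elem_skorohod (F j) (DF j) (back_avg T (eps n) (h j)) (fwd (eps n) (D n) (%t _. h j t)) w) (%w. elem_skorohod (F j) (DF j) (h j) (Y j) w)"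
    using T by (intro elem_skorohod_converges[OF F[OF j] fwd_wiener_integral[OF D h[OF j] eps] Y[OF j] back_avg_tendsto[OF h[OF j] _ eps l]]) simp
  qed
 qed
qed

lemma slice_L2:
 assumes f: "L2 TTM (case_triple f)"
 shows "AE s in time. L2 TM (%(t, w). f s t w)"
proof -
 interpret P: pair_sigma_finite time TM using sigma_finite_time sigma_finite_time_M by (simp add: pair_sigma_finite_def)
 have "integrable TTM (%(s, q). (f s (fst q) (snd q))^2)" using L2D(2)[OF f] by (simp add: split_beta')
 from P.AE_integrable_fst[OF this] show ?thesis
 proof (rule AE_mp, intro AE_I2 impI)
  fix s assume s: "s \<in> space time" and i: "integrable TM (%q. (f s (fst q) (snd q))^2)"
  have "(%q. f s (fst q) (snd q)) \<in> borel_measurable TM"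
   using measurable_compose[OF measurable_Pair1'[OF s] L2D(1)[OF f]] by (simp add: split_beta')
  with i show "L2 TM (%(t, w). f s t w)" by (simp add: square_integrable_def split_beta')
 qed
qed

lemma back_avg_contraction_TM:
 assumes f: "L2 TM (case_prod f)" and g: "L2 TM (case_prod g)" and eps: "eps > 0"
  and d: "L2 TM (%(t, w). back_avg T eps (%r. f r w) t - back_avg T eps (%r. g r w) t)"
 shows "(LINT (t, w)|TM. (back_avg T eps (%r. f r w) t - back_avg T eps (%r. g r w) t)^2) \<le> (LINT (t, w)|TM. (f t w - g t w)^2)"
proof -
 have I1: "integrable TM (%(t, w). (back_avg T eps (%r. f r w) t - back_avg T eps (%r. g r w) t)^2)"
  using L2D(2)[OF d] by (simp add: split_beta')
 have I2: "integrable TM (%(t, w). (f t w - g t w)^2)"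
  using L2D(2)[OF L2_diff[OF f g]] by (simp add: split_beta')
 show ?thesis
  unfolding integral_time_M(2)[OF I1] integral_time_M(2)[OF I2]
 proof (rule integral_mono_AE[OF integral_time_M(1)[OF I1] integral_time_M(1)[OF I2]])
  show "AE w in M. (LINT t|time. (case (t, w) of (t, w) \<Rightarrow> (back_avg T eps (%r. f r w) t - back_avg T eps (%r. g r w) t)^2))
    \<le> (LINT t|time. (case (t, w) of (t, w) \<Rightarrow> (f t w - g t w)^2))"
   using section_L2[OF f] section_L2[OF g]
  proof eventually_elim
   case (elim w)
   show ?case using back_avg_contraction(2)[OF L2_diff[OF elim] eps] by (simp add: back_avg_diff[OF elim])
  qed
 qed
qed

lemma back_avg_contraction_TTM:
 assumes f: "L2 TTM (case_triple f)" and g: "L2 TTM (case_triple g)" and eps: "eps > 0"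
  and d: "L2 TTM (%(s, t, w). back_avg T eps (%r. f s r w) t - back_avg T eps (%r. g s r w) t)"
 shows "(LINT (s, t, w)|TTM. (back_avg T eps (%r. f s r w) t - back_avg T eps (%r. g s r w) t)^2) \<le> (LINT (s, t, w)|TTM. (f s t w - g s t w)^2)"
proof -
 interpret P: pair_sigma_finite time TM using sigma_finite_time sigma_finite_time_M by (simp add: pair_sigma_finite_def)
 let ?B = "%s (t, w). (back_avg T eps (%r. f s r w) t - back_avg T eps (%r. g s r w) t)^2"
 let ?F = "%s (t, w). (f s t w - g s t w)^2"
 have I1: "integrable TTM (%(s, q). ?B s q)" using L2D(2)[OF d] by (simp add: split_beta')
 have I2: "integrable TTM (%(s, q). ?F s q)" using L2D(2)[OF L2_diff[OF f g]] by (simp add: split_beta')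
 have "(LINT s|time. (LINT q|TM. ?B s q)) \<le> (LINT s|time. (LINT q|TM. ?F s q))"
 proof (rule integral_mono_AE[OF P.integrable_fst[OF I1] P.integrable_fst[OF I2]])
  show "AE s in time. (LINT q|TM. ?B s q) \<le> (LINT q|TM. ?F s q)"
   using slice_L2[OF f] slice_L2[OF g] slice_L2[OF d]
   by eventually_elim (rule back_avg_contraction_TM[OF _ _ eps])
 qed
 then show ?thesis using P.integral_fst[OF I1] P.integral_fst[OF I2] by (simp add: split_beta')
qed


lemma fwd_integral:
 assumes D: "increment_version eps D" and v: "L2 TM (case_prod v)"
 shows "integrable M (fwd eps D v)"
  and "A \<in> sets M \<Longrightarrow> L2 TM (%p. indicator A (snd p) * D (fst p) (snd p))"
  and "A \<in> sets M \<Longrightarrow> (LINT w|M. indicator A w * fwd eps D v w) = inverse eps * (LINT p|TM. case_prod v p * (indicator A (snd p) * D (fst p) (snd p)))"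
proof -
 have DS: "L2 TM (%p. D (fst p) (snd p))" using D by (simp add: increment_version_def split_beta')
 have vS: "L2 TM (%p. v (fst p) (snd p))" using v by (simp add: split_beta')
 show "integrable M (fwd eps D v)"
  using integral_time_M(1)[OF integrable_mult_L2[OF vS DS]] by (simp add: fwd_def[abs_def])
 show AS: "L2 TM (%p. indicator A (snd p) * D (fst p) (snd p))" if A: "A \<in> sets M" for A
  by (rule L2_bound[OF DS borel_measurable_times[OF measurable_compose[OF measurable_snd borel_measurable_indicator[OF A]] L2D(1)[OF DS]], where C = 1])
   (auto simp: indicator_def)
 assume A: "A \<in> sets M"
 have "(LINT p|TM. v (fst p) (snd p) * (indicator A (snd p) * D (fst p) (snd p))) = (LINT w|M. (LINT t|time. indicator A w * (v t w * D t w)))"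
  using integral_time_M(2)[OF integrable_mult_L2[OF vS AS[OF A]]] by (simp add: mult_ac)
 then show "(LINT w|M. indicator A w * fwd eps D v w) = inverse eps * (LINT p|TM. case_prod v p * (indicator A (snd p) * D (fst p) (snd p)))"
  by (simp add: fwd_def split_beta' mult.left_commute)
qed

lemma window_TTM: "(%p. indicator {fst p - eps..<fst p} (fst (snd p)) :: real) \<in> borel_measurable TTM"
proof -
 have "(%p. (fst p, fst (snd p))) \<in> measurable TTM (time \<Otimes>\<^sub>M time)" by measurable
 from measurable_compose[OF this measurable_window[of eps T]] show ?thesis by simp
qed

lemma trace_integral:
 assumes Dv: "L2 TTM (case_triple Dv)"
 shows "integrable M (trace_avg eps Dv)"
  and "A \<in> sets M \<Longrightarrow> L2 TTM (%p. indicator {fst p - eps..<fst p} (fst (snd p)) * indicator A (snd (snd p)))"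
  and "A \<in> sets M \<Longrightarrow> (LINT w|M. indicator A w * trace_avg eps Dv w)
   = inverse eps * (LINT p|TTM. case_triple Dv p * (indicator {fst p - eps..<fst p} (fst (snd p)) * indicator A (snd (snd p))))"
proof -
 have DS: "L2 TTM (%p. Dv (fst p) (fst (snd p)) (snd (snd p)))" using Dv by (simp add: split_beta')
 have fin: "finite_measure TTM"
  by (rule finite_measure_pair_measure[OF finite_measure_pair_measure[OF finite_measure_axioms finite_measure_time_measure] finite_measure_time_measure])
 show AS: "L2 TTM (%p. indicator {fst p - eps..<fst p} (fst (snd p)) * indicator A (snd (snd p)))" if A: "A \<in> sets M" for A
  by (rule finite_measure.L2_of_bounded[OF fin borel_measurable_times[OF window_TTM measurable_compose[OF measurable_compose[OF measurable_snd measurable_snd] borel_measurable_indicator[OF A]]], where C = 1])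
   (auto simp: indicator_def)
 note I = integrable_mult_L2[OF DS AS]
 have e: "(LINT t|time. (LINT s|time. Dv s t w * (indicator {s - eps..<s} t * indicator A w))) = indicator A w * (LINT t|time. (LINT s|time. indicator {s - eps..<s} t * Dv s t w))" for A w
 proof -
  have "Dv s t w * (indicator {s - eps..<s} t * indicator A w) = indicator A w * (indicator {s - eps..<s} t * Dv s t w)" for s t by simp
  then show ?thesis by (simp only: integral_mult_right_zero)
 qed
 have "integrable M (%w. indicator (space M) w * (LINT t|time. (LINT s|time. indicator {s - eps..<s} t * Dv s t w)))"
  using integral_triple(1)[OF I[OF sets.top]] by (simp add: e)
 then have "integrable M (%w. (LINT t|time. (LINT s|time. indicator {s - eps..<s} t * Dv s t w)))"
  by (subst Bochner_Integration.integrable_cong[OF refl, where g = "%w. indicator (space M) w * (LINT t|time. (LINT s|time. indicator {s - eps..<s} t * Dv s t w))"]) auto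
 then show "integrable M (trace_avg eps Dv)" unfolding trace_avg_def[abs_def] by simp
 assume A: "A \<in> sets M"
 show "(LINT w|M. indicator A w * trace_avg eps Dv w)
   = inverse eps * (LINT p|TTM. case_triple Dv p * (indicator {fst p - eps..<fst p} (fst (snd p)) * indicator A (snd (snd p))))"
  using integral_triple(2)[OF I[OF A]] by (simp add: e trace_avg_def split_beta' mult.left_commute)
qed

text \<open>Pairings with indicators of events are continuous on \<open>\<L>\<^sup>1\<^sup>,\<^sup>2\<close>, so the identity of \<open>smooth_forward\<close> passes
 to the limit weakly.\<close>

lemma forward_limit_identify:
 assumes D: "increment_version eps D"
  and vs: "L2_converges TM (%k. case_prod (vs k)) (case_prod v)"
  and Dvs: "L2_converges TTM (%k. case_triple (Dvs k)) (case_triple Dv)"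
  and Rk: "\<And>k. AE w in M. Rk k w = fwd eps D (vs k) w - trace_avg eps (Dvs k) w"
  and R: "L2_converges M Rk R"
 shows "AE w in M. R w = fwd eps D v w - trace_avg eps Dv w"
proof -
 let ?G = "%v Dv w. fwd eps D v w - trace_avg eps Dv w"
 note f = fwd_integral[OF D L2_convergesD(2)[OF vs]] and t = trace_integral[OF L2_convergesD(2)[OF Dvs], where eps = eps]
 note fk = fwd_integral[OF D L2_convergesD(1)[OF vs]] and tk = trace_integral[OF L2_convergesD(1)[OF Dvs], where eps = eps]
 note RI = L2_integrable[OF L2_convergesD(2)[OF R]] and RkI = L2_integrable[OF L2_convergesD(1)[OF R]]
 have I: "integrable M (%w. R w - ?G v Dv w)" by (intro Bochner_Integration.integrable_diff RI f(1) t(1))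
 have "AE w in M. R w - ?G v Dv w = 0"
 proof (rule density_zero[OF I])
  fix A assume A: "A \<in> sets M"
  have AI: "integrable M (%w. indicator A w * g w)" if "integrable M g" for g :: "'a \<Rightarrow> real"
   using integrable_mult_indicator[OF A that] by simp
  have split: "(LINT w|M. indicator A w * (a w - b w)) = (LINT w|M. indicator A w * a w) - (LINT w|M. indicator A w * b w)"
   if "integrable M a" "integrable M b" for a b :: "'a \<Rightarrow> real"
   using AI[OF that(1)] AI[OF that(2)] by (simp add: right_diff_distrib)
  have indS: "L2 M (indicator A :: 'a \<Rightarrow> real)"
   by (rule L2_of_bounded[where C = 1]) (use A in \<open>auto simp: indicator_def\<close>)
  have l0: "(%k. (LINT w|M. indicator A w * Rk k w)) \<longlonglongrightarrow> (LINT w|M. indicator A w * R w)"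
   by (rule L2_converges_inner[OF L2_converges_const[OF indS] R])
  have lk: "(LINT w|M. indicator A w * Rk k w) = (LINT w|M. indicator A w * fwd eps D (vs k) w) - (LINT w|M. indicator A w * trace_avg eps (Dvs k) w)" for k
  proof -
   have "(LINT w|M. indicator A w * Rk k w) = (LINT w|M. indicator A w * ?G (vs k) (Dvs k) w)"
   proof (rule integral_cong_AE)
    show "(%w. indicator A w * Rk k w) \<in> borel_measurable M" by (rule borel_measurable_integrable[OF AI[OF RkI]])
    show "(%w. indicator A w * ?G (vs k) (Dvs k) w) \<in> borel_measurable M"
     by (rule borel_measurable_integrable[OF AI[OF Bochner_Integration.integrable_diff[OF fk(1) tk(1)]]])
    show "AE w in M. indicator A w * Rk k w = indicator A w * ?G (vs k) (Dvs k) w" using Rk[of k] by eventually_elim simp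
   qed
   then show ?thesis by (simp only: split[OF fk(1) tk(1)])
  qed
  have l1: "(%k. (LINT w|M. indicator A w * fwd eps D (vs k) w)) \<longlonglongrightarrow> (LINT w|M. indicator A w * fwd eps D v w)"
   unfolding f(3)[OF A] fk(3)[OF A] by (rule tendsto_mult_left[OF L2_converges_inner[OF vs L2_converges_const[OF f(2)[OF A]]]])
  have l2: "(%k. (LINT w|M. indicator A w * trace_avg eps (Dvs k) w)) \<longlonglongrightarrow> (LINT w|M. indicator A w * trace_avg eps Dv w)"
   unfolding t(3)[OF A] tk(3)[OF A] by (rule tendsto_mult_left[OF L2_converges_inner[OF Dvs L2_converges_const[OF t(2)[OF A]]]])
  have "(LINT w|M. indicator A w * R w) = (LINT w|M. indicator A w * fwd eps D v w) - (LINT w|M. indicator A w * trace_avg eps Dv w)"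
   by (rule LIMSEQ_unique[OF l0[unfolded lk] tendsto_diff[OF l1 l2]])
  then have "(LINT w|M. indicator A w * (R w - ?G v Dv w)) = 0"
   by (simp only: split[OF RI Bochner_Integration.integrable_diff[OF f(1) t(1)]] split[OF f(1) t(1)])
  then show "(LINT w:A|M. R w - ?G v Dv w) = 0" by (simp add: set_lebesgue_integral_def)
 qed
 then show ?thesis by eventually_elim simp
qed

text \<open>The Skorohod integrals \<open>R\<close> of the averaged smooth approximations converge uniformly in \<open>\<epsilon>\<close>, because
 averaging is a contraction; so the two limits may be exchanged.\<close>

theorem forward_minus_trace_converges:
 assumes v: "malliavin v Dv" and S: "skorohod v S"
  and eps: "\<And>n. eps n > 0" "eps \<longlonglongrightarrow> 0" and D: "\<And>n. increment_version (eps n) (D n)"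
 obtains Rs where "\<And>n. AE w in M. Rs n w = fwd (eps n) (D n) v w - trace_avg (eps n) Dv w" "L2_converges M Rs S"
proof -
 obtain vs Dvs Xs where X: "\<And>k. smooth_skorohod (vs k) (Dvs k) (Xs k)"
  and vs: "L2_converges TM (%k. case_prod (vs k)) (case_prod v)"
  and Dvs: "L2_converges TTM (%k. case_triple (Dvs k)) (case_triple Dv)"
  by (rule malliavin_process_smooth_approx[OF v]) blast
 obtain S' where S': "L2_converges M Xs S'" "skorohod v S'" by (rule skorohod_limit[OF X vs Dvs])
 have SS: "L2 M S" using S by (simp add: has_skorohod_integral_def)
 have XS: "L2_converges M Xs S"
 proof (rule L2_converges_le[OF S'(1) L2D(1)[OF L2_convergesD(1)[OF S'(1)]] SS])
  show "AE w in M. \<bar>Xs k w - S w\<bar> \<le> \<bar>Xs k w - S' w\<bar>" for k using skorohod_unique[OF S S'(2)] by eventually_elim simp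
 qed
 let ?P = "%k R. (\<forall>eps D. eps > 0 \<longrightarrow> increment_version eps D \<longrightarrow>
   smooth_skorohod (%t w. back_avg T eps (%r. vs k r w) t) (%s t w. back_avg T eps (%r. Dvs k s r w) t) (R eps D)) \<and>
  (\<forall>eps D. eps > 0 \<longrightarrow> increment_version eps D \<longrightarrow> (AE w in M. R eps D w = fwd eps D (vs k) w - trace_avg eps (Dvs k) w)) \<and>
  (\<forall>eps D. (\<forall>n. eps n > 0) \<longrightarrow> (\<forall>n. increment_version (eps n) (D n)) \<longrightarrow> eps \<longlonglongrightarrow> 0 \<longrightarrow> L2_converges M (%n. R (eps n) (D n)) (Xs k))"
 have "\<forall>k. \<exists>R. ?P k R"
 proof
  fix k show "\<exists>R. ?P k R"
  proof (rule smooth_forward[OF X[of k]])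
   fix R
   assume "\<And>eps D. eps > 0 \<Longrightarrow> increment_version eps D \<Longrightarrow>
     smooth_skorohod (%t w. back_avg T eps (%r. vs k r w) t) (%s t w. back_avg T eps (%r. Dvs k s r w) t) (R eps D)"
    "\<And>eps D. eps > 0 \<Longrightarrow> increment_version eps D \<Longrightarrow> AE w in M. R eps D w = fwd eps D (vs k) w - trace_avg eps (Dvs k) w"
    "\<And>eps D. (\<And>n. eps n > 0) \<Longrightarrow> (\<And>n. increment_version (eps n) (D n)) \<Longrightarrow> eps \<longlonglongrightarrow> 0 \<Longrightarrow> L2_converges M (%n. R (eps n) (D n)) (Xs k)"
   then show "\<exists>R. ?P k R" by (intro exI[of _ R]) simp
  qed
 qed
 from choice[OF this] obtain R where "\<forall>k. ?P k (R k)" by blast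
 then have R1: "\<And>k n. smooth_skorohod (%t w. back_avg T (eps n) (%r. vs k r w) t) (%s t w. back_avg T (eps n) (%r. Dvs k s r w) t) (R k (eps n) (D n))"
  and R2: "\<And>k n. AE w in M. R k (eps n) (D n) w = fwd (eps n) (D n) (vs k) w - trace_avg (eps n) (Dvs k) w"
  and R3: "\<And>k. L2_converges M (%n. R k (eps n) (D n)) (Xs k)"
  using eps D by blast+
 define d where "d k l = (LINT (t, w)|TM. (vs k t w - vs l t w)^2) + (LINT (s, t, w)|TTM. (Dvs k s t w - Dvs l s t w)^2)" for k l
 have Rd: "(LINT w|M. (R k (eps n) (D n) w - R l (eps n) (D n) w)^2) \<le> d k l" for k l n
 proof -
  note q = smooth_skorohod_L2[OF smooth_skorohod_diff[OF R1[of n k] R1[of n l]]]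
  show ?thesis
   using q(4) back_avg_contraction_TM[OF L2_convergesD(1)[OF vs] L2_convergesD(1)[OF vs] eps(1) q(1)]
    back_avg_contraction_TTM[OF L2_convergesD(1)[OF Dvs] L2_convergesD(1)[OF Dvs] eps(1) q(2)]
   unfolding d_def by linarith
 qed
 have dC: "\<exists>K. \<forall>k\<ge>K. \<forall>l\<ge>K. d k l < e" if e: "e > 0" for e
 proof -
  have e2: "e / 2 > 0" using e by simp
  obtain K1 where K1: "\<forall>i\<ge>K1. \<forall>j\<ge>K1. (LINT p|TM. (case_prod (vs i) p - case_prod (vs j) p)^2) < e / 2"
   using L2_converges_Cauchy[OF vs e2] by blast
  obtain K2 where K2: "\<forall>i\<ge>K2. \<forall>j\<ge>K2. (LINT p|TTM. (case_triple (Dvs i) p - case_triple (Dvs j) p)^2) < e / 2"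
   using L2_converges_Cauchy[OF Dvs e2] by blast
  show ?thesis
  proof (intro exI[of _ "max K1 K2"] allI impI)
   fix k l assume kl: "k \<ge> max K1 K2" "l \<ge> max K1 K2"
   from K1[rule_format, of k l] K2[rule_format, of k l] kl show "d k l < e" unfolding d_def by (simp add: split_beta')
  qed
 qed
 have RS: "L2 M (R k (eps n) (D n))" for k n by (rule smooth_skorohod_L2(3)[OF R1])
 have "\<forall>n. \<exists>f. L2_converges M (%k. R k (eps n) (D n)) f"
 proof
  fix n
  show "\<exists>f. L2_converges M (%k. R k (eps n) (D n)) f"
  proof (rule L2_complete[OF RS])
   fix e :: real assume "e > 0"
   then obtain K where "\<forall>k\<ge>K. \<forall>l\<ge>K. d k l < e" using dC by blast
   then show "\<exists>K. \<forall>k\<ge>K. \<forall>l\<ge>K. (LINT w|M. (R k (eps n) (D n) w - R l (eps n) (D n) w)^2) < e"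
    by (intro exI[of _ K] allI impI) (rule le_less_trans[OF Rd], simp)
  qed
 qed
 from choice[OF this] obtain Rs where Rs: "\<And>n. L2_converges M (%k. R k (eps n) (D n)) (Rs n)" by blast
 have unif: "(LINT w|M. (Rs n w - R k (eps n) (D n) w)^2) \<le> 2 * e" if K: "\<forall>l\<ge>K. d k l < e" for K k e n
 proof (rule LIMSEQ_le_const)
  show "(%l. 2 * (LINT w|M. (R l (eps n) (D n) w - Rs n w)^2) + 2 * e) \<longlonglongrightarrow> 2 * e"
   using tendsto_add[OF tendsto_mult_left[OF L2_convergesD(3)[OF Rs[of n]], of 2] tendsto_const[of "2 * e"]] by simp
  show "\<exists>N. \<forall>l\<ge>N. (LINT w|M. (Rs n w - R k (eps n) (D n) w)^2) \<le> 2 * (LINT w|M. (R l (eps n) (D n) w - Rs n w)^2) + 2 * e"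
  proof (intro exI[of _ K] allI impI)
   fix l assume "l \<ge> K"
   then have "d k l < e" using K by simp
   moreover have "(LINT w|M. (R k (eps n) (D n) w - R l (eps n) (D n) w)^2) \<le> d k l" by (rule Rd)
   ultimately show "(LINT w|M. (Rs n w - R k (eps n) (D n) w)^2) \<le> 2 * (LINT w|M. (R l (eps n) (D n) w - Rs n w)^2) + 2 * e"
    using L2_triangle[OF RS[of k n] RS[of l n] L2_convergesD(2)[OF Rs[of n]]] by (simp add: power2_commute)
  qed
 qed
 have conv: "L2_converges M Rs S"
  unfolding L2_converges_def
 proof (intro conjI allI SS)
  show "L2 M (Rs n)" for n by (rule L2_convergesD(2)[OF Rs])
  show "(%n. (LINT w|M. (Rs n w - S w)^2)) \<longlonglongrightarrow> 0"
  proof (rule order_tendstoI)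
   fix a :: real assume a: "0 < a"
   \<comment> \<open>The triangle inequality is used twice below, which adds up to \<open>12 e\<close>.\<close>
   define e where "e = a / 16"
   have e: "e > 0" using a by (simp add: e_def)
   obtain K where K: "\<forall>k\<ge>K. \<forall>l\<ge>K. d k l < e" using dC[OF e] by blast
   have "\<forall>\<^sub>F k in sequentially. k \<ge> K \<and> (LINT w|M. (Xs k w - S w)^2) < e"
    by (rule eventually_conj[OF eventually_ge_at_top order_tendstoD(2)[OF L2_convergesD(3)[OF XS] e]])
   then obtain k where k: "k \<ge> K" "(LINT w|M. (Xs k w - S w)^2) < e" using eventually_happens'[OF sequentially_bot] by blast
   have kK: "\<forall>l\<ge>K. d k l < e" using K k by blast
   have "\<forall>\<^sub>F n in sequentially. (LINT w|M. (R k (eps n) (D n) w - Xs k w)^2) < e"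
    by (rule order_tendstoD(2)[OF L2_convergesD(3)[OF R3] e])
   then show "\<forall>\<^sub>F n in sequentially. (LINT w|M. (Rs n w - S w)^2) < a"
   proof eventually_elim
    case (elim n)
    have "(LINT w|M. (R k (eps n) (D n) w - S w)^2) \<le> 4 * e"
     using L2_triangle[OF RS[of k n] L2_convergesD(1)[OF XS, of k] SS] elim k(2) by linarith
    then show ?case
     using L2_triangle[OF L2_convergesD(2)[OF Rs[of n]] RS[of k n] SS] unif[OF kK, of n] a unfolding e_def by linarith
   qed
  next
   fix a :: real assume "a < 0"
   then show "\<forall>\<^sub>F n in sequentially. a < (LINT w|M. (Rs n w - S w)^2)"
    by (intro always_eventually allI less_le_trans[OF _ integral_nonneg_AE]) auto
  qed
 qed
 show thesis
  by (rule that[OF forward_limit_identify[OF D vs Dvs R2 Rs] conv])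
qed

end

lemma ennreal_abs_integral_le: "ennreal \<bar>(LINT x|N. f x)\<bar> \<le> (\<integral>\<^sup>+x. ennreal \<bar>f x\<bar> \<partial>N)" for f :: "'b \<Rightarrow> real"
proof (cases "integrable N f")
 case True
 from integral_norm_bound_ennreal[OF this] show ?thesis by simp
qed (simp add: not_integrable_integral_eq)

context brownian begin

lemma nn_integral_triple:
 assumes f: "f \<in> borel_measurable TTM"
 shows "(\<integral>\<^sup>+w. \<integral>\<^sup>+t. \<integral>\<^sup>+s. f (s, t, w) \<partial>time \<partial>time \<partial>M) = (\<integral>\<^sup>+p. f p \<partial>TTM)"
  and "(\<integral>\<^sup>+s. \<integral>\<^sup>+t. \<integral>\<^sup>+w. f (s, t, w) \<partial>M \<partial>time \<partial>time) = (\<integral>\<^sup>+p. f p \<partial>TTM)"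
proof -
 interpret P1: pair_sigma_finite time TM using sigma_finite_time sigma_finite_time_M by (simp add: pair_sigma_finite_def)
 interpret P2: pair_sigma_finite time M using sigma_finite_time sigma_finite_M by (simp add: pair_sigma_finite_def)
 have g: "(%q. \<integral>\<^sup>+s. f (s, q) \<partial>time) \<in> borel_measurable TM"
  using sigma_finite_measure.borel_measurable_nn_integral_fst[OF sigma_finite_time measurable_pair_swap[OF f]] by simp
 show "(\<integral>\<^sup>+w. \<integral>\<^sup>+t. \<integral>\<^sup>+s. f (s, t, w) \<partial>time \<partial>time \<partial>M) = (\<integral>\<^sup>+p. f p \<partial>TTM)"
  using P2.nn_integral_snd[OF g] P1.nn_integral_snd[OF f] by simp
 have "(\<integral>\<^sup>+t. \<integral>\<^sup>+w. f (s, t, w) \<partial>M \<partial>time) = (\<integral>\<^sup>+q. f (s, q) \<partial>TM)" if "s \<in> space time" for s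
  using sigma_finite_measure.nn_integral_fst[OF sigma_finite_M measurable_compose[OF measurable_Pair1'[OF that] f]] by simp
 then have "(\<integral>\<^sup>+s. \<integral>\<^sup>+t. \<integral>\<^sup>+w. f (s, t, w) \<partial>M \<partial>time \<partial>time) = (\<integral>\<^sup>+s. \<integral>\<^sup>+q. f (s, q) \<partial>TM \<partial>time)"
  by (intro nn_integral_cong) auto
 then show "(\<integral>\<^sup>+s. \<integral>\<^sup>+t. \<integral>\<^sup>+w. f (s, t, w) \<partial>M \<partial>time \<partial>time) = (\<integral>\<^sup>+p. f p \<partial>TTM)"
  using sigma_finite_measure.nn_integral_fst[OF sigma_finite_time_M f] by simp
qed

text \<open>For given \<open>s\<close>, the trace averages over the times \<open>t\<close> in \<open>[s-\<epsilon>, s)\<close>, and a mean is at most the supremum.\<close>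

lemma trace_avg_L1_bound:
 assumes f: "(case_triple f) \<in> borel_measurable TTM" and eps: "eps > 0"
 shows "(\<integral>\<^sup>+w. ennreal \<bar>trace_avg eps f w\<bar> \<partial>M) \<le> (\<integral>\<^sup>+s. (SUP t\<in>{max (s - eps) 0..<s}. \<integral>\<^sup>+w. ennreal \<bar>f s t w\<bar> \<partial>M) \<partial>time)"
proof -
 define F where "F p = ennreal \<bar>inverse eps * (indicator {fst p - eps..<fst p} (fst (snd p)) * f (fst p) (fst (snd p)) (snd (snd p)))\<bar>" for p
 have f': "(%p. f (fst p) (fst (snd p)) (snd (snd p))) \<in> borel_measurable TTM" using f by (simp add: split_beta')
 have Fm: "F \<in> borel_measurable TTM" unfolding F_def[abs_def] using borel_measurable_times[OF window_TTM f'] by simp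
 have "(\<integral>\<^sup>+w. ennreal \<bar>trace_avg eps f w\<bar> \<partial>M) \<le> (\<integral>\<^sup>+w. \<integral>\<^sup>+t. \<integral>\<^sup>+s. F (s, t, w) \<partial>time \<partial>time \<partial>M)"
 proof (rule nn_integral_mono)
  fix w
  have "trace_avg eps f w = (LINT t|time. (LINT s|time. inverse eps * (indicator {s - eps..<s} t * f s t w)))" by (simp add: trace_avg_def)
  also have "ennreal \<bar>\<dots>\<bar> \<le> (\<integral>\<^sup>+t. ennreal \<bar>(LINT s|time. inverse eps * (indicator {s - eps..<s} t * f s t w))\<bar> \<partial>time)" by (rule ennreal_abs_integral_le)
  also have "\<dots> \<le> (\<integral>\<^sup>+t. \<integral>\<^sup>+s. F (s, t, w) \<partial>time \<partial>time)"
   unfolding F_def fst_conv snd_conv by (intro nn_integral_mono ennreal_abs_integral_le)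
  finally show "ennreal \<bar>trace_avg eps f w\<bar> \<le> (\<integral>\<^sup>+t. \<integral>\<^sup>+s. F (s, t, w) \<partial>time \<partial>time)" .
 qed
 also have "\<dots> = (\<integral>\<^sup>+s. \<integral>\<^sup>+t. \<integral>\<^sup>+w. F (s, t, w) \<partial>M \<partial>time \<partial>time)" using nn_integral_triple[OF Fm] by simp
 also have "\<dots> \<le> (\<integral>\<^sup>+s. (SUP t\<in>{max (s - eps) 0..<s}. \<integral>\<^sup>+w. ennreal \<bar>f s t w\<bar> \<partial>M) \<partial>time)"
 proof (rule nn_integral_mono)
  fix s assume s: "s \<in> space time"
  define B where "B = (SUP t\<in>{max (s - eps) 0..<s}. \<integral>\<^sup>+w. ennreal \<bar>f s t w\<bar> \<partial>M)"
  have "(\<integral>\<^sup>+t. \<integral>\<^sup>+w. F (s, t, w) \<partial>M \<partial>time) \<le> (\<integral>\<^sup>+t. (ennreal (inverse eps) * B) * indicator {s - eps..<s} t \<partial>time)"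
  proof (rule nn_integral_mono)
   fix t assume t: "t \<in> space time"
   show "(\<integral>\<^sup>+w. F (s, t, w) \<partial>M) \<le> (ennreal (inverse eps) * B) * indicator {s - eps..<s} t"
   proof (cases "t \<in> {s - eps..<s}")
    case True
    have m: "f s t \<in> borel_measurable M"
     using measurable_compose[OF measurable_compose[OF measurable_Pair1'[OF t] measurable_Pair1'[OF s]] f'] by simp
    have "(\<integral>\<^sup>+w. F (s, t, w) \<partial>M) = (\<integral>\<^sup>+w. ennreal (inverse eps) * ennreal \<bar>f s t w\<bar> \<partial>M)"
     using True eps by (intro nn_integral_cong) (simp add: F_def abs_mult ennreal_mult)
    also have "\<dots> = ennreal (inverse eps) * (\<integral>\<^sup>+w. ennreal \<bar>f s t w\<bar> \<partial>M)" using m by (intro nn_integral_cmult) auto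
    also have "\<dots> \<le> ennreal (inverse eps) * B"
     unfolding B_def by (intro mult_left_mono SUP_upper) (use True t in auto)
    finally show ?thesis using True by simp
   qed (simp add: F_def)
  qed
  also have "\<dots> = (ennreal (inverse eps) * B) * (\<integral>\<^sup>+t. indicator {s - eps..<s} t \<partial>time)"
   by (intro nn_integral_cmult measurable_time_measureI) simp
  also have "\<dots> \<le> (ennreal (inverse eps) * B) * ennreal eps"
  proof (rule mult_left_mono)
   have "(\<integral>\<^sup>+t. indicator {s - eps..<s} t \<partial>time) \<le> ennreal (s - (s - eps))"
    by (rule nn_integral_time_measure_interval) (use eps in auto)
   then show "(\<integral>\<^sup>+t. indicator {s - eps..<s} t \<partial>time) \<le> ennreal eps" by simp
  qed simp
  also have "\<dots> = B * (ennreal (inverse eps) * ennreal eps)" by (simp add: mult_ac)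
  also have "ennreal (inverse eps) * ennreal eps = 1" using eps by (simp flip: ennreal_mult)
  finally show "(\<integral>\<^sup>+t. \<integral>\<^sup>+w. F (s, t, w) \<partial>M \<partial>time) \<le> (SUP t\<in>{max (s - eps) 0..<s}. \<integral>\<^sup>+w. ennreal \<bar>f s t w\<bar> \<partial>M)" by (simp add: B_def)
 qed
 finally show ?thesis .
qed

lemma L2_lift:
 assumes V: "L2 TM (case_prod V)" and k: "k \<in> borel_measurable time" "\<And>t. \<bar>k t\<bar> \<le> 1"
 shows "L2 TTM (%(s, t, w). V s w * k t)"
proof -
 have V': "(%p. V (fst p) (snd p)) \<in> borel_measurable TM" using L2D(1)[OF V] by (simp add: split_beta')
 have pr: "(%p. (fst p, snd (snd p))) \<in> measurable TTM TM" by measurable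
 have Vm: "(%p. V (fst p) (snd (snd p))) \<in> borel_measurable TTM" using measurable_compose[OF pr V'] by simp
 have fin: "emeasure time (space time) < \<infinity>" using finite_measure.emeasure_finite[OF finite_measure_time_measure, of T "space time"] by (simp add: less_top)
 have Vn: "(%p. ennreal ((V (fst p) (snd p))^2)) \<in> borel_measurable TM" using V' by simp
 have "(\<integral>\<^sup>+p. ennreal ((V (fst p) (snd (snd p)))^2) \<partial>TTM) = (\<integral>\<^sup>+s. \<integral>\<^sup>+t. \<integral>\<^sup>+w. ennreal ((V s w)^2) \<partial>M \<partial>time \<partial>time)"
  using nn_integral_triple(2)[of "%p. ennreal ((V (fst p) (snd (snd p)))^2)"] Vm by simp
 also have "\<dots> = (\<integral>\<^sup>+s. (\<integral>\<^sup>+w. ennreal ((V s w)^2) \<partial>M) * emeasure time (space time) \<partial>time)" by (subst nn_integral_const) simp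
 also have "\<dots> = (\<integral>\<^sup>+s. (\<integral>\<^sup>+w. ennreal ((V s w)^2) \<partial>M) \<partial>time) * emeasure time (space time)"
  using sigma_finite_measure.borel_measurable_nn_integral_fst[OF sigma_finite_M Vn] by (intro nn_integral_multc) simp
 also have "(\<integral>\<^sup>+s. (\<integral>\<^sup>+w. ennreal ((V s w)^2) \<partial>M) \<partial>time) = (\<integral>\<^sup>+p. ennreal ((V (fst p) (snd p))^2) \<partial>TM)"
  using sigma_finite_measure.nn_integral_fst[OF sigma_finite_M Vn] by simp
 also have "\<dots> * emeasure time (space time) < \<infinity>"
  using L2D(2)[OF V] fin by (auto simp: integrable_iff_bounded split_beta' ennreal_mult_less_top)
 finally have S: "L2 TTM (%p. V (fst p) (snd (snd p)))"
  using Vm by (auto simp: square_integrable_def integrable_iff_bounded)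
 have km: "(%p. k (fst (snd p))) \<in> borel_measurable TTM" by (rule measurable_compose[OF measurable_compose[OF measurable_snd measurable_fst] k(1)])
 have "L2 TTM (%p. V (fst p) (snd (snd p)) * k (fst (snd p)))"
  by (rule L2_bound[OF S borel_measurable_times[OF Vm km], where C = 1]) (use k(2) in \<open>auto simp: abs_mult mult_right_le_one_le\<close>)
 then show ?thesis by (simp add: split_beta')
qed

text \<open>The integrals exist for almost all sample points only, so linearity is checked after integration over an event.\<close>

lemma trace_avg_diff:
 assumes f: "L2 TTM (case_triple f)" and g: "L2 TTM (case_triple g)"
 shows "AE w in M. trace_avg eps (%s t w. f s t w - g s t w) w = trace_avg eps f w - trace_avg eps g w"
proof -
 have fg: "L2 TTM (%(s, t, w). f s t w - g s t w)" using L2_diff[OF f g] by (simp add: split_beta')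
 note If = trace_integral[OF f, where eps = eps] and Ig = trace_integral[OF g, where eps = eps] and Id = trace_integral[OF fg, where eps = eps]
 let ?G = "%w. trace_avg eps (%s t w. f s t w - g s t w) w - (trace_avg eps f w - trace_avg eps g w)"
 have "integrable M ?G" by (intro Bochner_Integration.integrable_diff If(1) Ig(1) Id(1))
 then have "AE w in M. ?G w = 0"
 proof (rule density_zero)
  fix A assume A: "A \<in> sets M"
  have AI: "integrable M (%w. indicator A w * h w)" if "integrable M h" for h :: "'a \<Rightarrow> real"
   using integrable_mult_indicator[OF A that] by simp
  let ?wt = "%p. indicator {fst p - eps..<fst p} (fst (snd p)) * indicator A (snd (snd p)) :: real"
  have "(LINT p|TTM. (case p of (s, t, w) \<Rightarrow> f s t w - g s t w) * ?wt p)
   = (LINT p|TTM. case_triple f p * ?wt p - case_triple g p * ?wt p)"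
   by (simp add: split_beta' left_diff_distrib)
  also have "\<dots> = (LINT p|TTM. case_triple f p * ?wt p) - (LINT p|TTM. case_triple g p * ?wt p)"
   by (rule Bochner_Integration.integral_diff[OF integrable_mult_L2[OF f If(2)[OF A]] integrable_mult_L2[OF g Ig(2)[OF A]]])
  finally have "(LINT w|M. indicator A w * trace_avg eps (%s t w. f s t w - g s t w) w)
   = (LINT w|M. indicator A w * trace_avg eps f w) - (LINT w|M. indicator A w * trace_avg eps g w)"
   unfolding If(3)[OF A] Ig(3)[OF A] Id(3)[OF A] by (simp add: right_diff_distrib)
  then have "(LINT w|M. indicator A w * ?G w) = 0"
   using AI[OF If(1)] AI[OF Ig(1)] AI[OF Id(1)] by (simp add: right_diff_distrib)
  then show "(LINT w:A|M. ?G w) = 0" by (simp add: set_lebesgue_integral_def)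
 qed
 then show ?thesis by eventually_elim simp
qed

lemma trace_avg_time:
 assumes V: "L2 time (%s. V s w)" and k: "L2 time k"
 shows "trace_avg eps (%s t w. V s w * k t) w = (LINT s|time. V s w * back_avg T eps k s)"
proof -
 have "(LINT s|time. indicator {s - eps..<s} t * (V s w * k t)) = k t * (LINT s|time. indicator {s - eps..<s} t * V s w)" for t
 proof -
  have "indicator {s - eps..<s} t * (V s w * k t) = k t * (indicator {s - eps..<s} t * V s w)" for s by simp
  then show ?thesis by (simp only: integral_mult_right_zero)
 qed
 then show ?thesis unfolding trace_avg_def using back_avg_dual(1)[OF k V] by simp
qed

lemma prob_three_le:
 assumes A: "L2 M A" and B: "integrable M B" and C: "L2 M C" and \<eta>: "\<eta> > 0"
  and X: "AE w in M. \<bar>X w\<bar> \<le> \<bar>A w\<bar> + \<bar>B w\<bar> + \<bar>C w\<bar>"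
 shows "measure M {w\<in>space M. \<bar>X w\<bar> > 3 * \<eta>} \<le> (LINT w|M. (A w)^2) / \<eta>^2 + (LINT w|M. \<bar>B w\<bar>) / \<eta> + (LINT w|M. (C w)^2) / \<eta>^2"
proof -
 let ?A = "{w\<in>space M. \<eta>^2 \<le> (A w)^2}" and ?B = "{w\<in>space M. \<eta> \<le> \<bar>B w\<bar>}" and ?C = "{w\<in>space M. \<eta>^2 \<le> (C w)^2}"
 note [measurable] = L2D(1)[OF A] borel_measurable_integrable[OF B] L2D(1)[OF C]
 have m: "?A \<in> sets M" "?B \<in> sets M" "?C \<in> sets M" by measurable
 have "measure M {w\<in>space M. \<bar>X w\<bar> > 3 * \<eta>} \<le> measure M (?A \<union> ?B \<union> ?C)"
 proof (rule finite_measure_mono_AE)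
  show "AE w in M. w \<in> {w\<in>space M. \<bar>X w\<bar> > 3 * \<eta>} \<longrightarrow> w \<in> ?A \<union> ?B \<union> ?C"
   using X
  proof eventually_elim
   case (elim w)
   have sq: "\<bar>a\<bar> < \<eta>" if "\<not> \<eta>^2 \<le> a^2" for a :: real using that \<eta> power_mono[of \<eta> "\<bar>a\<bar>" 2] by force
   show ?case
   proof (rule impI, rule ccontr)
    assume h: "w \<in> {w\<in>space M. \<bar>X w\<bar> > 3 * \<eta>}" "w \<notin> ?A \<union> ?B \<union> ?C"
    then have "\<not> \<eta>^2 \<le> (A w)^2" "\<not> \<eta> \<le> \<bar>B w\<bar>" "\<not> \<eta>^2 \<le> (C w)^2" by auto
    then show False using sq[of "A w"] sq[of "C w"] h(1) elim by auto
   qed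
  qed
 qed (use m in auto)
 also have "\<dots> \<le> measure M (?A \<union> ?B) + measure M ?C" using m by (intro measure_Un_le) auto
 also have "measure M (?A \<union> ?B) \<le> measure M ?A + measure M ?B" using m by (intro measure_Un_le) auto
 finally have le: "measure M {w\<in>space M. \<bar>X w\<bar> > 3 * \<eta>} \<le> measure M ?A + measure M ?B + measure M ?C" by simp
 have "measure M ?A \<le> (LINT w|M. (A w)^2) / \<eta>^2" "measure M ?C \<le> (LINT w|M. (C w)^2) / \<eta>^2"
  by (rule integral_Markov_inequality_measure[OF _ sets.top]; use L2D(2)[OF A] L2D(2)[OF C] \<eta> in simp)+
 moreover have "measure M ?B \<le> (LINT w|M. \<bar>B w\<bar>) / \<eta>"
  by (rule integral_Markov_inequality_measure[OF _ sets.top]) (use B \<eta> in auto)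
 ultimately show ?thesis using le by linarith
qed


text \<open>The forward approximation is \<open>R\<^sub>n\<close> plus the trace of \<open>D\<^sub>s v\<^sub>t 1\<^bsub>t \<le> r\<^esub>\<close>. That trace is compared with the trace of
 \<open>V\<^sub>s 1\<^bsub>t \<le> r\<^esub>\<close>, in \<open>L\<^sup>1\<close> by the assumption; and the latter is the integral of \<open>V\<close> against the average of \<open>1\<^bsub>[0,r]\<^esub>\<close>,
 which tends to \<open>1\<^bsub>[0,r]\<^esub>\<close>.\<close>

theorem forward_integral_trace:
 assumes v: "malliavin v E" and V: "L2 TM (case_prod V)"
  and lim: "((%eps. \<integral>\<^sup>+s. (SUP t\<in>{max (s - eps) 0..<s}. \<integral>\<^sup>+w. ennreal \<bar>E s t w - V s w\<bar> \<partial>M) \<partial>time) \<longlongrightarrow> 0) (at_right 0)"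
  and r: "r \<in> {0..T}" and S: "skorohod (%s w. v s w * indicator {0..r} s) S"
 shows "has_forward_integral M T W (%s w. v s w * indicator {0..r} s) (%w. S w + (LINT s:{0..r}|lborel. V s w))"
proof -
 define k where "k = (indicator {0..r} :: real \<Rightarrow> real)"
 define vr where "vr t w = v t w * k t" for t w
 define I where "I w = (LINT s|time. V s w * k s)" for w
 have I_eq: "(LINT s:{0..r}|lborel. V s w) = I w" for w
  unfolding I_def integral_time_measure set_lebesgue_integral_def k_def
  by (rule Bochner_Integration.integral_cong) (use r in \<open>auto simp: indicator_def\<close>)
 have km: "k \<in> borel_measurable time" unfolding k_def by (rule measurable_time_measureI) simp
 have kle: "\<bar>k t\<bar> \<le> 1" for t by (simp add: k_def indicator_def)
 have kS: "L2 time k" unfolding k_def by (rule L2_indicator) simp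
 note vrE = malliavin_process_time_mult[OF v km kle]
 have vrm: "malliavin vr (%s t w. E s t w * k t)" using vrE by (simp add: vr_def[abs_def])
 have vrS: "L2 TM (case_prod vr)" by (rule malliavin_L2(1)[OF vrm])
 have ES: "L2 TTM (case_triple E)" by (rule malliavin_L2(2)[OF v])
 have EkS: "L2 TTM (%(s, t, w). E s t w * k t)" by (rule malliavin_L2(2)[OF vrm])
 have VkS: "L2 TTM (%(s, t, w). V s w * k t)" by (rule L2_lift[OF V km kle])
 have SS: "L2 M S" and S': "skorohod vr S"
  using S by (auto simp: has_skorohod_integral_def vr_def[abs_def] k_def)
 have V'S: "L2 TM (%p. V (fst p) (snd p))" using V by (simp add: split_beta')
 have Ik: "integrable TM (%p. V (fst p) (snd p) * k (fst p))"
 proof -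
  have one: "L2 M (%_. 1)" by (simp add: square_integrable_def)
  show ?thesis using integrable_mult_L2[OF V'S tensor_L2[OF sigma_finite_time sigma_finite_M kS one]] by simp
 qed
 have II: "integrable M I" using integral_time_M(1)[OF Ik] by (simp add: I_def[abs_def])
 have vW: "AE w in M. integrable time (%t. vr t w * (W (min (t + eps) T) w - W t w))"
  "AE w in M. forward_approx T W vr eps w = fwd eps D vr w" if D: "increment_version eps D" for eps D
 proof -
  have DS: "L2 TM (case_prod D)" and DW: "AE w in M. \<forall>t\<in>{0..T}. D t w = W (min (t + eps) T) w - W t w"
   using D by (auto simp: increment_version_def)
  show "AE w in M. integrable time (%t. vr t w * (W (min (t + eps) T) w - W t w))"
   using section_L2[OF DS] section_L2[OF vrS] DW
  proof eventually_elim
   case (elim w)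
   have "integrable time (%t. vr t w * D t w)" by (rule integrable_mult_L2[OF elim(2,1)])
   then show ?case by (rule Bochner_Integration.integrable_cong[OF refl, THEN iffD1, rotated]) (use elim(3) in auto)
  qed
  show "AE w in M. forward_approx T W vr eps w = fwd eps D vr w"
   using DW
  proof eventually_elim
   case (elim w)
   have "(LINT t|time. vr t w * (W (min (t + eps) T) w - W t w)) = (LINT t|time. vr t w * D t w)"
    by (rule Bochner_Integration.integral_cong) (use elim in auto)
   then show ?case by (simp add: forward_approx_def fwd_def)
  qed
 qed
 have "has_forward_integral M T W vr (%w. S w + I w)"
  unfolding has_forward_integral_def
 proof (intro conjI allI impI)
  show "(%w. S w + I w) \<in> borel_measurable M" by (rule borel_measurable_add[OF L2D(1)[OF SS] borel_measurable_integrable[OF II]])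
  fix eps :: real assume eps: "eps > 0"
  obtain D where D: "increment_version eps D" by (rule increment_version_exists[OF eps])
  show "AE w in M. integrable time (%t. vr t w * (W (min (t + eps) T) w - W t w))" by (rule vW(1)[OF D])
  show "forward_approx T W vr eps \<in> borel_measurable M"
   by (rule measurable_cong_AE_complete[OF borel_measurable_integrable[OF fwd_integral(1)[OF D vrS]] vW(2)[OF D]])
 next
  fix \<eta>' :: real assume "\<eta>' > 0"
  define \<eta> where "\<eta> = \<eta>' / 3"
  have \<eta>: "\<eta> > 0" "\<eta>' = 3 * \<eta>" using \<open>\<eta>' > 0\<close> by (simp_all add: \<eta>_def)
  show "((%eps. measure M {w\<in>space M. \<bar>forward_approx T W vr eps w - (S w + I w)\<bar> > \<eta>'}) \<longlongrightarrow> 0) (at_right 0)"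
  proof (rule tendsto_at_right_sequentially[of _ 1])
   fix eps :: "nat \<Rightarrow> real" assume eps: "\<And>n. 0 < eps n" "eps \<longlonglongrightarrow> 0"
   have "\<forall>n. \<exists>D. increment_version (eps n) D" by (rule allI, rule increment_version_exists[OF eps(1)]) blast
   from choice[OF this] obtain D where D: "\<And>n. increment_version (eps n) (D n)" by blast
   obtain Rs where Rs: "\<And>n. AE w in M. Rs n w = fwd (eps n) (D n) vr w - trace_avg (eps n) (%s t w. E s t w * k t) w" "L2_converges M Rs S"
    by (rule forward_minus_trace_converges[OF vrm S' eps D]) blast
   define P where "P n = trace_avg (eps n) (%s t w. E s t w * k t - V s w * k t)" for n
   define Q where "Q n w = trace_avg (eps n) (%s t w. V s w * k t) w - I w" for n w
   have EV: "L2 TTM (%(s, t, w). E s t w * k t - V s w * k t)"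
    using L2_diff[OF EkS VkS] by (simp add: split_beta')
   have PI: "integrable M (P n)" for n unfolding P_def by (rule trace_integral(1)[OF EV])
   have P0: "(%n. (LINT w|M. \<bar>P n w\<bar>)) \<longlonglongrightarrow> 0"
   proof -
    have e: "ennreal (LINT w|M. \<bar>P n w\<bar>) = (\<integral>\<^sup>+w. ennreal \<bar>P n w\<bar> \<partial>M)" for n
     using nn_integral_eq_integral[OF integrable_abs[OF PI]] by simp
    have "filterlim eps (at_right 0) sequentially"
     using eps by (intro tendsto_imp_filterlim_at_right) (auto intro!: always_eventually)
    from filterlim_compose[OF lim this]
    have l: "(%n. \<integral>\<^sup>+s. (SUP t\<in>{max (s - eps n) 0..<s}. \<integral>\<^sup>+w. ennreal \<bar>E s t w - V s w\<bar> \<partial>M) \<partial>time) \<longlonglongrightarrow> 0" .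
    have "(%n. ennreal (LINT w|M. \<bar>P n w\<bar>)) \<longlonglongrightarrow> ennreal 0"
    proof (rule tendsto_sandwich[OF _ _ tendsto_const])
     show "(%n. \<integral>\<^sup>+s. (SUP t\<in>{max (s - eps n) 0..<s}. \<integral>\<^sup>+w. ennreal \<bar>E s t w - V s w\<bar> \<partial>M) \<partial>time) \<longlonglongrightarrow> ennreal 0" using l by simp
     show "\<forall>\<^sub>F n in sequentially. ennreal (LINT w|M. \<bar>P n w\<bar>) \<le> (\<integral>\<^sup>+s. (SUP t\<in>{max (s - eps n) 0..<s}. \<integral>\<^sup>+w. ennreal \<bar>E s t w - V s w\<bar> \<partial>M) \<partial>time)"
     proof (rule always_eventually, rule allI)
      fix n
      have "(\<integral>\<^sup>+w. ennreal \<bar>P n w\<bar> \<partial>M) \<le> (\<integral>\<^sup>+s. (SUP t\<in>{max (s - eps n) 0..<s}. \<integral>\<^sup>+w. ennreal \<bar>E s t w * k t - V s w * k t\<bar> \<partial>M) \<partial>time)"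
       unfolding P_def by (rule trace_avg_L1_bound[OF L2D(1)[OF EV] eps(1)])
      also have "\<dots> \<le> (\<integral>\<^sup>+s. (SUP t\<in>{max (s - eps n) 0..<s}. \<integral>\<^sup>+w. ennreal \<bar>E s t w - V s w\<bar> \<partial>M) \<partial>time)"
       by (intro nn_integral_mono SUP_subset_mono order_refl ennreal_leI) (auto simp: k_def indicator_def)
      finally show "ennreal (LINT w|M. \<bar>P n w\<bar>) \<le> (\<integral>\<^sup>+s. (SUP t\<in>{max (s - eps n) 0..<s}. \<integral>\<^sup>+w. ennreal \<bar>E s t w - V s w\<bar> \<partial>M) \<partial>time)" by (simp only: e)
     qed
    qed simp
    then show ?thesis by (subst (asm) tendsto_ennreal_iff) auto
   qed
   define d where "d n = (LINT s|time. (back_avg T (eps n) k s - k s)^2)" for n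
   define c where "c = (LINT p|TM. (V (fst p) (snd p))^2)"
   note V2 = L2D(2)[OF V'S]
   have Qm: "Q n \<in> borel_measurable M" for n
    unfolding Q_def[abs_def] by (rule borel_measurable_diff[OF borel_measurable_integrable[OF trace_integral(1)[OF VkS]] borel_measurable_integrable[OF II]])
   have Q2: "AE w in M. (Q n w)^2 \<le> (LINT s|time. (V s w)^2) * d n" for n
    using section_L2[OF V]
   proof eventually_elim
    case (elim w)
    note b = back_avg_contraction(1)[OF kS eps(1)[of n]]
    have "Q n w = (LINT s|time. V s w * (back_avg T (eps n) k s - k s))"
     unfolding Q_def I_def trace_avg_time[where V = V and k = k, OF elim kS]
     using integrable_mult_L2[OF elim b] integrable_mult_L2[OF elim kS] by (simp add: right_diff_distrib)
    then show ?case unfolding d_def using L2_Cauchy_Schwarz[OF elim L2_diff[OF b kS]] by simp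
   qed
   have QI: "integrable M (%w. (LINT s|time. (V s w)^2) * d n)" for n using integral_time_M(1)[OF V2] by simp
   have d0: "d n \<ge> 0" for n by (simp add: d_def)
   have QS: "L2 M (Q n)" for n
    unfolding square_integrable_def
   proof (intro conjI Qm Bochner_Integration.integrable_bound[OF QI borel_measurable_power[OF Qm]])
    show "AE w in M. norm ((Q n w)^2) \<le> norm ((LINT s|time. (V s w)^2) * d n)" using Q2[of n] by eventually_elim simp
   qed
   have Qle: "(LINT w|M. (Q n w)^2) \<le> c * d n" for n
    using integral_mono_AE[OF L2D(2)[OF QS] QI Q2] integral_time_M(2)[OF V2] by (simp add: c_def)
   have dl: "d \<longlonglongrightarrow> 0" using L2_convergesD(3)[OF back_avg_tendsto[OF kS _ eps]] T by (simp add: d_def[abs_def])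
   define b where "b n = (LINT w|M. (Rs n w - S w)^2) / \<eta>^2 + (LINT w|M. \<bar>P n w\<bar>) / \<eta> + c * d n / \<eta>^2" for n
   have bl: "b \<longlonglongrightarrow> 0"
    unfolding b_def[abs_def] using tendsto_add[OF tendsto_add[OF tendsto_divide[OF L2_convergesD(3)[OF Rs(2)] tendsto_const[of "\<eta>^2"]] tendsto_divide[OF P0 tendsto_const[of \<eta>]]]
     tendsto_divide[OF tendsto_mult_left[OF dl, of c] tendsto_const[of "\<eta>^2"]]] \<eta>(1) by simp
   show "(%n. measure M {w\<in>space M. \<bar>forward_approx T W vr (eps n) w - (S w + I w)\<bar> > \<eta>'}) \<longlonglongrightarrow> 0"
   proof (rule tendsto_sandwich[OF _ _ tendsto_const bl])
    show "\<forall>\<^sub>F n in sequentially. measure M {w\<in>space M. \<bar>forward_approx T W vr (eps n) w - (S w + I w)\<bar> > \<eta>'} \<le> b n"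
    proof (rule always_eventually, rule allI)
     fix n
     have "AE w in M. \<bar>forward_approx T W vr (eps n) w - (S w + I w)\<bar> \<le> \<bar>Rs n w - S w\<bar> + \<bar>P n w\<bar> + \<bar>Q n w\<bar>"
      using vW(2)[OF D[of n]] Rs(1)[of n] trace_avg_diff[OF EkS VkS, of "eps n"]
      unfolding P_def Q_def by eventually_elim linarith
     from prob_three_le[OF L2_diff[OF L2_convergesD(1)[OF Rs(2)] SS] PI QS \<eta>(1) this]
     have "measure M {w\<in>space M. \<bar>forward_approx T W vr (eps n) w - (S w + I w)\<bar> > \<eta>'}
      \<le> (LINT w|M. (Rs n w - S w)^2) / \<eta>^2 + (LINT w|M. \<bar>P n w\<bar>) / \<eta> + (LINT w|M. (Q n w)^2) / \<eta>^2" unfolding \<eta>(2) .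
     also have "\<dots> \<le> b n" unfolding b_def using Qle[of n] by (intro add_left_mono divide_right_mono) auto
     finally show "measure M {w\<in>space M. \<bar>forward_approx T W vr (eps n) w - (S w + I w)\<bar> > \<eta>'} \<le> b n" .
    qed
   qed simp
  qed simp
 qed
 then show ?thesis by (simp add: vr_def[abs_def] k_def I_eq)
qed

end

section \<open>The forward integral of a product\<close>

theorem proposition2p12:
  fixes M :: "'a measure" and T :: real
    and W u \<sigma> Dmu :: "real \<Rightarrow> 'a \<Rightarrow> real"
    and D\<sigma> :: "real \<Rightarrow> real \<Rightarrow> 'a \<Rightarrow> real"
  assumes T: "T > 0"
    and W: "brownian_motion M T W"
    and u: "has_Dminus M T W 2 u Dmu"
    and u_bdd: "L2_bounded M T u"
    and \<sigma>: "has_malliavin_deriv_process M T W \<sigma> D\<sigma>"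
    and \<sigma>_adapted: "\<forall>t\<in>{0..T}. \<sigma> t \<in> borel_measurable (augmented_filtration M T W t)"
    and \<sigma>_L2_bdd: "L2_bounded M T \<sigma>"
    and \<sigma>_left_cont: "L2_left_continuous M T \<sigma>"
    and \<sigma>_bdd: "\<exists>C. AE (t, \<omega>) in time_measure T \<Otimes>\<^sub>M M. \<bar>\<sigma> t \<omega>\<bar> \<le> C"
    and D\<sigma>_bdd: "\<exists>C. AE (s, t, \<omega>) in time_measure T \<Otimes>\<^sub>M (time_measure T \<Otimes>\<^sub>M M). \<bar>D\<sigma> s t \<omega>\<bar> \<le> C"
  shows "(\<lambda>t \<omega>. u t \<omega> * \<sigma> t \<omega>) \<in> L12_minus M T W 1 \<and>
    (\<forall>t\<in>{0..T}.
       (\<exists>S. has_skorohod_integral M T W (\<lambda>s \<omega>. u s \<omega> * \<sigma> s \<omega> * indicator {0..t} s) S) \<and>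
       (\<forall>S. has_skorohod_integral M T W (\<lambda>s \<omega>. u s \<omega> * \<sigma> s \<omega> * indicator {0..t} s) S \<longrightarrow>
         has_forward_integral M T W (\<lambda>s \<omega>. u s \<omega> * \<sigma> s \<omega> * indicator {0..t} s)
           (\<lambda>\<omega>. S \<omega> + (LINT s:{0..t}|lborel. Dmu s \<omega> * \<sigma> s \<omega>))))"
proof -
 have "prob_space M" using W by (simp add: brownian_motion_def)
 then interpret brownian M T W by (intro brownian.intro brownian_axioms.intro T W)
 have sq: "\<bar>x\<bar> powr 2 = x^2" for x :: real by (simp add: powr_numeral)
 obtain Du where Du: "malliavin u Du"
  "((%eps. \<integral>\<^sup>+s. (SUP t\<in>{max (s - eps) 0..<s}. \<integral>\<^sup>+w. ennreal ((Du s t w - Dmu s w)^2) \<partial>M) \<partial>tm T) \<longlongrightarrow> 0) (at_right 0)"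
  using u unfolding has_Dminus_def sq by blast
 have "in_Lp 2 TM (case_prod Dmu)" using u by (simp add: has_Dminus_def)
 then have Dmu: "L2 TM (case_prod Dmu)" by (simp add: in_Lp_def square_integrable_def sq)
 obtain C where C: "AE (t, w) in TM. \<bar>\<sigma> t w\<bar> \<le> C" using \<sigma>_bdd by blast
 obtain C' where C': "AE (s, t, w) in TTM. \<bar>D\<sigma> s t w\<bar> \<le> C'" using D\<sigma>_bdd by blast
 obtain E where E: "malliavin (%t w. u t w * \<sigma> t w) E"
  "((%eps. \<integral>\<^sup>+s. (SUP t\<in>{max (s - eps) 0..<s}. \<integral>\<^sup>+w. ennreal \<bar>E s t w - Dmu s w * \<sigma> s w\<bar> \<partial>M) \<partial>tm T) \<longlongrightarrow> 0) (at_right 0)"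
  by (rule Dminus_mult[OF Du(1) Dmu Du(2) \<sigma> \<sigma>_adapted \<sigma>_L2_bdd \<sigma>_left_cont C C'])
 have \<sigma>S: "L2 TM (case_prod \<sigma>)" by (rule malliavin_L2(1)[OF \<sigma>])
 have V: "L2 TM (%(s, w). Dmu s w * \<sigma> s w)"
 proof (rule L2_bound_AE[OF L2_cmult[OF Dmu, of C]])
  show "(%(s, w). Dmu s w * \<sigma> s w) \<in> borel_measurable TM"
   using borel_measurable_times[OF L2D(1)[OF Dmu] L2D(1)[OF \<sigma>S]] by (simp add: split_beta')
  show "AE p in TM. \<bar>case p of (s, w) \<Rightarrow> Dmu s w * \<sigma> s w\<bar> \<le> \<bar>C * case_prod Dmu p\<bar>"
   using C
  proof eventually_elim
   case (elim p)
   obtain s w where p: "p = (s, w)" by (cases p)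
   from elim have "\<bar>\<sigma> s w\<bar> \<le> \<bar>C\<bar>" by (simp add: p)
   from abs_mult_right_le(2)[OF this] show ?case by (simp add: p)
  qed
 qed
 have "finite_measure TM" by (rule finite_measure_pair_measure[OF finite_measure_axioms finite_measure_time_measure])
 from finite_measure.L2_integrable[OF this V]
 have "in_Lp 1 TM (%(s, w). Dmu s w * \<sigma> s w)" by (simp add: in_Lp_def split_beta')
 then have "has_Dminus M T W 1 (%t w. u t w * \<sigma> t w) (%s w. Dmu s w * \<sigma> s w)"
  unfolding has_Dminus_def using E by (intro conjI exI[of _ E]) simp_all
 then have L12: "(%t w. u t w * \<sigma> t w) \<in> L12_minus M T W 1" by (auto simp: L12_minus_def)
 have ex: "\<exists>S. skorohod (%s w. u s w * \<sigma> s w * indicator {0..r} s) S" for r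
 proof -
  have k: "(indicator {0..r} :: real \<Rightarrow> real) \<in> borel_measurable (tm T)" by (rule measurable_time_measureI) simp
  have kle: "\<bar>indicator {0..r} t :: real\<bar> \<le> 1" for t by (simp add: indicator_def)
  obtain vs Dvs Xs where X: "\<And>k. smooth_skorohod (vs k) (Dvs k) (Xs k)"
   "L2_converges TM (%k. case_prod (vs k)) (%(t, w). u t w * \<sigma> t w * indicator {0..r} t)"
   "L2_converges TTM (%k. case_triple (Dvs k)) (%(s, t, w). E s t w * indicator {0..r} t)"
   by (rule malliavin_process_smooth_approx[OF malliavin_process_time_mult[OF E(1) k kle]]) blast
  show ?thesis by (rule skorohod_limit[OF X]) blast
 qed
 show ?thesis
  using L12 ex forward_integral_trace[OF E(1) V E(2)] by blast
qed

end
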